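(* Let $n\ge2$ and use the notation of the context. The cone $C(I,I^m(\mathcal N))\subset\mathbb{R}^{\mathcal N}$ consists exactly of those $w$ that satisfy $w_a+w_b<w_{a\vee b}+w_{a\odot b}$ for every diamond pair $\{a,b\}\subset\mathcal N$ and $w_a+w_b<w_{g_1(a,b)}+w_{h_1(a,b)}$ for every special diamond pair $\{a,b\}\subset\mathcal N$. This description is minimal: each of these inequalities, when turned into an equality, cuts out a facet of $\overline{C(I,I^m(\mathcal N))}$.
   Context: $R$ is the polynomial ring over $\mathbb{C}$ in the Plücker variables $X_{i_1,\ldots,i_k}$, $1\le k\le n-1$, $1\le i_1<\dots<i_k\le n$ ($X_{i_{\sigma(1)}..i_{\sigma(k)}}=\mathrm{sgn}(\sigma)X_{i_1..i_k}$), and $I$ is the kernel of $X_{i_1,\ldots,i_k}\mapsto\det(z_{r,i_s})_{1\le r,s\le k}$. PBW-semistandard: a column $(\alpha_1..\alpha_k)$ is PBW-semistandard if $\alpha_r\le k$ implies $\alpha_r=r$, and $r_1<r_2$, $\alpha_{r_1},\alpha_{r_2}>k$ imply $\alpha_{r_1}>\alpha_{r_2}$; two columns $(\alpha_1..\alpha_k)$, $(\beta_1..\beta_l)$, $k\ge l$, form a PBW-semistandard tableau if each is PBW-semistandard and for each $r\le l$ some $s\ge r$ has $\alpha_s\ge\beta_r$. $\mathcal N$ is the set of $b_{\alpha_1..\alpha_k}$ over one-column PBW-semistandard tableaux ($1\le k\le n-1$), with $b_\beta\le b_\alpha$ iff columns $\alpha,\beta$ (in this order) form a PBW-semistandard tableau;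 $X_{b_{\alpha_1..\alpha_k}}:=X_{\alpha_1..\alpha_k}$, and coordinates on $\mathbb{R}^{\mathcal N}$ are $w_b$. $I^m(\mathcal N)$ is generated by $X_aX_b$ for incomparable $a,b\in\mathcal N$. For $w$, $\mathrm{in}_wp$ is the part of $p$ of minimal $w$-weight, $\mathrm{in}_wI$ the span of all $\mathrm{in}_wp$, $p\in I$, $C(I,J)=\{w:\mathrm{in}_wI=J\}$. Let $P=\{(r,s):1\le r\le s\le n\}\setminus\{(1,1),(n,n)\}$ with componentwise order; for an order ideal $J$ of $P$, $b(J)=b_{\alpha_1..\alpha_k}$ with $k$ the largest $l$ with $(l,l)\in J$ ($k=1$ if none), $\alpha_s=t$ for each maximal $(s,t)\in J$, $\alpha_r=r$ otherwise; $J\mapsto b(J)$ is a lattice isomorphism onto $\mathcal N$ with inverse $\iota$. $V_o=\{(i,i):2\le i\le n-1\}$, $V_c=\{(r,s):r<s\}$, $K(J)=(J\cap V_o)\cup\{$maximal elements of $J$ in $V_c\}$; $a\odot b=b(J')$ for the unique order ideal $J'$ with $\mathbf 1_{K(\iota(a))}+\mathbf 1_{K(\iota(b))}=\mathbf 1_{K(\iota(a)\cup\iota(b))}+\mathbf 1_{K(J')}$. Diamond pair: $\{a,b\}$ with $a\vee b$ covering $a,b$ and both covering $a\wedge b$. For incomparable $a,b\in\mathcal N$, $e(a,b)=X_aX_b-\sum_i c_iX_{g_i(a,b)}X_{h_i(a,b)}$ is the unique element of $I$ with pairwise distinct pairs, $g_i<h_i$ in $\mathcal N$, $c_i\ne0$.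 A diamond pair $\{a,b\}$ is special if, writing $\iota(a)=\iota(a\wedge b)\cup\{(s,t)\}$ and $\iota(b)=\iota(a\wedge b)\cup\{(u,v)\}$ with $u<s\le t<v$, one has $u=s-1$ and $v=t+1$ (in the paper this is defined by transporting the notion of special diamond pair from the semistandard lattice via the lattice isomorphism $\tau$, and shown equivalent to this condition). For a special diamond pair, $e(a,b)$ has exactly three terms: $X_aX_b-X_{a\odot b}X_{a\vee b}-c_1X_{g_1(a,b)}X_{h_1(a,b)}$. *)

theory Defs
  imports
    "HOL-Analysis.Analysis"
    "HOL-Library.Poly_Mapping"
    "Jordan_Normal_Form.Determinant"
begin

section \<open>Polynomials\<close>

text \<open>
  A polynomial with variables indexed by \<open>'v\<close> is a finitely supported map from monomials
  (exponent vectors \<open>'v \<Rightarrow>\<^sub>0 nat\<close>) to coefficients; the ring operations are those of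
  \<^theory>\<open>HOL-Library.Poly_Mapping\<close>.
\<close>

type_synonym 'v cpoly = "('v \<Rightarrow>\<^sub>0 nat) \<Rightarrow>\<^sub>0 complex"

definition pconst :: "complex \<Rightarrow> 'v cpoly"
  where "pconst c = Poly_Mapping.single 0 c"

definition pvar :: "'v \<Rightarrow> 'v cpoly"
  where "pvar x = Poly_Mapping.single (Poly_Mapping.single x 1) 1"

definition psubst :: "('v \<Rightarrow> 'u cpoly) \<Rightarrow> 'v cpoly \<Rightarrow> 'u cpoly"
  where "psubst f p =
    (\<Sum>m\<in>Poly_Mapping.keys p. pconst (Poly_Mapping.lookup p m) * (\<Prod>x\<in>Poly_Mapping.keys m. f x ^ Poly_Mapping.lookup m x))"


section \<open>The Pluecker ideal\<close>

definition pl_vars :: "nat \<Rightarrow> nat list set"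
  where "pl_vars n =
    {i. sorted_wrt (<) i \<and> set i \<subseteq> {1..n} \<and> 1 \<le> length i \<and> length i \<le> n - 1}"

text \<open>The ring \<open>R\<close>; the type \<open>nat list cpoly\<close> has further variables, which are not used.\<close>

definition pl_ring :: "nat \<Rightarrow> nat list cpoly set"
  where "pl_ring n = {p. \<forall>m\<in>Poly_Mapping.keys p. Poly_Mapping.keys m \<subseteq> pl_vars n}"

text \<open>
  \<open>X\<^sub>\<alpha>\<close> for an arbitrary sequence \<open>\<alpha>\<close> of distinct indices: the sign of the permutation carrying
  the increasing rearrangement of \<open>\<alpha>\<close> to \<open>\<alpha>\<close>, times the variable of that rearrangement.
\<close>

definition pl_X :: "nat list \<Rightarrow> nat list cpoly"
  where "pl_X \<alpha> =
    of_int (sign (THE \<sigma>. \<sigma> permutes {..<length \<alpha>} \<and> permute_list \<sigma> (sort \<alpha>) = \<alpha>))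
      * pvar (sort \<alpha>)"

text \<open>
  The minor \<open>det (z\<^sub>r\<^sub>,\<^sub>i\<^sub>s)\<close> with \<open>1 \<le> r, s \<le> k\<close>; matrices and lists are indexed from 0.
\<close>

definition pl_minor :: "nat list \<Rightarrow> (nat \<times> nat) cpoly"
  where "pl_minor i =
    Determinant.det (Matrix.mat (length i) (length i) (\<lambda>(r, s). pvar (Suc r, i ! s)))"

definition pl_ideal :: "nat \<Rightarrow> nat list cpoly set"
  where "pl_ideal n = {p \<in> pl_ring n. psubst pl_minor p = 0}"


section \<open>PBW-semistandard columns\<close>

definition pbw_columns :: "nat \<Rightarrow> nat list set"
  where "pbw_columns n =
    {\<alpha>. 1 \<le> length \<alpha> \<and> length \<alpha> \<le> n - 1 \<and> set \<alpha> \<subseteq> {1..n} \<and>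
        (\<forall>r\<in>{1..length \<alpha>}. \<alpha> ! (r - 1) \<le> length \<alpha> \<longrightarrow> \<alpha> ! (r - 1) = r) \<and>
        (\<forall>r1\<in>{1..length \<alpha>}. \<forall>r2\<in>{1..length \<alpha>}.
           r1 < r2 \<and> \<alpha> ! (r1 - 1) > length \<alpha> \<and> \<alpha> ! (r2 - 1) > length \<alpha> \<longrightarrow>
           \<alpha> ! (r1 - 1) > \<alpha> ! (r2 - 1))}"

text \<open>\<open>pbw_le \<beta> \<alpha>\<close>: the columns \<open>\<alpha>\<close>, \<open>\<beta>\<close>, in this order, form a PBW-semistandard tableau.\<close>

definition pbw_le :: "nat list \<Rightarrow> nat list \<Rightarrow> bool"
  where "pbw_le \<beta> \<alpha> \<longleftrightarrow> length \<beta> \<le> length \<alpha> \<and>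
    (\<forall>r\<in>{1..length \<beta>}. \<exists>s\<in>{r..length \<alpha>}. \<alpha> ! (s - 1) \<ge> \<beta> ! (r - 1))"

definition pbw_less :: "nat list \<Rightarrow> nat list \<Rightarrow> bool"
  where "pbw_less \<beta> \<alpha> \<longleftrightarrow> pbw_le \<beta> \<alpha> \<and> \<beta> \<noteq> \<alpha>"

definition pbw_incomparable :: "nat \<Rightarrow> nat list \<Rightarrow> nat list \<Rightarrow> bool"
  where "pbw_incomparable n a b \<longleftrightarrow>
    a \<in> pbw_columns n \<and> b \<in> pbw_columns n \<and> \<not> pbw_le a b \<and> \<not> pbw_le b a"

definition pbw_join :: "nat \<Rightarrow> nat list \<Rightarrow> nat list \<Rightarrow> nat list"
  where "pbw_join n a b =
    (THE c. c \<in> pbw_columns n \<and> pbw_le a c \<and> pbw_le b c \<and>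
       (\<forall>d\<in>pbw_columns n. pbw_le a d \<and> pbw_le b d \<longrightarrow> pbw_le c d))"

definition pbw_meet :: "nat \<Rightarrow> nat list \<Rightarrow> nat list \<Rightarrow> nat list"
  where "pbw_meet n a b =
    (THE c. c \<in> pbw_columns n \<and> pbw_le c a \<and> pbw_le c b \<and>
       (\<forall>d\<in>pbw_columns n. pbw_le d a \<and> pbw_le d b \<longrightarrow> pbw_le d c))"

definition pbw_covers :: "nat \<Rightarrow> nat list \<Rightarrow> nat list \<Rightarrow> bool"
  where "pbw_covers n a b \<longleftrightarrow> a \<in> pbw_columns n \<and> b \<in> pbw_columns n \<and> pbw_less b a \<and>
    \<not> (\<exists>c\<in>pbw_columns n. pbw_less b c \<and> pbw_less c a)"

definition diamond_pair :: "nat \<Rightarrow> nat list \<Rightarrow> nat list \<Rightarrow> bool"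
  where "diamond_pair n a b \<longleftrightarrow> a \<in> pbw_columns n \<and> b \<in> pbw_columns n \<and>
    pbw_covers n (pbw_join n a b) a \<and> pbw_covers n (pbw_join n a b) b \<and>
    pbw_covers n a (pbw_meet n a b) \<and> pbw_covers n b (pbw_meet n a b)"


section \<open>Order ideals\<close>

text \<open>The order on pairs is the componentwise one of \<^theory>\<open>HOL-Library.Product_Order\<close>.\<close>

definition tri :: "nat \<Rightarrow> (nat \<times> nat) set"
  where "tri n = {(r, s). 1 \<le> r \<and> r \<le> s \<and> s \<le> n} - {(1, 1), (n, n)}"

definition order_ideals :: "nat \<Rightarrow> (nat \<times> nat) set set"
  where "order_ideals n = {J. J \<subseteq> tri n \<and> (\<forall>p\<in>J. \<forall>q\<in>tri n. q \<le> p \<longrightarrow> q \<in> J)}"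

definition maximal_elems :: "(nat \<times> nat) set \<Rightarrow> (nat \<times> nat) set"
  where "maximal_elems J = {p \<in> J. \<forall>q\<in>J. p \<le> q \<longrightarrow> q = p}"

definition column_length :: "(nat \<times> nat) set \<Rightarrow> nat"
  where "column_length J = (if \<exists>l. (l, l) \<in> J then Max {l. (l, l) \<in> J} else 1)"

definition ideal_column :: "(nat \<times> nat) set \<Rightarrow> nat list"
  where "ideal_column J =
    map (\<lambda>s. if \<exists>t. (s, t) \<in> maximal_elems J then THE t. (s, t) \<in> maximal_elems J else s)
      [1..<column_length J + 1]"

definition column_ideal :: "nat \<Rightarrow> nat list \<Rightarrow> (nat \<times> nat) set"
  where "column_ideal n = inv_into (order_ideals n) ideal_column"

definition V_o :: "nat \<Rightarrow> (nat \<times> nat) set"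
  where "V_o n = {(i, i) | i. 2 \<le> i \<and> i \<le> n - 1}"

definition V_c :: "nat \<Rightarrow> (nat \<times> nat) set"
  where "V_c n = {(r, s). 1 \<le> r \<and> r < s \<and> s \<le> n}"

text \<open>Maximality is meant in the whole of \<open>J\<close>, not only in \<open>J \<inter> V_c n\<close>.\<close>

definition K_set :: "nat \<Rightarrow> (nat \<times> nat) set \<Rightarrow> (nat \<times> nat) set"
  where "K_set n J = (J \<inter> V_o n) \<union> (maximal_elems J \<inter> V_c n)"

definition pbw_odot :: "nat \<Rightarrow> nat list \<Rightarrow> nat list \<Rightarrow> nat list"
  where "pbw_odot n a b = ideal_column (THE J. J \<in> order_ideals n \<and>
    (\<forall>p. indicator (K_set n (column_ideal n a)) p + indicator (K_set n (column_ideal n b)) p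
       = (indicator (K_set n (column_ideal n a \<union> column_ideal n b)) p
          + indicator (K_set n J) p :: nat)))"

definition special_diamond_pair :: "nat \<Rightarrow> nat list \<Rightarrow> nat list \<Rightarrow> bool"
  where "special_diamond_pair n a b \<longleftrightarrow> diamond_pair n a b \<and>
    (\<exists>a' b' s t u v. {a', b'} = {a, b} \<and>
       column_ideal n a' = insert (s, t) (column_ideal n (pbw_meet n a b)) \<and>
       column_ideal n b' = insert (u, v) (column_ideal n (pbw_meet n a b)) \<and>
       u < s \<and> s \<le> t \<and> t < v \<and> s = u + 1 \<and> v = t + 1)"


section \<open>Straightening relations\<close>

text \<open>
  The coefficients \<open>c (g, h)\<close> of the relation
  \<open>e(a,b) = X\<^sub>a X\<^sub>b - \<Sum> c (g, h) X\<^sub>g X\<^sub>h\<close>; the pairs \<open>(g\<^sub>i, h\<^sub>i)\<close>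
  occurring in \<open>e(a,b)\<close> are those with nonzero coefficient.
\<close>

definition straightening :: "nat \<Rightarrow> nat list \<Rightarrow> nat list \<Rightarrow> nat list \<times> nat list \<Rightarrow> complex"
  where "straightening n a b = (THE c.
    (\<forall>g h. c (g, h) \<noteq> 0 \<longrightarrow> g \<in> pbw_columns n \<and> h \<in> pbw_columns n \<and> pbw_less g h) \<and>
    pl_X a * pl_X b
      - (\<Sum>(g, h)\<in>pbw_columns n \<times> pbw_columns n. pconst (c (g, h)) * pl_X g * pl_X h)
      \<in> pl_ideal n)"

text \<open>
  For a special diamond pair, \<open>e(a,b)\<close> has precisely one term besides \<open>X\<^sub>a X\<^sub>b\<close> and the one of
  the pair \<open>(a \<odot> b, a \<or> b)\<close>; \<open>(g\<^sub>1(a,b), h\<^sub>1(a,b))\<close> is the pair of this term.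
\<close>

definition extra_pair :: "nat \<Rightarrow> nat list \<Rightarrow> nat list \<Rightarrow> nat list \<times> nat list"
  where "extra_pair n a b =
    (THE q. straightening n a b q \<noteq> 0 \<and> q \<noteq> (pbw_odot n a b, pbw_join n a b))"

definition g1 :: "nat \<Rightarrow> nat list \<Rightarrow> nat list \<Rightarrow> nat list"
  where "g1 n a b = fst (extra_pair n a b)"

definition h1 :: "nat \<Rightarrow> nat list \<Rightarrow> nat list \<Rightarrow> nat list"
  where "h1 n a b = snd (extra_pair n a b)"


section \<open>Initial ideals\<close>

text \<open>
  Weights are indexed by columns: the variable \<open>X\<^sub>i\<close>, \<open>i\<close> increasing, has the weight of the
  PBW-semistandard column with the same entries.
\<close>

definition var_weight :: "nat \<Rightarrow> (nat list \<Rightarrow> real) \<Rightarrow> nat list \<Rightarrow> real"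
  where "var_weight n w i = w (THE \<alpha>. \<alpha> \<in> pbw_columns n \<and> sort \<alpha> = i)"

definition mon_weight :: "nat \<Rightarrow> (nat list \<Rightarrow> real) \<Rightarrow> (nat list \<Rightarrow>\<^sub>0 nat) \<Rightarrow> real"
  where "mon_weight n w m = (\<Sum>i\<in>Poly_Mapping.keys m. real (Poly_Mapping.lookup m i) * var_weight n w i)"

definition initial_part :: "nat \<Rightarrow> (nat list \<Rightarrow> real) \<Rightarrow> nat list cpoly \<Rightarrow> nat list cpoly"
  where "initial_part n w p =
    (\<Sum>m\<in>{m \<in> Poly_Mapping.keys p. \<forall>m'\<in>Poly_Mapping.keys p. mon_weight n w m \<le> mon_weight n w m'}.
       Poly_Mapping.single m (Poly_Mapping.lookup p m))"

definition initial_space ::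
    "nat \<Rightarrow> (nat list \<Rightarrow> real) \<Rightarrow> nat list cpoly set \<Rightarrow> nat list cpoly set"
  where "initial_space n w I =
    Modules.module.span (\<lambda>c p. pconst c * p) (initial_part n w ` I)"

definition ideal_generated :: "nat \<Rightarrow> nat list cpoly set \<Rightarrow> nat list cpoly set"
  where "ideal_generated n G =
    {(\<Sum>g\<in>F. q g * g) | F q. finite F \<and> F \<subseteq> G \<and> (\<forall>g\<in>F. q g \<in> pl_ring n)}"

definition monomial_ideal :: "nat \<Rightarrow> nat list cpoly set"
  where "monomial_ideal n = ideal_generated n {pl_X a * pl_X b | a b. pbw_incomparable n a b}"


section \<open>The cone and its inequalities\<close>

text \<open>
  \<open>\<real>\<^sup>N\<close> is realised as \<open>real ^ 'm\<close> through a bijection \<open>idx\<close> from the index type \<open>'m\<close> onto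
  the columns; \<open>coords idx w\<close> is the family of coordinates \<open>w\<^sub>b\<close>.
\<close>

definition coords :: "('m::finite \<Rightarrow> nat list) \<Rightarrow> real ^ 'm \<Rightarrow> nat list \<Rightarrow> real"
  where "coords idx w b = vec_nth w (inv_into UNIV idx b)"

definition initial_cone ::
    "nat \<Rightarrow> ('m::finite \<Rightarrow> nat list) \<Rightarrow> nat list cpoly set \<Rightarrow> nat list cpoly set \<Rightarrow> (real ^ 'm) set"
  where "initial_cone n idx I J = {w. initial_space n (coords idx w) I = J}"

definition lt_set ::
    "('m::finite \<Rightarrow> nat list) \<Rightarrow> nat list \<Rightarrow> nat list \<Rightarrow> nat list \<Rightarrow> nat list \<Rightarrow> (real ^ 'm) set"
  where "lt_set idx a b c d =
    {w. coords idx w a + coords idx w b < coords idx w c + coords idx w d}"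

definition eq_set ::
    "('m::finite \<Rightarrow> nat list) \<Rightarrow> nat list \<Rightarrow> nat list \<Rightarrow> nat list \<Rightarrow> nat list \<Rightarrow> (real ^ 'm) set"
  where "eq_set idx a b c d =
    {w. coords idx w a + coords idx w b = coords idx w c + coords idx w d}"

definition halfspaces :: "nat \<Rightarrow> ('m::finite \<Rightarrow> nat list) \<Rightarrow> (real ^ 'm) set set"
  where "halfspaces n idx =
    {lt_set idx a b (pbw_join n a b) (pbw_odot n a b) | a b. diamond_pair n a b} \<union>
    {lt_set idx a b (g1 n a b) (h1 n a b) | a b. special_diamond_pair n a b}"

end

theory Submission imports Defs begin

text \<open>
  With respect to a weight on the entries \<open>z\<^sub>r\<^sub>,\<^sub>s\<close> of the matrix that is strictly concave in the
  distance from the diagonal, the initial term of the minor of a PBW-semistandard column \<open>\<alpha>\<close> is the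
  product of the cells \<open>(r, \<alpha>\<^sub>r)\<close>. A chain of columns is determined by the product of its
  initial terms, so monomials supported on chains are linearly independent modulo the ideal. A
  product of two minors is a combination of minors of chains by Garnir exchange, and the term of
  the pair \<open>(a \<odot> b, a \<or> b)\<close> is the one with the same initial term. Hence a weight \<open>w\<close> lies in the
  cone iff \<open>w\<^sub>a + w\<^sub>b < w\<^sub>g + w\<^sub>h\<close> for every term \<open>X\<^sub>g X\<^sub>h\<close> of every \<open>e(a,b)\<close>.

  If such a term is not one of those listed for diamond pairs, there is a column \<open>x\<close>
  incomparable to \<open>a\<close> or \<open>b\<close> but comparable to \<open>g\<close> and \<open>h\<close>. Straightening \<open>X\<^sub>a X\<^sub>b X\<^sub>x\<close> in two
  ways and comparing coefficients of \<open>X\<^sub>g X\<^sub>h X\<^sub>x\<close> expresses the inequality as a sum of smaller ones.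

  The inequality of a pair \<open>(g, h)\<close> on the list is irredundant because \<open>h\<close> together with a lower
  bound \<open>g\<close> on the smaller member determines it: starting from a point of the cone, one lowers the
  coordinate of \<open>h\<close> until this inequality becomes an equality, and repairs the others by adding weights
  that grow rapidly above the columns not below \<open>h\<close> and below the columns not above \<open>g\<close>.
\<close>

section \<open>Columns and order ideals\<close>

text \<open>Garnir exchange does not lead to PBW chains directly: it stops at the ordinary
  semistandard pairs of subsets. The two families are linked by a dimension count:
  \<open>subset_column\<close> embeds the semistandard pairs of given cardinalities into the PBW
  chains of the same lengths, and products of minors over chains are independent, so both span the
  same space. This yields no rewriting rule, hence nothing is known about the coefficients beyond
  homogeneity and leading terms; only for special diamonds, where the content leaves few candidates,
  is a relation computed. Questions about the order are moved to order ideals, where join and meet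
  are union and intersection, while contents are compared as multisets of entries. The concave
  weight alone cannot direct the straightening, because the term of the join has the same weight as
  the pair \<open>(a, b)\<close>; \<open>base_weight\<close> therefore adds a tie-breaker depending
  on the size of the ideals. It serves three times: as termination measure, as measure for the
  induction over detours, and as a point of the cone.\<close>

definition cells :: "nat list \<Rightarrow> (nat \<times> nat) set"
  where "cells \<alpha> = {(Suc r, \<alpha> ! r) | r. r < length \<alpha>}"

text \<open>An explicit inverse of \<open>ideal_column\<close>, see \<open>column_ideal_eq\<close>.
  Restricting to \<open>tri n\<close> drops the cell (1, 1), which occurs in every column that
  starts with 1.\<close>

definition col_ideal :: "nat \<Rightarrow> nat list \<Rightarrow> (nat \<times> nat) set"
  where "col_ideal n \<alpha> = {p \<in> tri n. \<exists>q\<in>cells \<alpha>. p \<le> q}"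

lemma pbw_columnsI:
  assumes "1 \<le> length \<alpha>" "length \<alpha> \<le> n - 1"
    and "\<And>r. r < length \<alpha> \<Longrightarrow> 1 \<le> \<alpha> ! r \<and> \<alpha> ! r \<le> n"
    and "\<And>r. r < length \<alpha> \<Longrightarrow> \<alpha> ! r \<le> length \<alpha> \<Longrightarrow> \<alpha> ! r = Suc r"
    and "\<And>r s. r < s \<Longrightarrow> s < length \<alpha> \<Longrightarrow> length \<alpha> < \<alpha> ! r \<Longrightarrow> length \<alpha> < \<alpha> ! s \<Longrightarrow> \<alpha> ! s < \<alpha> ! r"
  shows "\<alpha> \<in> pbw_columns n"
proof -
  have "set \<alpha> \<subseteq> {1..n}"
    using assms(3) by (auto simp: in_set_conv_nth)
  moreover have "\<alpha> ! (r - 1) = r" if "r \<in> {1..length \<alpha>}" "\<alpha> ! (r - 1) \<le> length \<alpha>" for r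
    using assms(4)[of "r - 1"] that by auto
  moreover have "\<alpha> ! (s - 1) < \<alpha> ! (r - 1)"
    if "r \<in> {1..length \<alpha>}" "s \<in> {1..length \<alpha>}" "r < s" "length \<alpha> < \<alpha> ! (r - 1)" "length \<alpha> < \<alpha> ! (s - 1)" for r s
    using assms(5)[of "r - 1" "s - 1"] that by auto
  ultimately show ?thesis
    using assms(1,2) unfolding pbw_columns_def by blast
qed

lemma pbw_columnsD:
  assumes "\<alpha> \<in> pbw_columns n"
  shows "1 \<le> length \<alpha>" "length \<alpha> \<le> n - 1"
    and "r < length \<alpha> \<Longrightarrow> 1 \<le> \<alpha> ! r" "r < length \<alpha> \<Longrightarrow> \<alpha> ! r \<le> n"
    and "r < length \<alpha> \<Longrightarrow> \<alpha> ! r \<le> length \<alpha> \<Longrightarrow> \<alpha> ! r = Suc r"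
    and "r < s \<Longrightarrow> s < length \<alpha> \<Longrightarrow> length \<alpha> < \<alpha> ! r \<Longrightarrow> length \<alpha> < \<alpha> ! s \<Longrightarrow> \<alpha> ! s < \<alpha> ! r"
proof -
  note * = assms[unfolded pbw_columns_def mem_Collect_eq]
  show "1 \<le> length \<alpha>" "length \<alpha> \<le> n - 1" using * by auto
  show "r < length \<alpha> \<Longrightarrow> 1 \<le> \<alpha> ! r" "r < length \<alpha> \<Longrightarrow> \<alpha> ! r \<le> n"
    using * by (meson atLeastAtMost_iff nth_mem subsetD)+
  show "\<alpha> ! r = Suc r" if "r < length \<alpha>" "\<alpha> ! r \<le> length \<alpha>"
  proof -
    have "Suc r \<in> {1..length \<alpha>}" using that by auto
    then have "\<alpha> ! (Suc r - 1) \<le> length \<alpha> \<longrightarrow> \<alpha> ! (Suc r - 1) = Suc r" using * by blast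
    then show ?thesis using that by simp
  qed
  show "\<alpha> ! s < \<alpha> ! r" if "r < s" "s < length \<alpha>" "length \<alpha> < \<alpha> ! r" "length \<alpha> < \<alpha> ! s"
  proof -
    have "Suc r \<in> {1..length \<alpha>}" "Suc s \<in> {1..length \<alpha>}" using that by auto
    then have "Suc r < Suc s \<and> \<alpha> ! (Suc r - 1) > length \<alpha> \<and> \<alpha> ! (Suc s - 1) > length \<alpha> \<longrightarrow>
           \<alpha> ! (Suc r - 1) > \<alpha> ! (Suc s - 1)" using * by blast
    then show ?thesis using that by simp
  qed
qed

lemma pbw_columns_ge:
  assumes "\<alpha> \<in> pbw_columns n" "r < length \<alpha>"
  shows "Suc r \<le> \<alpha> ! r"
  using pbw_columnsD(5)[OF assms] assms(2) by (cases "\<alpha> ! r \<le> length \<alpha>") auto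

lemma pbw_columns_distinct:
  assumes "\<alpha> \<in> pbw_columns n"
  shows "distinct \<alpha>"
proof -
  have *: "\<alpha> ! i \<noteq> \<alpha> ! j" if "i < j" "j < length \<alpha>" for i j
    using pbw_columnsD(5)[OF assms, of i] pbw_columnsD(5)[OF assms, of j] pbw_columnsD(6)[OF assms that] that
    by (metis Suc_inject less_trans not_le nat_neq_iff)
  show ?thesis
    unfolding distinct_conv_nth using * by (metis nat_neq_iff)
qed

lemma pbw_columns_set: "\<alpha> \<in> pbw_columns n \<Longrightarrow> set \<alpha> \<subseteq> {1..n}"
  unfolding pbw_columns_def by blast

lemma finite_pbw_columns: "finite (pbw_columns n)"
proof (rule finite_subset)
  show "pbw_columns n \<subseteq> {xs. set xs \<subseteq> {1..n} \<and> length xs \<le> n}"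
    unfolding pbw_columns_def by auto
qed (rule finite_lists_length_le, simp)

lemma pbw_columns_mem_fixed:
  assumes "\<alpha> \<in> pbw_columns n" "x \<in> set \<alpha>" "x \<le> length \<alpha>"
  shows "0 < x" "\<alpha> ! (x - 1) = x"
proof -
  obtain i where i: "i < length \<alpha>" "\<alpha> ! i = x" using assms(2) by (auto simp: in_set_conv_nth)
  have "x = Suc i" using pbw_columnsD(5)[OF assms(1) i(1)] i assms(3) by simp
  then show "0 < x" "\<alpha> ! (x - 1) = x" using i by auto
qed

text \<open>The length condition in \<open>pbw_le\<close> follows from domination: the cell in the
  last row of \<open>\<beta>\<close> needs a cell of \<open>\<alpha>\<close> at least as far down.
  This is where \<open>\<beta>\<close> must be nonempty.\<close>

lemma pbw_le_iff_cells:
  assumes "\<beta> \<noteq> []"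
  shows "pbw_le \<beta> \<alpha> \<longleftrightarrow> (\<forall>q\<in>cells \<beta>. \<exists>q'\<in>cells \<alpha>. q \<le> q')"
proof
  assume *: "pbw_le \<beta> \<alpha>"
  show "\<forall>q\<in>cells \<beta>. \<exists>q'\<in>cells \<alpha>. q \<le> q'"
  proof
    fix q assume "q \<in> cells \<beta>"
    then obtain r where r: "r < length \<beta>" "q = (Suc r, \<beta> ! r)" unfolding cells_def by auto
    then have "Suc r \<in> {1..length \<beta>}" by auto
    then obtain s where s: "s \<in> {Suc r..length \<alpha>}" "\<beta> ! (Suc r - 1) \<le> \<alpha> ! (s - 1)"
      using * unfolding pbw_le_def by blast
    then have "(s, \<alpha> ! (s - 1)) \<in> cells \<alpha>" unfolding cells_def
      by (auto intro!: exI[of _ "s - 1"])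
    moreover have "q \<le> (s, \<alpha> ! (s - 1))" using r s by auto
    ultimately show "\<exists>q'\<in>cells \<alpha>. q \<le> q'" by blast
  qed
next
  assume *: "\<forall>q\<in>cells \<beta>. \<exists>q'\<in>cells \<alpha>. q \<le> q'"
  have **: "\<exists>s\<in>{r..length \<alpha>}. \<alpha> ! (s - 1) \<ge> \<beta> ! (r - 1)" if "r \<in> {1..length \<beta>}" for r
  proof -
    have "(r, \<beta> ! (r - 1)) \<in> cells \<beta>" unfolding cells_def using that
      by (auto intro!: exI[of _ "r - 1"])
    then obtain q' where "q' \<in> cells \<alpha>" "(r, \<beta> ! (r - 1)) \<le> q'" using * by blast
    then obtain s where "s < length \<alpha>" "r \<le> Suc s" "\<beta> ! (r - 1) \<le> \<alpha> ! s"
      unfolding cells_def by auto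
    then show ?thesis by (intro bexI[of _ "Suc s"]) auto
  qed
  have "length \<beta> \<in> {1..length \<beta>}" using assms by (simp add: Suc_le_eq)
  then have "length \<beta> \<le> length \<alpha>" using **[of "length \<beta>"] by auto
  then show "pbw_le \<beta> \<alpha>"
    unfolding pbw_le_def using ** by blast
qed

lemma pbw_le_nth:
  assumes "pbw_le \<beta> \<alpha>" "r < length \<beta>"
  shows "\<exists>s<length \<alpha>. r \<le> s \<and> \<beta> ! r \<le> \<alpha> ! s"
proof -
  have "(Suc r, \<beta> ! r) \<in> cells \<beta>" using assms unfolding cells_def by auto
  moreover have "\<beta> \<noteq> []" using assms by auto
  ultimately obtain q' where "q' \<in> cells \<alpha>" "(Suc r, \<beta> ! r) \<le> q'"
    using assms(1) pbw_le_iff_cells by blast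
  then show ?thesis unfolding cells_def by auto
qed

lemma pbw_columns_nonempty: "\<alpha> \<in> pbw_columns n \<Longrightarrow> \<alpha> \<noteq> []"
  using pbw_columnsD(1) by fastforce

lemma cells_tri:
  assumes "\<alpha> \<in> pbw_columns n" "q \<in> cells \<alpha>" "q \<noteq> (1, 1)"
  shows "q \<in> tri n"
proof -
  obtain r where r: "r < length \<alpha>" "q = (Suc r, \<alpha> ! r)" using assms(2) unfolding cells_def by auto
  then show ?thesis
    using pbw_columnsD(2)[OF assms(1)] pbw_columnsD(4)[OF assms(1) r(1)] pbw_columns_ge[OF assms(1) r(1)]
      assms(3) unfolding tri_def by auto
qed

text \<open>The only cell that can lie outside \<open>tri n\<close> is (1, 1), and it is below the
  first cell of every column; so nothing is lost in passing from cells to ideals.\<close>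

lemma pbw_le_iff_subset:
  assumes "\<alpha> \<in> pbw_columns n" "\<beta> \<in> pbw_columns n"
  shows "pbw_le \<beta> \<alpha> \<longleftrightarrow> col_ideal n \<beta> \<subseteq> col_ideal n \<alpha>"
proof
  assume "pbw_le \<beta> \<alpha>"
  then show "col_ideal n \<beta> \<subseteq> col_ideal n \<alpha>"
    unfolding pbw_le_iff_cells[OF pbw_columns_nonempty[OF assms(2)]] col_ideal_def
    by (blast intro: order_trans)
next
  assume *: "col_ideal n \<beta> \<subseteq> col_ideal n \<alpha>"
  show "pbw_le \<beta> \<alpha>"
    unfolding pbw_le_iff_cells[OF pbw_columns_nonempty[OF assms(2)]]
  proof
    fix q assume q: "q \<in> cells \<beta>"
    show "\<exists>q'\<in>cells \<alpha>. q \<le> q'"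
    proof (cases "q = (1, 1)")
      case True
      have "(1, \<alpha> ! 0) \<in> cells \<alpha>" using pbw_columns_nonempty[OF assms(1)] unfolding cells_def by auto
      moreover have "q \<le> (1, \<alpha> ! 0)" using True pbw_columns_ge[OF assms(1), of 0] pbw_columns_nonempty[OF assms(1)] by auto
      ultimately show ?thesis by blast
    next
      case False
      then have "q \<in> col_ideal n \<beta>" using q cells_tri[OF assms(2) q] unfolding col_ideal_def by auto
      then show ?thesis using * unfolding col_ideal_def by auto
    qed
  qed
qed

section \<open>Order ideals of the triangle and the columns encoding them\<close>

lemma order_ideals_down:
  "J \<in> order_ideals n \<Longrightarrow> p \<in> J \<Longrightarrow> q \<in> tri n \<Longrightarrow> q \<le> p \<Longrightarrow> q \<in> J"
  unfolding order_ideals_def by blast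

lemma order_ideals_sub: "J \<in> order_ideals n \<Longrightarrow> J \<subseteq> tri n"
  unfolding order_ideals_def by blast

lemma order_ideals_Un: "I \<in> order_ideals n \<Longrightarrow> J \<in> order_ideals n \<Longrightarrow> I \<union> J \<in> order_ideals n"
  and order_ideals_Int: "I \<in> order_ideals n \<Longrightarrow> J \<in> order_ideals n \<Longrightarrow> I \<inter> J \<in> order_ideals n"
  unfolding order_ideals_def by auto

lemma finite_tri: "finite (tri n)"
  by (rule finite_subset[of _ "{0..n} \<times> {0..n}"]) (auto simp: tri_def)

lemma order_ideals_finite: "J \<in> order_ideals n \<Longrightarrow> finite J"
  using order_ideals_sub finite_tri finite_subset by blast

lemma col_ideal_order_ideal: "col_ideal n \<alpha> \<in> order_ideals n"
  unfolding order_ideals_def col_ideal_def by (auto intro: order_trans)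

lemma maximal_above:
  assumes "J \<in> order_ideals n" "p \<in> J"
  shows "\<exists>q\<in>maximal_elems J. p \<le> q"
proof -
  have "finite {q \<in> J. p \<le> q}" "{q \<in> J. p \<le> q} \<noteq> {}" using assms order_ideals_finite[OF assms(1)] by (simp, blast)
  from finite_has_maximal[OF this] obtain q where
    q: "q \<in> {q \<in> J. p \<le> q}" "\<And>q'. q' \<in> {q \<in> J. p \<le> q} \<Longrightarrow> q \<le> q' \<Longrightarrow> q = q'"
    by blast
  then have "q \<in> maximal_elems J" unfolding maximal_elems_def by (simp, metis order_trans)
  then show ?thesis using q by blast
qed

text \<open>If \<open>(r, t)\<close> is in the ideal and r is at least 2, then so is
  \<open>(r, r)\<close>: it lies below, and r = n is impossible because (n, n) is excluded. Hence
  the diagonal determines which rows occur.\<close>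

lemma column_length_props:
  assumes "J \<in> order_ideals n" "2 \<le> n"
  shows "1 \<le> column_length J" "column_length J \<le> n - 1"
    and "(l, l) \<in> J \<Longrightarrow> l \<le> column_length J"
    and "2 \<le> l \<Longrightarrow> l \<le> column_length J \<Longrightarrow> (l, l) \<in> J"
    and "(r, t) \<in> J \<Longrightarrow> r \<le> column_length J"
proof -
  let ?L = "{l. (l, l) \<in> J}"
  have sub: "J \<subseteq> tri n" using assms(1) by (rule order_ideals_sub)
  have L: "2 \<le> l \<and> l \<le> n - 1" if "(l, l) \<in> J" for l
  proof -
    have "(l, l) \<in> tri n" using that sub by auto
    then show ?thesis unfolding tri_def by auto
  qed
  have fin: "finite ?L" by (rule finite_subset[of _ "{0..n - 1}"]) (use L in auto)
  show 3: "l \<le> column_length J" if "(l, l) \<in> J" for l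
    using that fin unfolding column_length_def by auto
  have 4: "column_length J = 1 \<or> (column_length J, column_length J) \<in> J"
  proof (cases "\<exists>l. (l, l) \<in> J")
    case True
    then have "Max ?L \<in> ?L" using fin Max_in by blast
    then show ?thesis unfolding column_length_def by auto
  qed (simp add: column_length_def)
  show "1 \<le> column_length J" "column_length J \<le> n - 1" using 4 L assms(2) by force+
  show 5: "(l, l) \<in> J" if "2 \<le> l" "l \<le> column_length J" for l
  proof -
    have J: "(column_length J, column_length J) \<in> J" using 4 that by auto
    have "(l, l) \<in> tri n" using that L[OF J] unfolding tri_def by auto
    then show ?thesis using order_ideals_down[OF assms(1) J] that by auto
  qed
  show "r \<le> column_length J" if "(r, t) \<in> J"
  proof (cases "r \<ge> 2")
    case True
    have rt: "(r, t) \<in> tri n" using that sub by auto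
    show ?thesis
    proof (cases "r = n")
      case True
      then show ?thesis using rt unfolding tri_def by auto
    next
      case False
      then have "(r, r) \<in> tri n" "(r, r) \<le> (r, t)" using rt True unfolding tri_def by auto
      then show ?thesis using 3 order_ideals_down[OF assms(1) that] by blast
    qed
  next
    case False
    then show ?thesis using \<open>1 \<le> column_length J\<close> by auto
  qed
qed

lemma ideal_column_length [simp]: "length (ideal_column J) = column_length J"
  unfolding ideal_column_def by simp

lemma ideal_column_nth:
  assumes "r < column_length J"
  shows "(Suc r, t) \<in> maximal_elems J \<Longrightarrow> ideal_column J ! r = t"
    and "(\<And>t. (Suc r, t) \<notin> maximal_elems J) \<Longrightarrow> ideal_column J ! r = Suc r"
proof -
  have nth: "ideal_column J ! r = (if \<exists>t. (Suc r, t) \<in> maximal_elems J then THE t. (Suc r, t) \<in> maximal_elems J else Suc r)"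
    unfolding ideal_column_def using assms by (simp add: nth_map del: upt_Suc)
  show "ideal_column J ! r = t" if "(Suc r, t) \<in> maximal_elems J"
  proof -
    have "t' = t" if "(Suc r, t') \<in> maximal_elems J" for t'
      using that \<open>(Suc r, t) \<in> maximal_elems J\<close> unfolding maximal_elems_def
      by (cases "t \<le> t'") auto
    then have "(THE t. (Suc r, t) \<in> maximal_elems J) = t" using that by blast
    then show ?thesis using nth that by auto
  qed
  show "(\<And>t. (Suc r, t) \<notin> maximal_elems J) \<Longrightarrow> ideal_column J ! r = Suc r" using nth by auto
qed

lemma ideal_column_cases:
  assumes "r < column_length J"
  obtains "(Suc r, ideal_column J ! r) \<in> maximal_elems J"
  | "\<And>t. (Suc r, t) \<notin> maximal_elems J" "ideal_column J ! r = Suc r"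
  using ideal_column_nth[OF assms] by metis

text \<open>With k the column length, a maximal element \<open>(r, t)\<close> with t at most k lies
  below (k, k), hence equals it; this gives the first column condition. The second holds because
  maximal elements form an antichain.\<close>

lemma ideal_column_mem:
  assumes "J \<in> order_ideals n" "2 \<le> n"
  shows "ideal_column J \<in> pbw_columns n"
proof (rule pbw_columnsI; simp only: ideal_column_length)
  note cl = column_length_props[OF assms]
  show "1 \<le> column_length J" "column_length J \<le> n - 1" using cl by auto
  show "1 \<le> ideal_column J ! r \<and> ideal_column J ! r \<le> n" if "r < column_length J" for r
    using that
  proof (cases rule: ideal_column_cases)
    case 1
    then have "(Suc r, ideal_column J ! r) \<in> tri n"
      using order_ideals_sub[OF assms(1)] unfolding maximal_elems_def by auto
    then show ?thesis unfolding tri_def by auto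
  next
    case 2
    then show ?thesis using that cl by auto
  qed
  show "ideal_column J ! r = Suc r" if "r < column_length J" "ideal_column J ! r \<le> column_length J" for r
    using that(1)
  proof (cases rule: ideal_column_cases)
    case 1
    let ?t = "ideal_column J ! r"
    have mem: "(Suc r, ?t) \<in> J" using 1 unfolding maximal_elems_def by auto
    have tri: "(Suc r, ?t) \<in> tri n" using mem order_ideals_sub[OF assms(1)] by auto
    then have ge: "2 \<le> column_length J" using that unfolding tri_def by auto
    have "(column_length J, column_length J) \<in> J" using cl(4)[OF ge] by auto
    moreover have "(Suc r, ?t) \<le> (column_length J, column_length J)" using that by auto
    ultimately have "(Suc r, ?t) = (column_length J, column_length J)" using 1 unfolding maximal_elems_def by force
    then show ?thesis by auto
  qed auto
  show "ideal_column J ! s < ideal_column J ! r"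
    if "r < s" "s < column_length J" "column_length J < ideal_column J ! r" "column_length J < ideal_column J ! s" for r s
  proof -
    have "(Suc r, ideal_column J ! r) \<in> maximal_elems J"
      by (rule ideal_column_cases[of r J]) (use that in auto)
    moreover have "(Suc s, ideal_column J ! s) \<in> maximal_elems J"
      by (rule ideal_column_cases[of s J]) (use that in auto)
    ultimately show ?thesis using that(1) unfolding maximal_elems_def by (cases "ideal_column J ! r \<le> ideal_column J ! s") auto
  qed
qed

text \<open>A row r without a maximal element carries the entry r; the cell \<open>(r, r)\<close> it
  adds lies in \<open>J\<close> anyway, unless it is (1, 1), which does not count.\<close>

lemma col_ideal_ideal_column:
  assumes "J \<in> order_ideals n" "2 \<le> n"
  shows "col_ideal n (ideal_column J) = J"
proof
  note cl = column_length_props[OF assms]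
  show "J \<subseteq> col_ideal n (ideal_column J)"
  proof
    fix p assume p: "p \<in> J"
    obtain s t where st: "(s, t) \<in> maximal_elems J" "p \<le> (s, t)" using maximal_above[OF assms(1) p] by auto
    have "(s, t) \<in> J" using st unfolding maximal_elems_def by auto
    then have s: "1 \<le> s" "s \<le> column_length J" using order_ideals_sub[OF assms(1)] cl(5) unfolding tri_def by auto
    then have "ideal_column J ! (s - 1) = t" using ideal_column_nth(1)[of "s - 1" J t] st by auto
    then have "(s, t) \<in> cells (ideal_column J)" unfolding cells_def using s by (auto intro!: exI[of _ "s - 1"])
    then show "p \<in> col_ideal n (ideal_column J)"
      unfolding col_ideal_def using st p order_ideals_sub[OF assms(1)] by auto
  qed
  show "col_ideal n (ideal_column J) \<subseteq> J"
  proof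
    fix p assume "p \<in> col_ideal n (ideal_column J)"
    then obtain r where p: "p \<in> tri n" "r < column_length J" "p \<le> (Suc r, ideal_column J ! r)"
      unfolding col_ideal_def cells_def by auto
    from p(2) show "p \<in> J"
    proof (cases rule: ideal_column_cases)
      case 1
      then have "(Suc r, ideal_column J ! r) \<in> J" unfolding maximal_elems_def by simp
      then show ?thesis using p(1,3) order_ideals_down[OF assms(1)] by blast
    next
      case 2
      have "2 \<le> Suc r" using 2 p unfolding tri_def by (cases r) auto
      then have "(Suc r, Suc r) \<in> J" using cl(4)[of "Suc r"] p by auto
      then show ?thesis using p 2 order_ideals_down[OF assms(1)] by auto
    qed
  qed
qed

lemma col_ideal_diag:
  assumes "\<alpha> \<in> pbw_columns n"
  shows "(l, l) \<in> col_ideal n \<alpha> \<longleftrightarrow> 2 \<le> l \<and> l \<le> length \<alpha>"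
proof
  assume "(l, l) \<in> col_ideal n \<alpha>"
  then show "2 \<le> l \<and> l \<le> length \<alpha>" unfolding col_ideal_def cells_def tri_def by auto
next
  assume *: "2 \<le> l \<and> l \<le> length \<alpha>"
  have "l \<le> \<alpha> ! (l - 1)" using pbw_columns_ge[OF assms, of "l - 1"] * by auto
  then have "(l, l) \<le> (l, \<alpha> ! (l - 1))" by simp
  moreover have "(l, \<alpha> ! (l - 1)) \<in> cells \<alpha>" unfolding cells_def using * by (auto intro!: exI[of _ "l - 1"])
  moreover have "(l, l) \<in> tri n" using * pbw_columnsD(2)[OF assms] unfolding tri_def by auto
  ultimately show "(l, l) \<in> col_ideal n \<alpha>" unfolding col_ideal_def by blast
qed

lemma column_length_col_ideal:
  assumes "\<alpha> \<in> pbw_columns n"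
  shows "column_length (col_ideal n \<alpha>) = length \<alpha>"
proof (cases "2 \<le> length \<alpha>")
  case True
  have "{l. (l, l) \<in> col_ideal n \<alpha>} = {2..length \<alpha>}" by (simp add: set_eq_iff col_ideal_diag[OF assms])
  moreover have "\<exists>l. (l, l) \<in> col_ideal n \<alpha>" using True by (auto simp: col_ideal_diag[OF assms])
  moreover have "Max {2..length \<alpha>} = length \<alpha>" using True by (intro Max_eqI) auto
  ultimately show ?thesis unfolding column_length_def by simp
next
  case False
  then have "\<not> (\<exists>l. (l, l) \<in> col_ideal n \<alpha>)" by (auto simp: col_ideal_diag[OF assms])
  then show ?thesis using False pbw_columnsD(1)[OF assms] unfolding column_length_def by simp
qed

text \<open>A cell \<open>(r, r)\<close> in a row before the last one is dominated by the cell of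
  the last row, so only cells whose entry exceeds the length are sure to be maximal.\<close>

lemma maximal_col_ideal:
  assumes "\<alpha> \<in> pbw_columns n"
  shows "q \<in> maximal_elems (col_ideal n \<alpha>) \<Longrightarrow> q \<in> cells \<alpha>"
    and "q \<in> cells \<alpha> \<Longrightarrow> length \<alpha> < snd q \<Longrightarrow> q \<in> maximal_elems (col_ideal n \<alpha>)"
proof -
  show "q \<in> cells \<alpha>" if q: "q \<in> maximal_elems (col_ideal n \<alpha>)"
  proof -
    obtain q' where q': "q' \<in> cells \<alpha>" "q \<le> q'" "q \<in> tri n" using q unfolding maximal_elems_def col_ideal_def by auto
    have "q' \<noteq> (1, 1)" using q' unfolding tri_def by auto
    then have "q' \<in> col_ideal n \<alpha>" using q' cells_tri[OF assms] unfolding col_ideal_def by auto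
    then show ?thesis using q q' unfolding maximal_elems_def by auto
  qed
  show "q \<in> maximal_elems (col_ideal n \<alpha>)" if q: "q \<in> cells \<alpha>" "length \<alpha> < snd q"
  proof -
    obtain r where r: "r < length \<alpha>" "q = (Suc r, \<alpha> ! r)" using q unfolding cells_def by auto
    have "q \<noteq> (1, 1)" using q(2) r pbw_columnsD(1)[OF assms] by auto
    then have mem: "q \<in> col_ideal n \<alpha>" using q cells_tri[OF assms] unfolding col_ideal_def by auto
    have "q' = q" if q': "q' \<in> col_ideal n \<alpha>" "q \<le> q'" for q'
    proof -
      obtain s where s: "s < length \<alpha>" "q' \<le> (Suc s, \<alpha> ! s)" using q' unfolding col_ideal_def cells_def by auto
      then have "(Suc r, \<alpha> ! r) \<le> (Suc s, \<alpha> ! s)" using q' r order_trans by metis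
      then have rs: "r \<le> s" "\<alpha> ! r \<le> \<alpha> ! s" by auto
      have "r = s" using pbw_columnsD(6)[OF assms, of r s] rs s q(2) r by (cases "r = s") auto
      then show ?thesis using q' s r by (simp add: order_antisym)
    qed
    then show ?thesis using mem unfolding maximal_elems_def by auto
  qed
qed

lemma ideal_column_col_ideal:
  assumes "\<alpha> \<in> pbw_columns n"
  shows "ideal_column (col_ideal n \<alpha>) = \<alpha>"
proof (rule nth_equalityI)
  show len: "length (ideal_column (col_ideal n \<alpha>)) = length \<alpha>" by (simp add: column_length_col_ideal[OF assms])
  fix r assume "r < length (ideal_column (col_ideal n \<alpha>))"
  then have r: "r < column_length (col_ideal n \<alpha>)" "r < length \<alpha>" using len by auto
  show "ideal_column (col_ideal n \<alpha>) ! r = \<alpha> ! r"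
  proof (cases "length \<alpha> < \<alpha> ! r")
    case True
    then have "(Suc r, \<alpha> ! r) \<in> maximal_elems (col_ideal n \<alpha>)"
      using maximal_col_ideal(2)[OF assms, of "(Suc r, \<alpha> ! r)"] r unfolding cells_def by auto
    then show ?thesis using ideal_column_nth(1)[OF r(1)] by auto
  next
    case False
    from r(1) show ?thesis
    proof (cases rule: ideal_column_cases)
      case 1
      then show ?thesis using maximal_col_ideal(1)[OF assms] unfolding cells_def by auto
    next
      case 2
      then show ?thesis using False pbw_columnsD(5)[OF assms r(2)] by auto
    qed
  qed
qed

lemma col_ideal_inj:
  "\<alpha> \<in> pbw_columns n \<Longrightarrow> \<beta> \<in> pbw_columns n \<Longrightarrow> col_ideal n \<alpha> = col_ideal n \<beta> \<longleftrightarrow> \<alpha> = \<beta>"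
  using ideal_column_col_ideal by metis

lemma column_ideal_eq:
  assumes "\<alpha> \<in> pbw_columns n" "2 \<le> n"
  shows "column_ideal n \<alpha> = col_ideal n \<alpha>"
proof -
  have "inj_on ideal_column (order_ideals n)"
    by (rule inj_on_inverseI[of _ "col_ideal n"]) (use col_ideal_ideal_column assms(2) in auto)
  then show ?thesis unfolding column_ideal_def
    using inv_into_f_f[OF _ col_ideal_order_ideal] ideal_column_col_ideal[OF assms(1)] by metis
qed

section \<open>The lattice of columns: joins, meets, covers and diamond pairs\<close>

lemma pbw_le_refl: "\<alpha> \<in> pbw_columns n \<Longrightarrow> pbw_le \<alpha> \<alpha>"
  by (simp add: pbw_le_iff_subset)

lemma pbw_le_antisym:
  "\<alpha> \<in> pbw_columns n \<Longrightarrow> \<beta> \<in> pbw_columns n \<Longrightarrow> pbw_le \<alpha> \<beta> \<Longrightarrow> pbw_le \<beta> \<alpha> \<Longrightarrow> \<alpha> = \<beta>"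
  using pbw_le_iff_subset col_ideal_inj by blast

lemma pbw_le_trans:
  "\<alpha> \<in> pbw_columns n \<Longrightarrow> \<beta> \<in> pbw_columns n \<Longrightarrow> \<gamma> \<in> pbw_columns n \<Longrightarrow>
    pbw_le \<alpha> \<beta> \<Longrightarrow> pbw_le \<beta> \<gamma> \<Longrightarrow> pbw_le \<alpha> \<gamma>"
  using pbw_le_iff_subset by blast

lemma col_of_ideal:
  assumes "J \<in> order_ideals n" "2 \<le> n"
  obtains c where "c \<in> pbw_columns n" "col_ideal n c = J"
  using ideal_column_mem[OF assms] col_ideal_ideal_column[OF assms] by blast

lemma pbw_join:
  assumes "a \<in> pbw_columns n" "b \<in> pbw_columns n" "2 \<le> n"
  shows "pbw_join n a b \<in> pbw_columns n"
    and "col_ideal n (pbw_join n a b) = col_ideal n a \<union> col_ideal n b"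
proof -
  obtain c where c: "c \<in> pbw_columns n" "col_ideal n c = col_ideal n a \<union> col_ideal n b"
    using col_of_ideal[OF order_ideals_Un[OF col_ideal_order_ideal col_ideal_order_ideal] assms(3)] by metis
  have "pbw_join n a b = c"
    unfolding pbw_join_def
  proof (rule the_equality)
    show "c \<in> pbw_columns n \<and> pbw_le a c \<and> pbw_le b c \<and>
       (\<forall>d\<in>pbw_columns n. pbw_le a d \<and> pbw_le b d \<longrightarrow> pbw_le c d)"
      using c assms by (auto simp: pbw_le_iff_subset)
  next
    fix d assume d: "d \<in> pbw_columns n \<and> pbw_le a d \<and> pbw_le b d \<and>
       (\<forall>e\<in>pbw_columns n. pbw_le a e \<and> pbw_le b e \<longrightarrow> pbw_le d e)"
    have "pbw_le a c" "pbw_le b c" using c assms by (auto simp: pbw_le_iff_subset)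
    then have "pbw_le d c" using d c(1) by blast
    moreover have "pbw_le c d" using c d assms by (auto simp: pbw_le_iff_subset)
    ultimately show "d = c" using pbw_le_antisym c d by blast
  qed
  then show "pbw_join n a b \<in> pbw_columns n"
    and "col_ideal n (pbw_join n a b) = col_ideal n a \<union> col_ideal n b" using c by auto
qed

lemma pbw_meet:
  assumes "a \<in> pbw_columns n" "b \<in> pbw_columns n" "2 \<le> n"
  shows "pbw_meet n a b \<in> pbw_columns n"
    and "col_ideal n (pbw_meet n a b) = col_ideal n a \<inter> col_ideal n b"
proof -
  obtain c where c: "c \<in> pbw_columns n" "col_ideal n c = col_ideal n a \<inter> col_ideal n b"
    using col_of_ideal[OF order_ideals_Int[OF col_ideal_order_ideal col_ideal_order_ideal] assms(3)] by metis
  have "pbw_meet n a b = c"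
    unfolding pbw_meet_def
  proof (rule the_equality)
    show "c \<in> pbw_columns n \<and> pbw_le c a \<and> pbw_le c b \<and>
       (\<forall>d\<in>pbw_columns n. pbw_le d a \<and> pbw_le d b \<longrightarrow> pbw_le d c)"
      using c assms by (auto simp: pbw_le_iff_subset)
  next
    fix d assume d: "d \<in> pbw_columns n \<and> pbw_le d a \<and> pbw_le d b \<and>
       (\<forall>e\<in>pbw_columns n. pbw_le e a \<and> pbw_le e b \<longrightarrow> pbw_le e d)"
    have "pbw_le c a" "pbw_le c b" using c assms by (auto simp: pbw_le_iff_subset)
    then have "pbw_le c d" using d c(1) by blast
    moreover have "pbw_le d c" using c d assms by (auto simp: pbw_le_iff_subset)
    ultimately show "d = c" using pbw_le_antisym c d by blast
  qed
  then show "pbw_meet n a b \<in> pbw_columns n"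
    and "col_ideal n (pbw_meet n a b) = col_ideal n a \<inter> col_ideal n b" using c by auto
qed

text \<open>A minimal element of \<open>J - I\<close> can be added: whatever is strictly below it
  lies in \<open>J\<close>, hence in \<open>I\<close>. So every strict inclusion of ideals starts
  with a cover.\<close>

lemma order_ideals_insert_minimal:
  assumes "I \<in> order_ideals n" "J \<in> order_ideals n" "I \<subseteq> J" "I \<noteq> J"
  obtains x where "x \<in> J - I" "insert x I \<in> order_ideals n"
proof -
  have "finite (J - I)" "J - I \<noteq> {}" using order_ideals_finite[OF assms(2)] assms by auto
  then obtain x where x: "x \<in> J - I" "\<And>y. y \<in> J - I \<Longrightarrow> y \<le> x \<Longrightarrow> x = y"
    using finite_has_minimal by metis
  have "insert x I \<in> order_ideals n"
    unfolding order_ideals_def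
  proof (intro CollectI conjI ballI impI)
    show "insert x I \<subseteq> tri n" using x assms(1,2) order_ideals_sub by blast
  next
    fix p q assume q: "p \<in> insert x I" "q \<in> tri n" "q \<le> p"
    show "q \<in> insert x I"
    proof (cases "p = x")
      case True
      then have "q \<in> J" using x(1) q order_ideals_down[OF assms(2)] by blast
      then show ?thesis using x(2)[of q] True q(3) by blast
    next
      case False
      then show ?thesis using q order_ideals_down[OF assms(1)] by blast
    qed
  qed
  then show ?thesis using that x by blast
qed

lemma pbw_covers_iff:
  assumes "a \<in> pbw_columns n" "b \<in> pbw_columns n" "2 \<le> n"
  shows "pbw_covers n a b \<longleftrightarrow> (\<exists>x. x \<notin> col_ideal n b \<and> col_ideal n a = insert x (col_ideal n b))"
proof
  assume *: "pbw_covers n a b"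
  have sub: "col_ideal n b \<subseteq> col_ideal n a" "col_ideal n b \<noteq> col_ideal n a"
    using * assms unfolding pbw_covers_def pbw_less_def by (auto simp: pbw_le_iff_subset col_ideal_inj)
  obtain x where x: "x \<in> col_ideal n a - col_ideal n b" "insert x (col_ideal n b) \<in> order_ideals n"
    using order_ideals_insert_minimal[OF col_ideal_order_ideal col_ideal_order_ideal sub] by metis
  obtain c where c: "c \<in> pbw_columns n" "col_ideal n c = insert x (col_ideal n b)" using col_of_ideal[OF x(2) assms(3)] by metis
  have "pbw_less b c" unfolding pbw_less_def using c x assms by (auto simp: pbw_le_iff_subset)
  then have "\<not> pbw_less c a" using * c unfolding pbw_covers_def by blast
  then have "c = a" unfolding pbw_less_def using c x sub assms by (auto simp: pbw_le_iff_subset)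
  then show "\<exists>x. x \<notin> col_ideal n b \<and> col_ideal n a = insert x (col_ideal n b)" using c x by blast
next
  assume "\<exists>x. x \<notin> col_ideal n b \<and> col_ideal n a = insert x (col_ideal n b)"
  then obtain x where x: "x \<notin> col_ideal n b" "col_ideal n a = insert x (col_ideal n b)" by auto
  have "\<not> (pbw_less b c \<and> pbw_less c a)" if "c \<in> pbw_columns n" for c
  proof
    assume "pbw_less b c \<and> pbw_less c a"
    then have "col_ideal n b \<subset> col_ideal n c" "col_ideal n c \<subset> col_ideal n a"
      using that assms col_ideal_inj[of b n c] col_ideal_inj[of c n a] unfolding pbw_less_def by (auto simp: pbw_le_iff_subset)
    then show False using x by auto
  qed
  then show "pbw_covers n a b" unfolding pbw_covers_def pbw_less_def using assms x by (auto simp: pbw_le_iff_subset)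
qed

text \<open>The one element missing from \<open>a\<close> realises both the cover of
  \<open>a\<close> by the join and the cover of the meet by \<open>b\<close>; so two singletons
  encode all four coverings.\<close>

lemma diamond_pair_iff:
  assumes "2 \<le> n"
  shows "diamond_pair n a b \<longleftrightarrow> a \<in> pbw_columns n \<and> b \<in> pbw_columns n \<and>
    (\<exists>P Q. col_ideal n a - col_ideal n b = {P} \<and> col_ideal n b - col_ideal n a = {Q})"
proof (cases "a \<in> pbw_columns n \<and> b \<in> pbw_columns n")
  case True
  then have ab: "a \<in> pbw_columns n" "b \<in> pbw_columns n" by auto
  let ?A = "col_ideal n a" and ?B = "col_ideal n b"
  note j = pbw_join[OF ab assms] and m = pbw_meet[OF ab assms]
  have "diamond_pair n a b \<longleftrightarrow> (\<exists>x. x \<notin> ?A \<and> ?A \<union> ?B = insert x ?A) \<and> (\<exists>x. x \<notin> ?B \<and> ?A \<union> ?B = insert x ?B)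
     \<and> (\<exists>x. x \<notin> ?A \<inter> ?B \<and> ?A = insert x (?A \<inter> ?B)) \<and> (\<exists>x. x \<notin> ?A \<inter> ?B \<and> ?B = insert x (?A \<inter> ?B))"
    unfolding diamond_pair_def using ab j m by (simp add: pbw_covers_iff assms)
  also have "\<dots> \<longleftrightarrow> (\<exists>P. ?A - ?B = {P}) \<and> (\<exists>Q. ?B - ?A = {Q})" (is "?l \<longleftrightarrow> ?r")
  proof
    assume ?l
    then obtain x y where x: "x \<notin> ?A" "?A \<union> ?B = insert x ?A" and y: "y \<notin> ?B" "?A \<union> ?B = insert y ?B" by metis
    have "?B - ?A = {x}" using x by blast
    moreover have "?A - ?B = {y}" using y by blast
    ultimately show ?r by blast
  next
    assume ?r
    then obtain P Q where PQ: "?A - ?B = {P}" "?B - ?A = {Q}" by blast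
    have "Q \<notin> ?A \<and> ?A \<union> ?B = insert Q ?A" "P \<notin> ?B \<and> ?A \<union> ?B = insert P ?B"
      "P \<notin> ?A \<inter> ?B \<and> ?A = insert P (?A \<inter> ?B)" "Q \<notin> ?A \<inter> ?B \<and> ?B = insert Q (?A \<inter> ?B)" using PQ by blast+
    then show ?l by blast
  qed
  finally show ?thesis using ab by auto
qed (auto simp: diamond_pair_def)

text \<open>Here \<open>s\<close> is the smaller row, called \<open>u\<close> in the definition; so
  the two elements are \<open>(Suc s, t)\<close> and \<open>(s, Suc t)\<close>, and
  \<open>s < t\<close> replaces \<open>Suc s \<le> t\<close>.\<close>

lemma special_diamond_pair_iff:
  assumes "2 \<le> n"
  shows "special_diamond_pair n a b \<longleftrightarrow> a \<in> pbw_columns n \<and> b \<in> pbw_columns n \<and>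
    (\<exists>a' b' s t. {a', b'} = {a, b} \<and> s < t \<and> col_ideal n a' - col_ideal n b' = {(Suc s, t)} \<and> col_ideal n b' - col_ideal n a' = {(s, Suc t)})"
    (is "_ \<longleftrightarrow> ?r")
proof
  assume *: "special_diamond_pair n a b"
  then obtain a' b' s t u v where st: "{a', b'} = {a, b}"
       "column_ideal n a' = insert (s, t) (column_ideal n (pbw_meet n a b))"
       "column_ideal n b' = insert (u, v) (column_ideal n (pbw_meet n a b))"
       "u < s" "s \<le> t" "t < v" "s = u + 1" "v = t + 1" unfolding special_diamond_pair_def by blast
  have d: "diamond_pair n a b" using * unfolding special_diamond_pair_def by auto
  then have ab: "a \<in> pbw_columns n" "b \<in> pbw_columns n" unfolding diamond_pair_def by auto
  then have ab': "a' \<in> pbw_columns n" "b' \<in> pbw_columns n" using st(1) by auto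
  note m = pbw_meet[OF ab assms]
  have e: "col_ideal n a' = insert (s, t) (col_ideal n a \<inter> col_ideal n b)"
      "col_ideal n b' = insert (u, v) (col_ideal n a \<inter> col_ideal n b)"
    using st(2,3) m ab' assms by (simp_all add: column_ideal_eq)
  have d': "\<exists>P Q. col_ideal n a' - col_ideal n b' = {P} \<and> col_ideal n b' - col_ideal n a' = {Q}"
    using d st(1) unfolding diamond_pair_iff[OF assms] by (auto simp: doubleton_eq_iff)
  moreover have "col_ideal n a' - col_ideal n b' \<subseteq> {(s, t)}" "col_ideal n b' - col_ideal n a' \<subseteq> {(u, v)}"
    unfolding e by auto
  ultimately have "col_ideal n a' - col_ideal n b' = {(s, t)}" "col_ideal n b' - col_ideal n a' = {(u, v)}"
    by (metis subset_singletonD insert_not_empty)+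
  then have "{a', b'} = {a, b} \<and> u < t \<and> col_ideal n a' - col_ideal n b' = {(Suc u, t)} \<and>
      col_ideal n b' - col_ideal n a' = {(u, Suc t)}" using st by simp
  then have "\<exists>a' b' s t. {a', b'} = {a, b} \<and> s < t \<and> col_ideal n a' - col_ideal n b' = {(Suc s, t)} \<and>
      col_ideal n b' - col_ideal n a' = {(s, Suc t)}"
    by (intro exI)
  then show ?r using ab by simp
next
  assume ?r
  then obtain a' b' s t where ab: "a \<in> pbw_columns n" "b \<in> pbw_columns n" and
    st: "{a', b'} = {a, b}" "s < t" "col_ideal n a' - col_ideal n b' = {(Suc s, t)}" "col_ideal n b' - col_ideal n a' = {(s, Suc t)}"
    by - (elim conjE exE, rule that, assumption+)
  note m = pbw_meet[OF ab assms]
  have ab': "a' \<in> pbw_columns n" "b' \<in> pbw_columns n" using st(1) ab by auto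
  have i: "col_ideal n a \<inter> col_ideal n b = col_ideal n a' \<inter> col_ideal n b'" using st(1) by (auto simp: doubleton_eq_iff)
  have "diamond_pair n a b" using st ab unfolding diamond_pair_iff[OF assms] by (auto simp: doubleton_eq_iff)
  moreover have "col_ideal n a' = insert (Suc s, t) (col_ideal n a' \<inter> col_ideal n b')"
    using st(3) by blast
  moreover have "col_ideal n b' = insert (s, Suc t) (col_ideal n a' \<inter> col_ideal n b')"
    using st(4) by blast
  moreover have "column_ideal n a' = col_ideal n a'" "column_ideal n b' = col_ideal n b'"
    "column_ideal n (pbw_meet n a b) = col_ideal n a' \<inter> col_ideal n b'"
    using m i ab' by (simp_all only: column_ideal_eq assms)
  ultimately have "diamond_pair n a b \<and> ({a', b'} = {a, b} \<and>
       column_ideal n a' = insert (Suc s, t) (column_ideal n (pbw_meet n a b)) \<and>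
       column_ideal n b' = insert (s, Suc t) (column_ideal n (pbw_meet n a b)) \<and>
       s < Suc s \<and> Suc s \<le> t \<and> t < Suc t \<and> Suc s = s + 1 \<and> Suc t = t + 1)"
    using st by simp
  then show "special_diamond_pair n a b" unfolding special_diamond_pair_def
    by (elim conjE) (intro conjI exI)
qed

section \<open>Contents of columns\<close>

text \<open>The rows can be filled from the top in one way only: row r takes the entry r if it is
  available and otherwise the largest entry left.\<close>

lemma pbw_columns_mset_inj:
  assumes "x \<in> pbw_columns n" "y \<in> pbw_columns n" "mset x = mset y"
  shows "x = y"
proof (rule nth_equalityI)
  show len: "length x = length y" using assms(3) by (metis size_mset)
  fix r assume "r < length x"
  then show "x ! r = y ! r"
  proof (induction r rule: less_induct)
    case (less r)
    have "take r x = take r y"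
      by (rule nth_equalityI) (use less len in auto)
    moreover have "mset (take r x) + mset (drop r x) = mset (take r y) + mset (drop r y)"
      using assms(3) by (simp flip: mset_append)
    ultimately have "mset (drop r x) = mset (drop r y)" by simp
    then have s: "set (drop r x) = set (drop r y)" by (metis set_mset_mset)
    \<comment> \<open>The larger value \<open>v ! r\<close> would have to occur in \<open>u\<close>
      further down, where the large entries of \<open>u\<close> only decrease.\<close>
    have sub: "\<not> u ! r < v ! r" if u: "u \<in> pbw_columns n" and v: "v \<in> pbw_columns n"
      and "length u = length v" "r < length u" "set (drop r u) = set (drop r v)"
      "Suc r \<notin> set u" for u v
    proof
      assume lt: "u ! r < v ! r"
      have gt: "length u < u ! r"
        using pbw_columnsD(5)[OF u that(4)] that(4,6) nth_mem[of r u] by (cases "u ! r \<le> length u") auto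
      have "v ! r \<in> set (drop r v)" using that by (metis Cons_nth_drop_Suc list.set_intros(1))
      then have "v ! r \<in> set (drop r u)" using that by auto
      then obtain i where i: "i < length u - r" "drop r u ! i = v ! r" by (auto simp: in_set_conv_nth)
      then have i': "u ! (r + i) = v ! r" "r + i < length u" by auto
      then have "i \<noteq> 0" using lt by (cases i) auto
      then have "r < r + i" by simp
      from pbw_columnsD(6)[OF u this i'(2) gt] show False using i' lt gt by simp
    qed
    show ?case
    proof (cases "Suc r \<in> set x")
      case True
      then have "Suc r \<in> set y" using assms(3) by (metis set_mset_mset)
      then have "y ! r = Suc r" "x ! r = Suc r"
        using pbw_columns_mem_fixed[OF assms(1) True] pbw_columns_mem_fixed[OF assms(2), of "Suc r"] less len by auto
      then show ?thesis by simp
    next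
      case False
      then have F': "Suc r \<notin> set y" using assms(3) by (metis set_mset_mset)
      have "\<not> x ! r < y ! r"
        using sub[OF assms(1,2) len less(2) s False] .
      moreover have "\<not> y ! r < x ! r"
        using sub[OF assms(2,1) len[symmetric] _ s[symmetric] F'] less(2) len by simp
      ultimately show ?thesis by simp
    qed
  qed
qed

text \<open>Row by row, the largest remaining entry has to occur in all four columns.\<close>

lemma columns_eq_if_le_content:
  assumes cols: "x \<in> pbw_columns n" "y \<in> pbw_columns n" "z \<in> pbw_columns n" "w \<in> pbw_columns n"
    and le: "pbw_le x z" "pbw_le x w" "pbw_le y z" "pbw_le y w"
    and content: "mset x + mset y = mset z + mset w"
  shows "y = x \<and> z = x \<and> w = x"
proof -
  have "size (mset x + mset y) = size (mset z + mset w)" using content by simp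
  then have sz: "length x + length y = length z + length w" by simp
  have "length x \<le> length z" "length x \<le> length w" "length y \<le> length z" "length y \<le> length w"
    using le unfolding pbw_le_def by auto
  then have len: "length y = length x" "length z = length x" "length w = length x" using sz by auto
  define k where "k = length x"
  define F where "F = {x, y, z, w}"
  have F: "\<alpha> \<in> pbw_columns n" "length \<alpha> = k" "distinct \<alpha>" if "\<alpha> \<in> F" for \<alpha>
    using that cols len pbw_columns_distinct unfolding F_def k_def by auto
  have main: "r < k \<Longrightarrow> y ! r = x ! r \<and> z ! r = x ! r \<and> w ! r = x ! r" for r
  proof (induction r rule: less_induct)
    case (less r)
    have IH: "take r y = take r x" "take r z = take r x" "take r w = take r x"
      by (rule nth_equalityI; use less len k_def in auto)+
    let ?m = "\<lambda>\<alpha>. mset (drop r \<alpha>)"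
    let ?s = "\<lambda>\<alpha>. set (drop r \<alpha>)"
    have split: "mset \<alpha> = mset (take r \<alpha>) + ?m \<alpha>" for \<alpha> :: "nat list"
      by (simp flip: mset_append)
    have cm: "?m x + ?m y = ?m z + ?m w"
      using content split[of x] split[of y] split[of z] split[of w] IH by (simp add: ac_simps)
    then have "set_mset (?m x + ?m y) = set_mset (?m z + ?m w)" by simp
    then have s: "?s x \<union> ?s y = ?s z \<union> ?s w" by simp
    define M where "M = Max (?s x \<union> ?s y)"
    have ne: "?s x \<noteq> {}" using less(2) k_def by simp
    have M_in: "M \<in> ?s x \<union> ?s y" unfolding M_def by (rule Max_in) (use ne in auto)
    have M_max: "e \<le> M" if "e \<in> ?s \<alpha>" "\<alpha> \<in> F" for e \<alpha>
    proof -
      have "e \<in> ?s x \<union> ?s y" using that s unfolding F_def by auto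
      then show ?thesis unfolding M_def by (intro Max_ge) auto
    qed
    have in_drop: "\<exists>i. r \<le> i \<and> i < k \<and> \<alpha> ! i = e" if "e \<in> ?s \<alpha>" "\<alpha> \<in> F" for e \<alpha>
    proof -
      obtain j where "j < length (drop r \<alpha>)" "drop r \<alpha> ! j = e" using \<open>e \<in> ?s \<alpha>\<close> by (metis in_set_conv_nth)
      then show ?thesis using F(2)[OF that(2)] by (intro exI[of _ "r + j"]) auto
    qed
    have drop_mem: "\<alpha> ! i \<in> ?s \<alpha>" if "r \<le> i" "i < k" "\<alpha> \<in> F" for i \<alpha>
      using nth_mem[of "i - r" "drop r \<alpha>"] that(1,2) F(2)[OF that(3)] by simp
    have up: "\<exists>j. i \<le> j \<and> j < k \<and> e \<le> \<beta> ! j" if "\<alpha> \<in> {x, y}" "\<beta> \<in> {z, w}" "i < k" "\<alpha> ! i = e" for \<alpha> \<beta> e i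
    proof -
      have "pbw_le \<alpha> \<beta>" "length \<alpha> = k" "length \<beta> = k" using that le len k_def by auto
      then show ?thesis using pbw_le_nth[of \<alpha> \<beta> i] that by auto
    qed
    have M_zw: "M \<in> ?s \<beta>" if bzw: "\<beta> \<in> {z, w}" for \<beta>
    proof -
      obtain \<alpha> where a: "\<alpha> \<in> {x, y}" "M \<in> ?s \<alpha>" using M_in by auto
      then have aF: "\<alpha> \<in> F" unfolding F_def by auto
      obtain i where i: "r \<le> i" "i < k" "\<alpha> ! i = M" using in_drop[OF a(2) aF] by auto
      obtain j where j: "i \<le> j" "j < k" "M \<le> \<beta> ! j" using up[OF a(1) bzw i(2,3)] by auto
      have bF: "\<beta> \<in> F" using that unfolding F_def by auto
      have b: "\<beta> ! j \<in> ?s \<beta>" using drop_mem[of j \<beta>] i j bF by auto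
      then show ?thesis using M_max[OF b bF] j by simp
    qed
    have cnt: "count (?m \<alpha>) v = (if v \<in> ?s \<alpha> then 1 else 0)" if "\<alpha> \<in> F" for v \<alpha>
      using F(3)[OF that] distinct_count_atmost_1[of "drop r \<alpha>"] by auto
    \<comment> \<open>Entries within a column are distinct, so contents compare as sums of
      indicators.\<close>
    have cnt_eq: "(if v \<in> ?s x then 1 else 0) + (if v \<in> ?s y then 1 else 0)
        = (if v \<in> ?s z then 1 else 0) + (if v \<in> ?s w then 1 else (0::nat))" for v
    proof -
      have "count (?m x + ?m y) v = count (?m z + ?m w) v" using cm by simp
      then have e: "count (?m x) v + count (?m y) v = count (?m z) v + count (?m w) v" by simp
      have "x \<in> F" "y \<in> F" "z \<in> F" "w \<in> F" unfolding F_def by auto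
      then show ?thesis using e by (simp only: cnt)
    qed
    have M_all: "M \<in> ?s \<alpha>" if "\<alpha> \<in> F" for \<alpha>
    proof -
      have "M \<in> ?s z" "M \<in> ?s w" using M_zw by auto
      moreover from this have "M \<in> ?s x" "M \<in> ?s y" using cnt_eq[of M] by (auto split: if_splits)
      ultimately show ?thesis using that unfolding F_def by auto
    qed
    show ?case
    proof (cases "M \<le> k")
      case True
      have "\<alpha> ! r = Suc r" if "\<alpha> \<in> F" for \<alpha>
        using M_max[OF drop_mem[of r \<alpha>] that] pbw_columnsD(5)[OF F(1)[OF that], of r] less(2) F(2)[OF that] True that by auto
      then show ?thesis unfolding F_def by simp
    next
      case False
      \<comment> \<open>Row r contains its own index or a large entry. In the latter case the
        maximum \<open>M\<close>, which occurs in the remaining rows, cannot come strictly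
        later.\<close>
      have dich: "\<alpha> ! r = M \<or> \<alpha> ! r = Suc r" if aF: "\<alpha> \<in> F" for \<alpha>
      proof (cases "\<alpha> ! r \<le> k")
        case True
        then show ?thesis using pbw_columnsD(5)[OF F(1)[OF that], of r] less(2) F(2)[OF that] by auto
      next
        case F2: False
        obtain i where i: "r \<le> i" "i < k" "\<alpha> ! i = M" using in_drop[OF M_all[OF aF] aF] by auto
        show ?thesis
        proof (cases "i = r")
          case F3: False
          have "M < \<alpha> ! r" using pbw_columnsD(6)[OF F(1)[OF that], of r i] i F3 F2 False F(2)[OF that] by auto
          then show ?thesis using M_max[OF drop_mem[of r \<alpha>] that] less(2) that by auto
        qed (use i in auto)
      qed
      have Sr: "Suc r \<in> ?s \<alpha> \<longleftrightarrow> \<alpha> ! r = Suc r" if "\<alpha> \<in> F" for \<alpha>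
      proof
        assume "Suc r \<in> ?s \<alpha>"
        then have "Suc r \<in> set \<alpha>" by (rule in_set_dropD)
        then show "\<alpha> ! r = Suc r" using pbw_columns_mem_fixed[OF F(1)[OF that], of "Suc r"] F(2)[OF that] less(2) by auto
      next
        assume "\<alpha> ! r = Suc r"
        then show "Suc r \<in> ?s \<alpha>" using drop_mem[of r \<alpha>] less(2) that by auto
      qed
      \<comment> \<open>If \<open>M\<close> were further down in \<open>\<alpha>\<close>, domination
        would put an entry at least \<open>M\<close>, hence \<open>M\<close> itself, below row r of
        \<open>\<beta>\<close>, contradicting distinctness.\<close>
      have propg: "\<alpha> ! r = M" if ab: "\<alpha> \<in> {x, y}" "\<beta> \<in> {z, w}" "\<beta> ! r = M" for \<alpha> \<beta>
      proof (rule ccontr)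
        assume neq: "\<alpha> ! r \<noteq> M"
        have aF: "\<alpha> \<in> F" and bF: "\<beta> \<in> F" using ab unfolding F_def by auto
        obtain i where i: "r \<le> i" "i < k" "\<alpha> ! i = M" using in_drop[OF M_all[OF aF] aF] by auto
        then have ri: "r < i" using neq by (cases "i = r") auto
        obtain j where j: "i \<le> j" "j < k" "M \<le> \<beta> ! j" using up[OF ab(1,2) i(2,3)] by auto
        have "\<beta> ! j \<in> ?s \<beta>" using drop_mem[of j \<beta>] i j bF by auto
        then have "\<beta> ! j = M" using M_max[OF _ bF] j by (simp add: antisym)
        then have "j = r" using F(3)[OF bF] ab(3) j less(2) F(2)[OF bF] by (metis nth_eq_iff_index_eq)
        then show False using ri j by simp
      qed
      have mem: "x \<in> F" "y \<in> F" "z \<in> F" "w \<in> F" unfolding F_def by auto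
      show ?thesis
      proof (cases "z ! r = M \<or> w ! r = M")
        case True
        then have xy: "x ! r = M" "y ! r = M" using propg by auto
        have "Suc r \<noteq> M" using False less(2) by auto
        then have "Suc r \<notin> ?s x" "Suc r \<notin> ?s y" using Sr[OF mem(1)] Sr[OF mem(2)] xy by auto
        then have "Suc r \<notin> ?s z" "Suc r \<notin> ?s w" using cnt_eq[of "Suc r"] by (auto split: if_splits)
        then have "z ! r = M" "w ! r = M" using Sr[OF mem(3)] Sr[OF mem(4)] dich[OF mem(3)] dich[OF mem(4)] by auto
        then show ?thesis using xy by simp
      next
        case False
        then have zw: "z ! r = Suc r" "w ! r = Suc r" using dich[OF mem(3)] dich[OF mem(4)] by auto
        then have "Suc r \<in> ?s z" "Suc r \<in> ?s w" using Sr[OF mem(3)] Sr[OF mem(4)] by auto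
        then have "Suc r \<in> ?s x" "Suc r \<in> ?s y" using cnt_eq[of "Suc r"] by (auto split: if_splits)
        then have "x ! r = Suc r" "y ! r = Suc r" using Sr[OF mem(1)] Sr[OF mem(2)] by auto
        then show ?thesis using zw by simp
      qed
    qed
  qed
  have "y = x" "z = x" "w = x" by (rule nth_equalityI; use len main k_def in simp)+
  then show ?thesis by simp
qed

section \<open>A weight singling out columns\<close>

text \<open>With d the distance to the diagonal this is d(2n - d). The constant 2n makes it strictly
  increasing for d up to n, besides strictly concave.\<close>

definition cell_weight :: "nat \<Rightarrow> nat \<times> nat \<Rightarrow> int"
  where "cell_weight n q = \<bar>int (fst q) - int (snd q)\<bar> * (2 * int n - \<bar>int (fst q) - int (snd q)\<bar>)"

definition list_weight :: "nat \<Rightarrow> nat list \<Rightarrow> int"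
  where "list_weight n \<sigma> = (\<Sum>r<length \<sigma>. cell_weight n (Suc r, \<sigma> ! r))"

text \<open>The weight is a strictly concave function of the distance to the diagonal; hence it
  satisfies the strict triangle inequality and strictly favours nested over crossing cells.\<close>

lemma cell_weight_triangle:
  assumes "r \<in> {1..n}" "s \<in> {1..n}" "c \<in> {1..n}" "s \<noteq> r" "c \<noteq> r"
  shows "cell_weight n (r, r) + cell_weight n (s, c) < cell_weight n (r, c) + cell_weight n (s, r)"
proof -
  define x y z where "x = \<bar>int s - int r\<bar>" and "y = \<bar>int r - int c\<bar>" and "z = \<bar>int s - int c\<bar>"
  have x: "1 \<le> x" "x \<le> int n" and y: "1 \<le> y" "y \<le> int n" and z: "0 \<le> z" "z \<le> int n"
    using assms unfolding x_def y_def z_def by auto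
  have px: "0 < x * (2 * int n - x)" and py: "0 < y * (2 * int n - y)" using x y by auto
  have mono: "p * (2 * int n - p) \<le> q * (2 * int n - q)" if "0 \<le> p" "p \<le> q" "q \<le> int n" for p q
  proof -
    have "0 \<le> (q - p) * (2 * int n - p - q)" using that by simp
    then show ?thesis by (simp add: algebra_simps)
  qed
  \<comment> \<open>Either r lies between s and c, or the distance from s to c is at most one of the
    two others.\<close>
  have "z \<le> x \<or> z \<le> y \<or> z = x + y" unfolding x_def y_def z_def by linarith
  then have "z * (2 * int n - z) < x * (2 * int n - x) + y * (2 * int n - y)"
  proof (elim disjE)
    assume "z \<le> x" then show ?thesis using mono[of z x] x z py by linarith
  next
    assume "z \<le> y" then show ?thesis using mono[of z y] y z px by linarith
  next
    assume e: "z = x + y"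
    have "0 < x * y" using x y by simp
    then show ?thesis unfolding e by (simp add: algebra_simps)
  qed
  then show ?thesis unfolding cell_weight_def x_def y_def z_def by simp
qed

lemma cell_weight_nested:
  assumes "r < s" "s \<le> c" "c < d"
  shows "cell_weight n (r, d) + cell_weight n (s, c) < cell_weight n (r, c) + cell_weight n (s, d)"
proof -
  have "0 < (int s - int r) * (int d - int c)" using assms by simp
  moreover have "\<bar>int r - int d\<bar> = int d - int r" "\<bar>int s - int c\<bar> = int c - int s"
     "\<bar>int r - int c\<bar> = int c - int r" "\<bar>int s - int d\<bar> = int d - int s" using assms by auto
  ultimately show ?thesis unfolding cell_weight_def by (simp add: algebra_simps)
qed

lemma sum_swap_list:
  fixes f :: "nat \<Rightarrow> nat \<Rightarrow> int"
  assumes "i < length \<sigma>" "j < length \<sigma>" "i \<noteq> j"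
  defines "\<tau> \<equiv> \<sigma>[i := \<sigma> ! j, j := \<sigma> ! i]"
  shows "(\<Sum>r<length \<tau>. f r (\<tau> ! r)) = (\<Sum>r<length \<sigma>. f r (\<sigma> ! r)) - f i (\<sigma> ! i) - f j (\<sigma> ! j) + f i (\<sigma> ! j) + f j (\<sigma> ! i)"
proof -
  let ?R = "{..<length \<sigma>} - {i} - {j}"
  have split: "(\<Sum>r<length \<sigma>. g r) = g i + (g j + (\<Sum>r\<in>?R. g r))" for g :: "nat \<Rightarrow> int"
    using assms(1-3) by (subst sum.remove[of _ i], simp, simp, subst sum.remove[of _ j]) auto
  have "(\<Sum>r<length \<tau>. f r (\<tau> ! r)) = (\<Sum>r<length \<sigma>. f r (\<tau> ! r))" unfolding \<tau>_def by simp
  also have "\<dots> = f i (\<tau> ! i) + (f j (\<tau> ! j) + (\<Sum>r\<in>?R. f r (\<tau> ! r)))" by (rule split)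
  also have "(\<Sum>r\<in>?R. f r (\<tau> ! r)) = (\<Sum>r\<in>?R. f r (\<sigma> ! r))" unfolding \<tau>_def by (rule sum.cong) auto
  also have "\<tau> ! i = \<sigma> ! j" using assms(1-3) unfolding \<tau>_def by auto
  also have "\<tau> ! j = \<sigma> ! i" using assms(1-3) unfolding \<tau>_def by auto
  finally show ?thesis using split[of "\<lambda>r. f r (\<sigma> ! r)"] by simp
qed

text \<open>Each violation of the column conditions is repaired by a swap: a small entry outside its
  row is moved there (triangle inequality), and two large entries in increasing order are exchanged
  (nested beats crossing).\<close>

lemma list_weight_decrease:
  assumes "distinct \<sigma>" "set \<sigma> \<subseteq> {1..n}" "1 \<le> length \<sigma>" "length \<sigma> \<le> n - 1" "\<sigma> \<notin> pbw_columns n"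
  shows "\<exists>\<tau>. mset \<tau> = mset \<sigma> \<and> list_weight n \<tau> < list_weight n \<sigma>"
proof -
  have rng: "\<sigma> ! r \<in> {1..n}" if "r < length \<sigma>" for r using that assms(2) nth_mem by blast
  have swap: "list_weight n (\<sigma>[i := \<sigma> ! j, j := \<sigma> ! i]) = list_weight n \<sigma>
      - cell_weight n (Suc i, \<sigma> ! i) - cell_weight n (Suc j, \<sigma> ! j)
      + cell_weight n (Suc i, \<sigma> ! j) + cell_weight n (Suc j, \<sigma> ! i)"
    if "i < length \<sigma>" "j < length \<sigma>" "i \<noteq> j" for i j
    using sum_swap_list[OF that, of "\<lambda>r c. cell_weight n (Suc r, c)"] unfolding list_weight_def .
  have ms: "mset (\<sigma>[i := \<sigma> ! j, j := \<sigma> ! i]) = mset \<sigma>" if "i < length \<sigma>" "j < length \<sigma>" for i j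
    using mset_swap[OF that(2,1)] by simp
  have "\<not> ((\<forall>r<length \<sigma>. \<sigma> ! r \<le> length \<sigma> \<longrightarrow> \<sigma> ! r = Suc r) \<and>
    (\<forall>r s. r < s \<longrightarrow> s < length \<sigma> \<longrightarrow> length \<sigma> < \<sigma> ! r \<longrightarrow> length \<sigma> < \<sigma> ! s \<longrightarrow> \<sigma> ! s < \<sigma> ! r))"
    using assms(5) pbw_columnsI[OF assms(3,4)] rng by auto
  then consider (a) r where "r < length \<sigma>" "\<sigma> ! r \<le> length \<sigma>" "\<sigma> ! r \<noteq> Suc r"
    | (b) r s where "r < s" "s < length \<sigma>" "length \<sigma> < \<sigma> ! r" "length \<sigma> < \<sigma> ! s" "\<not> \<sigma> ! s < \<sigma> ! r"
    by blast
  then show ?thesis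
  proof cases
    case a
    \<comment> \<open>The row, counted from 0, in which the small entry \<open>\<sigma> ! r\<close>
      belongs.\<close>
    define j where "j = \<sigma> ! r - 1"
    have j: "Suc j = \<sigma> ! r" "j < length \<sigma>" "j \<noteq> r" using rng[OF a(1)] a unfolding j_def by auto
    have neq: "\<sigma> ! j \<noteq> \<sigma> ! r" using assms(1) j a by (simp add: nth_eq_iff_index_eq)
    have r': "Suc r \<in> {1..n}" using a assms(4) by auto
    have "list_weight n (\<sigma>[r := \<sigma> ! j, j := \<sigma> ! r]) < list_weight n \<sigma>"
      using swap[OF a(1) j(2)] j cell_weight_triangle[OF rng[OF a(1)] r' rng[OF j(2)]] a neq by auto
    then show ?thesis using ms[OF a(1) j(2)] by blast
  next
    case b
    have "\<sigma> ! r \<noteq> \<sigma> ! s" using assms(1) b by (simp add: nth_eq_iff_index_eq)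
    then have lt: "\<sigma> ! r < \<sigma> ! s" using b by simp
    have "list_weight n (\<sigma>[r := \<sigma> ! s, s := \<sigma> ! r]) < list_weight n \<sigma>"
      using swap[of r s] b lt cell_weight_nested[of "Suc r" "Suc s" "\<sigma> ! r" "\<sigma> ! s" n] by auto
    moreover have "mset (\<sigma>[r := \<sigma> ! s, s := \<sigma> ! r]) = mset \<sigma>" using ms[of r s] b by auto
    ultimately show ?thesis by blast
  qed
qed

text \<open>An arrangement of least weight exists and admits no improvement, so it is a
  column.\<close>

lemma column_arrangement_le:
  assumes "distinct \<sigma>" "set \<sigma> \<subseteq> {1..n}" "1 \<le> length \<sigma>" "length \<sigma> \<le> n - 1"
  shows "\<exists>\<alpha>\<in>pbw_columns n. mset \<alpha> = mset \<sigma> \<and> list_weight n \<alpha> \<le> list_weight n \<sigma>"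
proof -
  let ?S = "{\<tau>. mset \<tau> = mset \<sigma>}"
  have fin: "finite ?S"
    by (rule finite_subset[of _ "{xs. set xs \<subseteq> set \<sigma> \<and> length xs \<le> length \<sigma>}"])
      (auto simp: finite_lists_length_le dest: mset_eq_setD mset_eq_length)
  have ne: "?S \<noteq> {}" by auto
  obtain \<alpha> where a: "\<alpha> \<in> ?S" "\<And>\<tau>. \<tau> \<in> ?S \<Longrightarrow> list_weight n \<alpha> \<le> list_weight n \<tau>"
    using ex_min_if_finite[of "list_weight n ` ?S"] fin ne
    by (metis (no_types, lifting) arg_min_if_finite(1) arg_min_least)
  have m: "mset \<alpha> = mset \<sigma>" using a by simp
  have "\<alpha> \<in> pbw_columns n"
  proof (rule ccontr)
    assume "\<alpha> \<notin> pbw_columns n"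
    moreover have "distinct \<alpha>" "set \<alpha> \<subseteq> {1..n}" "1 \<le> length \<alpha>" "length \<alpha> \<le> n - 1"
      using assms m mset_eq_imp_distinct_iff[OF m] mset_eq_setD[OF m] mset_eq_length[OF m] by auto
    ultimately obtain \<tau> where "mset \<tau> = mset \<alpha>" "list_weight n \<tau> < list_weight n \<alpha>"
      using list_weight_decrease by blast
    then show False using a(2)[of \<tau>] m by simp
  qed
  then show ?thesis using m a(2)[of \<sigma>] by auto
qed

text \<open>Some arrangement is strictly lighter than \<open>\<sigma>\<close>, and some column is at
  most as heavy as that one; by uniqueness of the column with these entries it is
  \<open>\<alpha>\<close>.\<close>

lemma list_weight_column_less:
  assumes "\<alpha> \<in> pbw_columns n" "mset \<sigma> = mset \<alpha>" "\<sigma> \<noteq> \<alpha>"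
  shows "list_weight n \<alpha> < list_weight n \<sigma>"
proof -
  have s: "distinct \<sigma>" "set \<sigma> \<subseteq> {1..n}" "1 \<le> length \<sigma>" "length \<sigma> \<le> n - 1"
    using pbw_columns_distinct[OF assms(1)] pbw_columns_set[OF assms(1)] pbw_columnsD(1,2)[OF assms(1)]
      mset_eq_imp_distinct_iff[OF assms(2)] mset_eq_setD[OF assms(2)] mset_eq_length[OF assms(2)] by auto
  have "\<sigma> \<notin> pbw_columns n" using pbw_columns_mset_inj assms by blast
  from list_weight_decrease[OF s this] obtain \<tau> where t: "mset \<tau> = mset \<sigma>" "list_weight n \<tau> < list_weight n \<sigma>" by blast
  have "distinct \<tau>" "set \<tau> \<subseteq> {1..n}" "1 \<le> length \<tau>" "length \<tau> \<le> n - 1"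
    using s mset_eq_imp_distinct_iff[OF t(1)] mset_eq_setD[OF t(1)] mset_eq_length[OF t(1)] by auto
  then obtain \<alpha>' where a: "\<alpha>' \<in> pbw_columns n" "mset \<alpha>' = mset \<tau>" "list_weight n \<alpha>' \<le> list_weight n \<tau>"
    using column_arrangement_le by blast
  then have "\<alpha>' = \<alpha>" using pbw_columns_mset_inj[OF a(1) assms(1)] t assms by simp
  then show ?thesis using a t by simp
qed

section \<open>Variables and the columns they stand for\<close>

lemma pl_varsD:
  assumes "i \<in> pl_vars n"
  shows "sorted i" "distinct i" "set i \<subseteq> {1..n}" "1 \<le> length i" "length i \<le> n - 1" "sort i = i"
  using assms unfolding pl_vars_def by (auto simp: strict_sorted_iff sorted_sort_id)

lemma sort_column_pl_vars:
  assumes "\<alpha> \<in> pbw_columns n"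
  shows "sort \<alpha> \<in> pl_vars n"
  using pbw_columns_distinct[OF assms] pbw_columns_set[OF assms] pbw_columnsD(1,2)[OF assms]
  unfolding pl_vars_def by (auto simp: strict_sorted_iff)

lemma sort_column_inj:
  assumes "\<alpha> \<in> pbw_columns n" "\<beta> \<in> pbw_columns n" "sort \<alpha> = sort \<beta>"
  shows "\<alpha> = \<beta>"
  using pbw_columns_mset_inj[OF assms(1,2)] assms(3) by (metis mset_sort)

definition var_column :: "nat \<Rightarrow> nat list \<Rightarrow> nat list"
  where "var_column n i = (THE \<alpha>. \<alpha> \<in> pbw_columns n \<and> sort \<alpha> = i)"

lemma var_column_sort:
  assumes "\<alpha> \<in> pbw_columns n"
  shows "var_column n (sort \<alpha>) = \<alpha>"
  unfolding var_column_def using assms sort_column_inj by blast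

lemma var_column:
  assumes "i \<in> pl_vars n"
  shows "var_column n i \<in> pbw_columns n" "sort (var_column n i) = i"
proof -
  obtain \<alpha> where a: "\<alpha> \<in> pbw_columns n" "mset \<alpha> = mset i"
    using column_arrangement_le[of i n] pl_varsD[OF assms] by blast
  then have "sort \<alpha> = i" using pl_varsD(6)[OF assms] by (metis properties_for_sort sorted_sort mset_sort)
  then show "var_column n i \<in> pbw_columns n" "sort (var_column n i) = i" using var_column_sort[OF a(1)] a by auto
qed

section \<open>Semistandard pairs\<close>

definition count_ge :: "nat set \<Rightarrow> nat \<Rightarrow> nat"
  where "count_ge A x = card {y \<in> A. x \<le> y}"

text \<open>The condition says that the r-th largest element of \<open>A\<close> is at least t + 1 -
  r. Comparing subsets entry by entry, aligned at their largest elements, thus becomes inclusion of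
  ideals; the shift by r turns strictly decreasing sequences into weakly decreasing ones.\<close>

definition subset_ideal :: "nat \<Rightarrow> nat set \<Rightarrow> (nat \<times> nat) set"
  where "subset_ideal n A = {(r, t) \<in> tri n. r \<le> count_ge A (Suc t - r)}"

definition subset_column :: "nat \<Rightarrow> nat set \<Rightarrow> nat list"
  where "subset_column n A = ideal_column (subset_ideal n A)"

lemma count_ge_antimono:
  assumes "finite A" "x \<le> y"
  shows "count_ge A y \<le> count_ge A x"
  unfolding count_ge_def by (rule card_mono) (use assms in auto)

lemma count_ge_Suc:
  assumes "finite A"
  shows "count_ge A x \<le> Suc (count_ge A (Suc x))"
proof -
  have "{y \<in> A. x \<le> y} \<subseteq> insert x {y \<in> A. Suc x \<le> y}" by auto
  then have "card {y \<in> A. x \<le> y} \<le> card (insert x {y \<in> A. Suc x \<le> y})" by (rule card_mono[rotated]) (use assms in simp)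
  also have "\<dots> \<le> Suc (card {y \<in> A. Suc x \<le> y})" by (rule card_insert_le_m1) auto
  finally show ?thesis unfolding count_ge_def .
qed

lemma count_ge_add:
  assumes "finite A"
  shows "count_ge A x \<le> count_ge A (x + d) + d"
proof (induction d)
  case (Suc d)
  then show ?case using count_ge_Suc[OF assms, of "x + d"] by simp
qed simp

text \<open>Passing from row r to a smaller row s raises the threshold by r - s, which costs at most
  r - s elements.\<close>

lemma subset_ideal_order_ideal:
  assumes "finite A"
  shows "subset_ideal n A \<in> order_ideals n"
  unfolding order_ideals_def
proof (intro CollectI conjI ballI impI)
  show "subset_ideal n A \<subseteq> tri n" unfolding subset_ideal_def by auto
  fix p q assume pq: "p \<in> subset_ideal n A" "q \<in> tri n" "q \<le> p"
  obtain r t where p: "p = (r, t)" by (cases p)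
  obtain s v where q: "q = (s, v)" by (cases q)
  have le: "s \<le> r" "v \<le> t" "1 \<le> s" "s \<le> v" "r \<le> t" and rc: "r \<le> count_ge A (Suc t - r)"
    using pq unfolding p q subset_ideal_def tri_def by auto
  have "count_ge A (Suc t - r) \<le> count_ge A (Suc t - r + (r - s)) + (r - s)" by (rule count_ge_add[OF assms])
  also have "Suc t - r + (r - s) = Suc t - s" using le by auto
  finally have "s \<le> count_ge A (Suc t - s)" using rc le by simp
  also have "\<dots> \<le> count_ge A (Suc v - s)" by (rule count_ge_antimono[OF assms]) (use le in auto)
  finally show "q \<in> subset_ideal n A" using pq(2) unfolding q subset_ideal_def by auto
qed

lemma subset_column:
  assumes "A \<subseteq> {1..n}" "1 \<le> card A" "card A \<le> n - 1"
  shows "subset_column n A \<in> pbw_columns n" "col_ideal n (subset_column n A) = subset_ideal n A"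
    "length (subset_column n A) = card A"
proof -
  have fin: "finite A" using assms(1) finite_subset by blast
  have n: "2 \<le> n" using assms by linarith
  show 1: "subset_column n A \<in> pbw_columns n" and 2: "col_ideal n (subset_column n A) = subset_ideal n A"
    unfolding subset_column_def
    using ideal_column_mem[OF subset_ideal_order_ideal[OF fin] n] col_ideal_ideal_column[OF subset_ideal_order_ideal[OF fin] n] by auto
  have c1: "count_ge A 1 = card A" unfolding count_ge_def using assms(1) by (intro arg_cong[of _ _ card]) auto
  have d: "(l, l) \<in> subset_ideal n A \<longleftrightarrow> 2 \<le> l \<and> l \<le> card A" for l
    unfolding subset_ideal_def tri_def using c1 assms(3) by (auto simp: Suc_diff_le)
  have "2 \<le> l \<and> l \<le> length (subset_column n A) \<longleftrightarrow> 2 \<le> l \<and> l \<le> card A" for l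
    using col_ideal_diag[OF 1, of l] d[of l] 2 by simp
  from this[of "card A"] this[of "length (subset_column n A)"]
  show "length (subset_column n A) = card A" using assms(2) pbw_columnsD(1)[OF 1] by linarith
qed

text \<open>The number r of elements at least x is visible in the ideal at the cell (r, x + r - 1),
  and these numbers determine the set.\<close>

lemma subset_column_inj:
  assumes "A \<subseteq> {1..n}" "1 \<le> card A" "card A \<le> n - 1" "B \<subseteq> {1..n}" "1 \<le> card B" "card B \<le> n - 1"
    and eq: "subset_column n A = subset_column n B"
  shows "A = B"
proof -
  have J: "subset_ideal n A = subset_ideal n B"
    using subset_column(2)[OF assms(1-3)] subset_column(2)[OF assms(4-6)] eq by simp
  have fin: "finite A" "finite B" using assms finite_subset by blast+
  have le: "count_ge C x \<le> count_ge D x" if C: "C \<subseteq> {1..n}" "card C \<le> n - 1" and D: "D \<subseteq> {1..n}" "1 \<le> card D"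
    and "subset_ideal n C = subset_ideal n D" and x: "1 \<le> x" for C D x
  proof (cases "count_ge C x = 0")
    case False
    define r where "r = count_ge C x"
    have fC: "finite C" using C finite_subset by blast
    have "{y \<in> C. x \<le> y} \<subseteq> {x..n}" using C by auto
    then have "r \<le> card {x..n}" unfolding r_def count_ge_def by (intro card_mono) auto
    moreover have r1: "1 \<le> r" using False unfolding r_def by simp
    ultimately have rn: "x + r - 1 \<le> n" by auto
    have rC: "r \<le> card C" unfolding r_def count_ge_def using fC by (intro card_mono) auto
    have "r \<le> count_ge D x"
    \<comment> \<open>The cell (1, 1) is not in \<open>tri n\<close>; it would record nonemptiness,
      which is known from the cardinality of \<open>D\<close>.\<close>
    proof (cases "(r, x + r - 1) = (1, 1)")
      case True
      then have "count_ge D x = card D" unfolding count_ge_def using D by (intro arg_cong[of _ _ card]) auto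
      then show ?thesis using True D by simp
    next
      case False
      have "(r, x + r - 1) \<in> tri n" unfolding tri_def using False r1 rn x rC C(2) by auto
      moreover have "Suc (x + r - 1) - r = x" using r1 x by auto
      ultimately have "(r, x + r - 1) \<in> subset_ideal n C" unfolding subset_ideal_def r_def by auto
      then have "(r, x + r - 1) \<in> subset_ideal n D" using that by simp
      then show ?thesis unfolding subset_ideal_def using \<open>Suc (x + r - 1) - r = x\<close> by auto
    qed
    then show ?thesis unfolding r_def .
  qed simp
  have ce: "count_ge A x = count_ge B x" if "1 \<le> x" for x
    using le[of A B x] le[of B A x] J assms that by (simp add: antisym)
  have memb: "x \<in> C \<longleftrightarrow> count_ge C x \<noteq> count_ge C (Suc x)" if "finite C" for C x
  proof -
    have "x \<in> C \<Longrightarrow> {y \<in> C. x \<le> y} = insert x {y \<in> C. Suc x \<le> y}" by auto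
    moreover have "x \<notin> C \<Longrightarrow> {y \<in> C. x \<le> y} = {y \<in> C. Suc x \<le> y}" by (auto simp: le_eq_less_or_eq)
    ultimately show ?thesis unfolding count_ge_def using that by (cases "x \<in> C") simp_all
  qed
  show "A = B"
  proof (rule Set.set_eqI)
    fix x show "x \<in> A \<longleftrightarrow> x \<in> B"
    proof (cases "1 \<le> x")
      case True then show ?thesis using memb[OF fin(1)] memb[OF fin(2)] ce by simp
    next
      case False then show ?thesis using assms by auto
    qed
  qed
qed

lemma subset_column_le:
  assumes "A \<subseteq> {1..n}" "1 \<le> card A" "card A \<le> n - 1" "B \<subseteq> {1..n}" "1 \<le> card B" "card B \<le> n - 1"
    and "\<And>x. count_ge B x \<le> count_ge A x"
  shows "pbw_le (subset_column n B) (subset_column n A)"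
  unfolding pbw_le_iff_subset[OF subset_column(1)[OF assms(1-3)] subset_column(1)[OF assms(4-6)]]
    subset_column(2)[OF assms(1-3)] subset_column(2)[OF assms(4-6)]
  using assms(7) order_trans unfolding subset_ideal_def by blast

section \<open>Polynomials as finite maps\<close>

abbreviation coef where "coef \<equiv> Poly_Mapping.lookup"
abbreviation supp where "supp \<equiv> Poly_Mapping.keys"
abbreviation monom where "monom \<equiv> Poly_Mapping.single"

lemma coef_sum_monom:
  assumes "finite S"
  shows "coef (\<Sum>m\<in>S. monom m (f m)) k = (if k \<in> S then f k else 0)"
proof -
  have "coef (\<Sum>m\<in>S. monom m (f m)) k = (\<Sum>m\<in>S. if m = k then f m else 0)"
    unfolding lookup_sum by (rule sum.cong) (auto simp: lookup_single when_def)
  also have "\<dots> = (if k \<in> S then f k else 0)" using assms by simp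
  finally show ?thesis .
qed

lemma poly_sum_monoms:
  assumes "finite S" "supp p \<subseteq> S"
  shows "p = (\<Sum>m\<in>S. monom m (coef p m))"
  by (rule poly_mapping_eqI) (use assms in \<open>auto simp: coef_sum_monom in_keys_iff\<close>)

lemma monomial_add_supp: "supp (m + m' :: 'v \<Rightarrow>\<^sub>0 nat) = supp m \<union> supp m'"
  by (auto simp: in_keys_iff lookup_add)

lemma monomial_induct [case_names zero add]:
  fixes m :: "'v \<Rightarrow>\<^sub>0 nat"
  assumes "P 0" "\<And>m x. P m \<Longrightarrow> P (m + monom x 1)"
  shows "P m"
proof (induction "\<Sum>x\<in>supp m. coef m x" arbitrary: m rule: less_induct)
  case less
  show ?case
  proof (cases "m = 0")
    case False
    then obtain x where x: "x \<in> supp m" by (metis ex_in_conv keys_eq_empty)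
    define m' where "m' = m - monom x 1"
    have l: "coef m x = Suc (coef m' x)" "\<And>y. y \<noteq> x \<Longrightarrow> coef m y = coef m' y"
      using x unfolding m'_def by (auto simp: lookup_minus lookup_single in_keys_iff when_def)
    have mm: "m = m' + monom x 1"
      by (rule poly_mapping_eqI) (use l in \<open>auto simp: lookup_add lookup_single when_def\<close>)
    have "(\<Sum>y\<in>supp m'. coef m' y) = (\<Sum>y\<in>supp m. coef m' y)"
      by (rule sum.mono_neutral_left) (auto simp: mm monomial_add_supp in_keys_iff)
    also have "\<dots> < (\<Sum>y\<in>supp m. coef m y)"
    proof (rule sum_strict_mono_ex1)
      show "\<forall>y\<in>supp m. coef m' y \<le> coef m y" using l by (metis Suc_n_not_le_n le_refl nat_le_linear)
      show "\<exists>y\<in>supp m. coef m' y < coef m y" using x l(1) by (intro bexI[of _ x]) auto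
    qed simp
    finally have "P m'" by (rule less)
    then show ?thesis using assms(2) mm by simp
  qed (simp add: assms(1))
qed

definition mon_eval :: "('v \<Rightarrow> 'r::comm_semiring_1) \<Rightarrow> ('v \<Rightarrow>\<^sub>0 nat) \<Rightarrow> 'r"
  where "mon_eval f m = (\<Prod>x\<in>supp m. f x ^ coef m x)"

lemma mon_eval_superset:
  assumes "finite S" "supp m \<subseteq> S"
  shows "mon_eval f m = (\<Prod>x\<in>S. f x ^ coef m x)"
  unfolding mon_eval_def using assms by (intro prod.mono_neutral_left) (auto simp: in_keys_iff)

lemma mon_eval_add: "mon_eval f (m + m') = mon_eval f m * mon_eval f m'"
proof -
  let ?S = "supp m \<union> supp m'"
  have "mon_eval f (m + m') = (\<Prod>x\<in>?S. f x ^ coef (m + m') x)"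
    by (rule mon_eval_superset) (auto simp: monomial_add_supp)
  also have "\<dots> = (\<Prod>x\<in>?S. f x ^ coef m x) * (\<Prod>x\<in>?S. f x ^ coef m' x)"
    by (simp add: lookup_add power_add prod.distrib)
  also have "\<dots> = mon_eval f m * mon_eval f m'"
    by (subst (1 2) mon_eval_superset[of ?S]) auto
  finally show ?thesis .
qed

lemma mon_eval_simps [simp]: "mon_eval f 0 = 1" "mon_eval f (monom x (Suc 0)) = f x" "mon_eval f (monom x 1) = f x"
  by (simp_all add: mon_eval_def)

lemma pconst_simps: "pconst 0 = 0" "pconst 1 = 1" "pconst (a + b) = pconst a + pconst b"
  "pconst (a * b) = pconst a * pconst b" "pconst (- a) = - pconst a"
  by (simp_all add: pconst_def single_add mult_single single_uminus)

lemma pconst_monom: "pconst c * monom m d = monom m (c * d)"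
  by (simp add: pconst_def mult_single)

lemma coef_monom_mult: "coef (monom m c * p) (m + k) = c * coef (p :: 'v cpoly) k"
proof -
  have "monom m c * p = (\<Sum>j\<in>supp p. monom (m + j) (c * coef p j))"
    by (subst poly_sum_monoms[of "supp p" p]) (simp_all add: sum_distrib_left mult_single)
  then have "coef (monom m c * p) (m + k) = (\<Sum>j\<in>supp p. if j = k then c * coef p j else 0)"
    by (simp add: lookup_sum lookup_single when_def)
  also have "\<dots> = c * coef p k" by (simp add: in_keys_iff)
  finally show ?thesis .
qed

lemma supp_monom_mult: "supp (monom m c * p) \<subseteq> (+) m ` supp (p :: 'v cpoly)"
  using keys_mult[of "monom m c" p] by (cases "c = 0") auto

lemma coef_pconst_mult: "coef (pconst c * p) k = c * coef (p :: 'v cpoly) k"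
  using coef_monom_mult[of 0 c p k] by (simp add: pconst_def)

lemma supp_pconst_mult: "supp (pconst c * p) \<subseteq> supp (p :: 'v cpoly)"
  by (auto simp: in_keys_iff coef_pconst_mult)

text \<open>Linear algebra over the complex numbers; \<open>cpoly.span\<close> is the span occurring
  in \<open>initial_space\<close>.\<close>

interpretation cpoly: vector_space "\<lambda>c (p :: 'v cpoly). pconst c * p"
  by unfold_locales (simp_all add: pconst_simps algebra_simps)

lemma psubst_superset:
  assumes "finite S" "supp p \<subseteq> S"
  shows "psubst f p = (\<Sum>m\<in>S. pconst (coef p m) * mon_eval f m)"
proof -
  have "psubst f p = (\<Sum>m\<in>supp p. pconst (coef p m) * mon_eval f m)"
    unfolding psubst_def mon_eval_def ..
  also have "\<dots> = (\<Sum>m\<in>S. pconst (coef p m) * mon_eval f m)"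
    by (rule sum.mono_neutral_left) (use assms in \<open>auto simp: in_keys_iff pconst_simps\<close>)
  finally show ?thesis .
qed

lemma psubst_add: "psubst f (p + q) = psubst f p + psubst f q"
proof -
  let ?S = "supp p \<union> supp q"
  have "psubst f (p + q) = (\<Sum>m\<in>?S. pconst (coef (p + q) m) * mon_eval f m)"
    by (rule psubst_superset) (use keys_add[of p q] in auto)
  also have "\<dots> = (\<Sum>m\<in>?S. pconst (coef p m) * mon_eval f m) + (\<Sum>m\<in>?S. pconst (coef q m) * mon_eval f m)"
    by (simp add: lookup_add pconst_simps distrib_right sum.distrib)
  also have "\<dots> = psubst f p + psubst f q"
    by (subst (1 2) psubst_superset[of ?S]) auto
  finally show ?thesis .
qed

lemma psubst_0 [simp]: "psubst f 0 = 0"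
  by (simp add: psubst_def)

lemma psubst_monom: "psubst f (monom m c) = pconst c * mon_eval f m"
  by (subst psubst_superset[of "{m}"]) auto

lemma psubst_sum: "psubst f (sum g S) = (\<Sum>s\<in>S. psubst f (g s))"
  by (induction S rule: infinite_finite_induct) (simp_all add: psubst_add)

lemma psubst_monom_mult: "psubst f (monom m c * p) = psubst f (monom m c) * psubst f p"
proof -
  have "psubst f (monom m c * p) = psubst f (\<Sum>k\<in>supp p. monom (m + k) (c * coef p k))"
    by (subst poly_sum_monoms[of "supp p" p]) (simp_all add: sum_distrib_left mult_single)
  also have "\<dots> = psubst f (monom m c) * (\<Sum>k\<in>supp p. pconst (coef p k) * mon_eval f k)"
    by (simp add: psubst_sum psubst_monom mon_eval_add pconst_simps sum_distrib_left mult_ac)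
  also have "\<dots> = psubst f (monom m c) * psubst f p" by (subst psubst_superset[of "supp p" p]) auto
  finally show ?thesis .
qed

lemma psubst_mult: "psubst f (p * q) = psubst f p * psubst f q"
proof -
  have "psubst f (p * q) = psubst f (\<Sum>k\<in>supp p. monom k (coef p k) * q)"
    by (subst poly_sum_monoms[of "supp p" p]) (simp_all add: sum_distrib_right)
  also have "\<dots> = (\<Sum>k\<in>supp p. psubst f (monom k (coef p k))) * psubst f q"
    by (simp add: psubst_sum psubst_monom_mult sum_distrib_right)
  also have "(\<Sum>k\<in>supp p. psubst f (monom k (coef p k))) = psubst f p"
    by (subst poly_sum_monoms[of "supp p" p]) (simp_all add: psubst_sum)
  finally show ?thesis .
qed

lemma psubst_pconst_mult: "psubst f (pconst c * p) = pconst c * psubst f p"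
  unfolding psubst_mult by (simp add: pconst_def[of c] psubst_monom)

lemma psubst_diff: "psubst f (p - q) = psubst f p - psubst f q"
  by (metis psubst_add add_diff_cancel diff_add_cancel)

section \<open>Weights of monomials and leading monomials\<close>

definition mweight :: "('v \<Rightarrow> 'r::comm_ring_1) \<Rightarrow> ('v \<Rightarrow>\<^sub>0 nat) \<Rightarrow> 'r"
  where "mweight u m = (\<Sum>x\<in>supp m. of_nat (coef m x) * u x)"

lemma mweight_superset:
  assumes "finite S" "supp m \<subseteq> S"
  shows "mweight u m = (\<Sum>x\<in>S. of_nat (coef m x) * u x)"
  unfolding mweight_def using assms by (intro sum.mono_neutral_left) (auto simp: in_keys_iff)

lemma mweight_add: "mweight u (m + m') = mweight u m + mweight u m'"
  by (subst (1 2 3) mweight_superset[of "supp m \<union> supp m'"])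
    (auto simp: monomial_add_supp lookup_add distrib_right sum.distrib)

lemma mweight_simps [simp]: "mweight u 0 = 0" "mweight u (monom x (Suc 0)) = u x"
  by (simp_all add: mweight_def)

lemma mweight_sum: "mweight u (sum f S) = (\<Sum>s\<in>S. mweight u (f s))"
  by (induction S rule: infinite_finite_induct) (simp_all add: mweight_add)

text \<open>Least weight rather than greatest, as in \<open>initial_part\<close>. The minimum has to
  be attained only once, which makes the notion multiplicative without a monomial order.\<close>

definition lead :: "('v \<Rightarrow> int) \<Rightarrow> 'v cpoly \<Rightarrow> ('v \<Rightarrow>\<^sub>0 nat) \<Rightarrow> bool"
  where "lead u p m \<longleftrightarrow> coef p m \<noteq> 0 \<and> (\<forall>k\<in>supp p. k \<noteq> m \<longrightarrow> mweight u m < mweight u k)"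

lemma lead_le: "lead u p m \<Longrightarrow> k \<in> supp p \<Longrightarrow> mweight u m \<le> mweight u k"
  unfolding lead_def by (cases "k = m") auto

lemma lead_eq: "lead u p m \<Longrightarrow> k \<in> supp p \<Longrightarrow> mweight u k = mweight u m \<Longrightarrow> k = m"
  unfolding lead_def by force

text \<open>Once both leading terms are split off, every remaining product has a non-leading factor
  and is strictly heavier.\<close>

lemma lead_mult:
  assumes "lead u p m" "lead u q k"
  shows "lead u (p * q) (m + k)"
proof -
  have gt: "mweight u (m + k) < mweight u j"
    if jpq: "j \<in> supp (p' * q')" and that: "supp p' \<subseteq> supp p" "supp q' \<subseteq> supp q" "m \<notin> supp p' \<or> k \<notin> supp q'" for j p' q'
  proof -
    obtain a b where ab: "j = a + b" "a \<in> supp p'" "b \<in> supp q'" using jpq keys_mult[of p' q'] by blast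
    have "mweight u m \<le> mweight u a" "mweight u k \<le> mweight u b"
      using ab that lead_le[OF assms(1)] lead_le[OF assms(2)] by auto
    moreover have "mweight u m < mweight u a \<or> mweight u k < mweight u b"
      using ab that assms unfolding lead_def by (metis subsetD)
    ultimately show ?thesis unfolding ab by (auto simp: mweight_add)
  qed
  define p' q' where "p' = p - monom m (coef p m)" and "q' = q - monom k (coef q k)"
  have p': "supp p' \<subseteq> supp p" "m \<notin> supp p'" and q': "supp q' \<subseteq> supp q" "k \<notin> supp q'"
    unfolding p'_def q'_def by (auto simp: in_keys_iff lookup_minus lookup_single when_def split: if_splits)
  have k1: "supp (monom k (coef q k)) \<subseteq> supp q" by (auto simp: in_keys_iff lookup_single when_def)
  have eq: "p * q = monom (m + k) (coef p m * coef q k) + (p' * q + monom m (coef p m) * q')"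
    unfolding p'_def q'_def by (simp add: algebra_simps mult_single)
  have m1: "supp (monom m (coef p m)) \<subseteq> supp p" by (auto simp: in_keys_iff lookup_single when_def)
  have r: "mweight u (m + k) < mweight u j" if "j \<in> supp (p' * q + monom m (coef p m) * q')" for j
  proof -
    have "j \<in> supp (p' * q) \<union> supp (monom m (coef p m) * q')" using that keys_add[of "p' * q" "monom m (coef p m) * q'"] by (rule rev_subsetD)
    then show ?thesis using gt[of j p' q] gt[of j "monom m (coef p m)" q'] p' q' m1 by auto
  qed
  then have z: "coef (p' * q + monom m (coef p m) * q') (m + k) = 0"
    by (metis in_keys_iff less_irrefl)
  have "coef (p * q) (m + k) = coef p m * coef q k"
    unfolding eq lookup_add[of "monom _ _"] z by simp
  moreover have "mweight u (m + k) < mweight u j" if "j \<in> supp (p * q)" "j \<noteq> m + k" for j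
  proof -
    have "j \<in> supp (p' * q + monom m (coef p m) * q')"
      using that unfolding eq in_keys_iff lookup_add[of "monom _ _"] by (simp add: lookup_single)
    then show ?thesis by (rule r)
  qed
  ultimately show ?thesis using assms unfolding lead_def by auto
qed

lemma lead_one: "lead u 1 0"
  unfolding lead_def by simp

text \<open>\<open>h\<close> is the additive extension of \<open>g\<close> to monomials, given only
  through its recursion; it will be \<open>var_cells n\<close>.\<close>

lemma lead_mon_eval:
  assumes "\<And>x. x \<in> supp m \<Longrightarrow> lead u (f x) (g x)"
    and "h 0 = 0" "\<And>m x. h (m + monom x 1) = h m + g x"
  shows "lead u (mon_eval f m) (h m)"
  using assms(1)
proof (induction m rule: monomial_induct)
  case zero
  then show ?case using assms(2) lead_one by simp
next
  case (add m x)
  have "lead u (f y) (g y)" if "y \<in> supp m \<or> y = x" for y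
    using add(2)[of y] that by (auto simp: monomial_add_supp)
  then have "lead u (mon_eval f m) (h m)" "lead u (f x) (g x)" using add(1) by auto
  then show ?case unfolding mon_eval_add assms(3) mon_eval_simps by (rule lead_mult)
qed

section \<open>Minors\<close>

definition cell_mon :: "nat list \<Rightarrow> (nat \<times> nat) \<Rightarrow>\<^sub>0 nat"
  where "cell_mon \<alpha> = (\<Sum>r<length \<alpha>. monom (Suc r, \<alpha> ! r) 1)"

lemma coef_cell_mon:
  "coef (cell_mon \<alpha>) (s, c) = (if 1 \<le> s \<and> s \<le> length \<alpha> \<and> \<alpha> ! (s - 1) = c then 1 else 0)"
proof (cases s)
  case 0
  then show ?thesis unfolding cell_mon_def lookup_sum by (simp add: lookup_single)
next
  case (Suc s')
  have "coef (cell_mon \<alpha>) (s, c) = (\<Sum>r<length \<alpha>. if r = s' then (if \<alpha> ! s' = c then 1 else 0) else 0)"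
    unfolding cell_mon_def lookup_sum Suc by (rule sum.cong) (simp_all add: lookup_single when_def)
  also have "\<dots> = (if 1 \<le> s \<and> s \<le> length \<alpha> \<and> \<alpha> ! (s - 1) = c then 1 else 0)"
    unfolding Suc by (simp add: Suc_le_eq)
  finally show ?thesis .
qed

lemma supp_cell_mon: "supp (cell_mon \<alpha>) = cells \<alpha>"
proof (rule Set.set_eqI)
  fix q :: "nat \<times> nat"
  obtain s c where q: "q = (s, c)" by (cases q)
  show "q \<in> supp (cell_mon \<alpha>) \<longleftrightarrow> q \<in> cells \<alpha>"
    unfolding q in_keys_iff coef_cell_mon cells_def
    by (auto intro!: exI[of _ "s - 1"] split: if_splits)
qed

lemma cell_mon_inj:
  assumes "cell_mon \<alpha> = cell_mon \<beta>" "length \<alpha> = length \<beta>"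
  shows "\<alpha> = \<beta>"
proof (rule nth_equalityI)
  fix r assume "r < length \<alpha>"
  then have "coef (cell_mon \<beta>) (Suc r, \<alpha> ! r) = 1" using assms(1)[symmetric] by (simp add: coef_cell_mon)
  then show "\<alpha> ! r = \<beta> ! r" by (simp add: coef_cell_mon split: if_splits)
qed (fact assms(2))

lemma mweight_cell_mon: "mweight (cell_weight n) (cell_mon \<alpha>) = list_weight n \<alpha>"
  unfolding cell_mon_def list_weight_def mweight_sum by simp

lemma prod_pvar: "finite S \<Longrightarrow> (\<Prod>s\<in>S. pvar (f s)) = monom (\<Sum>s\<in>S. monom (f s) 1) 1"
  by (induction S rule: finite_induct) (simp_all add: pvar_def mult_single)

lemma pl_minor_leibniz:
  "pl_minor i = (\<Sum>\<sigma> | \<sigma> permutes {..<length i}. of_int (sign \<sigma>) * (\<Prod>c<length i. pvar (Suc (\<sigma> c), i ! c)))"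
proof -
  let ?k = "length i"
  let ?A = "Matrix.mat ?k ?k (\<lambda>(r, s). pvar (Suc r, i ! s))"
  have "pl_minor i = (\<Sum>\<sigma> | \<sigma> permutes {0..<?k}. of_int (sign \<sigma>) * (\<Prod>c<?k. ?A $$ (\<sigma> c, c)))"
    unfolding pl_minor_def by (rule det_col) simp
  also have "\<dots> = (\<Sum>\<sigma> | \<sigma> permutes {..<?k}. of_int (sign \<sigma>) * (\<Prod>c<?k. pvar (Suc (\<sigma> c), i ! c)))"
  proof (rule sum.cong)
    fix \<sigma> assume "\<sigma> \<in> {\<sigma>. \<sigma> permutes {..<?k}}"
    then have "\<sigma> c < ?k" if "c < ?k" for c using that permutes_in_image[of \<sigma> "{..<?k}" c] by auto
    then show "of_int (sign \<sigma>) * (\<Prod>c<?k. ?A $$ (\<sigma> c, c)) = of_int (sign \<sigma>) * (\<Prod>c<?k. pvar (Suc (\<sigma> c), i ! c))"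
      by (intro arg_cong2[of _ _ _ _ "(*)"] prod.cong) auto
  qed (simp add: atLeast0LessThan)
  finally show ?thesis .
qed

lemma prod_pvar_permutes:
  assumes "\<sigma> permutes {..<length i}"
  shows "(\<Prod>c<length i. pvar (Suc (\<sigma> c), i ! c)) = monom (cell_mon (permute_list (Hilbert_Choice.inv \<sigma>) i)) 1"
proof -
  have inv: "Hilbert_Choice.inv \<sigma> permutes {..<length i}" by (rule permutes_inv[OF assms])
  have "(\<Sum>r<length i. monom (Suc r, i ! Hilbert_Choice.inv \<sigma> r) 1) = (\<Sum>c<length i. monom (Suc (\<sigma> c), i ! c) (1::nat))"
    using sum.permute[OF assms, of "\<lambda>r. monom (Suc r, i ! Hilbert_Choice.inv \<sigma> r) (1::nat)"] permutes_inverses(2)[OF assms]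
    by (simp add: comp_def)
  moreover have "cell_mon (permute_list (Hilbert_Choice.inv \<sigma>) i) = (\<Sum>r<length i. monom (Suc r, i ! Hilbert_Choice.inv \<sigma> r) 1)"
    unfolding cell_mon_def by (rule sum.cong) (simp_all add: permute_list_nth[OF inv])
  ultimately show ?thesis by (simp add: prod_pvar)
qed

lemma pl_minor_expand:
  "pl_minor i = (\<Sum>\<sigma> | \<sigma> permutes {..<length i}. monom (cell_mon (permute_list (Hilbert_Choice.inv \<sigma>) i)) (of_int (sign \<sigma>)))"
  unfolding pl_minor_leibniz
  by (rule sum.cong) (simp_all add: prod_pvar_permutes sign_def single_uminus)

lemma supp_pl_minor:
  assumes "m \<in> supp (pl_minor i)"
  shows "\<exists>\<tau>. mset \<tau> = mset i \<and> m = cell_mon \<tau>"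
proof -
  obtain \<sigma> where s: "\<sigma> permutes {..<length i}" "m \<in> supp (monom (cell_mon (permute_list (Hilbert_Choice.inv \<sigma>) i)) (of_int (sign \<sigma>) :: complex))"
    using assms keys_sum[of "\<lambda>\<sigma>. monom (cell_mon (permute_list (Hilbert_Choice.inv \<sigma>) i)) (of_int (sign \<sigma>) :: complex)" "{\<sigma>. \<sigma> permutes {..<length i}}"]
    unfolding pl_minor_expand by blast
  then have "m = cell_mon (permute_list (Hilbert_Choice.inv \<sigma>) i)" by (simp split: if_splits)
  moreover have "mset (permute_list (Hilbert_Choice.inv \<sigma>) i) = mset i" by (rule mset_permute_list[OF permutes_inv[OF s(1)]])
  ultimately show ?thesis by blast
qed

text \<open>As the entries are distinct, different permutations give different cell monomials, so
  nothing cancels in the Leibniz sum.\<close>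

lemma coef_pl_minor:
  assumes "distinct i" "mset \<tau> = mset i"
  shows "coef (pl_minor i) (cell_mon \<tau>) \<noteq> 0"
proof -
  obtain p where p: "p permutes {..<length i}" "permute_list p i = \<tau>" using mset_eq_permutation[OF assms(2)] by blast
  have iff: "cell_mon (permute_list (Hilbert_Choice.inv \<sigma>) i) = cell_mon \<tau> \<longleftrightarrow> \<sigma> = Hilbert_Choice.inv p" if s: "\<sigma> permutes {..<length i}" for \<sigma>
  proof
    assume "cell_mon (permute_list (Hilbert_Choice.inv \<sigma>) i) = cell_mon \<tau>"
    then have "permute_list (Hilbert_Choice.inv \<sigma>) i = permute_list p i"
      using cell_mon_inj[of "permute_list (Hilbert_Choice.inv \<sigma>) i" \<tau>] p(2) mset_eq_length[OF assms(2)] by simp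
    then have e: "i ! Hilbert_Choice.inv \<sigma> r = i ! p r" if "r < length i" for r
      using permute_list_nth[OF permutes_inv[OF s], of r] permute_list_nth[OF p(1), of r] that by simp
    have "Hilbert_Choice.inv \<sigma> r = p r" for r
    proof (cases "r < length i")
      case True
      then have "Hilbert_Choice.inv \<sigma> r < length i" "p r < length i"
        using permutes_in_image[OF permutes_inv[OF s], of r] permutes_in_image[OF p(1), of r] by auto
      then show ?thesis using e[OF True] assms(1) by (simp add: nth_eq_iff_index_eq)
    next
      case False
      then show ?thesis using permutes_inv[OF s] p(1) by (simp add: permutes_not_in)
    qed
    then have "Hilbert_Choice.inv \<sigma> = p" by (rule ext)
    then show "\<sigma> = Hilbert_Choice.inv p" using permutes_inv_inv[OF s] by simp
  qed (use p permutes_inv_inv[OF p(1)] in auto)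
  have "coef (pl_minor i) (cell_mon \<tau>) = (\<Sum>\<sigma> | \<sigma> permutes {..<length i}. if \<sigma> = Hilbert_Choice.inv p then of_int (sign \<sigma>) else 0)"
    unfolding pl_minor_expand lookup_sum by (rule sum.cong) (auto simp: lookup_single when_def iff)
  also have "\<dots> = of_int (sign (Hilbert_Choice.inv p))" using permutes_inv[OF p(1)] by (simp add: finite_permutations)
  finally show ?thesis by (simp add: sign_def)
qed

lemma lead_pl_minor:
  assumes "\<alpha> \<in> pbw_columns n"
  shows "lead (cell_weight n) (pl_minor (sort \<alpha>)) (cell_mon \<alpha>)"
  unfolding lead_def
proof (intro conjI ballI impI)
  show "coef (pl_minor (sort \<alpha>)) (cell_mon \<alpha>) \<noteq> 0"
    by (rule coef_pl_minor) (use pbw_columns_distinct[OF assms] in auto)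
  fix k assume "k \<in> supp (pl_minor (sort \<alpha>))" "k \<noteq> cell_mon \<alpha>"
  then obtain \<tau> where t: "mset \<tau> = mset \<alpha>" "k = cell_mon \<tau>" "\<tau> \<noteq> \<alpha>" using supp_pl_minor[of k "sort \<alpha>"] by auto
  then show "mweight (cell_weight n) (cell_mon \<alpha>) < mweight (cell_weight n) k"
    using list_weight_column_less[OF assms t(1,3)] by (simp add: mweight_cell_mon)
qed

section \<open>Linear independence of the standard monomials\<close>

text \<open>These are the monomials of the ring outside \<open>monomial_ideal n\<close>, see
  \<open>monomial_ideal_iff\<close>. Repeated variables are allowed.\<close>

definition standard :: "nat \<Rightarrow> (nat list \<Rightarrow>\<^sub>0 nat) \<Rightarrow> bool"
  where "standard n m \<longleftrightarrow> supp m \<subseteq> pl_vars n \<and>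
    (\<forall>i\<in>supp m. \<forall>j\<in>supp m. pbw_le (var_column n i) (var_column n j) \<or> pbw_le (var_column n j) (var_column n i))"

text \<open>The leading monomial of the product of minors that \<open>m\<close> stands for. The
  inner sum of a constant is multiplication by the exponent.\<close>

definition var_cells :: "nat \<Rightarrow> (nat list \<Rightarrow>\<^sub>0 nat) \<Rightarrow> (nat \<times> nat) \<Rightarrow>\<^sub>0 nat"
  where "var_cells n m = (\<Sum>i\<in>supp m. \<Sum>_<coef m i. cell_mon (var_column n i))"

lemma sum_const_add: "(\<Sum>_<a + b. x) = (\<Sum>_<a. x) + (\<Sum>_<b. (x :: 'a :: comm_monoid_add))" for a b :: nat
  by (induction b) (simp_all add: ac_simps)

lemma var_cells_superset:
  assumes "finite S" "supp m \<subseteq> S"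
  shows "var_cells n m = (\<Sum>i\<in>S. \<Sum>_<coef m i. cell_mon (var_column n i))"
  unfolding var_cells_def using assms by (intro sum.mono_neutral_left) (auto simp: in_keys_iff)

lemma var_cells_add: "var_cells n (m + m') = var_cells n m + var_cells n m'"
  by (subst (1 2 3) var_cells_superset[of "supp m \<union> supp m'"])
    (auto simp: monomial_add_supp lookup_add sum_const_add sum.distrib simp del: sum_constant)

lemma var_cells_simps [simp]: "var_cells n 0 = 0" "var_cells n (monom x (Suc 0)) = cell_mon (var_column n x)"
  by (simp_all add: var_cells_def)

lemma lead_mon_eval_minor:
  assumes "supp m \<subseteq> pl_vars n"
  shows "lead (cell_weight n) (mon_eval pl_minor m) (var_cells n m)"
proof (rule lead_mon_eval)
  fix x assume "x \<in> supp m"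
  then have "x \<in> pl_vars n" using assms by auto
  then show "lead (cell_weight n) (pl_minor x) (cell_mon (var_column n x))"
    using lead_pl_minor[OF var_column(1)] var_column(2) by metis
qed (simp_all add: var_cells_add)

lemma supp_var_cells: "supp (var_cells n m) = (\<Union>i\<in>supp m. cells (var_column n i))"
proof (induction m rule: monomial_induct)
  case (add m x)
  then show ?case by (auto simp: var_cells_add monomial_add_supp supp_cell_mon)
qed simp

lemma standard_top:
  assumes "standard n m" "m \<noteq> 0"
  obtains i where "i \<in> supp m" "\<And>j. j \<in> supp m \<Longrightarrow> pbw_le (var_column n j) (var_column n i)"
proof -
  have sub: "supp m \<subseteq> pl_vars n" using assms unfolding standard_def by auto
  let ?C = "(\<lambda>i. col_ideal n (var_column n i)) ` supp m"
  have "finite ?C" "?C \<noteq> {}" using assms(2) by auto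
  from finite_has_maximal[OF this] obtain i where
    i: "i \<in> supp m" "\<And>j. j \<in> supp m \<Longrightarrow> col_ideal n (var_column n i) \<subseteq> col_ideal n (var_column n j) \<Longrightarrow>
      col_ideal n (var_column n i) = col_ideal n (var_column n j)" by blast
  have "pbw_le (var_column n j) (var_column n i)" if j: "j \<in> supp m" for j
  proof -
    have c: "var_column n i \<in> pbw_columns n" "var_column n j \<in> pbw_columns n"
      using var_column(1) i(1) j sub by auto
    have "pbw_le (var_column n i) (var_column n j) \<or> pbw_le (var_column n j) (var_column n i)"
      using assms(1) i(1) j unfolding standard_def by blast
    then show ?thesis using i(2)[OF j] c by (auto simp: pbw_le_iff_subset)
  qed
  then show ?thesis using that i(1) by blast
qed

lemma var_column_inj:
  "i \<in> pl_vars n \<Longrightarrow> j \<in> pl_vars n \<Longrightarrow> var_column n i = var_column n j \<Longrightarrow> i = j"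
  using var_column(2) by metis

text \<open>The largest column of a chain is determined by the cells of the product.\<close>

lemma var_cells_inj:
  assumes "standard n m" "standard n m'" "var_cells n m = var_cells n m'"
  shows "m = m'"
  using assms
proof (induction "\<Sum>x\<in>supp m. coef m x" arbitrary: m m' rule: less_induct)
  case less
  have s: "supp m \<subseteq> pl_vars n" "supp m' \<subseteq> pl_vars n" using less(2,3) unfolding standard_def by auto
  have cells_ne: "cells (var_column n i) \<noteq> {}" if "i \<in> pl_vars n" for i
    using pbw_columnsD(1)[OF var_column(1)[OF that]] unfolding cells_def by fastforce
  have z: "m1 = 0 \<longleftrightarrow> supp (var_cells n m1) = {}" if "supp m1 \<subseteq> pl_vars n" for m1
  proof
    assume "supp (var_cells n m1) = {}"
    then have "supp m1 = {}" unfolding supp_var_cells using cells_ne that by blast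
    then show "m1 = 0" by simp
  qed simp
  show ?case
  proof (cases "m = 0")
    case True
    then show ?thesis using z[OF s(1)] z[OF s(2)] less(4) by simp
  next
    case False
    then have F': "m' \<noteq> 0" using z[OF s(1)] z[OF s(2)] less(4) by simp
    obtain i where i: "i \<in> supp m" "\<And>j. j \<in> supp m \<Longrightarrow> pbw_le (var_column n j) (var_column n i)"
      using standard_top[OF less(2) False] by blast
    obtain i' where i': "i' \<in> supp m'" "\<And>j. j \<in> supp m' \<Longrightarrow> pbw_le (var_column n j) (var_column n i')"
      using standard_top[OF less(3) F'] by blast
    \<comment> \<open>Only the sets of cells matter: each cell of the column of \<open>i1\<close>
      occurs in some column of \<open>m2\<close> and is therefore dominated by the top column of
      \<open>m2\<close>.\<close>
    have le: "pbw_le (var_column n i1) (var_column n i2)"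
      if "i1 \<in> supp m1" "supp (var_cells n m1) = supp (var_cells n m2)" "supp m1 \<subseteq> pl_vars n" "supp m2 \<subseteq> pl_vars n"
        "\<And>j. j \<in> supp m2 \<Longrightarrow> pbw_le (var_column n j) (var_column n i2)" for i1 i2 m1 m2
    proof -
      have ne: "var_column n j \<noteq> []" if "j \<in> pl_vars n" for j using pbw_columns_nonempty[OF var_column(1)[OF that]] .
      have "\<exists>q'\<in>cells (var_column n i2). q \<le> q'" if q: "q \<in> cells (var_column n i1)" for q
      proof -
        have "q \<in> supp (var_cells n m1)" using q \<open>i1 \<in> supp m1\<close> unfolding supp_var_cells by blast
        then have "q \<in> supp (var_cells n m2)" using \<open>supp (var_cells n m1) = supp (var_cells n m2)\<close> by simp
        then obtain j where j: "j \<in> supp m2" "q \<in> cells (var_column n j)" unfolding supp_var_cells by blast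
        then have "j \<in> pl_vars n" using \<open>supp m2 \<subseteq> pl_vars n\<close> by blast
        then show ?thesis using pbw_le_iff_cells[OF ne] \<open>\<And>j. j \<in> supp m2 \<Longrightarrow> pbw_le (var_column n j) (var_column n i2)\<close>[OF j(1)] j(2) by blast
      qed
      moreover have "i1 \<in> pl_vars n" using \<open>i1 \<in> supp m1\<close> \<open>supp m1 \<subseteq> pl_vars n\<close> by blast
      ultimately show ?thesis using pbw_le_iff_cells[OF ne] by blast
    qed
    have "pbw_le (var_column n i) (var_column n i')" "pbw_le (var_column n i') (var_column n i)"
      using le[of i m m' i'] le[of i' m' m i] i i' less(4) s by auto
    moreover have iv: "i \<in> pl_vars n" "i' \<in> pl_vars n" using i i' s by auto
    ultimately have "var_column n i = var_column n i'" using pbw_le_antisym var_column(1) by blast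
    then have ii: "i' = i" using var_column_inj iv by blast
    define m1 m1' where "m1 = m - monom i 1" and "m1' = m' - monom i 1"
    have m1: "m = m1 + monom i 1" unfolding m1_def
      by (rule poly_mapping_eqI) (use i(1) in \<open>auto simp: lookup_add lookup_minus lookup_single when_def in_keys_iff\<close>)
    have m1': "m' = m1' + monom i 1" unfolding m1'_def
      by (rule poly_mapping_eqI) (use i'(1) ii in \<open>auto simp: lookup_add lookup_minus lookup_single when_def in_keys_iff\<close>)
    have "standard n m1" "standard n m1'" using less(2,3) unfolding m1 m1' standard_def monomial_add_supp by auto
    moreover have "var_cells n m1 = var_cells n m1'" using less(4) unfolding m1 m1' var_cells_add by simp
    moreover have "(\<Sum>x\<in>supp m1. coef m1 x) < (\<Sum>x\<in>supp m. coef m x)"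
    proof -
      have "(\<Sum>x\<in>supp m1. coef m1 x) = (\<Sum>x\<in>supp m. coef m1 x)"
        by (rule sum.mono_neutral_left) (auto simp: m1 monomial_add_supp in_keys_iff)
      also have "\<dots> < (\<Sum>x\<in>supp m. coef m x)"
        by (rule sum_strict_mono_ex1) (use i(1) in \<open>auto simp: m1 lookup_add lookup_single when_def intro!: bexI[of _ i]\<close>)
      finally show ?thesis .
    qed
    ultimately have "m1 = m1'" using less(1) by blast
    then show ?thesis using m1 m1' by simp
  qed
qed

text \<open>The lightest of the leading terms occurs in the product of a single standard monomial,
  by \<open>var_cells_inj\<close>, and so cannot be cancelled.\<close>

theorem standard_independent:
  assumes "\<And>m. m \<in> supp p \<Longrightarrow> standard n m" "psubst pl_minor p = 0"
  shows "p = 0"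
proof (rule ccontr)
  assume "p \<noteq> 0"
  let ?w = "\<lambda>m. mweight (cell_weight n) (var_cells n m)"
  have fin: "finite (supp p)" "supp p \<noteq> {}" using \<open>p \<noteq> 0\<close> by auto
  define m where "m = arg_min_on ?w (supp p)"
  have m: "m \<in> supp p" "\<And>k. k \<in> supp p \<Longrightarrow> ?w m \<le> ?w k"
    unfolding m_def using arg_min_if_finite(1)[OF fin] arg_min_least[OF fin] by auto
  have l: "lead (cell_weight n) (mon_eval pl_minor k) (var_cells n k)" if "k \<in> supp p" for k
    using lead_mon_eval_minor assms(1)[OF that] unfolding standard_def by auto
  have z: "coef (mon_eval pl_minor k) (var_cells n m) = 0" if k: "k \<in> supp p" "k \<noteq> m" for k
  proof (rule ccontr)
    assume "coef (mon_eval pl_minor k) (var_cells n m) \<noteq> 0"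
    then have "var_cells n m \<in> supp (mon_eval pl_minor k)" by (simp add: in_keys_iff)
    then have "?w k \<le> ?w m" "var_cells n m = var_cells n k"
      using lead_le[OF l[OF k(1)]] lead_eq[OF l[OF k(1)]] m(2)[OF k(1)] by (auto simp: antisym)
    then show False using var_cells_inj[of n m k] assms(1) m(1) k by auto
  qed
  have "coef (psubst pl_minor p) (var_cells n m) = (\<Sum>k\<in>supp p. coef p k * coef (mon_eval pl_minor k) (var_cells n m))"
    by (subst psubst_superset[of "supp p" p]) (simp_all add: lookup_sum coef_pconst_mult)
  also have "\<dots> = (\<Sum>k\<in>supp p. if k = m then coef p m * coef (mon_eval pl_minor m) (var_cells n m) else 0)"
    by (rule sum.cong) (auto simp: z)
  also have "\<dots> = coef p m * coef (mon_eval pl_minor m) (var_cells n m)" using m(1) by simp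
  also have "\<dots> \<noteq> 0" using m(1) l[OF m(1)] unfolding lead_def by (simp add: in_keys_iff)
  finally show False using assms(2) by simp
qed

section \<open>Alternating sums of products of minors\<close>

lemma cpoly_eq_minus_self: "(p :: 'v cpoly) = - p \<Longrightarrow> p = 0"
proof (rule poly_mapping_eqI)
  fix k assume "p = - p"
  then have "coef p k = - coef p k" by (metis lookup_uminus)
  then show "coef p k = coef 0 k" by simp
qed

lemma sign_compose_transpose:
  assumes "permutation \<pi>" "i \<noteq> j"
  shows "sign (\<pi> \<circ> Transposition.transpose i j) = - sign \<pi>"
  using assms by (simp add: sign_compose permutation_swap_id sign_swap_id)

lemma prod_lessThan_add: "(\<Prod>c<a + b. g c) = (\<Prod>c<a. g c) * (\<Prod>j<b. g (a + j))" for g :: "nat \<Rightarrow> 'r::comm_monoid_mult"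
  by (induction b) (simp_all add: ac_simps)

lemma pl_minor_permute_list:
  assumes "q permutes {..<length i}"
  shows "pl_minor (permute_list q i) = of_int (sign q) * pl_minor i"
proof -
  let ?k = "length i"
  have "pl_minor (permute_list q i) = (\<Sum>\<sigma> | \<sigma> permutes {..<?k}. of_int (sign \<sigma>) * (\<Prod>c<?k. pvar (Suc (\<sigma> c), i ! q c)))"
    unfolding pl_minor_leibniz by (simp add: permute_list_nth[OF assms] cong: sum.cong)
  also have "\<dots> = (\<Sum>\<sigma> | \<sigma> permutes {..<?k}. of_int (sign (\<sigma> \<circ> q)) * (\<Prod>c<?k. pvar (Suc ((\<sigma> \<circ> q) c), i ! q c)))"
    by (rule sum_permutations_compose_right[OF assms])
  also have "\<dots> = (\<Sum>\<sigma> | \<sigma> permutes {..<?k}. of_int (sign q) * (of_int (sign \<sigma>) * (\<Prod>c<?k. pvar (Suc (\<sigma> c), i ! c))))"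
  proof (rule sum.cong)
    fix \<sigma> assume "\<sigma> \<in> {\<sigma>. \<sigma> permutes {..<?k}}"
    then have "permutation \<sigma>" "permutation q" using assms permutes_imp_permutation by auto
    moreover have "(\<Prod>c<?k. pvar (Suc ((\<sigma> \<circ> q) c), i ! q c)) = (\<Prod>c<?k. pvar (Suc (\<sigma> c), i ! c))"
      using prod.permute[OF assms, of "\<lambda>c. pvar (Suc (\<sigma> c), i ! c)"] by (simp add: comp_def)
    ultimately show "of_int (sign (\<sigma> \<circ> q)) * (\<Prod>c<?k. pvar (Suc ((\<sigma> \<circ> q) c), i ! q c))
        = of_int (sign q) * (of_int (sign \<sigma>) * (\<Prod>c<?k. pvar (Suc (\<sigma> c), i ! c)))"
      by (simp add: sign_compose)
  qed simp
  finally show ?thesis unfolding pl_minor_leibniz by (simp add: sum_distrib_left)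
qed

lemma pl_minor_not_distinct:
  assumes "\<not> distinct i"
  shows "pl_minor i = 0"
proof -
  obtain a b where ab: "a < length i" "b < length i" "a \<noteq> b" "i ! a = i ! b" using assms by (auto simp: distinct_conv_nth)
  have t: "Transposition.transpose a b permutes {..<length i}" using ab by (intro permutes_swap_id) auto
  have "permute_list (Transposition.transpose a b) i = i"
    by (rule nth_equalityI) (use ab permute_list_nth[OF t] in \<open>auto simp: Transposition.transpose_def\<close>)
  then have "pl_minor i = - pl_minor i"
    using pl_minor_permute_list[OF t] ab by (simp add: sign_swap_id)
  then show ?thesis by (rule cpoly_eq_minus_self)
qed

lemma pl_minor_mset:
  assumes "mset i = mset j"
  obtains \<epsilon> :: int where "\<epsilon> \<in> {1, -1}" "pl_minor i = of_int \<epsilon> * pl_minor j"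
proof -
  obtain q where "q permutes {..<length j}" "permute_list q j = i" using mset_eq_permutation[OF assms] by blast
  then have "pl_minor i = of_int (sign q) * pl_minor j" using pl_minor_permute_list by blast
  then show ?thesis using that[of "sign q"] by (auto simp: sign_def)
qed

lemma mult_sum_product: "s * (sum f X * sum g Y) = (\<Sum>x\<in>X. \<Sum>y\<in>Y. s * (f x * g y))" for s :: "'r::comm_semiring_0"
  unfolding sum_product unfolding sum_distrib_left ..

text \<open>\<open>u\<close> and \<open>v\<close> stay in their minors while the entries of
  \<open>L\<close> are permuted; the first \<open>p\<close> positions belong to the first minor, the
  others to the second.\<close>

definition garnir_term :: "nat list \<Rightarrow> nat list \<Rightarrow> nat list \<Rightarrow> nat \<Rightarrow> (nat \<Rightarrow> nat) \<Rightarrow> (nat \<times> nat) cpoly"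
  where "garnir_term u v L p \<pi> = of_int (sign \<pi>) *
    (pl_minor (u @ map (\<lambda>j. L ! \<pi> j) [0..<p]) * pl_minor (map (\<lambda>j. L ! \<pi> j) [p..<length L] @ v))"

text \<open>After expanding both minors, more than \<open>k\<close> positions are assigned to at most \<open>k\<close> rows;
  exchanging two positions in the same row changes only the sign.\<close>

lemma sum_garnir_term:
  assumes "length u + p = k" "p \<le> length L" "length L - p + length v \<le> k" "k < length L"
  shows "(\<Sum>\<pi> | \<pi> permutes {..<length L}. garnir_term u v L p \<pi>) = 0"
proof -
  define N where "N = length L"
  define l where "l = N - p + length v"
  \<comment> \<open>The monomial selected by the row permutations \<open>\<sigma>\<close> and
    \<open>\<tau>\<close> of the two Leibniz sums.\<close>
  define G where "G \<sigma> \<tau> \<pi> = (\<Prod>c<length u. pvar (Suc (\<sigma> c), u ! c)) * (\<Prod>j<p. pvar (Suc (\<sigma> (length u + j)), L ! \<pi> j))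
     * ((\<Prod>j<N - p. pvar (Suc (\<tau> j), L ! \<pi> (p + j))) * (\<Prod>c<length v. pvar (Suc (\<tau> (N - p + c)), v ! c)))" for \<sigma> \<tau> \<pi>
  have pN: "p \<le> N" using assms N_def by simp
  have exp: "garnir_term u v L p \<pi> = (\<Sum>\<sigma> | \<sigma> permutes {..<k}. \<Sum>\<tau> | \<tau> permutes {..<l}. of_int (sign \<sigma>) * of_int (sign \<tau>) * (of_int (sign \<pi>) * G \<sigma> \<tau> \<pi>))" for \<pi>
  proof -
    let ?a = "u @ map (\<lambda>j. L ! \<pi> j) [0..<p]" and ?b = "map (\<lambda>j. L ! \<pi> j) [p..<N] @ v"
    have la: "length ?a = length u + p" and lb: "length ?b = (N - p) + length v" by auto
    have pa: "(\<Prod>c<k. pvar (Suc (\<sigma> c), ?a ! c)) = (\<Prod>c<length u. pvar (Suc (\<sigma> c), u ! c)) * (\<Prod>j<p. pvar (Suc (\<sigma> (length u + j)), L ! \<pi> j))" for \<sigma>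
      unfolding assms(1)[symmetric] prod_lessThan_add by (simp add: nth_append)
    have pb: "(\<Prod>c<l. pvar (Suc (\<tau> c), ?b ! c)) = (\<Prod>j<N - p. pvar (Suc (\<tau> j), L ! \<pi> (p + j))) * (\<Prod>c<length v. pvar (Suc (\<tau> (N - p + c)), v ! c))" for \<tau>
      unfolding l_def prod_lessThan_add by (simp add: nth_append)
    have pma: "pl_minor ?a = (\<Sum>\<sigma> | \<sigma> permutes {..<k}. of_int (sign \<sigma>) * (\<Prod>c<k. pvar (Suc (\<sigma> c), ?a ! c)))"
      unfolding pl_minor_leibniz la assms(1) ..
    have pmb: "pl_minor ?b = (\<Sum>\<tau> | \<tau> permutes {..<l}. of_int (sign \<tau>) * (\<Prod>c<l. pvar (Suc (\<tau> c), ?b ! c)))"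
      unfolding pl_minor_leibniz lb l_def ..
    show ?thesis unfolding garnir_term_def N_def[symmetric] pma pmb pa pb G_def mult_sum_product
      by (intro sum.cong refl) (simp add: mult_ac)
  qed
  have zero: "(\<Sum>\<pi> | \<pi> permutes {..<N}. of_int (sign \<pi>) * G \<sigma> \<tau> \<pi>) = 0"
    if s: "\<sigma> permutes {..<k}" and t: "\<tau> permutes {..<l}" for \<sigma> \<tau>
  proof -
    \<comment> \<open>The row given to each position of \<open>L\<close>, across both
      minors.\<close>
    define \<rho> where "\<rho> j = (if j < p then \<sigma> (length u + j) else \<tau> (j - p))" for j
    have "\<rho> j < k" if "j < N" for j
    proof (cases "j < p")
      case True
      then show ?thesis unfolding \<rho>_def using permutes_in_image[OF s, of "length u + j"] assms(1) by auto
    next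
      case False
      have "j - p < l" unfolding l_def using False that by auto
      then have "\<tau> (j - p) < l" using permutes_in_image[OF t, of "j - p"] by auto
      then show ?thesis unfolding \<rho>_def using False assms(3) l_def N_def by auto
    qed
    then have "\<rho> ` {..<N} \<subseteq> {..<k}" by auto
    then have "card (\<rho> ` {..<N}) \<le> card {..<k}" by (rule card_mono[rotated]) simp
    then have "card (\<rho> ` {..<N}) < card {..<N}" using assms(4) N_def by simp
    then have "\<not> inj_on \<rho> {..<N}" by (metis card_image less_irrefl)
    then obtain i j where ij: "i < N" "j < N" "i \<noteq> j" "\<rho> i = \<rho> j" unfolding inj_on_def by auto
    define K where "K = (\<Prod>c<length u. pvar (Suc (\<sigma> c), u ! c)) * (\<Prod>c<length v. pvar (Suc (\<tau> (N - p + c)), v ! c))"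
    have G: "G \<sigma> \<tau> \<pi> = K * (\<Prod>j<N. pvar (Suc (\<rho> j), L ! \<pi> j))" for \<pi>
    proof -
      have "(\<Prod>j<N. pvar (Suc (\<rho> j), L ! \<pi> j)) = (\<Prod>j<p + (N - p). pvar (Suc (\<rho> j), L ! \<pi> j))" using pN by simp
      also have "\<dots> = (\<Prod>j<p. pvar (Suc (\<sigma> (length u + j)), L ! \<pi> j)) * (\<Prod>j<N - p. pvar (Suc (\<tau> j), L ! \<pi> (p + j)))"
        unfolding prod_lessThan_add \<rho>_def by simp
      finally show ?thesis unfolding G_def K_def by (simp add: mult_ac)
    qed
    let ?t = "Transposition.transpose i j"
    have tp: "?t permutes {..<N}" using ij by (intro permutes_swap_id) auto
    have Gt: "G \<sigma> \<tau> (\<pi> \<circ> ?t) = G \<sigma> \<tau> \<pi>" for \<pi>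
    proof -
      have "(\<Prod>x<N. pvar (Suc (\<rho> x), L ! (\<pi> \<circ> ?t) x)) = (\<Prod>x<N. pvar (Suc (\<rho> (?t x)), L ! \<pi> (?t x)))"
        by (rule prod.cong) (use ij in \<open>auto simp: Transposition.transpose_def\<close>)
      also have "\<dots> = (\<Prod>x<N. pvar (Suc (\<rho> x), L ! \<pi> x))"
        using prod.permute[OF tp, of "\<lambda>x. pvar (Suc (\<rho> x), L ! \<pi> x)"] by (simp add: comp_def)
      finally show ?thesis unfolding G by simp
    qed
    have "(\<Sum>\<pi> | \<pi> permutes {..<N}. of_int (sign \<pi>) * G \<sigma> \<tau> \<pi>)
        = (\<Sum>\<pi> | \<pi> permutes {..<N}. of_int (sign (\<pi> \<circ> ?t)) * G \<sigma> \<tau> (\<pi> \<circ> ?t))"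
      by (rule sum_permutations_compose_right[OF tp])
    also have "\<dots> = (\<Sum>\<pi> | \<pi> permutes {..<N}. - (of_int (sign \<pi>) * G \<sigma> \<tau> \<pi>))"
    proof (rule sum.cong)
      fix \<pi> assume "\<pi> \<in> {\<pi>. \<pi> permutes {..<N}}"
      then have "permutation \<pi>" using permutation_permutes by blast
      from sign_compose_transpose[OF this ij(3)]
      show "of_int (sign (\<pi> \<circ> ?t)) * G \<sigma> \<tau> (\<pi> \<circ> ?t) = - (of_int (sign \<pi>) * G \<sigma> \<tau> \<pi>)" unfolding Gt by simp
    qed simp
    finally show ?thesis by (intro cpoly_eq_minus_self) (simp add: sum_negf)
  qed
  have "(\<Sum>\<pi> | \<pi> permutes {..<N}. garnir_term u v L p \<pi>)
      = (\<Sum>\<sigma> | \<sigma> permutes {..<k}. \<Sum>\<tau> | \<tau> permutes {..<l}. \<Sum>\<pi> | \<pi> permutes {..<N}. of_int (sign \<sigma>) * of_int (sign \<tau>) * (of_int (sign \<pi>) * G \<sigma> \<tau> \<pi>))"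
    unfolding exp by (subst sum.swap, rule sum.cong, simp, rule sum.swap)
  also have "\<dots> = 0"
    using zero by (simp flip: sum_distrib_left)
  finally show ?thesis unfolding N_def .
qed

text \<open>Swapping two positions of the same minor changes the sign of that minor as well as the
  sign of the permutation.\<close>

lemma garnir_term_transpose:
  assumes "permutation \<pi>" "p \<le> length L" "a \<noteq> b" "a < p \<and> b < p \<or> p \<le> a \<and> a < length L \<and> p \<le> b \<and> b < length L"
  shows "garnir_term u v L p (\<pi> \<circ> Transposition.transpose a b) = garnir_term u v L p \<pi>"
proof -
  let ?t = "Transposition.transpose a b"
  let ?A = "\<lambda>\<pi>. u @ map (\<lambda>j. L ! \<pi> j) [0..<p]" and ?B = "\<lambda>\<pi>. map (\<lambda>j. L ! \<pi> j) [p..<length L] @ v"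
  have s: "sign (\<pi> \<circ> ?t) = - sign \<pi>" by (rule sign_compose_transpose[OF assms(1,3)])
  from assms(4) show ?thesis
  proof
    assume ab: "a < p \<and> b < p"
    let ?q = "Transposition.transpose (length u + a) (length u + b)"
    have q: "?q permutes {..<length (?A \<pi>)}" using ab by (intro permutes_swap_id) auto
    have "?A (\<pi> \<circ> ?t) = permute_list ?q (?A \<pi>)"
      by (rule nth_equalityI) (use ab permute_list_nth[OF q] in \<open>auto simp: nth_append Transposition.transpose_def\<close>)
    then have m: "pl_minor (?A (\<pi> \<circ> ?t)) = - pl_minor (?A \<pi>)"
      using pl_minor_permute_list[OF q] assms(3) by (simp add: sign_swap_id)
    have b: "?B (\<pi> \<circ> ?t) = ?B \<pi>" using ab by (auto simp: Transposition.transpose_def)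
    show ?thesis unfolding garnir_term_def s m b by simp
  next
    assume ab: "p \<le> a \<and> a < length L \<and> p \<le> b \<and> b < length L"
    let ?q = "Transposition.transpose (a - p) (b - p)"
    have neq: "a - p \<noteq> b - p" using ab assms(3) by auto
    have q: "?q permutes {..<length (?B \<pi>)}" using ab by (intro permutes_swap_id) auto
    have "?B (\<pi> \<circ> ?t) = permute_list ?q (?B \<pi>)"
    proof (rule nth_equalityI)
      fix c assume "c < length (?B (\<pi> \<circ> ?t))"
      then have c: "c < length (?B \<pi>)" by simp
      have tq: "?t (p + c) = p + ?q c" "?q c < length L - p \<longleftrightarrow> c < length L - p"
        using ab by (auto simp: Transposition.transpose_def)
      have q0: "?q c = c" if "\<not> c < length L - p" using ab that by (auto simp: Transposition.transpose_def)
      show "?B (\<pi> \<circ> ?t) ! c = permute_list ?q (?B \<pi>) ! c"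
        unfolding permute_list_nth[OF q c] using tq(2)
        by (cases "c < length L - p") (simp_all add: nth_append tq(1) q0)
    qed simp
    then have m: "pl_minor (?B (\<pi> \<circ> ?t)) = - pl_minor (?B \<pi>)"
      using pl_minor_permute_list[OF q] neq by (simp add: sign_swap_id)
    have a: "?A (\<pi> \<circ> ?t) = ?A \<pi>" using ab by (auto simp: Transposition.transpose_def)
    show ?thesis unfolding garnir_term_def s m a by simp
  qed
qed

lemma garnir_term_block:
  assumes "permutation \<pi>" "p \<le> length L" "S = {..<p} \<or> S = {p..<length L}" "q permutes S"
  shows "garnir_term u v L p (\<pi> \<circ> q) = garnir_term u v L p \<pi>"
proof -
  have "finite S" using assms(3) by auto
  from this assms(4) show ?thesis
  proof (induction rule: permutes_rev_induct)
    case (swap a b q)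
    have "permutation q" using \<open>finite S\<close> swap.hyps by (intro permutes_imp_permutation) auto
    then have "permutation (\<pi> \<circ> q)" using assms(1) by (rule permutation_compose[rotated])
    then have "garnir_term u v L p ((\<pi> \<circ> q) \<circ> Transposition.transpose a b) = garnir_term u v L p (\<pi> \<circ> q)"
      by (rule garnir_term_transpose) (use swap assms in auto)
    then show ?case using swap.IH unfolding comp_assoc by (rule trans)
  qed simp
qed

text \<open>A permutation preserving the first block is a product of permutations of the two blocks,
  and neither factor changes the term.\<close>

lemma garnir_term_stable:
  assumes "\<pi> permutes {..<length L}" "p \<le> length L" "\<pi> ` {..<p} = {..<p}"
  shows "garnir_term u v L p \<pi> = garnir_term u v L p id"
proof -
  let ?P = "{..<p}" and ?Q = "{p..<length L}"
  have inj: "inj \<pi>" using assms(1) by (rule permutes_inj)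
  have st: "\<pi> x < p \<longleftrightarrow> x < p" for x
  proof
    assume "\<pi> x < p"
    then have "\<pi> x \<in> \<pi> ` {..<p}" using assms(3) by simp
    then show "x < p" using inj by (auto dest: injD)
  qed (use assms(3) in auto)
  define a where "a x = (if x < p then \<pi> x else x)" for x
  define b where "b x = (if x < p then x else \<pi> x)" for x
  have a: "a permutes ?P"
  proof (rule bij_imp_permutes)
    have "a ` ?P = \<pi> ` ?P" by (rule image_cong) (auto simp: a_def)
    moreover have "inj_on a ?P" by (rule inj_onI) (use inj in \<open>auto simp: a_def dest: injD\<close>)
    ultimately show "bij_betw a ?P ?P" using assms(3) unfolding bij_betw_def by simp
  qed (simp add: a_def)
  have b: "b permutes ?Q"
  proof (rule bij_imp_permutes)
    have Q: "?Q = {..<length L} - ?P" by auto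
    have "b ` ?Q = \<pi> ` ?Q" by (rule image_cong) (auto simp: b_def)
    also have "\<dots> = \<pi> ` {..<length L} - \<pi> ` ?P" unfolding Q by (rule image_set_diff[OF inj])
    also have "\<dots> = ?Q" unfolding Q assms(3) permutes_image[OF assms(1)] ..
    finally have "b ` ?Q = ?Q" .
    moreover have "inj_on b ?Q" by (rule inj_onI) (use inj in \<open>auto simp: b_def dest: injD\<close>)
    ultimately show "bij_betw b ?Q ?Q" unfolding bij_betw_def by simp
    show "b x = x" if "x \<notin> ?Q" for x
      using that assms(1) by (auto simp: b_def permutes_not_in)
  qed
  have "\<pi> = id \<circ> a \<circ> b" by (rule ext) (auto simp: a_def b_def st)
  moreover have "permutation a" using a by (rule permutes_imp_permutation[rotated]) simp
  ultimately show ?thesis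
    using garnir_term_block[of "id \<circ> a" p L ?Q b] garnir_term_block[of id p L ?P a] a b assms(2) by simp
qed

section \<open>Straightening two minors\<close>

definition set_minor :: "nat set \<Rightarrow> (nat \<times> nat) cpoly"
  where "set_minor A = pl_minor (sorted_list_of_set A)"

lemma pl_minor_set_minor:
  assumes "distinct i"
  obtains \<epsilon> :: int where "\<epsilon> \<in> {1, -1}" "pl_minor i = of_int \<epsilon> * set_minor (set i)"
proof -
  have "mset i = mset (sorted_list_of_set (set i))"
    using assms by (metis distinct_sorted_list_of_set set_sorted_list_of_set finite_set set_eq_iff_mset_eq_distinct)
  then show ?thesis using pl_minor_mset that unfolding set_minor_def by metis
qed

lemma of_int_sign_span:
  assumes "\<epsilon> \<in> {1, -1 :: int}" "p \<in> cpoly.span S"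
  shows "of_int \<epsilon> * p \<in> cpoly.span S"
  using assms cpoly.span_neg by auto

text \<open>Permute the elements of \<open>A\<close> below x together with those of \<open>B\<close>
  from x on; by the hypothesis on counts there are more of them than \<open>card A\<close>, so the
  alternating sum vanishes. Permutations preserving the blocks reproduce the given product; every
  other one either gives zero or brings entries at least x into \<open>A\<close> in place of entries
  below x.\<close>

lemma garnir_step:
  fixes x :: nat
  assumes A: "A \<subseteq> {1..n}" and B: "B \<subseteq> {1..n}" and card: "card B \<le> card A" and x: "count_ge A x < count_ge B x"
  shows "set_minor A * set_minor B \<in> cpoly.span {set_minor A' * set_minor B' | A' B'. A' \<subseteq> {1..n} \<and> B' \<subseteq> {1..n} \<and>
    card A' = card A \<and> card B' = card B \<and> \<Sum>A < \<Sum>A'}" (is "_ \<in> cpoly.span ?S")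
proof -
  have fin: "finite A" "finite B" using A B finite_subset by blast+
  define A1 A2 B1 B2 where "A1 = {y \<in> A. y < x}" and "A2 = {y \<in> A. x \<le> y}" and "B1 = {y \<in> B. x \<le> y}" and "B2 = {y \<in> B. y < x}"
  note defs = A1_def A2_def B1_def B2_def
  have f: "finite A1" "finite A2" "finite B1" "finite B2" using fin unfolding defs by auto
  have AU: "A = A1 \<union> A2" "A1 \<inter> A2 = {}" and BU: "B = B1 \<union> B2" "B1 \<inter> B2 = {}" unfolding defs by auto
  define u v L p where "u = sorted_list_of_set A2" and "v = sorted_list_of_set B2"
    and "L = sorted_list_of_set A1 @ sorted_list_of_set B1" and "p = card A1"
  have cA: "card A = card A2 + p" and cB: "card B = card B1 + card B2"
    unfolding p_def using AU BU f by (metis card_Un_disjoint add.commute)+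
  have len: "length u = card A2" "length v = card B2" "length L = p + card B1" unfolding u_def v_def L_def p_def by auto
  have gt: "card A2 < card B1" using x unfolding count_ge_def defs .
  have Ll: "L ! j \<in> A1" if "j < p" for j using that nth_mem[of j "sorted_list_of_set A1"] f unfolding L_def p_def by (auto simp: nth_append)
  have Lr: "L ! j \<in> B1" if "p \<le> j" "j < length L" for j
    using that nth_mem[of "j - p" "sorted_list_of_set B1"] f len unfolding L_def p_def by (auto simp: nth_append)
  let ?P = "{\<pi>. \<pi> permutes {..<length L}}"
  let ?H = "{\<pi> \<in> ?P. \<pi> ` {..<p} = {..<p}}"
  let ?f = "garnir_term u v L p"
  have finP: "finite ?P" by (rule finite_permutations) simp
  have "(\<Sum>\<pi>\<in>?P. ?f \<pi>) = 0"
    by (rule sum_garnir_term[of u p "card A"]) (use len cA cB card gt in auto)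
  moreover have "(\<Sum>\<pi>\<in>?P. ?f \<pi>) = (\<Sum>\<pi>\<in>?P - ?H. ?f \<pi>) + (\<Sum>\<pi>\<in>?H. ?f \<pi>)"
    by (rule sum.subset_diff[OF _ finP]) blast
  moreover have "(\<Sum>\<pi>\<in>?H. ?f \<pi>) = (\<Sum>\<pi>\<in>?H. ?f id)"
  proof (rule sum.cong)
    fix \<pi> assume "\<pi> \<in> ?H"
    then have "\<pi> permutes {..<length L}" "\<pi> ` {..<p} = {..<p}" by blast+
    then show "?f \<pi> = ?f id" by (intro garnir_term_stable) (simp_all add: len)
  qed simp
  moreover have "(\<Sum>\<pi>\<in>?H. ?f id) = of_nat (card ?H) * ?f id" by simp
  ultimately have e1: "of_nat (card ?H) * ?f id = - (\<Sum>\<pi>\<in>?P - ?H. ?f \<pi>)" by (simp add: eq_neg_iff_add_eq_0 add.commute)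
  have cH: "card ?H \<noteq> 0"
  proof -
    have "id \<in> ?H" using permutes_id by auto
    then show ?thesis using finP by (metis (no_types, lifting) card_0_eq empty_iff finite_Collect_conjI finite_subset mem_Collect_eq subsetI)
  qed
  have other: "?f \<pi> \<in> cpoly.span ?S" if pi: "\<pi> \<in> ?P - ?H" for \<pi>
  proof -
    let ?a = "u @ map (\<lambda>j. L ! \<pi> j) [0..<p]" and ?b = "map (\<lambda>j. L ! \<pi> j) [p..<length L] @ v"
    have perm: "\<pi> permutes {..<length L}" and np: "\<pi> ` {..<p} \<noteq> {..<p}" using pi by auto
    show ?thesis
    proof (cases "distinct ?a \<and> distinct ?b")
      case False
      then have "pl_minor ?a = 0 \<or> pl_minor ?b = 0" using pl_minor_not_distinct by blast
      then have "?f \<pi> = 0" unfolding garnir_term_def by (elim disjE) simp_all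
      then show ?thesis by (simp add: cpoly.span_zero)
    next
      case True
      obtain e1 where e1: "e1 \<in> {1, -1}" "pl_minor ?a = of_int e1 * set_minor (set ?a)" using True pl_minor_set_minor by blast
      obtain e2 where e2: "e2 \<in> {1, -1}" "pl_minor ?b = of_int e2 * set_minor (set ?b)" using True pl_minor_set_minor by blast
      have im: "\<pi> j < length L" if "j < length L" for j using permutes_in_image[OF perm, of j] that by auto
      have LU: "L ! j \<in> A \<union> B" if "j < length L" for j using Ll[of j] Lr[of j] that AU BU by (cases "j < p") auto
      have uv: "set u = A2" "set v = B2" unfolding u_def v_def using f by auto
      have Ln: "L ! \<pi> j \<in> {1..n}" if "j < length L" for j using LU[OF im[OF that]] A B by blast
      have "set ?a = A2 \<union> (\<lambda>j. L ! \<pi> j) ` {0..<p}" "set ?b = B2 \<union> (\<lambda>j. L ! \<pi> j) ` {p..<length L}"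
        using uv by auto
      moreover have "A2 \<subseteq> {1..n}" "B2 \<subseteq> {1..n}" using A B AU BU by auto
      moreover have "(\<lambda>j. L ! \<pi> j) ` {0..<p} \<subseteq> {1..n}" "(\<lambda>j. L ! \<pi> j) ` {p..<length L} \<subseteq> {1..n}"
        using Ln len(3) by (auto simp del: atLeastAtMost_iff)
      ultimately have sub: "set ?a \<subseteq> {1..n}" "set ?b \<subseteq> {1..n}" by simp_all
      have ca: "card (set ?a) = card A" "card (set ?b) = card B"
        using True distinct_card[of ?a] distinct_card[of ?b] len cA cB by auto
      have "\<Sum>A < \<Sum>(set ?a)"
      proof -
        let ?T = "\<pi> ` {..<p}"
        let ?Pp = "{..<p}"
        have cT: "card ?T = p" using permutes_inj_on[OF perm, of "{..<p}"] by (simp add: card_image)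
        have T: "?T \<subseteq> {..<length L}" using im len by auto
        have dn: "?T - ?Pp \<noteq> {}"
        proof
          assume "?T - ?Pp = {}"
          then have "?T \<subseteq> ?Pp" by auto
          then have "?T = ?Pp" using cT by (intro card_subset_eq) auto
          then show False using np by simp
        qed
        have c2: "card (?T - ?Pp) = card (?Pp - ?T)"
        proof -
          have "card ?T = card (?T \<inter> ?Pp) + card (?T - ?Pp)" by (rule card_Int_Diff) simp
          moreover have "card ?Pp = card (?Pp \<inter> ?T) + card (?Pp - ?T)" by (rule card_Int_Diff) simp
          ultimately show ?thesis using cT by (simp add: Int_commute)
        qed
        \<comment> \<open>Positions leaving the first minor carry entries below x; the equally many
          positions entering it carry entries at least x.\<close>
        have "(\<Sum>j\<in>?Pp - ?T. L ! j) < (\<Sum>j\<in>?T - ?Pp. L ! j)"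
        proof -
          have ne: "?Pp - ?T \<noteq> {}" using dn c2 by (metis card_0_eq finite_Diff finite_imageI finite_lessThan)
          have "(\<Sum>j\<in>?Pp - ?T. L ! j) < (\<Sum>j\<in>?Pp - ?T. x)"
            by (rule sum_strict_mono) (use ne Ll in \<open>auto simp: A1_def\<close>)
          also have "\<dots> = (\<Sum>j\<in>?T - ?Pp. x)" using c2 by simp
          also have "\<dots> \<le> (\<Sum>j\<in>?T - ?Pp. L ! j)"
          proof (rule sum_mono)
            fix j assume "j \<in> ?T - ?Pp"
            then show "x \<le> L ! j" using Lr[of j] T unfolding B1_def by auto
          qed
          finally show ?thesis .
        qed
        then have lt: "(\<Sum>j\<in>?Pp. L ! j) < (\<Sum>j\<in>?T. L ! j)"
          using sum.Int_Diff[of ?Pp "\<lambda>j. L ! j" ?T] sum.Int_Diff[of ?T "\<lambda>j. L ! j" ?Pp] by (simp add: Int_commute)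
        have "\<Sum>A = \<Sum>A1 + \<Sum>A2" using AU f by (simp add: sum.union_disjoint)
        also have "\<Sum>A1 = (\<Sum>j\<in>?Pp. L ! j)"
        proof -
          have "\<Sum>A1 = sum_list (sorted_list_of_set A1)" using sum_list_distinct_conv_sum_set[of "sorted_list_of_set A1" "\<lambda>y. y"] f by simp
          also have "\<dots> = (\<Sum>j = 0..<p. sorted_list_of_set A1 ! j)" by (simp add: sum_list_sum_nth p_def)
          also have "\<dots> = (\<Sum>j\<in>?Pp. L ! j)" unfolding L_def p_def by (simp add: nth_append atLeast0LessThan)
          finally show ?thesis .
        qed
        also have "\<dots> + \<Sum>A2 < (\<Sum>j\<in>?T. L ! j) + \<Sum>A2" using lt by simp
        also have "(\<Sum>j\<in>?T. L ! j) = sum_list (map (\<lambda>j. L ! \<pi> j) [0..<p])"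
          using permutes_inj_on[OF perm, of "{..<p}"] by (simp add: sum.reindex interv_sum_list_conv_sum_set_nat atLeast0LessThan)
        also have "\<dots> + \<Sum>A2 = sum_list ?a"
          using sum_list_distinct_conv_sum_set[of u "\<lambda>y. y"] f by (simp add: u_def)
        also have "\<dots> = \<Sum>(set ?a)" using True sum_list_distinct_conv_sum_set[of ?a "\<lambda>y. y"] by simp
        finally show ?thesis .
      qed
      then have "set_minor (set ?a) * set_minor (set ?b) \<in> ?S" using sub ca by blast
      then have m: "set_minor (set ?a) * set_minor (set ?b) \<in> cpoly.span ?S" by (rule cpoly.span_base)
      have feq: "?f \<pi> = of_int (sign \<pi>) * (of_int e1 * (of_int e2 * (set_minor (set ?a) * set_minor (set ?b))))"
        unfolding garnir_term_def e1(2) e2(2) by (simp add: mult_ac)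
      have "sign \<pi> \<in> {1, -1}" by (simp add: sign_def)
      then show ?thesis unfolding feq by (intro of_int_sign_span e1(1) e2(1) m)
    qed
  qed
  have e2: "of_nat (card ?H) * ?f id \<in> cpoly.span ?S"
    unfolding e1 using other by (intro cpoly.span_neg cpoly.span_sum) auto
  have nat: "(of_nat m :: (nat \<times> nat) cpoly) = pconst (of_nat m)" for m
    by (simp add: pconst_def flip: single_of_nat)
  \<comment> \<open>Characteristic zero enters here: the number of block-preserving permutations is
    inverted.\<close>
  have feq: "?f id = pconst (1 / of_nat (card ?H)) * (of_nat (card ?H) * ?f id)"
    using cH unfolding nat by (simp flip: mult.assoc pconst_simps)
  have e3: "?f id \<in> cpoly.span ?S" by (subst feq) (rule cpoly.span_scale[OF e2])
  have ma: "map (\<lambda>j. L ! j) [0..<p] = sorted_list_of_set A1" "map (\<lambda>j. L ! j) [p..<length L] = sorted_list_of_set B1"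
    by (rule nth_equalityI; auto simp: L_def p_def nth_append)+
  have dist: "distinct (u @ sorted_list_of_set A1)" "distinct (sorted_list_of_set B1 @ v)"
    using f unfolding u_def v_def by (auto simp: defs)
  have sets: "set (u @ sorted_list_of_set A1) = A" "set (sorted_list_of_set B1 @ v) = B"
    using f AU BU unfolding u_def v_def by auto
  obtain e4 where e4: "e4 \<in> {1, -1}" "pl_minor (u @ sorted_list_of_set A1) = of_int e4 * set_minor A"
    using pl_minor_set_minor[OF dist(1)] sets by metis
  obtain e5 where e5: "e5 \<in> {1, -1}" "pl_minor (sorted_list_of_set B1 @ v) = of_int e5 * set_minor B"
    using pl_minor_set_minor[OF dist(2)] sets by metis
  have "?f id = of_int e4 * (of_int e5 * (set_minor A * set_minor B))"
    unfolding garnir_term_def by (simp add: ma e4(2) e5(2) mult_ac)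
  then have feq: "set_minor A * set_minor B = of_int e4 * (of_int e5 * ?f id)"
    using e4(1) e5(1) by auto
  show ?thesis unfolding feq by (intro of_int_sign_span e4(1) e5(1) e3)
qed

definition ss_pairs :: "nat \<Rightarrow> nat \<Rightarrow> nat \<Rightarrow> (nat set \<times> nat set) set"
  where "ss_pairs n k l = {(A, B). A \<subseteq> {1..n} \<and> B \<subseteq> {1..n} \<and> card A = k \<and> card B = l \<and> (\<forall>x. count_ge B x \<le> count_ge A x)}"

lemma finite_ss_pairs: "finite (ss_pairs n k l)"
  by (rule finite_subset[of _ "Pow {1..n} \<times> Pow {1..n}"]) (auto simp: ss_pairs_def)

text \<open>Each exchange raises the sum of \<open>A\<close>, which is bounded by
  \<open>k * n\<close> because \<open>A\<close> has k elements of size at most n.\<close>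

lemma ss_pairs_span:
  assumes "A \<subseteq> {1..n}" "B \<subseteq> {1..n}" "card A = k" "card B = l" "l \<le> k"
  shows "set_minor A * set_minor B \<in> cpoly.span ((\<lambda>(A, B). set_minor A * set_minor B) ` ss_pairs n k l)"
  using assms(1-4)
proof (induction "k * n - \<Sum>A" arbitrary: A B rule: less_induct)
  case less
  let ?Z = "cpoly.span ((\<lambda>(A, B). set_minor A * set_minor B) ` ss_pairs n k l)"
  show ?case
  proof (cases "\<forall>x. count_ge B x \<le> count_ge A x")
    case True
    then have "(A, B) \<in> ss_pairs n k l" using less unfolding ss_pairs_def by auto
    then show ?thesis by (intro cpoly.span_base) force
  next
    case False
    then obtain x where x: "count_ge A x < count_ge B x" by (auto simp: not_le)
    let ?S = "{set_minor A' * set_minor B' | A' B'. A' \<subseteq> {1..n} \<and> B' \<subseteq> {1..n} \<and>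
      card A' = card A \<and> card B' = card B \<and> \<Sum>A < \<Sum>A'}"
    have "?S \<subseteq> ?Z"
    proof
      fix q assume "q \<in> ?S"
      then obtain A' B' where q: "q = set_minor A' * set_minor B'" "A' \<subseteq> {1..n}" "B' \<subseteq> {1..n}"
        "card A' = k" "card B' = l" "\<Sum>A < \<Sum>A'" using less by blast
      have "\<Sum>A' \<le> of_nat (card A') * n" by (rule sum_bounded_above) (use q in auto)
      then have "k * n - \<Sum>A' < k * n - \<Sum>A" using q by auto
      then show "q \<in> ?Z" using less(1) q by blast
    qed
    then have "cpoly.span ?S \<subseteq> ?Z" by (rule cpoly.span_minimal) (rule cpoly.subspace_span)
    moreover have "set_minor A * set_minor B \<in> cpoly.span ?S"
      by (rule garnir_step[OF less(2,3) _ x]) (use less assms(5) in simp)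
    ultimately show ?thesis by blast
  qed
qed

section \<open>Straightening relations\<close>

definition chain_pairs :: "nat \<Rightarrow> (nat list \<times> nat list) set"
  where "chain_pairs n = {(g, h). g \<in> pbw_columns n \<and> h \<in> pbw_columns n \<and> pbw_le g h}"

definition pair_minor :: "nat list \<times> nat list \<Rightarrow> (nat \<times> nat) cpoly"
  where "pair_minor q = pl_minor (sort (fst q)) * pl_minor (sort (snd q))"

definition pair_mon :: "nat list \<times> nat list \<Rightarrow> nat list \<Rightarrow>\<^sub>0 nat"
  where "pair_mon q = monom (sort (fst q)) 1 + monom (sort (snd q)) 1"

definition pair_cells :: "nat list \<times> nat list \<Rightarrow> (nat \<times> nat) \<Rightarrow>\<^sub>0 nat"
  where "pair_cells q = cell_mon (fst q) + cell_mon (snd q)"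

definition pair_weight :: "nat \<Rightarrow> nat list \<times> nat list \<Rightarrow> int"
  where "pair_weight n q = list_weight n (fst q) + list_weight n (snd q)"

lemma finite_chain_pairs: "finite (chain_pairs n)"
  by (rule finite_subset[of _ "pbw_columns n \<times> pbw_columns n"]) (auto simp: chain_pairs_def finite_pbw_columns)

lemma chain_pairsD:
  assumes "q \<in> chain_pairs n"
  shows "fst q \<in> pbw_columns n" "snd q \<in> pbw_columns n" "pbw_le (fst q) (snd q)"
  using assms unfolding chain_pairs_def by auto

lemma supp_pair_mon: "supp (pair_mon q) = {sort (fst q), sort (snd q)}"
  by (auto simp: pair_mon_def monomial_add_supp)

lemma pair_mon_standard:
  assumes "q \<in> chain_pairs n"
  shows "standard n (pair_mon q)"
  using chain_pairsD[OF assms] pbw_le_refl unfolding standard_def supp_pair_mon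
  by (auto simp: sort_column_pl_vars var_column_sort)

lemma pair_mon_eq:
  assumes "fst q \<in> pbw_columns n" "snd q \<in> pbw_columns n" "fst q' \<in> pbw_columns n" "snd q' \<in> pbw_columns n"
    and "pair_mon q = pair_mon q'"
  shows "q' = q \<or> q' = (snd q, fst q)"
proof -
  have "{sort (fst q), sort (snd q)} = {sort (fst q'), sort (snd q')}"
    using assms(5) supp_pair_mon by metis
  then have "sort (fst q) = sort (fst q') \<and> sort (snd q) = sort (snd q') \<or> sort (fst q) = sort (snd q') \<and> sort (snd q) = sort (fst q')"
    by (auto simp: doubleton_eq_iff)
  then have "fst q = fst q' \<and> snd q = snd q' \<or> fst q = snd q' \<and> snd q = fst q'"
    using sort_column_inj assms by metis
  then show ?thesis by (metis prod.collapse)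
qed

lemma pair_mon_inj:
  assumes "q \<in> chain_pairs n" "q' \<in> chain_pairs n" "pair_mon q = pair_mon q'"
  shows "q = q'"
proof -
  note c = chain_pairsD[OF assms(1)] chain_pairsD[OF assms(2)]
  from pair_mon_eq[OF c(1,2,4,5) assms(3)] show ?thesis
  proof
    assume e: "q' = (snd q, fst q)"
    then have "fst q = snd q" using c pbw_le_antisym by auto
    then show ?thesis using e by (metis prod.collapse)
  qed simp
qed

lemma var_cells_pair_mon:
  assumes "fst q \<in> pbw_columns n" "snd q \<in> pbw_columns n"
  shows "var_cells n (pair_mon q) = pair_cells q"
  using assms unfolding pair_mon_def pair_cells_def var_cells_add by (simp add: var_column_sort)

lemma pair_cells_inj:
  assumes "q \<in> chain_pairs n" "q' \<in> chain_pairs n" "pair_cells q = pair_cells q'"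
  shows "q = q'"
  using var_cells_inj[OF pair_mon_standard[OF assms(1)] pair_mon_standard[OF assms(2)]]
    var_cells_pair_mon chain_pairsD assms pair_mon_inj by metis

lemma mon_eval_pair_mon: "mon_eval pl_minor (pair_mon q) = pair_minor q"
  unfolding pair_mon_def pair_minor_def mon_eval_add by simp

lemma chain_pairs_independent:
  assumes "(\<Sum>q\<in>chain_pairs n. pconst (c q) * pair_minor q) = 0" "q \<in> chain_pairs n"
  shows "c q = 0"
proof -
  define p where "p = (\<Sum>q\<in>chain_pairs n. monom (pair_mon q) (c q))"
  have co: "coef p (pair_mon q') = c q'" if "q' \<in> chain_pairs n" for q'
  proof -
    have "coef p (pair_mon q') = (\<Sum>x\<in>chain_pairs n. if x = q' then c x else 0)"
      unfolding p_def lookup_sum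
      by (rule sum.cong) (use pair_mon_inj that in \<open>auto simp: lookup_single when_def\<close>)
    then show ?thesis using that finite_chain_pairs by simp
  qed
  have "supp p \<subseteq> pair_mon ` chain_pairs n"
    unfolding p_def using keys_sum[of "\<lambda>q. monom (pair_mon q) (c q)" "chain_pairs n"] by (auto split: if_splits)
  then have "p = 0"
    using assms(1) pair_mon_standard
    by (intro standard_independent[of p n]) (auto simp: p_def psubst_sum psubst_monom mon_eval_pair_mon)
  then show ?thesis using co[OF assms(2)] by simp
qed

lemma set_minor_column:
  assumes "a \<in> pbw_columns n"
  shows "set_minor (set a) = pl_minor (sort a)"
  unfolding set_minor_def using pbw_columns_distinct[OF assms]
  by (simp add: sorted_list_of_set_sort_remdups distinct_remdups_id)

text \<open>A dimension count. The products over \<open>T\<close> are independent and lie in the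
  span of the semistandard products, of which there are at most \<open>card T\<close> because
  \<open>subset_column\<close> embeds the semistandard pairs into \<open>T\<close>. A further vector
  outside the span of \<open>T\<close> would give one independent vector too many.\<close>

lemma chain_pairs_span:
  assumes a: "a \<in> pbw_columns n" and b: "b \<in> pbw_columns n" and len: "length b \<le> length a"
  defines "T \<equiv> {q \<in> chain_pairs n. length (snd q) = length a \<and> length (fst q) = length b}"
  shows "pair_minor (a, b) \<in> cpoly.span (pair_minor ` T)"
proof -
  let ?k = "length a" and ?l = "length b"
  let ?D = "\<lambda>(A, B). set_minor A * set_minor B"
  let ?SS = "ss_pairs n ?k ?l"
  have kl: "1 \<le> ?k" "?k \<le> n - 1" "1 \<le> ?l" "?l \<le> n - 1" using pbw_columnsD(1,2)[OF a] pbw_columnsD(1,2)[OF b] by auto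
  have finT: "finite T" unfolding T_def using finite_chain_pairs by auto
  have indep_T: "c q = 0" if "(\<Sum>q\<in>T. pconst (c q) * pair_minor q) = 0" "q \<in> T" for c q
  proof -
    have "(\<Sum>q\<in>chain_pairs n. pconst (if q \<in> T then c q else 0) * pair_minor q) = (\<Sum>q\<in>T. pconst (c q) * pair_minor q)"
      by (rule sum.mono_neutral_cong_right) (auto simp: T_def finite_chain_pairs pconst_simps)
    then have "(if q \<in> T then c q else 0) = 0"
      using chain_pairs_independent[of "\<lambda>q. if q \<in> T then c q else 0" n q] that T_def by simp
    then show ?thesis using that by simp
  qed
  have inj: "inj_on pair_minor T"
  proof (rule inj_onI, rule ccontr)
    fix x y assume xy: "x \<in> T" "y \<in> T" "pair_minor x = pair_minor y" "x \<noteq> y"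
    let ?c = "\<lambda>q. if q = x then 1 else if q = y then - 1 else (0 :: complex)"
    have "(\<Sum>q\<in>T. pconst (?c q) * pair_minor q) = (\<Sum>q\<in>{x, y}. pconst (?c q) * pair_minor q)"
      by (rule sum.mono_neutral_right) (use xy finT in \<open>auto simp: pconst_simps\<close>)
    also have "\<dots> = 0" using xy by (simp add: pconst_simps)
    finally show False using indep_T[of ?c x] xy(1) by simp
  qed
  have indep: "cpoly.independent (pair_minor ` T)"
  proof (rule cpoly.independent_if_scalars_zero)
    fix f x assume f: "(\<Sum>x\<in>pair_minor ` T. pconst (f x) * x) = 0" "x \<in> pair_minor ` T"
    then have "(\<Sum>q\<in>T. pconst (f (pair_minor q)) * pair_minor q) = 0" using inj by (simp add: sum.reindex)
    then show "f x = 0" using indep_T[of "\<lambda>q. f (pair_minor q)"] f(2) by auto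
  qed (use finT in simp)
  have "card ?SS \<le> card T"
  proof (rule card_inj_on_le)
    \<comment> \<open>Chain pairs list the smaller column first, semistandard pairs the larger set;
      hence the swap.\<close>
    let ?\<phi> = "\<lambda>(A, B). (subset_column n B, subset_column n A)"
    show "inj_on ?\<phi> ?SS"
    proof (rule inj_onI)
      fix x y assume "x \<in> ?SS" "y \<in> ?SS" and e: "?\<phi> x = ?\<phi> y"
      then obtain A B A' B' where xy: "x = (A, B)" "y = (A', B')"
        and s: "A \<subseteq> {1..n}" "B \<subseteq> {1..n}" "A' \<subseteq> {1..n}" "B' \<subseteq> {1..n}"
        and cd: "card A = ?k" "card A' = ?k" "card B = ?l" "card B' = ?l"
        unfolding ss_pairs_def by blast
      have "A = A'" by (rule subset_column_inj[of A n A']) (use s cd kl e xy in simp_all)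
      moreover have "B = B'" by (rule subset_column_inj[of B n B']) (use s cd kl e xy in simp_all)
      ultimately show "x = y" using xy by simp
    qed
    show "?\<phi> ` ?SS \<subseteq> T"
      using subset_column subset_column_le kl unfolding T_def chain_pairs_def by (auto simp: ss_pairs_def)
  qed (rule finT)
  have fin: "finite (?D ` ?SS)" using finite_ss_pairs by simp
  have set_len: "card (set x) = length x" if "x \<in> pbw_columns n" for x
    using distinct_card[OF pbw_columns_distinct[OF that]] .
  have PM: "pair_minor q \<in> cpoly.span (?D ` ?SS)"
    if "fst q \<in> pbw_columns n" "snd q \<in> pbw_columns n" "length (fst q) = ?k" "length (snd q) = ?l" for q
    using ss_pairs_span[of "set (fst q)" n "set (snd q)" ?k ?l] that len set_len pbw_columns_set
    unfolding pair_minor_def by (simp add: set_minor_column)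
  have T_span: "pair_minor ` T \<subseteq> cpoly.span (?D ` ?SS)"
  proof
    fix y assume "y \<in> pair_minor ` T"
    then obtain q where q: "q \<in> T" "y = pair_minor q" by auto
    then have "pair_minor (snd q, fst q) \<in> cpoly.span (?D ` ?SS)"
      by (intro PM) (use chain_pairsD in \<open>auto simp: T_def\<close>)
    then show "y \<in> cpoly.span (?D ` ?SS)" using q by (simp add: pair_minor_def mult.commute)
  qed
  have ab: "pair_minor (a, b) \<in> cpoly.span (?D ` ?SS)" using PM[of "(a, b)"] a b by simp
  show ?thesis
  proof (rule ccontr)
    assume n: "pair_minor (a, b) \<notin> cpoly.span (pair_minor ` T)"
    then have "pair_minor (a, b) \<notin> pair_minor ` T" by (rule contrapos_nn) (rule cpoly.span_base)
    then have "card (insert (pair_minor (a, b)) (pair_minor ` T)) = Suc (card T)"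
      using finT inj by (simp add: card_image)
    moreover have "cpoly.independent (insert (pair_minor (a, b)) (pair_minor ` T))"
      using cpoly.independent_insertI[OF n indep] .
    then have "card (insert (pair_minor (a, b)) (pair_minor ` T)) \<le> card (?D ` ?SS)"
      using cpoly.independent_span_bound[OF fin] T_span ab by blast
    moreover have "card (?D ` ?SS) \<le> card ?SS" by (rule card_image_le[OF finite_ss_pairs])
    ultimately show False using \<open>card ?SS \<le> card T\<close> by simp
  qed
qed

text \<open>The degree in the variables of column v of the matrix. Every minor is homogeneous for
  these degrees, which is what keeps the content fixed in a relation.\<close>

definition entry_count :: "nat \<Rightarrow> ((nat \<times> nat) \<Rightarrow>\<^sub>0 nat) \<Rightarrow> int"
  where "entry_count v = mweight (\<lambda>q. if snd q = v then 1 else 0)"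

lemma entry_count_cell_mon: "entry_count v (cell_mon \<alpha>) = int (count (mset \<alpha>) v)"
proof -
  have "entry_count v (cell_mon \<alpha>) = (\<Sum>r<length \<alpha>. if \<alpha> ! r = v then 1 else 0)"
    unfolding entry_count_def cell_mon_def mweight_sum by simp
  also have "\<dots> = int (card ({..<length \<alpha>} \<inter> {r. \<alpha> ! r = v}))"
    by (simp add: sum.If_cases)
  also have "{..<length \<alpha>} \<inter> {r. \<alpha> ! r = v} = {r. r < length \<alpha> \<and> \<alpha> ! r = v}" by auto
  also have "card {r. r < length \<alpha> \<and> \<alpha> ! r = v} = count (mset \<alpha>) v"
    by (simp add: count_mset count_list_eq_length_filter length_filter_conv_card eq_commute)
  finally show ?thesis .
qed

lemma entry_count_pair_minor:
  assumes "m \<in> supp (pair_minor q)"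
  shows "entry_count v m = int (count (mset (fst q) + mset (snd q)) v)"
proof -
  obtain m1 m2 where m: "m = m1 + m2" "m1 \<in> supp (pl_minor (sort (fst q)))" "m2 \<in> supp (pl_minor (sort (snd q)))"
    using assms keys_mult[of "pl_minor (sort (fst q))" "pl_minor (sort (snd q))"] unfolding pair_minor_def by blast
  obtain \<tau>1 \<tau>2 where t: "mset \<tau>1 = mset (fst q)" "m1 = cell_mon \<tau>1" "mset \<tau>2 = mset (snd q)" "m2 = cell_mon \<tau>2"
    using supp_pl_minor[OF m(2)] supp_pl_minor[OF m(3)] by auto
  have "entry_count v m = entry_count v m1 + entry_count v m2" unfolding m(1) entry_count_def mweight_add ..
  then show ?thesis unfolding t(2,4) entry_count_cell_mon t(1,3) by simp
qed

definition same_content :: "nat list \<times> nat list \<Rightarrow> nat list \<times> nat list \<Rightarrow> bool"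
  where "same_content q q' \<longleftrightarrow> mset (fst q) + mset (snd q) = mset (fst q') + mset (snd q')"

lemma same_content_if_common_supp:
  assumes "m \<in> supp (pair_minor q)" "m \<in> supp (pair_minor q')"
  shows "same_content q q'"
  unfolding same_content_def
proof (rule multiset_eqI)
  fix v show "count (mset (fst q) + mset (snd q)) v = count (mset (fst q') + mset (snd q')) v"
    using entry_count_pair_minor[OF assms(1), of v] entry_count_pair_minor[OF assms(2), of v] by linarith
qed

text \<open>Terms of the wrong content involve only monomials that occur nowhere else in the
  relation, so their sum vanishes and they may be dropped.\<close>

lemma pair_minor_straightening:
  assumes a: "a \<in> pbw_columns n" and b: "b \<in> pbw_columns n"
  obtains c where "pair_minor (a, b) = (\<Sum>q\<in>chain_pairs n. pconst (c q) * pair_minor q)"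
    "\<And>q. c q \<noteq> 0 \<Longrightarrow> q \<in> chain_pairs n \<and> same_content q (a, b) \<and>
      length (snd q) = max (length a) (length b) \<and> length (fst q) = min (length a) (length b)"
proof -
  have main: "\<exists>c. pair_minor (a, b) = (\<Sum>q\<in>chain_pairs n. pconst (c q) * pair_minor q) \<and>
    (\<forall>q. c q \<noteq> 0 \<longrightarrow> q \<in> chain_pairs n \<and> same_content q (a, b) \<and> length (snd q) = length a \<and> length (fst q) = length b)"
    if a: "a \<in> pbw_columns n" and b: "b \<in> pbw_columns n" and len: "length b \<le> length a" for a b
  proof -
    let ?T = "{q \<in> chain_pairs n. length (snd q) = length a \<and> length (fst q) = length b}"
    have "pair_minor (a, b) \<in> cpoly.span (pair_minor ` ?T)" by (rule chain_pairs_span[OF a b len])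
    also have "\<dots> = range (\<lambda>u. \<Sum>q\<in>?T. pconst (u q) * pair_minor q)"
    proof -
      have fin: "finite ?T" using finite_chain_pairs by auto
      show ?thesis
      proof
        show "cpoly.span (pair_minor ` ?T) \<subseteq> range (\<lambda>u. \<Sum>q\<in>?T. pconst (u q) * pair_minor q)"
        proof (rule cpoly.span_minimal)
          show "pair_minor ` ?T \<subseteq> range (\<lambda>u. \<Sum>q\<in>?T. pconst (u q) * pair_minor q)"
          proof
            fix y assume "y \<in> pair_minor ` ?T"
            then obtain x where x: "x \<in> ?T" "y = pair_minor x" by auto
            have "(\<Sum>q\<in>?T. pconst (if q = x then 1 else 0) * pair_minor q) = (\<Sum>q\<in>?T. if q = x then pair_minor q else 0)"
              by (rule sum.cong) (auto simp: pconst_simps)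
            also have "\<dots> = y" using x fin by simp
            finally have "y = (\<Sum>q\<in>?T. pconst (if q = x then 1 else 0) * pair_minor q)" ..
            then show "y \<in> range (\<lambda>u. \<Sum>q\<in>?T. pconst (u q) * pair_minor q)"
              by (rule range_eqI[of _ _ "\<lambda>q. if q = x then 1 else 0"])
          qed
          show "cpoly.subspace (range (\<lambda>u. \<Sum>q\<in>?T. pconst (u q) * pair_minor q))"
          proof (rule cpoly.subspaceI)
            show "0 \<in> range (\<lambda>u. \<Sum>q\<in>?T. pconst (u q) * pair_minor q)"
              by (rule range_eqI[of _ _ "\<lambda>_. 0"]) (simp add: pconst_simps)
          next
            fix x y assume "x \<in> range (\<lambda>u. \<Sum>q\<in>?T. pconst (u q) * pair_minor q)" "y \<in> range (\<lambda>u. \<Sum>q\<in>?T. pconst (u q) * pair_minor q)"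
            then obtain u v where "x = (\<Sum>q\<in>?T. pconst (u q) * pair_minor q)" "y = (\<Sum>q\<in>?T. pconst (v q) * pair_minor q)" by auto
            then show "x + y \<in> range (\<lambda>u. \<Sum>q\<in>?T. pconst (u q) * pair_minor q)"
              by (intro range_eqI[of _ _ "\<lambda>q. u q + v q"]) (simp add: pconst_simps distrib_right sum.distrib)
          next
            fix k x assume "x \<in> range (\<lambda>u. \<Sum>q\<in>?T. pconst (u q) * pair_minor q)"
            then obtain u where "x = (\<Sum>q\<in>?T. pconst (u q) * pair_minor q)" by auto
            then have "pconst k * x = (\<Sum>q\<in>?T. pconst (k * u q) * pair_minor q)"
              by (simp only: pconst_simps sum_distrib_left mult.assoc)
            then show "pconst k * x \<in> range (\<lambda>u. \<Sum>q\<in>?T. pconst (u q) * pair_minor q)"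
              by (rule range_eqI[of _ _ "\<lambda>q. k * u q"])
          qed
        qed
      qed (intro image_subsetI cpoly.span_sum cpoly.span_scale, rule cpoly.span_base, simp)
    qed
    finally obtain u where u: "pair_minor (a, b) = (\<Sum>q\<in>?T. pconst (u q) * pair_minor q)" by auto
    define R where "R = {q \<in> ?T. same_content q (a, b)}"
    have fin: "finite ?T" "finite R" unfolding R_def using finite_chain_pairs by auto
    define Y where "Y = pair_minor (a, b) - (\<Sum>q\<in>R. pconst (u q) * pair_minor q)"
    have Y: "Y = (\<Sum>q\<in>?T - R. pconst (u q) * pair_minor q)"
      unfolding Y_def u using fin by (subst sum.subset_diff[of R ?T]) (auto simp: R_def)
    have "Y = 0"
    proof (rule ccontr)
      assume "Y \<noteq> 0"
      then obtain m where m: "m \<in> supp Y" by (metis ex_in_conv keys_eq_empty)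
      have "m \<in> (\<Union>q\<in>?T - R. supp (pconst (u q) * pair_minor q))"        using m keys_sum[of "\<lambda>q. pconst (u q) * pair_minor q" "?T - R"] unfolding Y by (rule rev_subsetD)
      then obtain q where q: "q \<in> ?T - R" "m \<in> supp (pair_minor q)" using supp_pconst_mult by blast
      have "coef Y m = coef (pair_minor (a, b)) m - (\<Sum>q\<in>R. coef (pconst (u q) * pair_minor q) m)"
        unfolding Y_def by (simp add: lookup_minus lookup_sum)
      then have "coef (pair_minor (a, b)) m \<noteq> 0 \<or> (\<exists>q\<in>R. coef (pconst (u q) * pair_minor q) m \<noteq> 0)"
        using m by (metis (no_types, lifting) diff_self in_keys_iff sum.neutral)
      then have "m \<in> supp (pair_minor (a, b)) \<or> (\<exists>q\<in>R. m \<in> supp (pair_minor q))"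
        using supp_pconst_mult by (metis in_keys_iff subsetD)
      then have "same_content q (a, b)"
      proof
        assume "m \<in> supp (pair_minor (a, b))"
        then show ?thesis by (rule same_content_if_common_supp[OF q(2)])
      next
        assume "\<exists>q\<in>R. m \<in> supp (pair_minor q)"
        then obtain q' where q': "q' \<in> R" "m \<in> supp (pair_minor q')" by blast
        then show ?thesis using same_content_if_common_supp[OF q(2) q'(2)] unfolding R_def same_content_def by simp
      qed
      then show False using q(1) unfolding R_def by blast
    qed
    then have "pair_minor (a, b) = (\<Sum>q\<in>R. pconst (u q) * pair_minor q)" unfolding Y_def by simp
    also have "\<dots> = (\<Sum>q\<in>chain_pairs n. pconst (if q \<in> R then u q else 0) * pair_minor q)"
      by (rule sum.mono_neutral_cong_left) (auto simp: R_def finite_chain_pairs pconst_simps)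
    finally show ?thesis
      by (intro exI[of _ "\<lambda>q. if q \<in> R then u q else 0"]) (auto simp: R_def)
  qed
  show ?thesis
  proof (cases "length b \<le> length a")
    case True
    then show ?thesis using main[OF a b] that by (auto simp: max_def min_def)
  next
    case False
    have eq: "pair_minor (a, b) = pair_minor (b, a)" unfolding pair_minor_def by (simp add: mult.commute)
    have sc: "same_content q (b, a) = same_content q (a, b)" for q unfolding same_content_def by (simp add: add.commute)
    show ?thesis using main[OF b a] False that unfolding eq sc by (auto simp: max_def min_def)
  qed
qed

text \<open>The counterpart of \<open>straightening\<close> for minors of sorted sequences: free of
  the signs of \<open>pl_X\<close> and meaningful for comparable columns too. The two are compared
  in \<open>straightening_eq\<close>.\<close>

definition minor_coef :: "nat \<Rightarrow> nat list \<Rightarrow> nat list \<Rightarrow> nat list \<times> nat list \<Rightarrow> complex"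
  where "minor_coef n a b = (THE c. (\<forall>q. q \<notin> chain_pairs n \<longrightarrow> c q = 0) \<and>
    pair_minor (a, b) = (\<Sum>q\<in>chain_pairs n. pconst (c q) * pair_minor q))"

lemma chain_coef_unique:
  assumes "(\<Sum>q\<in>chain_pairs n. pconst (c q) * pair_minor q) = (\<Sum>q\<in>chain_pairs n. pconst (d q) * pair_minor q)"
    and "\<And>q. q \<notin> chain_pairs n \<Longrightarrow> c q = d q"
  shows "c = d"
proof
  fix q
  have "(\<Sum>q\<in>chain_pairs n. pconst (c q - d q) * pair_minor q) = 0"
    using assms(1) by (simp add: cpoly.scale_left_diff_distrib sum_subtractf)
  then have "q \<in> chain_pairs n \<Longrightarrow> c q - d q = 0" using chain_pairs_independent[of "\<lambda>q. c q - d q" n q] by simp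
  then show "c q = d q" using assms(2) by (cases "q \<in> chain_pairs n") auto
qed

lemma minor_coef:
  assumes a: "a \<in> pbw_columns n" and b: "b \<in> pbw_columns n"
  shows "pair_minor (a, b) = (\<Sum>q\<in>chain_pairs n. pconst (minor_coef n a b q) * pair_minor q)"
    and "minor_coef n a b q \<noteq> 0 \<Longrightarrow> q \<in> chain_pairs n \<and> same_content q (a, b) \<and>
      length (snd q) = max (length a) (length b) \<and> length (fst q) = min (length a) (length b)"
    and "\<lbrakk>\<And>q. q \<notin> chain_pairs n \<Longrightarrow> d q = 0; pair_minor (a, b) = (\<Sum>q\<in>chain_pairs n. pconst (d q) * pair_minor q)\<rbrakk>
       \<Longrightarrow> minor_coef n a b = d"
proof -
  obtain c where c: "pair_minor (a, b) = (\<Sum>q\<in>chain_pairs n. pconst (c q) * pair_minor q)"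
    "\<And>q. c q \<noteq> 0 \<Longrightarrow> q \<in> chain_pairs n \<and> same_content q (a, b) \<and>
      length (snd q) = max (length a) (length b) \<and> length (fst q) = min (length a) (length b)"
    by (rule pair_minor_straightening[OF a b]) (rule that, assumption, blast)
  have cz: "c q = 0" if "q \<notin> chain_pairs n" for q using c(2)[of q] that by blast
  have eq: "minor_coef n a b = c"
    unfolding minor_coef_def
  proof (rule the_equality)
    show "(\<forall>q. q \<notin> chain_pairs n \<longrightarrow> c q = 0) \<and> pair_minor (a, b) = (\<Sum>q\<in>chain_pairs n. pconst (c q) * pair_minor q)"
      using c by blast
    fix d assume d: "(\<forall>q. q \<notin> chain_pairs n \<longrightarrow> d q = 0) \<and> pair_minor (a, b) = (\<Sum>q\<in>chain_pairs n. pconst (d q) * pair_minor q)"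
    show "d = c"
    proof (rule chain_coef_unique)
      show "(\<Sum>q\<in>chain_pairs n. pconst (d q) * pair_minor q) = (\<Sum>q\<in>chain_pairs n. pconst (c q) * pair_minor q)"
        using c(1) d by simp
    qed (use cz d in metis)
  qed
  show "pair_minor (a, b) = (\<Sum>q\<in>chain_pairs n. pconst (minor_coef n a b q) * pair_minor q)" unfolding eq by (rule c(1))
  show "minor_coef n a b q \<noteq> 0 \<Longrightarrow> q \<in> chain_pairs n \<and> same_content q (a, b) \<and>
      length (snd q) = max (length a) (length b) \<and> length (fst q) = min (length a) (length b)" unfolding eq by (rule c(2))
  show "minor_coef n a b = d" if "\<And>q. q \<notin> chain_pairs n \<Longrightarrow> d q = 0"
    "pair_minor (a, b) = (\<Sum>q\<in>chain_pairs n. pconst (d q) * pair_minor q)"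
    unfolding eq
  proof (rule chain_coef_unique)
    show "(\<Sum>q\<in>chain_pairs n. pconst (c q) * pair_minor q) = (\<Sum>q\<in>chain_pairs n. pconst (d q) * pair_minor q)"
      using c(1) that(2) by simp
  qed (use cz that(1) in metis)
qed

lemma minor_coef_commute: "minor_coef n a b = minor_coef n b a"
  unfolding minor_coef_def pair_minor_def by (simp add: mult.commute)

section \<open>The lightest term of a straightening relation\<close>

lemma lead_pair_minor:
  assumes "fst q \<in> pbw_columns n" "snd q \<in> pbw_columns n"
  shows "lead (cell_weight n) (pair_minor q) (pair_cells q)"
  unfolding pair_minor_def pair_cells_def by (intro lead_mult lead_pl_minor assms)

lemma mweight_pair_cells: "mweight (cell_weight n) (pair_cells q) = pair_weight n q"
  unfolding pair_cells_def pair_weight_def by (simp add: mweight_add mweight_cell_mon)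

text \<open>A chain term of least weight cannot be cancelled, because its leading cells determine
  the chain. So its cells occur in the product for \<open>(a, b)\<close>, and no term is lighter
  than \<open>(a, b)\<close>. A term that produces the cells of \<open>(a, b)\<close> must then have
  them as its leading cells.\<close>

lemma minor_coef_top:
  assumes a: "a \<in> pbw_columns n" and b: "b \<in> pbw_columns n"
  obtains q where "minor_coef n a b q \<noteq> 0" "pair_cells q = pair_cells (a, b)"
    "\<And>q'. minor_coef n a b q' \<noteq> 0 \<Longrightarrow> q' \<noteq> q \<Longrightarrow> pair_weight n (a, b) < pair_weight n q'"
proof -
  let ?c = "minor_coef n a b"
  let ?D = "pair_minor (a, b)" and ?M = "pair_cells (a, b)"
  note mc = minor_coef[OF a b]
  have lab: "lead (cell_weight n) ?D ?M" by (rule lead_pair_minor) (use a b in auto)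
  have lq: "lead (cell_weight n) (pair_minor q) (pair_cells q)" if "?c q \<noteq> 0" for q
    by (rule lead_pair_minor) (use mc(2)[OF that] chain_pairsD in auto)
  have coD: "coef ?D m = (\<Sum>q\<in>chain_pairs n. ?c q * coef (pair_minor q) m)" for m
    by (subst mc(1)) (simp add: lookup_sum coef_pconst_mult)
  have min_in: "pair_cells q \<in> supp ?D" if q: "?c q \<noteq> 0" "\<And>q'. ?c q' \<noteq> 0 \<Longrightarrow> pair_weight n q \<le> pair_weight n q'" for q
  proof -
    have qc: "q \<in> chain_pairs n" using mc(2)[OF q(1)] by simp
    have "coef ?D (pair_cells q) = (\<Sum>q'\<in>chain_pairs n. if q' = q then ?c q * coef (pair_minor q) (pair_cells q) else 0)"
      unfolding coD
    proof (rule sum.cong)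
      fix q' assume q': "q' \<in> chain_pairs n"
      have "coef (pair_minor q') (pair_cells q) = 0" if "q' \<noteq> q" "?c q' \<noteq> 0"
      proof (rule ccontr)
        assume "coef (pair_minor q') (pair_cells q) \<noteq> 0"
        then have s: "pair_cells q \<in> supp (pair_minor q')" by (simp add: in_keys_iff)
        have "pair_weight n q' \<le> pair_weight n q" using lead_le[OF lq[OF that(2)] s] by (simp add: mweight_pair_cells)
        then have "pair_weight n q = pair_weight n q'" using q(2)[OF that(2)] by simp
        then have "pair_cells q = pair_cells q'" using lead_eq[OF lq[OF that(2)] s] by (simp add: mweight_pair_cells)
        then show False using pair_cells_inj[OF qc q'] that by simp
      qed
      then show "?c q' * coef (pair_minor q') (pair_cells q) = (if q' = q then ?c q * coef (pair_minor q) (pair_cells q) else 0)"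
        by auto
    qed simp
    also have "\<dots> = ?c q * coef (pair_minor q) (pair_cells q)" using qc finite_chain_pairs by simp
    finally show ?thesis using q(1) lq[OF q(1)] unfolding lead_def by (simp add: in_keys_iff)
  qed
  have ge: "pair_weight n (a, b) \<le> pair_weight n q" if q: "?c q \<noteq> 0" for q
  proof -
    let ?Q = "{q. ?c q \<noteq> 0}"
    have fin: "finite ?Q" by (rule finite_subset[OF _ finite_chain_pairs[of n]]) (use mc(2) in blast)
    have ne: "?Q \<noteq> {}" using q by blast
    define q1 where "q1 = arg_min_on (pair_weight n) ?Q"
    have q1: "?c q1 \<noteq> 0" "\<And>q'. ?c q' \<noteq> 0 \<Longrightarrow> pair_weight n q1 \<le> pair_weight n q'"
      unfolding q1_def using arg_min_if_finite(1)[OF fin ne] arg_min_least[OF fin ne] by auto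
    have "pair_weight n (a, b) \<le> pair_weight n q1"
      using lead_le[OF lab min_in[OF q1]] by (simp add: mweight_pair_cells)
    then show ?thesis using q1(2)[OF q] by simp
  qed
  have "coef ?D ?M \<noteq> 0" using lab unfolding lead_def by simp
  then obtain q where q: "?c q * coef (pair_minor q) ?M \<noteq> 0"
    unfolding coD by (metis (no_types, lifting) sum.neutral)
  then have cq: "?c q \<noteq> 0" and s: "?M \<in> supp (pair_minor q)" by (auto simp: in_keys_iff)
  have "pair_weight n q \<le> pair_weight n (a, b)" using lead_le[OF lq[OF cq] s] by (simp add: mweight_pair_cells)
  then have e: "?M = pair_cells q" using lead_eq[OF lq[OF cq] s] ge[OF cq] by (simp add: mweight_pair_cells)
  have "pair_weight n (a, b) < pair_weight n q'" if q': "?c q' \<noteq> 0" "q' \<noteq> q" for q'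
  proof (rule ccontr)
    assume "\<not> pair_weight n (a, b) < pair_weight n q'"
    then have w: "pair_weight n q' = pair_weight n (a, b)" using ge[OF q'(1)] by simp
    then have "pair_cells q' \<in> supp ?D" by (intro min_in q'(1)) (use ge in auto)
    then have "pair_cells q' = ?M" using lead_eq[OF lab] w by (simp add: mweight_pair_cells)
    then show False using pair_cells_inj[of q' n q] mc(2)[OF q'(1)] mc(2)[OF cq] e q'(2) by simp
  qed
  then show ?thesis using that cq e by metis
qed

lemma supp_pair_cells: "supp (pair_cells q) = cells (fst q) \<union> cells (snd q)"
  unfolding pair_cells_def monomial_add_supp supp_cell_mon ..

lemma pbw_le_if_cells:
  assumes "a \<noteq> []" "\<And>q. q \<in> cells a \<Longrightarrow> \<exists>q'\<in>cells h. q \<le> q'"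
  shows "pbw_le a h"
  using assms pbw_le_iff_cells by blast

text \<open>The larger column of the chain dominates all cells of \<open>a\<close> and
  \<open>b\<close>, and its own cells are among them; this gives both inclusions of ideals.\<close>

lemma same_cells_join:
  assumes a: "a \<in> pbw_columns n" and b: "b \<in> pbw_columns n" and q: "q \<in> chain_pairs n" and n: "2 \<le> n"
    and e: "pair_cells q = pair_cells (a, b)"
  shows "snd q = pbw_join n a b"
proof -
  note cq = chain_pairsD[OF q] and j = pbw_join[OF a b n]
  have ce: "cells (fst q) \<union> cells (snd q) = cells a \<union> cells b"
    using e supp_pair_cells[of q] supp_pair_cells[of "(a, b)"] by simp
  have up: "pbw_le x (snd q)" if x: "x \<in> {a, b}" for x
  proof (rule pbw_le_if_cells)
    show "x \<noteq> []" using x pbw_columns_nonempty a b by auto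
    fix y assume "y \<in> cells x"
    then have "y \<in> cells (fst q) \<or> y \<in> cells (snd q)" using ce x by auto
    then show "\<exists>q'\<in>cells (snd q). y \<le> q'"
      using cq(3) pbw_le_iff_cells[OF pbw_columns_nonempty[OF cq(1)]] by blast
  qed
  then have "col_ideal n a \<union> col_ideal n b \<subseteq> col_ideal n (snd q)"
    using pbw_le_iff_subset[OF cq(2) a] pbw_le_iff_subset[OF cq(2) b] by auto
  moreover have "col_ideal n (snd q) \<subseteq> col_ideal n a \<union> col_ideal n b"
    using ce unfolding col_ideal_def by blast
  ultimately show ?thesis using col_ideal_inj[OF cq(2) j(1)] j(2) by blast
qed

text \<open>Off the diagonal \<open>K_set\<close> consists of the cells of the column; on the
  diagonal it records merely that row s exists, that is, that some cell lies in row s. So the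
  indicator depends linearly on the cell monomial.\<close>

lemma K_set_indicator:
  assumes a: "\<alpha> \<in> pbw_columns n"
  shows "indicator (K_set n (col_ideal n \<alpha>)) (s, t) =
    (if s < t then coef (cell_mon \<alpha>) (s, t) else if s = t \<and> 2 \<le> s then (\<Sum>v\<le>n. coef (cell_mon \<alpha>) (s, v)) else 0)"
proof -
  note D = pbw_columnsD[OF a]
  consider "s < t" | "s = t" "2 \<le> s" | "s = t" "\<not> 2 \<le> s" | "t < s" by linarith
  then show ?thesis
  proof cases
    case 1
    have "(s, t) \<in> maximal_elems (col_ideal n \<alpha>) \<inter> V_c n \<longleftrightarrow> (s, t) \<in> cells \<alpha>"
    proof
      assume c: "(s, t) \<in> cells \<alpha>"
      then obtain r where r: "r < length \<alpha>" "s = Suc r" "t = \<alpha> ! r" unfolding cells_def by auto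
      then have "length \<alpha> < t" using D(5)[of r] 1 by (cases "\<alpha> ! r \<le> length \<alpha>") auto
      then have "(s, t) \<in> maximal_elems (col_ideal n \<alpha>)" using maximal_col_ideal(2)[OF a c] by simp
      moreover have "(s, t) \<in> V_c n" unfolding V_c_def using r 1 D(4)[of r] by auto
      ultimately show "(s, t) \<in> maximal_elems (col_ideal n \<alpha>) \<inter> V_c n" by simp
    qed (use maximal_col_ideal(1)[OF a] in auto)
    then have "(s, t) \<in> K_set n (col_ideal n \<alpha>) \<longleftrightarrow> (s, t) \<in> supp (cell_mon \<alpha>)"
      unfolding K_set_def supp_cell_mon using 1 by (auto simp: V_o_def)
    then show ?thesis using 1 by (auto simp: indicator_def in_keys_iff coef_cell_mon)
  next
    case 2
    have "(s, t) \<in> K_set n (col_ideal n \<alpha>) \<longleftrightarrow> s \<le> length \<alpha>"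
      using 2 col_ideal_diag[OF a, of s] D(2) unfolding K_set_def V_o_def V_c_def by auto
    moreover have "(\<Sum>v\<le>n. coef (cell_mon \<alpha>) (s, v)) = (if s \<le> length \<alpha> then 1 else 0)"
    proof (cases "s \<le> length \<alpha>")
      case True
      then have "\<alpha> ! (s - 1) \<le> n" using 2 D(4)[of "s - 1"] by auto
      then show ?thesis using True 2 by (simp add: coef_cell_mon)
    qed (simp add: coef_cell_mon)
    ultimately show ?thesis using 2 by (simp add: indicator_def)
  next
    case 3
    then show ?thesis unfolding K_set_def V_o_def V_c_def by (auto simp: indicator_def)
  next
    case 4
    then show ?thesis unfolding K_set_def V_o_def V_c_def by (auto simp: indicator_def)
  qed
qed

text \<open>\<open>K_set n J\<close> is contained in \<open>J\<close> and contains all its maximal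
  elements, hence generates it.\<close>

lemma K_set_inj:
  assumes "I \<in> order_ideals n" "J \<in> order_ideals n" "K_set n I = K_set n J"
  shows "I = J"
proof -
  have sub: "I \<subseteq> J" if I: "I \<in> order_ideals n" and J: "J \<in> order_ideals n" and K: "K_set n I = K_set n J" for I J
  proof
    fix p assume p: "p \<in> I"
    obtain q where q: "q \<in> maximal_elems I" "p \<le> q" using maximal_above[OF I p] by blast
    have qI: "q \<in> I" using q unfolding maximal_elems_def by simp
    then have "q \<in> tri n" using order_ideals_sub[OF I] by blast
    then have "q \<in> K_set n I" using q(1) qI unfolding K_set_def V_o_def V_c_def tri_def by (cases q) force
    then have "q \<in> K_set n J" using K by simp
    then have "q \<in> J" unfolding K_set_def maximal_elems_def by blast
    moreover have "p \<in> tri n" using order_ideals_sub[OF I] p by blast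
    ultimately show "p \<in> J" using order_ideals_down[OF J _ _ q(2)] by blast
  qed
  show ?thesis using sub[OF assms] sub[OF assms(2,1) assms(3)[symmetric]] by blast
qed

text \<open>By the linearity in \<open>K_set_indicator\<close>, equality of cell monomials is
  carried to the defining equation of \<open>pbw_odot\<close>, whose solution is unique by
  \<open>K_set_inj\<close>.\<close>

lemma same_cells_odot:
  assumes a: "a \<in> pbw_columns n" and b: "b \<in> pbw_columns n" and q: "q \<in> chain_pairs n" and n: "2 \<le> n"
    and e: "pair_cells q = pair_cells (a, b)"
  shows "fst q = pbw_odot n a b"
proof -
  note cq = chain_pairsD[OF q] and j = pbw_join[OF a b n]
  let ?K = "\<lambda>x. K_set n (col_ideal n x)"
  have J: "col_ideal n (snd q) = col_ideal n a \<union> col_ideal n b"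
    using same_cells_join[OF a b q n e] j by simp
  have co: "coef (cell_mon a) x + coef (cell_mon b) x = coef (cell_mon (snd q)) x + coef (cell_mon (fst q)) x" for x
    using arg_cong[OF e, of "\<lambda>m. coef m x"] unfolding pair_cells_def by (simp add: lookup_add)
  have ind: "(indicator (?K a) p + indicator (?K b) p :: nat) = indicator (?K (snd q)) p + indicator (?K (fst q)) p" for p
  proof -
    obtain s t where p: "p = (s, t)" by (cases p)
    have "(\<Sum>v\<le>n. coef (cell_mon a) (s, v)) + (\<Sum>v\<le>n. coef (cell_mon b) (s, v))
        = (\<Sum>v\<le>n. coef (cell_mon (snd q)) (s, v)) + (\<Sum>v\<le>n. coef (cell_mon (fst q)) (s, v))"
      unfolding sum.distrib[symmetric] co ..
    then show ?thesis
      unfolding p K_set_indicator[OF a] K_set_indicator[OF b] K_set_indicator[OF cq(1)] K_set_indicator[OF cq(2)]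
      using co[of "(s, t)"] by (cases "s < t"; cases "s = t"; cases "2 \<le> s") simp_all
  qed
  have "(THE J. J \<in> order_ideals n \<and> (\<forall>p. indicator (?K a) p + indicator (?K b) p
       = (indicator (K_set n (col_ideal n a \<union> col_ideal n b)) p + indicator (K_set n J) p :: nat))) = col_ideal n (fst q)"
  proof (rule the_equality)
    show "col_ideal n (fst q) \<in> order_ideals n \<and> (\<forall>p. indicator (?K a) p + indicator (?K b) p
       = (indicator (K_set n (col_ideal n a \<union> col_ideal n b)) p + indicator (K_set n (col_ideal n (fst q))) p :: nat))"
      using ind J col_ideal_order_ideal by simp
    fix J' assume J': "J' \<in> order_ideals n \<and> (\<forall>p. indicator (?K a) p + indicator (?K b) p
       = (indicator (K_set n (col_ideal n a \<union> col_ideal n b)) p + indicator (K_set n J') p :: nat))"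
    have "(indicator (K_set n J') p :: nat) = indicator (?K (fst q)) p" for p
    proof -
      have "(indicator (?K a) p + indicator (?K b) p :: nat) = indicator (?K (snd q)) p + indicator (K_set n J') p"
        using J' unfolding J by blast
      then show ?thesis using ind[of p] by simp
    qed
    then have "K_set n J' = ?K (fst q)" by (metis (no_types, opaque_lifting) indicator_eq_1_iff subsetI subset_antisym)
    then show "J' = col_ideal n (fst q)" using K_set_inj J' col_ideal_order_ideal by blast
  qed
  then have "pbw_odot n a b = ideal_column (col_ideal n (fst q))"
    unfolding pbw_odot_def by (simp add: column_ideal_eq a b n)
  then show ?thesis using ideal_column_col_ideal[OF cq(1)] by simp
qed

lemma odot_join:
  assumes a: "a \<in> pbw_columns n" and b: "b \<in> pbw_columns n" and n: "2 \<le> n"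
  shows "minor_coef n a b (pbw_odot n a b, pbw_join n a b) \<noteq> 0"
    and "pair_cells (pbw_odot n a b, pbw_join n a b) = pair_cells (a, b)"
    and "minor_coef n a b q \<noteq> 0 \<Longrightarrow> q \<noteq> (pbw_odot n a b, pbw_join n a b) \<Longrightarrow> pair_weight n (a, b) < pair_weight n q"
proof -
  obtain q0 where q0: "minor_coef n a b q0 \<noteq> 0" "pair_cells q0 = pair_cells (a, b)"
    "\<And>q'. minor_coef n a b q' \<noteq> 0 \<Longrightarrow> q' \<noteq> q0 \<Longrightarrow> pair_weight n (a, b) < pair_weight n q'"
    using minor_coef_top[OF a b] by blast
  have "q0 \<in> chain_pairs n" using minor_coef(2)[OF a b q0(1)] by simp
  then have e: "q0 = (pbw_odot n a b, pbw_join n a b)"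
    using same_cells_join[OF a b _ n q0(2)] same_cells_odot[OF a b _ n q0(2)] by (metis prod.collapse)
  show "minor_coef n a b (pbw_odot n a b, pbw_join n a b) \<noteq> 0"
    "pair_cells (pbw_odot n a b, pbw_join n a b) = pair_cells (a, b)"
    "minor_coef n a b q \<noteq> 0 \<Longrightarrow> q \<noteq> (pbw_odot n a b, pbw_join n a b) \<Longrightarrow> pair_weight n (a, b) < pair_weight n q"
    using q0 unfolding e by auto
qed

section \<open>Straightening in the Pluecker ring\<close>

definition pl_sign :: "nat list \<Rightarrow> complex"
  where "pl_sign \<alpha> = of_int (sign (THE \<sigma>. \<sigma> permutes {..<length \<alpha>} \<and> permute_list \<sigma> (sort \<alpha>) = \<alpha>))"

lemma pl_sign_mult_self [simp]: "pl_sign \<alpha> * pl_sign \<alpha> = 1" "pl_sign \<alpha> * (pl_sign \<alpha> * x) = x"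
  unfolding pl_sign_def by (simp_all add: sign_def)

lemma pl_sign_nonzero [simp]: "pl_sign \<alpha> \<noteq> 0"
  unfolding pl_sign_def by (simp add: sign_def)

lemma of_int_eq_pconst: "(of_int z :: 'v cpoly) = pconst (of_int z)"
  unfolding pconst_def by simp

lemma pl_X_eq: "pl_X \<alpha> = monom (monom (sort \<alpha>) 1) (pl_sign \<alpha>)"
  unfolding pl_X_def of_int_eq_pconst pl_sign_def pvar_def pconst_monom by simp

lemma pl_X_mult: "pl_X a * pl_X b = monom (pair_mon (a, b)) (pl_sign a * pl_sign b)"
  unfolding pl_X_eq pair_mon_def mult_single by simp

lemma psubst_pair_mon: "psubst pl_minor (monom (pair_mon q) c) = pconst c * pair_minor q"
  unfolding psubst_monom mon_eval_pair_mon ..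

lemma pl_ring_monom: "supp m \<subseteq> pl_vars n \<Longrightarrow> monom m c \<in> pl_ring n"
  unfolding pl_ring_def by simp

lemma pl_ring_0: "0 \<in> pl_ring n"
  unfolding pl_ring_def by simp

lemma pl_ring_add: "p \<in> pl_ring n \<Longrightarrow> q \<in> pl_ring n \<Longrightarrow> p + q \<in> pl_ring n"
  unfolding pl_ring_def using keys_add[of p q] by blast

lemma pl_ring_diff: "p \<in> pl_ring n \<Longrightarrow> q \<in> pl_ring n \<Longrightarrow> p - q \<in> pl_ring n"
  unfolding pl_ring_def using keys_diff[of p q] by blast

lemma pl_ring_sum: "(\<And>i. i \<in> S \<Longrightarrow> f i \<in> pl_ring n) \<Longrightarrow> sum f S \<in> pl_ring n"
  by (induction S rule: infinite_finite_induct) (auto simp: pl_ring_0 pl_ring_add)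

lemma pl_ring_mult: "p \<in> pl_ring n \<Longrightarrow> q \<in> pl_ring n \<Longrightarrow> p * q \<in> pl_ring n"
  unfolding pl_ring_def mem_Collect_eq
proof
  fix m assume *: "\<forall>m\<in>supp p. supp m \<subseteq> pl_vars n" "\<forall>m\<in>supp q. supp m \<subseteq> pl_vars n" "m \<in> supp (p * q)"
  obtain m1 m2 where "m = m1 + m2" "m1 \<in> supp p" "m2 \<in> supp q" using *(3) keys_mult[of p q] by blast
  then show "supp m \<subseteq> pl_vars n" using * by (auto simp: monomial_add_supp)
qed

lemma pl_ring_pconst_mult: "p \<in> pl_ring n \<Longrightarrow> pconst c * p \<in> pl_ring n"
  unfolding pl_ring_def using supp_pconst_mult[of c p] by blast

lemma supp_pair_mon_vars:
  "fst q \<in> pbw_columns n \<Longrightarrow> snd q \<in> pbw_columns n \<Longrightarrow> supp (pair_mon q) \<subseteq> pl_vars n"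
  unfolding supp_pair_mon by (simp add: sort_column_pl_vars)

lemma incomparable_not_standard:
  assumes "pbw_incomparable n a b" "sort a \<in> supp m" "sort b \<in> supp m"
  shows "\<not> standard n m"
  using assms var_column_sort unfolding pbw_incomparable_def standard_def by metis

lemma not_standard_split:
  assumes "supp m \<subseteq> pl_vars n" "\<not> standard n m"
  obtains a b k where "pbw_incomparable n a b" "m = pair_mon (a, b) + k" "supp k \<subseteq> pl_vars n"
proof -
  obtain i j where ij: "i \<in> supp m" "j \<in> supp m" "\<not> pbw_le (var_column n i) (var_column n j)" "\<not> pbw_le (var_column n j) (var_column n i)"
    using assms unfolding standard_def by blast
  have v: "i \<in> pl_vars n" "j \<in> pl_vars n" using ij assms by auto
  then have "i \<noteq> j" using ij pbw_le_refl var_column(1) by blast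
  let ?a = "var_column n i" and ?b = "var_column n j"
  define k where "k = m - pair_mon (?a, ?b)"
  have "m = pair_mon (?a, ?b) + k"
    unfolding k_def pair_mon_def
    by (rule poly_mapping_eqI)
      (use ij(1,2) \<open>i \<noteq> j\<close> var_column(2) v in \<open>auto simp: lookup_add lookup_minus lookup_single when_def in_keys_iff\<close>)
  moreover from this have "supp k \<subseteq> pl_vars n" using assms(1) monomial_add_supp[of "pair_mon (?a, ?b)" k] by auto
  moreover have "pbw_incomparable n ?a ?b" unfolding pbw_incomparable_def using ij v var_column(1) by auto
  ultimately show ?thesis using that by blast
qed

text \<open>Parity: each entry has even multiplicity on the left, while \<open>a\<close> and
  \<open>b\<close> contain it at most once each. This keeps squares out of the straightening
  relations.\<close>

lemma same_content_square:
  assumes "a \<in> pbw_columns n" "b \<in> pbw_columns n" "same_content (g, g) (a, b)"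
  shows "a = b"
proof (rule pbw_columns_mset_inj[OF assms(1,2)], rule multiset_eqI)
  fix v
  have "count (mset g) v + count (mset g) v = count (mset a) v + count (mset b) v"
    using assms(3) unfolding same_content_def by (metis count_union fst_conv snd_conv)
  moreover have "count (mset a) v \<le> 1" "count (mset b) v \<le> 1"
    using pbw_columns_distinct[OF assms(1)] pbw_columns_distinct[OF assms(2)] by (simp_all add: distinct_count_atmost_1)
  ultimately show "count (mset a) v = count (mset b) v" by presburger
qed

lemma incomparableD:
  assumes "pbw_incomparable n a b"
  shows "a \<in> pbw_columns n" "b \<in> pbw_columns n" "\<not> pbw_le a b" "\<not> pbw_le b a" "a \<noteq> b"
  using assms pbw_le_refl unfolding pbw_incomparable_def by auto

lemma minor_coef_chain_pairs:
  assumes "pbw_incomparable n a b" "minor_coef n a b q \<noteq> 0"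
  shows "q \<in> chain_pairs n" "fst q \<noteq> snd q" "same_content q (a, b)"
proof -
  note ab = incomparableD[OF assms(1)]
  show q: "q \<in> chain_pairs n" "same_content q (a, b)" using minor_coef(2)[OF ab(1,2) assms(2)] by auto
  show "fst q \<noteq> snd q"
    using same_content_square[OF ab(1,2), of "fst q"] ab(5) q(2) by (metis prod.collapse)
qed

text \<open>\<open>straightening\<close> asks for strictly increasing pairs,
  \<open>minor_coef\<close> for chains; as squares do not occur, both describe the same relation,
  rescaled by signs that are their own inverses.\<close>

lemma straightening_eq:
  assumes "pbw_incomparable n a b"
  shows "straightening n a b q = pl_sign a * pl_sign b * pl_sign (fst q) * pl_sign (snd q) * minor_coef n a b q"
proof -
  note ab = incomparableD[OF assms]
  note mc = minor_coef[OF ab(1,2)] and mcc = minor_coef_chain_pairs[OF assms]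
  define c0 where "c0 q = pl_sign a * pl_sign b * pl_sign (fst q) * pl_sign (snd q) * minor_coef n a b q" for q
  let ?S = "\<lambda>c. \<Sum>(g, h)\<in>pbw_columns n \<times> pbw_columns n. pconst (c (g, h)) * pl_X g * pl_X h"
  have S: "?S c = (\<Sum>q\<in>chain_pairs n. monom (pair_mon q) (c q * pl_sign (fst q) * pl_sign (snd q)))"
    if c: "\<forall>g h. c (g, h) \<noteq> 0 \<longrightarrow> g \<in> pbw_columns n \<and> h \<in> pbw_columns n \<and> pbw_less g h" for c
  proof (rule sum.mono_neutral_cong_right)
    show "finite (pbw_columns n \<times> pbw_columns n)" by (simp add: finite_pbw_columns)
    show "chain_pairs n \<subseteq> pbw_columns n \<times> pbw_columns n" unfolding chain_pairs_def by auto
    show "\<forall>i\<in>pbw_columns n \<times> pbw_columns n - chain_pairs n. (case i of (g, h) \<Rightarrow> pconst (c (g, h)) * pl_X g * pl_X h) = 0"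
    proof
      fix q assume q: "q \<in> pbw_columns n \<times> pbw_columns n - chain_pairs n"
      obtain g h where gh: "q = (g, h)" by (cases q)
      have "c (g, h) = 0" using c q unfolding gh chain_pairs_def pbw_less_def by blast
      then show "(case q of (g, h) \<Rightarrow> pconst (c (g, h)) * pl_X g * pl_X h) = 0" unfolding gh by (simp add: pconst_simps)
    qed
    show "(case q of (g, h) \<Rightarrow> pconst (c (g, h)) * pl_X g * pl_X h) = monom (pair_mon q) (c q * pl_sign (fst q) * pl_sign (snd q))" for q
      by (cases q) (simp add: mult.assoc pl_X_mult pconst_monom)
  qed
  have psub: "psubst pl_minor (pl_X a * pl_X b - ?S c) = pconst (pl_sign a * pl_sign b) * pair_minor (a, b)
      - (\<Sum>q\<in>chain_pairs n. pconst (c q * pl_sign (fst q) * pl_sign (snd q)) * pair_minor q)"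
    if c: "\<forall>g h. c (g, h) \<noteq> 0 \<longrightarrow> g \<in> pbw_columns n \<and> h \<in> pbw_columns n \<and> pbw_less g h" for c
    unfolding S[OF c] psubst_diff psubst_sum pl_X_mult psubst_pair_mon ..
  have c0: "\<forall>g h. c0 (g, h) \<noteq> 0 \<longrightarrow> g \<in> pbw_columns n \<and> h \<in> pbw_columns n \<and> pbw_less g h"
    using mcc chain_pairsD unfolding c0_def pbw_less_def by fastforce
  have "straightening n a b = c0"
    unfolding straightening_def
  proof (rule the_equality)
    have "pl_X a * pl_X b - ?S c0 \<in> pl_ring n"
      unfolding S[OF c0] pl_X_mult
      by (intro pl_ring_diff pl_ring_sum pl_ring_monom supp_pair_mon_vars) (use ab chain_pairsD in auto)
    moreover have "psubst pl_minor (pl_X a * pl_X b - ?S c0) = 0"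
    proof -
      have "(\<Sum>q\<in>chain_pairs n. pconst (c0 q * pl_sign (fst q) * pl_sign (snd q)) * pair_minor q)
          = (\<Sum>q\<in>chain_pairs n. pconst (pl_sign a * pl_sign b) * (pconst (minor_coef n a b q) * pair_minor q))"
      proof (rule sum.cong)
        fix q
        have "c0 q * pl_sign (fst q) * pl_sign (snd q) = (pl_sign a * pl_sign b) * minor_coef n a b q"
          unfolding c0_def by (simp add: mult_ac)
        then show "pconst (c0 q * pl_sign (fst q) * pl_sign (snd q)) * pair_minor q
          = pconst (pl_sign a * pl_sign b) * (pconst (minor_coef n a b q) * pair_minor q)"
          by (simp only: pconst_simps mult.assoc)
      qed simp
      also have "\<dots> = pconst (pl_sign a * pl_sign b) * pair_minor (a, b)"
        unfolding sum_distrib_left[symmetric] mc(1)[symmetric] ..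
      finally show ?thesis unfolding psub[OF c0] by simp
    qed
    ultimately show "(\<forall>g h. c0 (g, h) \<noteq> 0 \<longrightarrow> g \<in> pbw_columns n \<and> h \<in> pbw_columns n \<and> pbw_less g h) \<and>
      pl_X a * pl_X b - ?S c0 \<in> pl_ideal n"
      using c0 unfolding pl_ideal_def by simp
  next
    fix c assume "(\<forall>g h. c (g, h) \<noteq> 0 \<longrightarrow> g \<in> pbw_columns n \<and> h \<in> pbw_columns n \<and> pbw_less g h) \<and>
      pl_X a * pl_X b - ?S c \<in> pl_ideal n"
    then have c: "\<forall>g h. c (g, h) \<noteq> 0 \<longrightarrow> g \<in> pbw_columns n \<and> h \<in> pbw_columns n \<and> pbw_less g h"
      and z: "psubst pl_minor (pl_X a * pl_X b - ?S c) = 0" unfolding pl_ideal_def by auto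
    define d where "d q = pl_sign a * pl_sign b * pl_sign (fst q) * pl_sign (snd q) * c q" for q
    have cz: "c q = 0" if "q \<notin> chain_pairs n" for q
      using c that unfolding chain_pairs_def pbw_less_def by (cases q) auto
    have "minor_coef n a b = d"
    proof (rule mc(3))
      show "d q = 0" if "q \<notin> chain_pairs n" for q using cz[OF that] unfolding d_def by simp
      have e: "pconst (pl_sign a * pl_sign b) * pair_minor (a, b)
        = (\<Sum>q\<in>chain_pairs n. pconst (c q * pl_sign (fst q) * pl_sign (snd q)) * pair_minor q)"
        using z unfolding psub[OF c] by simp
      have "pair_minor (a, b) = pconst (pl_sign a * pl_sign b) * (pconst (pl_sign a * pl_sign b) * pair_minor (a, b))"
      proof -
        have "pl_sign a * pl_sign b * (pl_sign a * pl_sign b) = 1" by (simp add: mult_ac)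
        then have "pconst (pl_sign a * pl_sign b) * pconst (pl_sign a * pl_sign b) = (1 :: (nat \<times> nat) cpoly)"
          unfolding pconst_simps(4)[symmetric] by (simp only: pconst_simps(2))
        then show ?thesis by (simp only: mult.assoc[symmetric] mult_1)
      qed
      also have "\<dots> = (\<Sum>q\<in>chain_pairs n. pconst (d q) * pair_minor q)"
        unfolding e sum_distrib_left
      proof (rule sum.cong)
        fix q
        have "pl_sign a * pl_sign b * (c q * pl_sign (fst q) * pl_sign (snd q)) = d q" unfolding d_def by (simp add: mult_ac)
        then show "pconst (pl_sign a * pl_sign b) * (pconst (c q * pl_sign (fst q) * pl_sign (snd q)) * pair_minor q) = pconst (d q) * pair_minor q"
          by (metis mult.assoc pconst_simps(4))
      qed simp
      finally show "pair_minor (a, b) = (\<Sum>q\<in>chain_pairs n. pconst (d q) * pair_minor q)" .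
    qed
    then show "c = c0" unfolding c0_def by (intro ext) (simp add: d_def mult_ac)
  qed
  then show ?thesis unfolding c0_def by simp
qed

text \<open>The relation e(a, b) up to sign, written in the variables of sorted sequences.\<close>

definition rel :: "nat \<Rightarrow> nat list \<Rightarrow> nat list \<Rightarrow> nat list cpoly"
  where "rel n a b = monom (pair_mon (a, b)) 1 - (\<Sum>q\<in>chain_pairs n. monom (pair_mon q) (minor_coef n a b q))"

lemma rel_ideal:
  assumes "pbw_incomparable n a b"
  shows "rel n a b \<in> pl_ring n" "psubst pl_minor (rel n a b) = 0"
proof -
  note ab = incomparableD[OF assms]
  show "rel n a b \<in> pl_ring n" unfolding rel_def
    by (intro pl_ring_diff pl_ring_sum pl_ring_monom supp_pair_mon_vars) (use ab chain_pairsD in auto)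
  show "psubst pl_minor (rel n a b) = 0"
    unfolding rel_def psubst_diff psubst_sum psubst_pair_mon using minor_coef(1)[OF ab(1,2)] by (simp add: pconst_simps)
qed

lemma coef_rel:
  assumes "pbw_incomparable n a b"
  shows "coef (rel n a b) (pair_mon (a, b)) = 1"
    and "q \<in> chain_pairs n \<Longrightarrow> coef (rel n a b) (pair_mon q) = - minor_coef n a b q"
    and "m \<in> supp (rel n a b) \<Longrightarrow> m \<noteq> pair_mon (a, b) \<Longrightarrow> \<exists>q. m = pair_mon q \<and> minor_coef n a b q \<noteq> 0"
proof -
  note ab = incomparableD[OF assms]
  have ne: "pair_mon q \<noteq> pair_mon (a, b)" if "q \<in> chain_pairs n" for q
    using pair_mon_standard[OF that] incomparable_not_standard[OF assms, of "pair_mon (a, b)"] by (auto simp: supp_pair_mon)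
  have co: "coef (rel n a b) m = (if m = pair_mon (a, b) then 1 else 0) - (\<Sum>q\<in>chain_pairs n. if pair_mon q = m then minor_coef n a b q else 0)" for m
    unfolding rel_def lookup_minus lookup_sum by (auto simp: lookup_single when_def)
  have "(\<Sum>q\<in>chain_pairs n. if pair_mon q = pair_mon (a, b) then minor_coef n a b q else 0) = 0"
    by (rule sum.neutral) (use ne in auto)
  then show "coef (rel n a b) (pair_mon (a, b)) = 1" unfolding co by simp
  show "coef (rel n a b) (pair_mon q) = - minor_coef n a b q" if q: "q \<in> chain_pairs n"
  proof -
    have "(\<Sum>x\<in>chain_pairs n. if pair_mon x = pair_mon q then minor_coef n a b x else 0) = (\<Sum>x\<in>chain_pairs n. if x = q then minor_coef n a b x else 0)"
      by (rule sum.cong) (use pair_mon_inj[OF _ q] in auto)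
    then show ?thesis unfolding co using ne[OF q] q finite_chain_pairs by simp
  qed
  show "\<exists>q. m = pair_mon q \<and> minor_coef n a b q \<noteq> 0" if "m \<in> supp (rel n a b)" "m \<noteq> pair_mon (a, b)"
  proof (rule ccontr)
    assume "\<not> (\<exists>q. m = pair_mon q \<and> minor_coef n a b q \<noteq> 0)"
    then have "(\<Sum>q\<in>chain_pairs n. if pair_mon q = m then minor_coef n a b q else 0) = 0" by (intro sum.neutral) auto
    then show False using that unfolding in_keys_iff co by simp
  qed
qed

section \<open>Weights compatible with straightening\<close>

definition straight_term :: "nat \<Rightarrow> nat list \<Rightarrow> nat list \<Rightarrow> nat list \<times> nat list \<Rightarrow> bool"
  where "straight_term n a b q \<longleftrightarrow> pbw_incomparable n a b \<and> minor_coef n a b q \<noteq> 0"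

text \<open>Polymorphic, so as to cover the integral \<open>base_weight\<close>, which supports
  inductions, and the real points of the cone.\<close>

definition straightens :: "nat \<Rightarrow> (nat list \<Rightarrow> 'r::linordered_idom) \<Rightarrow> bool"
  where "straightens n w \<longleftrightarrow> (\<forall>a b q. straight_term n a b q \<longrightarrow> w a + w b < w (fst q) + w (snd q))"

definition col_mweight :: "nat \<Rightarrow> (nat list \<Rightarrow> 'r::comm_ring_1) \<Rightarrow> (nat list \<Rightarrow>\<^sub>0 nat) \<Rightarrow> 'r"
  where "col_mweight n w = mweight (\<lambda>i. w (var_column n i))"

lemma col_mweight_add: "col_mweight n w (m + m') = col_mweight n w m + col_mweight n w m'"
  unfolding col_mweight_def by (rule mweight_add)

lemma col_mweight_pair_mon:
  "fst q \<in> pbw_columns n \<Longrightarrow> snd q \<in> pbw_columns n \<Longrightarrow> col_mweight n w (pair_mon q) = w (fst q) + w (snd q)"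
  unfolding col_mweight_def pair_mon_def by (simp add: mweight_add var_column_sort)

lemma col_mweight_pair:
  "a \<in> pbw_columns n \<Longrightarrow> b \<in> pbw_columns n \<Longrightarrow> col_mweight n w (pair_mon (a, b)) = w a + w b"
  by (simp add: col_mweight_pair_mon)

lemma mon_weight_eq: "mon_weight n w = col_mweight n w"
  unfolding mon_weight_def col_mweight_def mweight_def var_weight_def var_column_def by simp

lemma straight_termD:
  assumes "straight_term n a b q"
  shows "pbw_incomparable n a b" "q \<in> chain_pairs n" "same_content q (a, b)" "fst q \<noteq> snd q"
  using assms minor_coef_chain_pairs[of n a b q] unfolding straight_term_def by blast+

text \<open>The list weight makes all terms strictly heavier than \<open>(a, b)\<close> except that
  of the join, where it ties. The power of 3 breaks the tie: the ideal of the join is larger than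
  those of \<open>a\<close> and \<open>b\<close>, and 3 times a power exceeds the sum of two. The
  factor in front outweighs any two tie-breakers.\<close>

definition base_weight :: "nat \<Rightarrow> nat list \<Rightarrow> int"
  where "base_weight n \<alpha> = (2 * 3 ^ card (tri n) + 1) * list_weight n \<alpha> + 3 ^ card (col_ideal n \<alpha>)"

lemma card_col_ideal_le: "card (col_ideal n \<alpha>) \<le> card (tri n)"
  by (rule card_mono) (auto simp: finite_tri col_ideal_def)

lemma straightens_base_weight:
  assumes n: "2 \<le> n"
  shows "straightens n (base_weight n)"
  unfolding straightens_def
proof (intro allI impI)
  fix a b q assume t: "straight_term n a b q"
  then have inc: "pbw_incomparable n a b" and mq: "minor_coef n a b q \<noteq> 0" unfolding straight_term_def by auto
  note ab = incomparableD[OF inc]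
  note oj = odot_join[OF ab(1,2) n]
  let ?N = "2 * 3 ^ card (tri n) + 1 :: int"
  let ?e = "\<lambda>\<alpha>. 3 ^ card (col_ideal n \<alpha>) :: int"
  have pos: "0 < ?e \<alpha>" for \<alpha> by simp
  show "base_weight n a + base_weight n b < base_weight n (fst q) + base_weight n (snd q)"
  proof (cases "q = (pbw_odot n a b, pbw_join n a b)")
    case True
    have "pair_weight n q = pair_weight n (a, b)"
      using mweight_pair_cells[of n q] mweight_pair_cells[of n "(a, b)"] oj(2) True by simp
    then have w: "list_weight n (fst q) + list_weight n (snd q) = list_weight n a + list_weight n b"
      unfolding pair_weight_def by simp
    have ideal: "col_ideal n (snd q) = col_ideal n a \<union> col_ideal n b" using pbw_join(2)[OF ab(1,2) n] True by simp
    have fin: "finite (col_ideal n x)" for x using order_ideals_finite[OF col_ideal_order_ideal] .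
    have "col_ideal n a \<subset> col_ideal n (snd q)" "col_ideal n b \<subset> col_ideal n (snd q)"
      using ab(3,4) unfolding pbw_le_iff_subset[OF ab(1,2)] pbw_le_iff_subset[OF ab(2,1)] ideal by auto
    then have "Suc (card (col_ideal n a)) \<le> card (col_ideal n (snd q))" "Suc (card (col_ideal n b)) \<le> card (col_ideal n (snd q))"
      using psubset_card_mono[OF fin] by (simp_all add: Suc_le_eq)
    then have "(3::int) ^ Suc (card (col_ideal n a)) \<le> ?e (snd q)" "(3::int) ^ Suc (card (col_ideal n b)) \<le> ?e (snd q)"
      by (intro power_increasing; simp)+
    then have "?e a + ?e b < ?e (fst q) + ?e (snd q)"
      unfolding power_Suc using pos[of a] pos[of b] pos[of "fst q"] by linarith
    moreover have "?N * list_weight n (fst q) + ?N * list_weight n (snd q) = ?N * list_weight n a + ?N * list_weight n b"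
      unfolding distrib_left[symmetric] w ..
    ultimately show ?thesis unfolding base_weight_def by linarith
  next
    case False
    have "pair_weight n (a, b) + 1 \<le> pair_weight n q" using oj(3)[OF mq False] by simp
    then have "?N * (list_weight n a + list_weight n b + 1) \<le> ?N * (list_weight n (fst q) + list_weight n (snd q))"
      unfolding pair_weight_def by (intro mult_left_mono) auto
    moreover have "?e a \<le> 3 ^ card (tri n)" "?e b \<le> 3 ^ card (tri n)"
      using card_col_ideal_le by (intro power_increasing; simp)+
    moreover have "?N * (list_weight n a + list_weight n b + 1) = ?N * list_weight n a + ?N * list_weight n b + ?N" by (simp add: algebra_simps)
    moreover have "?N * (list_weight n (fst q) + list_weight n (snd q)) = ?N * list_weight n (fst q) + ?N * list_weight n (snd q)" by (rule distrib_left)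
    ultimately show ?thesis unfolding base_weight_def using pos[of "fst q"] pos[of "snd q"] by linarith
  qed
qed

section \<open>Expansion into standard monomials by repeated straightening\<close>

definition straight_step :: "nat \<Rightarrow> (nat list \<Rightarrow>\<^sub>0 nat) \<Rightarrow> (nat list \<Rightarrow>\<^sub>0 nat) \<Rightarrow> bool"
  where "straight_step n m m' \<longleftrightarrow> (\<exists>a b q k. straight_term n a b q \<and> m = pair_mon (a, b) + k \<and> m' = pair_mon q + k)"

lemma straight_step_weight:
  assumes "straight_step n m m'"
  shows "\<exists>a b q. straight_term n a b q \<and> (\<forall>w :: nat list \<Rightarrow> 'r::comm_ring_1. col_mweight n w m' - col_mweight n w m = w (fst q) + w (snd q) - w a - w b)"
proof -
  obtain a b q k where t: "straight_term n a b q" "m = pair_mon (a, b) + k" "m' = pair_mon q + k"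
    using assms unfolding straight_step_def by blast
  note ab = incomparableD[OF straight_termD(1)[OF t(1)]] and q = chain_pairsD[OF straight_termD(2)[OF t(1)]]
  show ?thesis
    by (intro exI[of _ a] exI[of _ b] exI[of _ q] conjI t(1) allI)
      (simp add: t(2,3) col_mweight_add col_mweight_pair_mon q(1,2) ab(1,2))
qed

lemma straight_step_less:
  fixes w :: "nat list \<Rightarrow> 'r::linordered_idom"
  assumes "straightens n w" "straight_step n m m'"
  shows "col_mweight n w m < col_mweight n w m'"
proof -
  obtain a b q where t: "straight_term n a b q" "col_mweight n w m' - col_mweight n w m = w (fst q) + w (snd q) - w a - w b"
    using straight_step_weight[OF assms(2), where 'r='r] by blast
  have "0 < w (fst q) + w (snd q) - w a - w b" using assms(1) t(1) unfolding straightens_def by (simp add: algebra_simps)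
  then show ?thesis using t(2) by (metis diff_gt_0_iff_gt)
qed

lemma straight_steps_le:
  fixes w :: "nat list \<Rightarrow> 'r::linordered_idom"
  assumes "straightens n w" "(straight_step n)\<^sup>*\<^sup>* m m'"
  shows "col_mweight n w m \<le> col_mweight n w m'" "m \<noteq> m' \<Longrightarrow> col_mweight n w m < col_mweight n w m'"
proof -
  have "m = m' \<or> col_mweight n w m < col_mweight n w m'"
    using assms(2) by (induction rule: rtranclp_induct) (use straight_step_less[OF assms(1)] in force)+
  then show "col_mweight n w m \<le> col_mweight n w m'" "m \<noteq> m' \<Longrightarrow> col_mweight n w m < col_mweight n w m'" by auto
qed

text \<open>Termination: each step raises the base weight and preserves the degree
  \<open>d m\<close>, and the weight of a monomial is at most \<open>d m * B\<close> with
  \<open>B\<close> the largest weight of a variable.\<close>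

lemma straight_expansion:
  assumes n: "2 \<le> n" and m: "supp m \<subseteq> pl_vars n"
  shows "\<exists>E. psubst pl_minor E = mon_eval pl_minor m \<and> (\<forall>s\<in>supp E. standard n s \<and> (straight_step n)\<^sup>*\<^sup>* m s)"
proof -
  let ?w = "base_weight n"
  define B where "B = Max (?w ` pbw_columns n)"
  define d where "d m = col_mweight n (\<lambda>_. 1 :: int) m" for m
  have le: "col_mweight n ?w m \<le> d m * B" if "supp m \<subseteq> pl_vars n" for m
  proof -
    have "col_mweight n ?w m \<le> (\<Sum>x\<in>supp m. int (coef m x) * B)"
      unfolding col_mweight_def mweight_def
    proof (rule sum_mono)
      fix x assume "x \<in> supp m"
      then have "var_column n x \<in> pbw_columns n" using that var_column(1) by blast
      then have "?w (var_column n x) \<le> B" unfolding B_def by (simp add: finite_pbw_columns)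
      then show "of_nat (coef m x) * ?w (var_column n x) \<le> int (coef m x) * B" by (intro mult_left_mono) auto
    qed
    also have "\<dots> = d m * B" unfolding d_def col_mweight_def mweight_def by (simp add: sum_distrib_right)
    finally show ?thesis .
  qed
  show ?thesis
    using m
  proof (induction "nat (d m * B - col_mweight n ?w m)" arbitrary: m rule: less_induct)
    case less
    show ?case
    proof (cases "standard n m")
      case True
      then show ?thesis by (intro exI[of _ "monom m 1"]) (auto simp: psubst_monom pconst_simps)
    next
      case False
      obtain a b k where k: "pbw_incomparable n a b" "m = pair_mon (a, b) + k" "supp k \<subseteq> pl_vars n"
        using not_standard_split[OF less(2) False] by blast
      note ab = incomparableD[OF k(1)]
      let ?Q = "{q \<in> chain_pairs n. minor_coef n a b q \<noteq> 0}"
      have ex: "\<exists>E. psubst pl_minor E = mon_eval pl_minor (pair_mon q + k) \<and> (\<forall>s\<in>supp E. standard n s \<and> (straight_step n)\<^sup>*\<^sup>* m s)"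
        if q: "q \<in> ?Q" for q
      proof -
        have t: "straight_term n a b q" using k(1) q unfolding straight_term_def by simp
        have st: "straight_step n m (pair_mon q + k)" unfolding straight_step_def using t k(2) by blast
        have qc: "fst q \<in> pbw_columns n" "snd q \<in> pbw_columns n" using q chain_pairsD by auto
        have sv: "supp (pair_mon q + k) \<subseteq> pl_vars n" unfolding monomial_add_supp using supp_pair_mon_vars[OF qc] k(3) by simp
        have "d (pair_mon q + k) = d m" unfolding d_def k(2) col_mweight_add by (simp add: col_mweight_pair_mon col_mweight_pair qc ab)
        moreover have "col_mweight n ?w m < col_mweight n ?w (pair_mon q + k)"
          by (rule straight_step_less[OF straightens_base_weight[OF n] st])
        ultimately have "nat (d (pair_mon q + k) * B - col_mweight n ?w (pair_mon q + k)) < nat (d m * B - col_mweight n ?w m)"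
          using le[OF sv] by simp
        from less(1)[OF this sv] show ?thesis using st by (meson converse_rtranclp_into_rtranclp)
      qed
      have "\<forall>q\<in>?Q. \<exists>E. psubst pl_minor E = mon_eval pl_minor (pair_mon q + k) \<and> (\<forall>s\<in>supp E. standard n s \<and> (straight_step n)\<^sup>*\<^sup>* m s)"
        by (intro ballI ex)
      from bchoice[OF this] obtain E where E0: "\<forall>q\<in>?Q. psubst pl_minor (E q) = mon_eval pl_minor (pair_mon q + k) \<and>
        (\<forall>s\<in>supp (E q). standard n s \<and> (straight_step n)\<^sup>*\<^sup>* m s)" by (elim exE)
      note E = bspec[OF E0, THEN conjunct1] bspec[OF bspec[OF E0, THEN conjunct2]]
      let ?E = "\<Sum>q\<in>?Q. pconst (minor_coef n a b q) * E q"
      have "psubst pl_minor ?E = (\<Sum>q\<in>?Q. pconst (minor_coef n a b q) * pair_minor q) * mon_eval pl_minor k"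
        by (simp add: psubst_sum psubst_pconst_mult E(1) mon_eval_add mon_eval_pair_mon sum_distrib_right mult.assoc)
      also have "(\<Sum>q\<in>?Q. pconst (minor_coef n a b q) * pair_minor q) = (\<Sum>q\<in>chain_pairs n. pconst (minor_coef n a b q) * pair_minor q)"
        by (rule sum.mono_neutral_left) (auto simp: finite_chain_pairs pconst_simps)
      also have "\<dots> * mon_eval pl_minor k = mon_eval pl_minor m"
        unfolding minor_coef(1)[OF ab(1,2), symmetric] k(2) mon_eval_add mon_eval_pair_mon ..
      finally have "psubst pl_minor ?E = mon_eval pl_minor m" .
      moreover have "standard n s \<and> (straight_step n)\<^sup>*\<^sup>* m s" if "s \<in> supp ?E" for s
      proof -
        have "s \<in> (\<Union>q\<in>?Q. supp (pconst (minor_coef n a b q) * E q))"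
          using that keys_sum[of "\<lambda>q. pconst (minor_coef n a b q) * E q" ?Q] by (rule rev_subsetD)
        then obtain q where q: "q \<in> ?Q" "s \<in> supp (pconst (minor_coef n a b q) * E q)" by (rule UN_E)
        show ?thesis by (rule E(2)[OF q(1) subsetD[OF supp_pconst_mult q(2)]])
      qed
      ultimately show ?thesis by (intro exI[of _ ?E] conjI ballI) (assumption, simp_all only:)
    qed
  qed
qed

text \<open>The choice is harmless because standard monomials are independent; the case distinction
  makes a standard monomial its own expansion by definition.\<close>

definition expansion :: "nat \<Rightarrow> (nat list \<Rightarrow>\<^sub>0 nat) \<Rightarrow> nat list cpoly"
  where "expansion n m = (if standard n m then monom m 1 else
    (SOME E. psubst pl_minor E = mon_eval pl_minor m \<and> (\<forall>s\<in>supp E. standard n s \<and> (straight_step n)\<^sup>*\<^sup>* m s)))"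

lemma expansion:
  assumes "2 \<le> n" "supp m \<subseteq> pl_vars n"
  shows "psubst pl_minor (expansion n m) = mon_eval pl_minor m"
    and "s \<in> supp (expansion n m) \<Longrightarrow> standard n s" "s \<in> supp (expansion n m) \<Longrightarrow> (straight_step n)\<^sup>*\<^sup>* m s"
proof -
  have "psubst pl_minor (expansion n m) = mon_eval pl_minor m \<and> (\<forall>s\<in>supp (expansion n m). standard n s \<and> (straight_step n)\<^sup>*\<^sup>* m s)"
  proof (cases "standard n m")
    case True
    then show ?thesis unfolding expansion_def by (simp add: psubst_monom pconst_simps)
  next
    case False
    then have e: "expansion n m = (SOME E. psubst pl_minor E = mon_eval pl_minor m \<and> (\<forall>s\<in>supp E. standard n s \<and> (straight_step n)\<^sup>*\<^sup>* m s))"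
      unfolding expansion_def by (rule if_not_P)
    show ?thesis unfolding e by (rule someI_ex[OF straight_expansion[OF assms]])
  qed
  then show "psubst pl_minor (expansion n m) = mon_eval pl_minor m"
    and "s \<in> supp (expansion n m) \<Longrightarrow> standard n s" "s \<in> supp (expansion n m) \<Longrightarrow> (straight_step n)\<^sup>*\<^sup>* m s"
    by auto
qed

lemma expansion_standard: "standard n m \<Longrightarrow> expansion n m = monom m 1"
  unfolding expansion_def by simp

text \<open>Extended linearly, \<open>expansion\<close> turns an element of the ideal into a
  combination of standard monomials that vanishes on minors, hence into zero.\<close>

lemma expansion_ideal:
  assumes "2 \<le> n" "p \<in> pl_ideal n"
  shows "(\<Sum>m\<in>supp p. coef p m * coef (expansion n m) s) = 0"
proof -
  have v: "supp m \<subseteq> pl_vars n" if "m \<in> supp p" for m using assms(2) that unfolding pl_ideal_def pl_ring_def by auto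
  note ex = expansion[OF assms(1) v]
  define e where "e = (\<Sum>m\<in>supp p. pconst (coef p m) * expansion n m)"
  have "psubst pl_minor e = (\<Sum>m\<in>supp p. pconst (coef p m) * mon_eval pl_minor m)"
    unfolding e_def psubst_sum psubst_pconst_mult by (rule sum.cong) (simp_all add: ex(1))
  also have "\<dots> = psubst pl_minor p" by (rule psubst_superset[symmetric]) auto
  also have "\<dots> = 0" using assms(2) unfolding pl_ideal_def by simp
  finally have "psubst pl_minor e = 0" .
  moreover have "standard n t" if "t \<in> supp e" for t
  proof -
    have "t \<in> (\<Union>m\<in>supp p. supp (pconst (coef p m) * expansion n m))"
      using that keys_sum[of "\<lambda>m. pconst (coef p m) * expansion n m" "supp p"] unfolding e_def by (rule rev_subsetD)
    then show ?thesis using ex(2) supp_pconst_mult by (metis (no_types, lifting) UN_E subsetD)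
  qed
  ultimately have "e = 0" by (rule standard_independent[rotated])
  then have "coef e s = 0" by simp
  then show ?thesis unfolding e_def lookup_sum coef_pconst_mult .
qed

section \<open>Initial ideals\<close>

lemma ideal_generated_0: "0 \<in> ideal_generated n G"
  unfolding ideal_generated_def by (intro CollectI exI[of _ "{}"]) auto

lemma ideal_generated_mult:
  assumes "g \<in> G" "q \<in> pl_ring n"
  shows "q * g \<in> ideal_generated n G"
  unfolding ideal_generated_def
  by (intro CollectI exI[of _ "{g}"] exI[of _ "\<lambda>_. q"]) (use assms in auto)

lemma ideal_generated_add:
  assumes "x \<in> ideal_generated n G" "y \<in> ideal_generated n G"
  shows "x + y \<in> ideal_generated n G"
proof -
  obtain F1 q1 where 1: "x = (\<Sum>g\<in>F1. q1 g * g)" "finite F1" "F1 \<subseteq> G" "\<forall>g\<in>F1. q1 g \<in> pl_ring n"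
    using assms(1) unfolding ideal_generated_def by blast
  obtain F2 q2 where 2: "y = (\<Sum>g\<in>F2. q2 g * g)" "finite F2" "F2 \<subseteq> G" "\<forall>g\<in>F2. q2 g \<in> pl_ring n"
    using assms(2) unfolding ideal_generated_def by blast
  let ?F = "F1 \<union> F2"
  let ?q = "\<lambda>g. (if g \<in> F1 then q1 g else 0) + (if g \<in> F2 then q2 g else 0)"
  have "x = (\<Sum>g\<in>?F. (if g \<in> F1 then q1 g else 0) * g)"
    unfolding 1(1) by (rule sum.mono_neutral_cong_left) (use 1 2 in auto)
  moreover have "y = (\<Sum>g\<in>?F. (if g \<in> F2 then q2 g else 0) * g)"
    unfolding 2(1) by (rule sum.mono_neutral_cong_left) (use 1 2 in auto)
  ultimately have "x + y = (\<Sum>g\<in>?F. ?q g * g)" by (simp add: distrib_right sum.distrib)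
  moreover have "\<forall>g\<in>?F. ?q g \<in> pl_ring n" using 1 2 by (auto intro!: pl_ring_add simp: pl_ring_0)
  ultimately show ?thesis unfolding ideal_generated_def using 1 2 by (intro CollectI exI[of _ ?F] exI[of _ ?q]) auto
qed

lemma ideal_generated_sum: "(\<And>i. i \<in> S \<Longrightarrow> f i \<in> ideal_generated n G) \<Longrightarrow> sum f S \<in> ideal_generated n G"
  by (induction S rule: infinite_finite_induct) (auto simp: ideal_generated_0 ideal_generated_add)

text \<open>A monomial of the ring is nonstandard exactly when two incomparable variables divide it,
  and membership in an ideal generated by monomials is decided monomial by monomial.\<close>

lemma monomial_ideal_iff:
  "p \<in> monomial_ideal n \<longleftrightarrow> p \<in> pl_ring n \<and> (\<forall>m\<in>supp p. \<not> standard n m)"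
proof
  assume "p \<in> monomial_ideal n"
  then obtain F q where F: "p = (\<Sum>g\<in>F. q g * g)" "finite F" "F \<subseteq> {pl_X a * pl_X b | a b. pbw_incomparable n a b}" "\<forall>g\<in>F. q g \<in> pl_ring n"
    unfolding monomial_ideal_def ideal_generated_def by blast
  have "q g * g \<in> pl_ring n \<and> (\<forall>m\<in>supp (q g * g). \<not> standard n m)" if g: "g \<in> F" for g
  proof -
    obtain a b where ab: "g = monom (pair_mon (a, b)) (pl_sign a * pl_sign b)" "pbw_incomparable n a b"
      using F(3) g pl_X_mult by blast
    note i = incomparableD[OF ab(2)]
    have "q g * g \<in> pl_ring n"
      by (intro pl_ring_mult) (use F(4) g i ab(1) supp_pair_mon_vars[of "(a, b)"] in \<open>auto intro!: pl_ring_monom\<close>)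
    moreover have "\<not> standard n m" if m: "m \<in> supp (q g * g)" for m
    proof -
      have "m \<in> supp (g * q g)" using m by (simp add: mult.commute)
      then have "m \<in> (+) (pair_mon (a, b)) ` supp (q g)"
        unfolding ab(1) by (rule subsetD[OF supp_monom_mult])
      then show ?thesis
        by (intro incomparable_not_standard[OF ab(2)]) (auto simp: monomial_add_supp supp_pair_mon)
    qed
    ultimately show ?thesis by blast
  qed
  then show "p \<in> pl_ring n \<and> (\<forall>m\<in>supp p. \<not> standard n m)"
    using keys_sum[of "\<lambda>g. q g * g" F] unfolding F(1) by (auto intro!: pl_ring_sum)
next
  assume p: "p \<in> pl_ring n \<and> (\<forall>m\<in>supp p. \<not> standard n m)"
  have "monom m (coef p m) \<in> monomial_ideal n" if m: "m \<in> supp p" for m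
  proof -
    have "supp m \<subseteq> pl_vars n" "\<not> standard n m" using p m unfolding pl_ring_def by auto
    then obtain a b k where k: "pbw_incomparable n a b" "m = pair_mon (a, b) + k" "supp k \<subseteq> pl_vars n"
      using not_standard_split by blast
    have "monom m (coef p m) = monom k (coef p m * (pl_sign a * pl_sign b)) * (pl_X a * pl_X b)"
      unfolding pl_X_mult mult_single k(2) by (simp add: mult_ac add_ac)
    then show ?thesis unfolding monomial_ideal_def
      using ideal_generated_mult[of "pl_X a * pl_X b" "{pl_X a * pl_X b |a b. pbw_incomparable n a b}" "monom k (coef p m * (pl_sign a * pl_sign b))" n]
        k(1) pl_ring_monom[OF k(3)] by auto
  qed
  then have "(\<Sum>m\<in>supp p. monom m (coef p m)) \<in> monomial_ideal n"
    unfolding monomial_ideal_def by (rule ideal_generated_sum)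
  then show "p \<in> monomial_ideal n" using poly_sum_monoms[of "supp p" p] by simp
qed

lemma subspace_monomial_ideal: "cpoly.subspace (monomial_ideal n)"
proof (rule cpoly.subspaceI)
  show "0 \<in> monomial_ideal n" unfolding monomial_ideal_iff by (simp add: pl_ring_0)
  show "x + y \<in> monomial_ideal n" if "x \<in> monomial_ideal n" "y \<in> monomial_ideal n" for x y
    using that unfolding monomial_ideal_def by (rule ideal_generated_add)
  show "pconst c * x \<in> monomial_ideal n" if "x \<in> monomial_ideal n" for c x
    using that supp_pconst_mult[of c x] unfolding monomial_ideal_iff by (auto intro: pl_ring_pconst_mult)
qed

lemma coef_initial_part:
  "coef (initial_part n w p) m = (if m \<in> supp p \<and> (\<forall>m'\<in>supp p. mon_weight n w m \<le> mon_weight n w m') then coef p m else 0)"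
  unfolding initial_part_def by (subst coef_sum_monom) auto

text \<open>The quadratic relations suffice: their multiples produce every nonstandard monomial as
  an initial part, and straightening shows that no standard monomial can occur in an initial part.
  Conversely the initial part of \<open>rel n a b\<close> contains no standard monomial, so only the
  monomial of \<open>(a, b)\<close> remains for it.\<close>

theorem initial_space_iff:
  assumes n: "2 \<le> n"
  shows "initial_space n w (pl_ideal n) = monomial_ideal n \<longleftrightarrow> straightens n w"
proof
  assume w: "straightens n w"
  show "initial_space n w (pl_ideal n) = monomial_ideal n"
  proof
    show "initial_space n w (pl_ideal n) \<subseteq> monomial_ideal n"
      unfolding initial_space_def
    proof (rule cpoly.span_minimal[OF _ subspace_monomial_ideal], rule image_subsetI)
      fix p assume p: "p \<in> pl_ideal n"
      have v: "supp m \<subseteq> pl_vars n" if "m \<in> supp p" for m using p that unfolding pl_ideal_def pl_ring_def by auto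
      have ip: "m \<in> supp p" "\<And>m'. m' \<in> supp p \<Longrightarrow> col_mweight n w m \<le> col_mweight n w m'"
        if "m \<in> supp (initial_part n w p)" for m
        using that unfolding in_keys_iff[of m "initial_part n w p"] coef_initial_part mon_weight_eq by (auto split: if_splits)
      have "\<not> standard n m" if m: "m \<in> supp (initial_part n w p)" for m
      proof
        assume st: "standard n m"
        \<comment> \<open>If another monomial k of \<open>p\<close> contributed to m, then m would
          be reached from k by straightening and be strictly heavier, although m has least weight in
          \<open>p\<close>.\<close>
        have "coef p k * coef (expansion n k) m = (if k = m then coef p m else 0)" if k: "k \<in> supp p" for k
        proof (cases "k = m")
          case True
          then show ?thesis using st by (simp add: expansion_standard)
        next
          case False
          have "coef (expansion n k) m = 0"
          proof (rule ccontr)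
            assume "coef (expansion n k) m \<noteq> 0"
            then have "(straight_step n)\<^sup>*\<^sup>* k m" using expansion(3)[OF n v[OF k]] by (simp add: in_keys_iff)
            then have "col_mweight n w k < col_mweight n w m" using straight_steps_le(2)[OF w] False by blast
            then show False using ip(2)[OF m k] by simp
          qed
          then show ?thesis using False by simp
        qed
        then have "(\<Sum>k\<in>supp p. coef p k * coef (expansion n k) m) = (\<Sum>k\<in>supp p. if k = m then coef p m else 0)"
          by (rule sum.cong[OF refl])
        also have "\<dots> = coef p m" using ip(1)[OF m] by simp
        finally show False using expansion_ideal[OF n p, of m] ip(1)[OF m] by (simp add: in_keys_iff)
      qed
      moreover have "initial_part n w p \<in> pl_ring n" using ip(1) v unfolding pl_ring_def by blast
      ultimately show "initial_part n w p \<in> monomial_ideal n" unfolding monomial_ideal_iff by blast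
    qed
    show "monomial_ideal n \<subseteq> initial_space n w (pl_ideal n)"
    proof
      fix p assume p: "p \<in> monomial_ideal n"
      have "monom m (coef p m) \<in> initial_space n w (pl_ideal n)" if m: "m \<in> supp p" for m
      proof -
        have "supp m \<subseteq> pl_vars n" "\<not> standard n m" using p m unfolding monomial_ideal_iff pl_ring_def by auto
        then obtain a b k where k: "pbw_incomparable n a b" "m = pair_mon (a, b) + k" "supp k \<subseteq> pl_vars n"
          using not_standard_split by blast
        note ab = incomparableD[OF k(1)]
        \<comment> \<open>A multiple of the relation in which m is the unique monomial of least
          weight.\<close>
        let ?r = "monom k 1 * rel n a b"
        have r: "?r \<in> pl_ideal n"
          unfolding pl_ideal_def using rel_ideal[OF k(1)] pl_ring_monom[OF k(3)] by (simp add: pl_ring_mult psubst_mult)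
        have cr: "coef ?r (k + j) = coef (rel n a b) j" for j by (simp add: coef_monom_mult)
        have m1: "coef ?r m = 1" unfolding k(2) add.commute[of _ k] cr by (rule coef_rel(1)[OF k(1)])
        have gt: "col_mweight n w m < col_mweight n w m'" if m': "m' \<in> supp ?r" "m' \<noteq> m" for m'
        proof -
          obtain j where j: "m' = k + j" "j \<in> supp (rel n a b)" using m'(1) supp_monom_mult[of k 1 "rel n a b"] by blast
          then obtain q where q: "j = pair_mon q" "minor_coef n a b q \<noteq> 0" using coef_rel(3)[OF k(1) j(2)] m'(2) k(2) by (metis add.commute)
          have t: "straight_term n a b q" unfolding straight_term_def using k(1) q(2) by simp
          have "w a + w b < w (fst q) + w (snd q)" using w t unfolding straightens_def by blast
          then show ?thesis unfolding j(1) q(1) k(2) col_mweight_add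
            by (simp add: col_mweight_pair_mon col_mweight_pair chain_pairsD[OF straight_termD(2)[OF t]] ab)
        qed
        have "initial_part n w ?r = monom m 1"
        proof (rule poly_mapping_eqI)
          fix j
          show "coef (initial_part n w ?r) j = coef (monom m 1) j"
          proof (cases "j = m")
            case True
            have "m \<in> supp ?r" using m1 by (simp add: in_keys_iff)
            moreover have "col_mweight n w m \<le> col_mweight n w m'" if "m' \<in> supp ?r" for m'
              using gt[OF that] by (cases "m' = m") auto
            ultimately show ?thesis using True m1 unfolding coef_initial_part mon_weight_eq by simp
          next
            case False
            have "\<not> (j \<in> supp ?r \<and> (\<forall>m'\<in>supp ?r. col_mweight n w j \<le> col_mweight n w m'))"
              using gt[of j] False m1 by (metis in_keys_iff not_le zero_neq_one)
            then show ?thesis using False unfolding coef_initial_part mon_weight_eq by (auto simp: lookup_single)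
          qed
        qed
        then have "monom m 1 \<in> initial_space n w (pl_ideal n)"
          unfolding initial_space_def using r by (metis cpoly.span_base imageI)
        then have "pconst (coef p m) * monom m 1 \<in> initial_space n w (pl_ideal n)"
          unfolding initial_space_def by (rule cpoly.span_scale)
        then show ?thesis unfolding pconst_monom by simp
      qed
      then have "(\<Sum>m\<in>supp p. monom m (coef p m)) \<in> initial_space n w (pl_ideal n)"
        unfolding initial_space_def by (rule cpoly.span_sum)
      then show "p \<in> initial_space n w (pl_ideal n)" using poly_sum_monoms[of "supp p" p] by simp
    qed
  qed
next
  assume eq: "initial_space n w (pl_ideal n) = monomial_ideal n"
  show "straightens n w"
    unfolding straightens_def
  proof (intro allI impI)
    fix a b q assume t: "straight_term n a b q"
    have inc: "pbw_incomparable n a b" and mq: "minor_coef n a b q \<noteq> 0" using t unfolding straight_term_def by auto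
    note ab = incomparableD[OF inc] and qc = straight_termD(2)[OF t]
    let ?r = "rel n a b"
    have "?r \<in> pl_ideal n" unfolding pl_ideal_def using rel_ideal[OF inc] by simp
    then have "initial_part n w ?r \<in> initial_space n w (pl_ideal n)" unfolding initial_space_def by (intro cpoly.span_base imageI)
    then have ns: "\<not> standard n m" if "m \<in> supp (initial_part n w ?r)" for m using that unfolding eq monomial_ideal_iff by blast
    have q_in: "pair_mon q \<in> supp ?r" using coef_rel(2)[OF inc qc] mq by (simp add: in_keys_iff)
    have ab_in: "pair_mon (a, b) \<in> supp ?r" using coef_rel(1)[OF inc] by (simp add: in_keys_iff)
    define m0 where "m0 = arg_min_on (col_mweight n w) (supp ?r)"
    have fin: "finite (supp ?r)" "supp ?r \<noteq> {}" using ab_in by auto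
    have m0: "m0 \<in> supp ?r" "\<And>k. k \<in> supp ?r \<Longrightarrow> col_mweight n w m0 \<le> col_mweight n w k"
      unfolding m0_def using arg_min_if_finite(1)[OF fin] arg_min_least[OF fin] by auto
    have min_ns: "\<not> standard n m" if "m \<in> supp ?r" "\<And>k. k \<in> supp ?r \<Longrightarrow> col_mweight n w m \<le> col_mweight n w k" for m
      by (rule ns) (use that in \<open>simp add: in_keys_iff coef_initial_part mon_weight_eq\<close>)
    have sq: "standard n (pair_mon q')" if "minor_coef n a b q' \<noteq> 0" for q'
      using pair_mon_standard minor_coef_chain_pairs(1)[OF inc that] by blast
    have "m0 = pair_mon (a, b)"
    proof (rule ccontr)
      assume "m0 \<noteq> pair_mon (a, b)"
      then obtain q' where "m0 = pair_mon q'" "minor_coef n a b q' \<noteq> 0" using coef_rel(3)[OF inc m0(1)] by blast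
      then show False using sq min_ns[OF m0] by blast
    qed
    then have le: "col_mweight n w (pair_mon (a, b)) \<le> col_mweight n w k" if "k \<in> supp ?r" for k using m0(2)[OF that] by simp
    have "col_mweight n w (pair_mon (a, b)) < col_mweight n w (pair_mon q)"
    proof (rule ccontr)
      \<comment> \<open>In case of a tie the standard monomial of \<open>q\<close> would have least
        weight as well and occur in the initial part.\<close>
      assume "\<not> ?thesis"
      then have "col_mweight n w (pair_mon q) \<le> col_mweight n w k" if "k \<in> supp ?r" for k
        using le[OF that] by simp
      then show False using min_ns[OF q_in] sq[OF mq] by blast
    qed
    then show "w a + w b < w (fst q) + w (snd q)"
      by (simp add: col_mweight_pair_mon col_mweight_pair chain_pairsD[OF qc] ab)
  qed
qed

section \<open>Special diamond pairs\<close>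

text \<open>The alternating sum for the entries of \<open>l\<close> together with j: they occupy one
  position more than there are rows. Modulo permutations of the first block there remain the
  transpositions of the last position with position b, which carry a minus sign unless
  trivial.\<close>

lemma exchange_lists:
  assumes "length v < length l"
  shows "pl_minor l * pl_minor (j # v) = (\<Sum>b<length l. pl_minor (l[b := j]) * pl_minor (l ! b # v))"
proof -
  let ?k = "length l" and ?L = "l @ [j]"
  let ?f = "garnir_term [] v ?L (length l)"
  have len: "length ?L = Suc ?k" by simp
  have dom: "{..<length ?L} = insert ?k {..<?k}" unfolding len lessThan_Suc ..
  have "(\<Sum>\<pi> | \<pi> permutes {..<length ?L}. ?f \<pi>) = 0"
    by (rule sum_garnir_term[of _ _ ?k]) (use assms in auto)
  then have "(\<Sum>b\<in>insert ?k {..<?k}. \<Sum>q | q permutes {..<?k}. ?f (Transposition.transpose ?k b \<circ> q)) = 0"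
    unfolding dom by (subst (asm) sum_over_permutations_insert) auto
  moreover have "(\<Sum>q | q permutes {..<?k}. ?f (Transposition.transpose ?k b \<circ> q)) = of_nat (fact ?k) * ?f (Transposition.transpose ?k b)" for b
  proof -
    have "(\<Sum>q | q permutes {..<?k}. ?f (Transposition.transpose ?k b \<circ> q)) = (\<Sum>q | q permutes {..<?k}. ?f (Transposition.transpose ?k b))"
    proof (rule sum.cong)
      fix q assume "q \<in> {q. q permutes {..<?k}}"
      then show "?f (Transposition.transpose ?k b \<circ> q) = ?f (Transposition.transpose ?k b)"
        by (intro garnir_term_block[where S="{..<?k}"]) (auto simp: permutation_swap_id)
    qed simp
    also have "\<dots> = of_nat (fact ?k) * ?f (Transposition.transpose ?k b)"
      by (simp add: card_permutations[OF refl])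
    finally show ?thesis .
  qed
  ultimately have "of_nat (fact ?k) * (\<Sum>b\<in>insert ?k {..<?k}. ?f (Transposition.transpose ?k b)) = 0"
    by (simp only: sum_distrib_left)
  \<comment> \<open>Each coset contributes \<open>fact ?k\<close> equal terms; this factor is
    divided out.\<close>
  then have "pconst (1 / of_nat (fact ?k)) * (pconst (of_nat (fact ?k)) * (\<Sum>b\<in>insert ?k {..<?k}. ?f (Transposition.transpose ?k b))) = 0"
    unfolding pconst_def by (simp del: of_nat_fact)
  then have "(\<Sum>b\<in>insert ?k {..<?k}. ?f (Transposition.transpose ?k b)) = 0"
    unfolding mult.assoc[symmetric] pconst_simps(4)[symmetric] by (simp add: pconst_simps(2))
  then have s: "?f (Transposition.transpose ?k ?k) + (\<Sum>b<?k. ?f (Transposition.transpose ?k b)) = 0" by simp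
  have ids: "map (\<lambda>i. ?L ! id i) [0..<?k] = l" "map (\<lambda>i. ?L ! id i) [?k..<length ?L] = [j]"
    by (rule nth_equalityI; simp add: nth_append)+
  have "?f (Transposition.transpose ?k ?k) = pl_minor l * pl_minor (j # v)"
    unfolding garnir_term_def transpose_same by (simp only: ids sign_id of_int_1 mult_1 append_Nil append_Cons)
  moreover have "?f (Transposition.transpose ?k b) = - (pl_minor (l[b := j]) * pl_minor (l ! b # v))" if b: "b < ?k" for b
  proof -
    have m1: "map (\<lambda>i. ?L ! Transposition.transpose ?k b i) [0..<?k] = l[b := j]"
      by (rule nth_equalityI) (use b in \<open>auto simp: nth_append Transposition.transpose_def nth_list_update\<close>)
    have m2: "map (\<lambda>i. ?L ! Transposition.transpose ?k b i) [?k..<length ?L] = [l ! b]"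
      by (rule nth_equalityI) (use b in \<open>auto simp: nth_append Transposition.transpose_def\<close>)
    show ?thesis unfolding garnir_term_def m1 m2 using b by (simp add: sign_swap_id)
  qed
  ultimately show ?thesis using s by (simp add: sum_negf)
qed

text \<open>Exchanging j with an element already in \<open>B\<close> gives a minor with a repeated
  entry, hence zero. Sorting the others costs a sign, left unspecified because only nonvanishing
  coefficients matter.\<close>

lemma exchange_sets:
  assumes "finite A" "finite B" "card B \<le> card A" "j \<in> B - A"
  shows "\<exists>\<epsilon> :: nat \<Rightarrow> int. (\<forall>x. \<epsilon> x \<in> {1, -1}) \<and>
    set_minor A * set_minor B = (\<Sum>x\<in>A - B. of_int (\<epsilon> x) * (set_minor (insert j (A - {x})) * set_minor (insert x (B - {j}))))"
proof -
  let ?l = "sorted_list_of_set A" and ?v = "sorted_list_of_set (B - {j})"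
  have l: "distinct ?l" "set ?l = A" "length ?l = card A" and v: "distinct ?v" "set ?v = B - {j}" "length ?v = card B - 1"
    using assms by auto
  have bpos: "0 < card B" using assms by (metis DiffD1 card_gt_0_iff empty_iff)
  have lt: "length ?v < length ?l" using bpos assms(3) v(3) l(3) by simp
  obtain e where e: "e \<in> {1, -1}" "pl_minor (j # ?v) = of_int e * set_minor B"
  proof -
    have "distinct (j # ?v)" "set (j # ?v) = B" using v assms by auto
    then show ?thesis using pl_minor_set_minor that by metis
  qed
  have lnth: "?l ! b \<in> A" if "b < card A" for b using that l nth_mem by metis
  have ex: "\<exists>e'. e' \<in> {1, -1 :: int} \<and> pl_minor (?l[b := j]) * pl_minor (?l ! b # ?v)
      = of_int e' * (set_minor (insert j (A - {?l ! b})) * set_minor (insert (?l ! b) (B - {j})))" if b: "b < card A" "?l ! b \<notin> B" for b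
  proof -
    have d1: "distinct (?l[b := j])" using l assms(4) by (intro distinct_list_update) auto
    have s1: "set (?l[b := j]) = insert j (A - {?l ! b})" using set_update_distinct[OF l(1), of b j] b l by simp
    have d2: "distinct (?l ! b # ?v)" "set (?l ! b # ?v) = insert (?l ! b) (B - {j})" using v b by auto
    obtain e1 where e1: "e1 \<in> {1, -1}" "pl_minor (?l[b := j]) = of_int e1 * set_minor (insert j (A - {?l ! b}))"
      using pl_minor_set_minor[OF d1] s1 by metis
    obtain e2 where e2: "e2 \<in> {1, -1}" "pl_minor (?l ! b # ?v) = of_int e2 * set_minor (insert (?l ! b) (B - {j}))"
      using pl_minor_set_minor[OF d2(1)] d2(2) by metis
    show ?thesis by (rule exI[of _ "e1 * e2"]) (use e1 e2 in auto)
  qed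
  define idx where "idx x = (THE b. b < card A \<and> ?l ! b = x)" for x
  have idx: "idx (?l ! b) = b" if "b < card A" for b
    unfolding idx_def using that l by (intro the_equality) (auto simp: nth_eq_iff_index_eq)
  have "\<forall>b\<in>{b. b < card A \<and> ?l ! b \<notin> B}. \<exists>e'. e' \<in> {1, -1 :: int} \<and> pl_minor (?l[b := j]) * pl_minor (?l ! b # ?v)
      = of_int e' * (set_minor (insert j (A - {?l ! b})) * set_minor (insert (?l ! b) (B - {j})))" using ex by blast
  from bchoice[OF this] obtain E where E0: "\<forall>b\<in>{b. b < card A \<and> ?l ! b \<notin> B}. E b \<in> {1, -1 :: int} \<and> pl_minor (?l[b := j]) * pl_minor (?l ! b # ?v)
      = of_int (E b) * (set_minor (insert j (A - {?l ! b})) * set_minor (insert (?l ! b) (B - {j})))" by (elim exE)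
  define \<epsilon> where "\<epsilon> x = (if x \<in> A - B then e * E (idx x) else 1)" for x
  have img: "(\<lambda>b. ?l ! b) ` {b. b < card A \<and> ?l ! b \<notin> B} = A - B"
  proof
    show "A - B \<subseteq> (\<lambda>b. ?l ! b) ` {b. b < card A \<and> ?l ! b \<notin> B}"
    proof
      fix x assume "x \<in> A - B"
      then obtain b where "b < length ?l" "?l ! b = x" using l(2) by (metis DiffD1 in_set_conv_nth)
      then show "x \<in> (\<lambda>b. ?l ! b) ` {b. b < card A \<and> ?l ! b \<notin> B}" using \<open>x \<in> A - B\<close> l(3) by auto
    qed
  qed (use lnth in auto)
  have inj: "inj_on (\<lambda>b. ?l ! b) {b. b < card A \<and> ?l ! b \<notin> B}" using idx by (intro inj_on_inverseI[of _ idx]) auto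
  have e2: "of_int e * (of_int e * p) = (p :: (nat \<times> nat) cpoly)" for p using e(1) by auto
  have "set_minor A * set_minor B = of_int e * (pl_minor ?l * pl_minor (j # ?v))"
  proof -
    have "of_int e * (set_minor A * (of_int e * set_minor B)) = of_int e * (of_int e * (set_minor A * set_minor B))"
      by (simp only: mult_ac)
    then show ?thesis unfolding e(2) set_minor_def[of A, symmetric] e2 by (rule sym)
  qed
  also have "pl_minor ?l * pl_minor (j # ?v) = (\<Sum>b<card A. pl_minor (?l[b := j]) * pl_minor (?l ! b # ?v))"
    unfolding exchange_lists[OF lt] l(3) ..
  also have "\<dots> = (\<Sum>b\<in>{b. b < card A \<and> ?l ! b \<notin> B}. pl_minor (?l[b := j]) * pl_minor (?l ! b # ?v))"
  proof (rule sum.mono_neutral_right)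
    show "\<forall>b\<in>{..<card A} - {b. b < card A \<and> ?l ! b \<notin> B}. pl_minor (?l[b := j]) * pl_minor (?l ! b # ?v) = 0"
    proof
      fix b assume "b \<in> {..<card A} - {b. b < card A \<and> ?l ! b \<notin> B}"
      then have b: "b < card A" "?l ! b \<in> B" by auto
      then have "?l ! b \<noteq> j" using lnth assms(4) by auto
      then have "\<not> distinct (?l ! b # ?v)" using b v by auto
      then show "pl_minor (?l[b := j]) * pl_minor (?l ! b # ?v) = 0" using pl_minor_not_distinct by (metis mult_zero_right)
    qed
  qed auto
  also have "of_int e * \<dots> = (\<Sum>b\<in>{b. b < card A \<and> ?l ! b \<notin> B}.
      of_int (\<epsilon> (?l ! b)) * (set_minor (insert j (A - {?l ! b})) * set_minor (insert (?l ! b) (B - {j}))))"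
    unfolding sum_distrib_left
  proof (rule sum.cong)
    fix b assume b: "b \<in> {b. b < card A \<and> ?l ! b \<notin> B}"
    have "\<epsilon> (?l ! b) = e * E b" unfolding \<epsilon>_def using b idx lnth by auto
    then show "of_int e * (pl_minor (?l[b := j]) * pl_minor (?l ! b # ?v)) =
      of_int (\<epsilon> (?l ! b)) * (set_minor (insert j (A - {?l ! b})) * set_minor (insert (?l ! b) (B - {j})))"
      using bspec[OF E0 b, THEN conjunct2] by (simp only: of_int_mult mult.assoc)
  qed simp
  also have "\<dots> = (\<Sum>x\<in>A - B. of_int (\<epsilon> x) * (set_minor (insert j (A - {x})) * set_minor (insert x (B - {j}))))"
    unfolding img[symmetric] sum.reindex[OF inj] by simp
  finally have "set_minor A * set_minor B = (\<Sum>x\<in>A - B. of_int (\<epsilon> x) * (set_minor (insert j (A - {x})) * set_minor (insert x (B - {j}))))" .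
  moreover have "\<epsilon> x \<in> {1, -1}" for x
  proof (cases "x \<in> A - B")
    case True
    then obtain b where b: "b \<in> {b. b < card A \<and> ?l ! b \<notin> B}" "x = ?l ! b" using img by auto
    have "E b \<in> {1, -1}" using bspec[OF E0 b(1), THEN conjunct1] .
    then show ?thesis unfolding \<epsilon>_def using True b idx e(1) by auto
  next
    case False
    then have "\<epsilon> x = 1" unfolding \<epsilon>_def by (rule if_not_P)
    then show ?thesis by simp
  qed
  ultimately show ?thesis by blast
qed

text \<open>Besides the common part, \<open>H\<close> takes two of the points s, t, j, j', where j'
  = j if \<open>B - A\<close> has one element only. The possible choices are the two trivial splits
  and the exchanges of j with s or with t.\<close>

lemma two_point_split:
  assumes fin: "finite A" "finite B" and D: "A - B = {s, t}" "s \<noteq> t" and j: "j \<in> B - A" and card: "card B \<le> card A"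
    and G: "G \<union> H = A \<union> B" "G \<inter> H = A \<inter> B" "card H = card A"
  shows "H = A \<and> G = B \<or> H = B \<and> G = A \<or>
    (\<exists>x\<in>{s, t}. H = insert j (A - {x}) \<and> G = insert x (B - {j}) \<or> G = insert j (A - {x}) \<and> H = insert x (B - {j}))"
proof -
  define I where "I = A \<inter> B"
  have fI: "finite I" unfolding I_def using fin by simp
  have cA: "card A = card I + 2"
    using card_Int_Diff[OF fin(1), of B] D unfolding I_def by simp
  have "card B = card I + card (B - A)" using card_Int_Diff[OF fin(2), of A] unfolding I_def by (simp add: Int_commute)
  then have "card (B - A) \<le> 2" using cA card by simp
  then have "card (B - A - {j}) \<le> 1" using j fin by simp
  then obtain j' where E: "B - A = {j, j'}" 
  proof (cases "B - A - {j} = {}")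
    case True then show ?thesis using j that[of j] by auto
  next
    case False
    then have "card (B - A - {j}) = 1" using \<open>card (B - A - {j}) \<le> 1\<close> fin
      by (metis One_nat_def card_0_eq finite_Diff le_SucE le_zero_eq)
    then obtain j' where "B - A - {j} = {j'}" by (rule card_1_singletonE)
    then show ?thesis using j that[of j'] by auto
  qed
  have A: "A = I \<union> {s, t}" and B: "B = I \<union> {j, j'}" unfolding I_def using D E by auto
  have dis: "s \<notin> I" "t \<notin> I" "j \<notin> I" "j' \<notin> I" "s \<noteq> j" "s \<noteq> j'" "t \<noteq> j" "t \<noteq> j'" unfolding I_def using D E by auto
  have IH: "I \<subseteq> H" "I \<subseteq> G" using G(2) unfolding I_def by auto
  have fH: "finite H" using G(1) fin by (metis finite_Un)
  have "card (H - I) = 2" using card_Diff_subset[OF fI IH(1)] G(3) cA by simp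
  then obtain p q where pq: "H - I = {p, q}" "p \<noteq> q" by (auto simp: card_2_iff)
  have H: "H = I \<union> {p, q}" using pq IH by auto
  have pI: "p \<notin> I" "q \<notin> I" using pq by auto
  have "H \<subseteq> I \<union> {s, t, j, j'}" using G(1) A B by auto
  then have pin: "p \<in> {s, t, j, j'}" "q \<in> {s, t, j, j'}" using pq pI by auto
  have Gx: "x \<in> G \<longleftrightarrow> x \<in> I \<or> x \<in> {s, t, j, j'} \<and> x \<notin> {p, q}" for x
  proof -
    have "x \<in> G \<or> x \<in> H \<longleftrightarrow> x \<in> I \<union> {s, t, j, j'}" using G(1) A B by auto
    moreover have "x \<in> G \<and> x \<in> H \<longleftrightarrow> x \<in> I" using G(2) I_def by auto
    ultimately show ?thesis using H by auto
  qed
  have Ge: "G = I \<union> ({s, t, j, j'} - {p, q})" using Gx by auto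
  have HG: "H = I \<union> Z" "G = I \<union> ({s, t, j, j'} - Z)" if "{p, q} = Z" for Z using H Ge that by auto
  have Ax: "insert j (A - {s}) = I \<union> {t, j}" "insert j (A - {t}) = I \<union> {s, j}"
    unfolding A using dis D(2) by auto
  have Bs: "insert s (B - {j}) = I \<union> ({s, j'} - {j})" "insert t (B - {j}) = I \<union> ({t, j'} - {j})"
    unfolding B using dis by auto
  consider (1) "{p, q} = {s, t}" | (2) "{p, q} = {j, j'}" "j \<noteq> j'" | (3) "{p, q} = {s, j}" | (4) "{p, q} = {t, j}"
    | (5) "{p, q} = {s, j'}" "j \<noteq> j'" | (6) "{p, q} = {t, j'}" "j \<noteq> j'"
    using pin pq(2) by (auto simp: doubleton_eq_iff)
  then show ?thesis
  proof cases
    case 1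
    have "{s, t, j, j'} - {s, t} = {j, j'}" using dis by auto
    then show ?thesis using HG[OF 1] A B by simp
  next
    case 2
    have "{s, t, j, j'} - {j, j'} = {s, t}" using dis by auto
    then show ?thesis using HG[OF 2(1)] A B by simp
  next
    case 3
    have "{s, t, j, j'} - {s, j} = {t, j'} - {j}" using dis D(2) by auto
    then have "H = insert j (A - {t}) \<and> G = insert t (B - {j})" using HG[OF 3] Ax Bs by simp
    then show ?thesis by blast
  next
    case 4
    have "{s, t, j, j'} - {t, j} = {s, j'} - {j}" using dis D(2) by auto
    then have "H = insert j (A - {s}) \<and> G = insert s (B - {j})" using HG[OF 4] Ax Bs by simp
    then show ?thesis by blast
  next
    case 5
    have "{s, t, j, j'} - {s, j'} = {t, j}" "{s, j'} - {j} = {s, j'}" using dis D(2) 5(2) by auto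
    then have "G = insert j (A - {s}) \<and> H = insert s (B - {j})" using HG[OF 5(1)] Ax Bs by simp
    then show ?thesis by blast
  next
    case 6
    have "{s, t, j, j'} - {t, j'} = {s, j}" "{t, j'} - {j} = {t, j'}" using dis D(2) 6(2) by auto
    then have "G = insert j (A - {t}) \<and> H = insert t (B - {j})" using HG[OF 6(1)] Ax Bs by simp
    then show ?thesis by blast
  qed
qed

lemma coef_cell_mon_maximal:
  assumes a: "\<alpha> \<in> pbw_columns n" and "s < t"
  shows "coef (cell_mon \<alpha>) (s, t) = (if (s, t) \<in> maximal_elems (col_ideal n \<alpha>) then 1 else 0)"
proof -
  have "(s, t) \<in> maximal_elems (col_ideal n \<alpha>) \<longleftrightarrow> (s, t) \<in> cells \<alpha>"
  proof
    assume c: "(s, t) \<in> cells \<alpha>"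
    then obtain r where r: "r < length \<alpha>" "s = Suc r" "t = \<alpha> ! r" unfolding cells_def by auto
    then have "length \<alpha> < t" using pbw_columnsD(5)[OF a, of r] assms(2) by (cases "\<alpha> ! r \<le> length \<alpha>") auto
    then show "(s, t) \<in> maximal_elems (col_ideal n \<alpha>)" using maximal_col_ideal(2)[OF a c] by simp
  qed (rule maximal_col_ideal(1)[OF a])
  moreover have "coef (cell_mon \<alpha>) (s, t) \<noteq> 0 \<longleftrightarrow> (s, t) \<in> cells \<alpha>" unfolding supp_cell_mon[symmetric] in_keys_iff ..
  ultimately show ?thesis by (auto simp: coef_cell_mon split: if_splits)
qed

text \<open>Integer-valued so that differences can be formed. Maximal elements on the diagonal are
  left out because they leave the entry of their row unchanged.\<close>

definition off_max :: "nat \<Rightarrow> nat list \<Rightarrow> nat \<times> nat \<Rightarrow> int"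
  where "off_max n \<alpha> p = (if fst p < snd p \<and> p \<in> maximal_elems (col_ideal n \<alpha>) then 1 else 0)"

text \<open>The content of a column, read off from the off-diagonal maximal elements \<open>(s, t)\<close> of its
  ideal: each of them replaces the entry \<open>s\<close> of \<open>1, \<dots>, k\<close> by \<open>t\<close>.\<close>

lemma count_column:
  assumes a: "\<alpha> \<in> pbw_columns n"
  shows "int (count (mset \<alpha>) v) = (if 1 \<le> v \<and> v \<le> length \<alpha> then 1 else 0)
    + (\<Sum>s\<le>n. off_max n \<alpha> (s, v)) - (\<Sum>t\<le>n. off_max n \<alpha> (v, t))"
proof -
  note D = pbw_columnsD[OF a]
  let ?c = "\<lambda>s t. int (coef (cell_mon \<alpha>) (s, t))"
  have below: "?c s t = 0" if "t < s" for s t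
  proof -
    have "(s, t) \<notin> cells \<alpha>" using that pbw_columns_ge[OF a] unfolding cells_def by fastforce
    then show ?thesis unfolding supp_cell_mon[symmetric] by (simp add: in_keys_iff)
  qed
  have c: "?c s t = off_max n \<alpha> (s, t) + (if s = t then ?c s s else 0)" for s t
    using below[of t s] coef_cell_mon_maximal[OF a, of s t] unfolding off_max_def by (cases s t rule: linorder_cases) auto
  have beyond: "?c s t = 0" if "n < s \<or> n < t" for s t
  proof (rule ccontr)
    assume "?c s t \<noteq> 0"
    then have s: "1 \<le> s" "s \<le> length \<alpha>" "\<alpha> ! (s - 1) = t" by (auto simp: coef_cell_mon split: if_splits)
    then have "s - 1 < length \<alpha>" by linarith
    then show False using that s D(2) D(4)[of "s - 1"] by simp
  qed
  have row: "(\<Sum>t\<le>n. ?c v t) = (if 1 \<le> v \<and> v \<le> length \<alpha> then 1 else 0)"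
  proof (cases "1 \<le> v \<and> v \<le> length \<alpha>")
    case True
    then have "\<alpha> ! (v - 1) \<le> n" using D(4)[of "v - 1"] by auto
    then have "(\<Sum>t\<le>n. ?c v t) = (\<Sum>t\<le>n. if t = \<alpha> ! (v - 1) then 1 else 0)"
      by (intro sum.cong) (use True in \<open>auto simp: coef_cell_mon\<close>)
    also have "\<dots> = 1" using \<open>\<alpha> ! (v - 1) \<le> n\<close> by simp
    finally show ?thesis using True by simp
  next
    case False
    then show ?thesis by (auto simp: coef_cell_mon)
  qed
  have col: "(\<Sum>s\<le>n. ?c s v) = int (count (mset \<alpha>) v)"
  proof -
    have "entry_count v (cell_mon \<alpha>) = (\<Sum>q\<in>{..n} \<times> {..n}. int (coef (cell_mon \<alpha>) q) * (if snd q = v then 1 else 0))"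
      unfolding entry_count_def
    proof (subst mweight_superset[of "{..n} \<times> {..n}"])
      show "supp (cell_mon \<alpha>) \<subseteq> {..n} \<times> {..n}"
      proof
        fix q assume "q \<in> supp (cell_mon \<alpha>)"
        then show "q \<in> {..n} \<times> {..n}" using beyond[of "fst q" "snd q"] by (cases q) (auto simp: in_keys_iff not_less[symmetric])
      qed
    qed auto
    also have "\<dots> = (\<Sum>s\<le>n. \<Sum>t\<le>n. ?c s t * (if t = v then 1 else 0))" by (simp add: sum.cartesian_product case_prod_beta)
    also have "\<dots> = (\<Sum>s\<le>n. ?c s v)"
    proof (rule sum.cong)
      fix s
      have "(\<Sum>t\<le>n. ?c s t * (if t = v then 1 else 0)) = (\<Sum>t\<le>n. if t = v then ?c s v else 0)" by (rule sum.cong) auto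
      also have "\<dots> = ?c s v" using beyond[of s v] by auto
      finally show "(\<Sum>t\<le>n. ?c s t * (if t = v then 1 else 0)) = ?c s v" .
    qed simp
    finally show ?thesis unfolding entry_count_cell_mon by simp
  qed
  have "(\<Sum>s\<le>n. ?c s v) = (\<Sum>s\<le>n. off_max n \<alpha> (s, v)) + (\<Sum>s\<le>n. if s = v then ?c v v else 0)"
    unfolding sum.distrib[symmetric]
  proof (rule sum.cong)
    fix s show "?c s v = off_max n \<alpha> (s, v) + (if s = v then ?c v v else 0)" using c[of s v] by (cases "s = v") simp_all
  qed simp
  moreover have "(\<Sum>t\<le>n. ?c v t) = (\<Sum>t\<le>n. off_max n \<alpha> (v, t)) + (\<Sum>t\<le>n. if t = v then ?c v v else 0)"
    unfolding sum.distrib[symmetric]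
  proof (rule sum.cong)
    fix t show "?c v t = off_max n \<alpha> (v, t) + (if t = v then ?c v v else 0)" using c[of v t] by (cases "t = v") simp_all
  qed simp
  ultimately show ?thesis using row col by simp
qed

lemma tri_iff: "(s, t) \<in> tri n \<longleftrightarrow> 1 \<le> s \<and> s \<le> t \<and> t \<le> n \<and> (s, t) \<noteq> (1, 1) \<and> (s, t) \<noteq> (n, n)"
  unfolding tri_def by auto

text \<open>The configuration of a special diamond: with \<open>C = A \<inter> B\<close>, the ideals \<open>A\<close>, \<open>B\<close> arise from
  \<open>C\<close> by adding the two upper covers of the maximal element \<open>(s, t)\<close> of \<open>C\<close>; the ideal \<open>D\<close>
  contains in addition their join.\<close>

locale special_diamond =
  fixes n a b s t c d
  assumes n: "2 \<le> n" and a: "a \<in> pbw_columns n" and b: "b \<in> pbw_columns n"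
    and st: "s < t"
    and AB: "col_ideal n a - col_ideal n b = {(Suc s, t)}" and BA: "col_ideal n b - col_ideal n a = {(s, Suc t)}"
    and c: "c \<in> pbw_columns n" and C_eq: "col_ideal n c = col_ideal n a \<inter> col_ideal n b"
    and d: "d \<in> pbw_columns n" and D_eq: "col_ideal n d = insert (Suc s, Suc t) (col_ideal n a \<union> col_ideal n b)"
begin

abbreviation "A \<equiv> col_ideal n a"
abbreviation "B \<equiv> col_ideal n b"
abbreviation "C \<equiv> col_ideal n c"
abbreviation "D \<equiv> col_ideal n d"
abbreviation "P \<equiv> (Suc s, t)"
abbreviation "Q \<equiv> (s, Suc t)"
abbreviation "R \<equiv> (Suc s, Suc t)"

lemma downA: "p \<in> A \<Longrightarrow> q \<in> tri n \<Longrightarrow> q \<le> p \<Longrightarrow> q \<in> A"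
  and downB: "p \<in> B \<Longrightarrow> q \<in> tri n \<Longrightarrow> q \<le> p \<Longrightarrow> q \<in> B"
  and downC: "p \<in> C \<Longrightarrow> q \<in> tri n \<Longrightarrow> q \<le> p \<Longrightarrow> q \<in> C"
  using order_ideals_down[OF col_ideal_order_ideal] by blast+

lemma sub_tri: "A \<subseteq> tri n" "B \<subseteq> tri n" "C \<subseteq> tri n" "D \<subseteq> tri n"
  using order_ideals_sub[OF col_ideal_order_ideal] by blast+

lemma PQ_mem: "P \<in> A" "P \<notin> B" "Q \<in> B" "Q \<notin> A"
  using AB BA by auto

lemma bounds: "1 \<le> s" "Suc t \<le> n"
  using PQ_mem sub_tri by (auto simp: tri_iff)

lemma R_notin: "R \<notin> A" "R \<notin> B"
proof -
  have "P \<in> tri n" "Q \<in> tri n" using PQ_mem sub_tri by auto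
  moreover have "P \<le> R" "Q \<le> R" by auto
  ultimately show "R \<notin> A" "R \<notin> B" using downA downB PQ_mem by blast+
qed

lemma st_mem: "(s, t) \<in> C"
proof -
  have "(s, t) \<in> tri n" using st bounds by (auto simp: tri_iff)
  moreover have "(s, t) \<le> P" "(s, t) \<le> Q" by auto
  ultimately have "(s, t) \<in> A" "(s, t) \<in> B" using downA downB PQ_mem by blast+
  then show ?thesis unfolding C_eq by simp
qed

lemma A_eq: "A = insert P C" and B_eq: "B = insert Q C" and D_eq': "D = insert R (insert P (insert Q C))"
  using AB BA unfolding D_eq C_eq by blast+

lemma notin_C: "P \<notin> C" "Q \<notin> C" "R \<notin> C"
  using PQ_mem R_notin unfolding C_eq by auto

lemma below_R: "p \<le> R \<Longrightarrow> p \<noteq> R \<Longrightarrow> p \<le> P \<or> p \<le> Q"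
  by (cases p) auto

lemma not_above_C:
  assumes "x \<in> C" "p \<in> {P, Q, R}"
  shows "\<not> p \<le> x"
proof
  assume "p \<le> x"
  moreover have "p \<in> tri n" using assms(2) PQ_mem sub_tri D_eq' by blast
  ultimately have "p \<in> C" using downC assms(1) by blast
  then show False using assms(2) notin_C by blast
qed

lemma max_st: "(s, t) \<in> maximal_elems C"
  unfolding maximal_elems_def
proof (intro CollectI conjI ballI impI)
  fix q assume q: "q \<in> C" "(s, t) \<le> q"
  show "q = (s, t)"
  proof (rule ccontr)
    assume "q \<noteq> (s, t)"
    then have "P \<le> q \<or> Q \<le> q" using q(2) by (cases q) auto
    then show False using not_above_C[OF q(1)] by blast
  qed
qed (rule st_mem)

lemma max_PQR: "P \<in> maximal_elems A" "Q \<in> maximal_elems B" "R \<in> maximal_elems D"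
  "P \<notin> maximal_elems D" "Q \<notin> maximal_elems D" "P \<notin> maximal_elems B" "P \<notin> maximal_elems C"
  "Q \<notin> maximal_elems A" "Q \<notin> maximal_elems C"
  "R \<notin> maximal_elems A" "R \<notin> maximal_elems B" "R \<notin> maximal_elems C"
proof -
  have C: "\<not> P \<le> x" "\<not> Q \<le> x" "\<not> R \<le> x" if "x \<in> C" for x using not_above_C[OF that] by auto
  show "P \<in> maximal_elems A" unfolding maximal_elems_def A_eq using C by blast
  show "Q \<in> maximal_elems B" unfolding maximal_elems_def B_eq using C by blast
  show "R \<in> maximal_elems D" unfolding maximal_elems_def D_eq' using C by auto
  have "x \<notin> maximal_elems D" if "x \<le> R" "x \<noteq> R" for x
  proof
    have "R \<in> D" unfolding D_eq' by simp
    moreover assume "x \<in> maximal_elems D"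
    ultimately have "R = x" using that(1) unfolding maximal_elems_def by blast
    then show False using that(2) by simp
  qed
  then show "P \<notin> maximal_elems D" "Q \<notin> maximal_elems D" by simp_all
  show "P \<notin> maximal_elems B" "P \<notin> maximal_elems C" "Q \<notin> maximal_elems A" "Q \<notin> maximal_elems C"
    "R \<notin> maximal_elems A" "R \<notin> maximal_elems B" "R \<notin> maximal_elems C"
    using PQ_mem R_notin notin_C unfolding maximal_elems_def by blast+
qed

text \<open>Adding an element on top removes from the maximal elements precisely those below it;
  below R, apart from R itself, is the same as below P or below Q.\<close>

lemma max_other:
  assumes "p \<notin> {P, Q, R}"
  shows "p \<in> maximal_elems A \<longleftrightarrow> p \<in> maximal_elems C \<and> \<not> p \<le> P"
    and "p \<in> maximal_elems B \<longleftrightarrow> p \<in> maximal_elems C \<and> \<not> p \<le> Q"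
    and "p \<in> maximal_elems D \<longleftrightarrow> p \<in> maximal_elems C \<and> \<not> p \<le> P \<and> \<not> p \<le> Q"
proof -
  show "p \<in> maximal_elems A \<longleftrightarrow> p \<in> maximal_elems C \<and> \<not> p \<le> P"
    using assms unfolding maximal_elems_def A_eq by auto
  show "p \<in> maximal_elems B \<longleftrightarrow> p \<in> maximal_elems C \<and> \<not> p \<le> Q"
    using assms unfolding maximal_elems_def B_eq by auto
  have "p \<le> R \<longleftrightarrow> p \<le> P \<or> p \<le> Q"
    using below_R[of p] assms order_trans[of p P R] order_trans[of p Q R] by auto
  then show "p \<in> maximal_elems D \<longleftrightarrow> p \<in> maximal_elems C \<and> \<not> p \<le> P \<and> \<not> p \<le> Q"
    using assms unfolding maximal_elems_def D_eq' by auto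
qed

text \<open>The elements strictly below P lie below \<open>(s, t)\<close> or below
  \<open>(Suc s, t - 1)\<close>, and these are in \<open>C\<close> as far as they belong to the
  triangle; similarly for Q.\<close>

lemma max_C_below:
  assumes "p \<in> maximal_elems C"
  shows "p \<le> P \<longleftrightarrow> p = (s, t) \<or> p = (Suc s, t - 1)" "p \<le> Q \<longleftrightarrow> p = (s, t) \<or> p = (s - 1, Suc t)"
proof -
  have pC: "p \<in> C" and mx: "\<And>q. q \<in> C \<Longrightarrow> p \<le> q \<Longrightarrow> q = p" using assms unfolding maximal_elems_def by auto
  obtain p1 p2 where p: "p = (p1, p2)" by (cases p)
  have tp: "p \<in> tri n" using pC sub_tri by auto
  show "p \<le> P \<longleftrightarrow> p = (s, t) \<or> p = (Suc s, t - 1)"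
  proof
    assume le: "p \<le> P"
    show "p = (s, t) \<or> p = (Suc s, t - 1)"
    proof (cases "p \<le> (s, t)")
      case True
      then show ?thesis using mx[OF st_mem] by simp
    next
      case False
      then have p1: "p1 = Suc s" "p2 \<le> t" using le p by auto
      have "p \<noteq> P" using pC notin_C by auto
      then have p2: "p2 \<le> t - 1" "p2 < t" using p1 p by auto
      have "(Suc s, t - 1) \<in> tri n" using tp p1 p2 bounds unfolding p by (auto simp: tri_iff)
      moreover have "(Suc s, t - 1) \<le> P" by auto
      ultimately have "(Suc s, t - 1) \<in> A" using downA PQ_mem by blast
      moreover have "(Suc s, t - 1) \<noteq> P" using p2 by auto
      ultimately have "(Suc s, t - 1) \<in> C" unfolding A_eq by blast
      moreover have "p \<le> (Suc s, t - 1)" using p p1 p2 by simp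
      ultimately show ?thesis using mx by metis
    qed
  qed auto
  show "p \<le> Q \<longleftrightarrow> p = (s, t) \<or> p = (s - 1, Suc t)"
  proof
    assume le: "p \<le> Q"
    show "p = (s, t) \<or> p = (s - 1, Suc t)"
    proof (cases "p \<le> (s, t)")
      case True
      then show ?thesis using mx[OF st_mem] by simp
    next
      case False
      then have p1: "p2 = Suc t" "p1 \<le> s" using le p by auto
      have "p \<noteq> Q" using pC notin_C by auto
      then have p2: "p1 \<le> s - 1" "p1 < s" using p1 p by auto
      have "(s - 1, Suc t) \<in> tri n" using tp p1 p2 bounds st unfolding p by (auto simp: tri_iff)
      moreover have "(s - 1, Suc t) \<le> Q" by auto
      ultimately have "(s - 1, Suc t) \<in> B" using downB PQ_mem by blast
      moreover have "(s - 1, Suc t) \<noteq> Q" using p2 by auto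
      ultimately have "(s - 1, Suc t) \<in> C" unfolding B_eq by blast
      moreover have "p \<le> (s - 1, Suc t)" using p p1 p2 by simp
      ultimately show ?thesis using mx by metis
    qed
  qed auto
qed

lemma length_mem: "x \<in> pbw_columns n \<Longrightarrow> 1 \<le> v \<and> v \<le> length x \<longleftrightarrow> v = 1 \<or> (v, v) \<in> col_ideal n x"
  using col_ideal_diag[of x n v] pbw_columnsD(1)[of x n] by auto

text \<open>The side condition \<open>Suc s < t\<close> separates the case where P lies on the
  diagonal; there it affects the length of \<open>a\<close> and not the off-diagonal maximal
  elements.\<close>

lemma off_max_sum:
  "off_max n c p + off_max n d p = off_max n a p + off_max n b p
    + (if p = (s, t) then 1 else 0) + (if p = R then 1 else 0) - (if p = P \<and> Suc s < t then 1 else 0) - (if p = Q then 1 else 0)"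
proof (cases "p \<in> {P, Q, R}")
  case True
  then show ?thesis using max_PQR st unfolding off_max_def by (elim insertE emptyE) auto
next
  case F: False
  show ?thesis
  proof (cases "p = (s, t)")
    case True
    then show ?thesis using max_st max_other[OF F] F st unfolding off_max_def by auto
  next
    case False
    have "p \<in> maximal_elems C \<Longrightarrow> \<not> (p \<le> P \<and> p \<le> Q)"
      using max_C_below[of p] False by auto
    then show ?thesis using max_other[OF F] F False unfolding off_max_def by auto
  qed
qed

lemma length_sum: "(if 1 \<le> v \<and> v \<le> length c then 1 else 0) + (if 1 \<le> v \<and> v \<le> length d then 1 else 0)
    = (if 1 \<le> v \<and> v \<le> length a then 1 else 0) + (if 1 \<le> v \<and> v \<le> length b then 1 else (0::int))"
proof -
  have "(v, v) \<noteq> Q" "(v, v) \<in> D \<longleftrightarrow> (v, v) \<in> A \<or> (v, v) \<in> B"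
  proof -
    have "(v, v) \<noteq> R \<or> s = t" by auto
    then show "(v, v) \<noteq> Q" "(v, v) \<in> D \<longleftrightarrow> (v, v) \<in> A \<or> (v, v) \<in> B" using st unfolding D_eq by auto
  qed
  then show ?thesis unfolding length_mem[OF a] length_mem[OF b] length_mem[OF c] length_mem[OF d] C_eq by auto
qed

text \<open>In passing from \<open>(a, b)\<close> to \<open>(c, d)\<close> the replacements of Suc s
  by t and of s by Suc t give way to those of s by t and of Suc s by Suc t. The same entries are
  removed and inserted.\<close>

lemma same_content_cd: "same_content (c, d) (a, b)"
  unfolding same_content_def
proof (rule multiset_eqI)
  fix v
  let ?i = "\<lambda>Pr. if Pr then 1 else (0::int)"
  have delta: "(\<Sum>x\<le>n. ?i (x = y \<and> Pr)) = ?i (y \<le> n \<and> Pr)" for y Pr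
    by (cases Pr) simp_all
  have col: "(\<Sum>x\<le>n. off_max n c (x, v)) + (\<Sum>x\<le>n. off_max n d (x, v))
     = (\<Sum>x\<le>n. off_max n a (x, v)) + (\<Sum>x\<le>n. off_max n b (x, v))
      + ?i (v = t) + ?i (v = Suc t) - ?i (v = t \<and> Suc s < t) - ?i (v = Suc t)"
  proof -
    have "(\<Sum>x\<le>n. off_max n c (x, v)) + (\<Sum>x\<le>n. off_max n d (x, v))
     = (\<Sum>x\<le>n. off_max n a (x, v) + off_max n b (x, v) + ?i (x = s \<and> v = t) + ?i (x = Suc s \<and> v = Suc t)
         - ?i (x = Suc s \<and> v = t \<and> Suc s < t) - ?i (x = s \<and> v = Suc t))"
      unfolding sum.distrib[symmetric] off_max_sum by (rule sum.cong) (simp_all add: conj_ac)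
    also have "\<dots> = (\<Sum>x\<le>n. off_max n a (x, v)) + (\<Sum>x\<le>n. off_max n b (x, v)) + ?i (s \<le> n \<and> v = t) + ?i (Suc s \<le> n \<and> v = Suc t)
      - ?i (Suc s \<le> n \<and> v = t \<and> Suc s < t) - ?i (s \<le> n \<and> v = Suc t)"
      unfolding sum.distrib sum_subtractf delta ..
    moreover have "s \<le> n" "Suc s \<le> n" "s - 1 \<le> n" "t \<le> n" "t - 1 \<le> n" "Suc t \<le> n" using bounds st by linarith+
    ultimately show ?thesis by simp
  qed
  have row: "(\<Sum>x\<le>n. off_max n c (v, x)) + (\<Sum>x\<le>n. off_max n d (v, x))
     = (\<Sum>x\<le>n. off_max n a (v, x)) + (\<Sum>x\<le>n. off_max n b (v, x))
      + ?i (v = s) + ?i (v = Suc s) - ?i (v = Suc s \<and> Suc s < t) - ?i (v = s)"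
  proof -
    have "(\<Sum>x\<le>n. off_max n c (v, x)) + (\<Sum>x\<le>n. off_max n d (v, x))
     = (\<Sum>x\<le>n. off_max n a (v, x) + off_max n b (v, x) + ?i (x = t \<and> v = s) + ?i (x = Suc t \<and> v = Suc s)
         - ?i (x = t \<and> v = Suc s \<and> Suc s < t) - ?i (x = Suc t \<and> v = s))"
      unfolding sum.distrib[symmetric] off_max_sum by (rule sum.cong) (simp_all add: conj_ac)
    also have "\<dots> = (\<Sum>x\<le>n. off_max n a (v, x)) + (\<Sum>x\<le>n. off_max n b (v, x)) + ?i (t \<le> n \<and> v = s) + ?i (Suc t \<le> n \<and> v = Suc s)
      - ?i (t \<le> n \<and> v = Suc s \<and> Suc s < t) - ?i (Suc t \<le> n \<and> v = s)"
      unfolding sum.distrib sum_subtractf delta ..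
    moreover have "s \<le> n" "Suc s \<le> n" "s - 1 \<le> n" "t \<le> n" "t - 1 \<le> n" "Suc t \<le> n" using bounds st by linarith+
    ultimately show ?thesis by simp
  qed
  have "?i (v = t) + ?i (v = Suc t) - ?i (v = t \<and> Suc s < t) - ?i (v = Suc t)
      = ?i (v = s) + ?i (v = Suc s) - ?i (v = Suc s \<and> Suc s < t) - ?i (v = s)"
    using st by (cases "Suc s = t") simp_all
  then have "int (count (mset c) v) + int (count (mset d) v) = int (count (mset a) v) + int (count (mset b) v)"
    unfolding count_column[OF a] count_column[OF b] count_column[OF c] count_column[OF d]
    using col row length_sum[of v] by linarith
  then show "count (mset (fst (c, d)) + mset (snd (c, d))) v = count (mset (fst (a, b)) + mset (snd (a, b))) v" by simp
qed

text \<open>\<open>e1\<close> and \<open>e2\<close> record whether the neighbours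
  \<open>(Suc s, t - 1)\<close>, if off the diagonal, and \<open>(s - 1, Suc t)\<close> are maximal
  in \<open>C\<close>. Their values depend on \<open>C\<close> but will not affect the conclusion in
  \<open>count_diff\<close>.\<close>

lemma off_max_diff:
  "\<exists>e1 e2 :: int. (e1 = 0 \<or> e1 = 1 \<and> Suc s < t - 1) \<and> (e2 = 0 \<or> e2 = 1 \<and> 1 \<le> s - 1) \<and>
    (\<forall>p. off_max n a p - off_max n b p = (if p = P \<and> Suc s < t then 1 else 0) - (if p = Q then 1 else 0)
       + (if p = (s - 1, Suc t) then e2 else 0) - (if p = (Suc s, t - 1) then e1 else 0))"
proof -
  define e1 e2 :: int where "e1 = (if (Suc s, t - 1) \<in> maximal_elems C \<and> Suc s < t - 1 then 1 else 0)"
    and "e2 = (if (s - 1, Suc t) \<in> maximal_elems C then 1 else 0)"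
  have m2: "1 \<le> s - 1" if "(s - 1, Suc t) \<in> maximal_elems C"
    using that sub_tri unfolding maximal_elems_def by (auto simp: tri_iff)
  have ne: "(s - 1, Suc t) \<notin> {P, Q, R}" "(Suc s, t - 1) \<notin> {P, Q, R}" using bounds st by auto
  have "off_max n a p - off_max n b p = (if p = P \<and> Suc s < t then 1 else 0) - (if p = Q then 1 else 0)
       + (if p = (s - 1, Suc t) then e2 else 0) - (if p = (Suc s, t - 1) then e1 else 0)" for p
  proof (cases "p \<in> {P, Q, R}")
    case True
    then show ?thesis using max_PQR st ne unfolding off_max_def by (elim insertE emptyE) auto
  next
    case F: False
    have ne2: "(s - 1, Suc t) \<noteq> (Suc s, t - 1)" by auto
    have off: "off_max n a p - off_max n b p = (if fst p < snd p \<and> p \<in> maximal_elems C then (if p \<le> Q then 1 else 0) - (if p \<le> P then 1 else 0) else 0)"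
      unfolding off_max_def using max_other[OF F] by auto
    show ?thesis
    proof (cases "p \<in> maximal_elems C")
      case True
      have bP: "\<not> (s - 1, Suc t) \<le> P" "\<not> (Suc s, t - 1) \<le> Q" "\<not> (s, t) = (Suc s, t - 1)" "\<not> (s, t) = (s - 1, Suc t)" by auto
      show ?thesis
        unfolding off e1_def e2_def max_C_below[OF True]
        using True F ne2 bP st by (cases "p = (s, t)"; cases "p = (s - 1, Suc t)"; cases "p = (Suc s, t - 1)") auto
    next
      case False
      then show ?thesis unfolding off e1_def e2_def using F by auto
    qed
  qed
  then have all: "\<forall>p. off_max n a p - off_max n b p = (if p = P \<and> Suc s < t then 1 else 0) - (if p = Q then 1 else 0)
       + (if p = (s - 1, Suc t) then e2 else 0) - (if p = (Suc s, t - 1) then e1 else 0)" by (rule allI)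
  have "e1 = 0 \<or> e1 = 1 \<and> Suc s < t - 1" by (simp add: e1_def)
  moreover have "e2 = 0 \<or> e2 = 1 \<and> 1 \<le> s - 1" using m2 by (simp add: e2_def)
  ultimately show ?thesis using all by (intro exI[of _ e1] exI[of _ e2] conjI)
qed

lemma length_diff: "(if 1 \<le> v \<and> v \<le> length a then 1 else 0) - (if 1 \<le> v \<and> v \<le> length b then 1 else (0::int)) = (if v = t \<and> Suc s = t then 1 else 0)"
proof -
  have "(v, v) \<in> A \<longleftrightarrow> (v, v) \<in> C \<or> v = Suc s \<and> v = t" "(v, v) \<in> B \<longleftrightarrow> (v, v) \<in> C"
    unfolding A_eq B_eq using st by auto
  moreover have "(t, t) \<notin> C" "t \<noteq> 1" if "Suc s = t" using that notin_C bounds by auto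
  ultimately show ?thesis unfolding length_mem[OF a] length_mem[OF b] by auto
qed

lemma count_diff:
  "v \<in> set a \<and> v \<notin> set b \<longleftrightarrow> v = s \<or> v = t"
proof -
  let ?i = "\<lambda>Pr. if Pr then 1 else (0::int)"
  obtain e1 e2 :: int where e: "e1 = 0 \<or> e1 = 1 \<and> Suc s < t - 1" "e2 = 0 \<or> e2 = 1 \<and> 1 \<le> s - 1"
    "\<And>p. off_max n a p - off_max n b p = (if p = P \<and> Suc s < t then 1 else 0) - (if p = Q then 1 else 0)
       + (if p = (s - 1, Suc t) then e2 else 0) - (if p = (Suc s, t - 1) then e1 else 0)"
    using off_max_diff by blast
  have delta: "(\<Sum>x\<le>n. (if x = y \<and> Pr then z else 0)) = (if y \<le> n \<and> Pr then z else (0::int))" for y z Pr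
    by (cases Pr) simp_all
  have col: "(\<Sum>x\<le>n. off_max n a (x, v)) - (\<Sum>x\<le>n. off_max n b (x, v))
     = ?i (v = t \<and> Suc s < t) - ?i (v = Suc t) + (if v = Suc t then e2 else 0) - (if v = t - 1 then e1 else 0)"
  proof -
    have "(\<Sum>x\<le>n. off_max n a (x, v)) - (\<Sum>x\<le>n. off_max n b (x, v)) = (\<Sum>x\<le>n. ?i (x = Suc s \<and> v = t \<and> Suc s < t) - ?i (x = s \<and> v = Suc t)
      + (if x = s - 1 \<and> v = Suc t then e2 else 0) - (if x = Suc s \<and> v = t - 1 then e1 else 0))"
      unfolding sum_subtractf[symmetric] e(3) by (rule sum.cong) (simp_all add: conj_ac)
    also have "\<dots> = ?i (Suc s \<le> n \<and> v = t \<and> Suc s < t) - ?i (s \<le> n \<and> v = Suc t)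
      + (if s - 1 \<le> n \<and> v = Suc t then e2 else 0) - (if Suc s \<le> n \<and> v = t - 1 then e1 else 0)"
      unfolding sum.distrib sum_subtractf delta ..
    moreover have "s \<le> n" "Suc s \<le> n" "s - 1 \<le> n" "t \<le> n" "t - 1 \<le> n" "Suc t \<le> n" using bounds st by linarith+
    ultimately show ?thesis by simp
  qed
  have row: "(\<Sum>x\<le>n. off_max n a (v, x)) - (\<Sum>x\<le>n. off_max n b (v, x))
     = ?i (v = Suc s \<and> Suc s < t) - ?i (v = s) + (if v = s - 1 then e2 else 0) - (if v = Suc s then e1 else 0)"
  proof -
    have "(\<Sum>x\<le>n. off_max n a (v, x)) - (\<Sum>x\<le>n. off_max n b (v, x)) = (\<Sum>x\<le>n. ?i (x = t \<and> v = Suc s \<and> Suc s < t) - ?i (x = Suc t \<and> v = s)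
      + (if x = Suc t \<and> v = s - 1 then e2 else 0) - (if x = t - 1 \<and> v = Suc s then e1 else 0))"
      unfolding sum_subtractf[symmetric] e(3) by (rule sum.cong) (simp_all add: conj_ac)
    also have "\<dots> = ?i (t \<le> n \<and> v = Suc s \<and> Suc s < t) - ?i (Suc t \<le> n \<and> v = s)
      + (if Suc t \<le> n \<and> v = s - 1 then e2 else 0) - (if t - 1 \<le> n \<and> v = Suc s then e1 else 0)"
      unfolding sum.distrib sum_subtractf delta ..
    moreover have "s \<le> n" "Suc s \<le> n" "s - 1 \<le> n" "t \<le> n" "t - 1 \<le> n" "Suc t \<le> n" using bounds st by linarith+
    ultimately show ?thesis by simp
  qed
  have diff: "int (count (mset a) v) - int (count (mset b) v) =
      ?i (v = t \<and> Suc s = t) + (?i (v = t \<and> Suc s < t) - ?i (v = Suc t) + (if v = Suc t then e2 else 0) - (if v = t - 1 then e1 else 0))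
      - (?i (v = Suc s \<and> Suc s < t) - ?i (v = s) + (if v = s - 1 then e2 else 0) - (if v = Suc s then e1 else 0))"
    unfolding count_column[OF a] count_column[OF b] using col row length_diff[of v] by linarith
  have cnt: "count (mset x) v = (if v \<in> set x then 1 else 0)" if "x \<in> {a, b}" for x
  proof -
    have "distinct x" using that pbw_columns_distinct a b by auto
    then show ?thesis using distinct_count_atmost_1[of x] by simp
  qed
  have "v \<in> set a \<and> v \<notin> set b \<longleftrightarrow> int (count (mset a) v) - int (count (mset b) v) = 1"
    using cnt[of a] cnt[of b] by auto
  also have "\<dots> \<longleftrightarrow> v = s \<or> v = t"
  proof -
    \<comment> \<open>The difference is 1 precisely at s and t: all further contributions are
      nonpositive and vanish there, whatever \<open>e1\<close> and \<open>e2\<close> are.\<close>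
    have f: "int (count (mset a) v) - int (count (mset b) v) = ?i (v = t) + ?i (v = s) - (if v = Suc t then 1 - e2 else 0)
        - (if v = t - 1 then e1 else 0) - (if v = Suc s then ?i (Suc s < t) - e1 else 0) - (if v = s - 1 then e2 else 0)"
      unfolding diff using st by (cases "Suc s = t"; cases "v = Suc t"; cases "v = Suc s") simp_all
    have e0: "e1 = 0" if "Suc s = t \<or> t - 1 = s" using e(1) that st by auto
    show ?thesis
    proof (cases "v = s \<or> v = t")
      case True
      then have "(if v = Suc t then 1 - e2 else 0) = 0" "(if v = t - 1 then e1 else 0) = 0"
        "(if v = Suc s then ?i (Suc s < t) - e1 else 0) = 0" "(if v = s - 1 then e2 else 0) = 0"
        using st bounds e0 by auto
      then show ?thesis unfolding f using True st by auto
    next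
      case False
      have "0 \<le> (if v = Suc t then 1 - e2 else 0)" "0 \<le> (if v = t - 1 then e1 else 0)"
        "0 \<le> (if v = Suc s then ?i (Suc s < t) - e1 else 0)" "0 \<le> (if v = s - 1 then e2 else 0)"
        using e(1,2) by auto
      then show ?thesis unfolding f using False by auto
    qed
  qed
  finally show ?thesis .
qed

lemma set_diff: "set a - set b = {s, t}"
  using count_diff by auto

lemma same_content_sets:
  assumes q: "fst q \<in> pbw_columns n" "snd q \<in> pbw_columns n" and e: "same_content q (a, b)"
  shows "set (fst q) \<union> set (snd q) = set a \<union> set b" "set (fst q) \<inter> set (snd q) = set a \<inter> set b"
proof -
  have cnt: "count (mset x) v = (if v \<in> set x then 1 else 0)" if "x \<in> pbw_columns n" for x v
    using that pbw_columns_distinct distinct_count_atmost_1 by metis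
  have "(v \<in> set (fst q) \<or> v \<in> set (snd q) \<longleftrightarrow> v \<in> set a \<or> v \<in> set b) \<and> (v \<in> set (fst q) \<and> v \<in> set (snd q) \<longleftrightarrow> v \<in> set a \<and> v \<in> set b)" for v
  proof -
    have "count (mset (fst q) + mset (snd q)) v = count (mset a + mset b) v" using e unfolding same_content_def by simp
    then show ?thesis unfolding count_union cnt[OF a] cnt[OF b] cnt[OF q(1)] cnt[OF q(2)] by (auto split: if_splits)
  qed
  then show "set (fst q) \<union> set (snd q) = set a \<union> set b" "set (fst q) \<inter> set (snd q) = set a \<inter> set b" by blast+
qed

lemma length_ba: "length b \<le> length a"
proof (rule ccontr)
  assume "\<not> length b \<le> length a"
  then show False using length_diff[of "length b"] pbw_columnsD(1)[OF b] by (auto split: if_splits)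
qed

lemma length_d: "length d = length a"
proof -
  have i: "1 \<le> v \<and> v \<le> length d \<longleftrightarrow> 1 \<le> v \<and> v \<le> length a" for v
  proof -
    have "(v, v) \<in> D \<longleftrightarrow> (v, v) \<in> A" unfolding D_eq' A_eq using st by auto
    then show ?thesis using length_mem[OF d] length_mem[OF a] by simp
  qed
  show ?thesis using i[of "length a"] i[of "length d"] pbw_columnsD(1)[OF a] pbw_columnsD(1)[OF d] by linarith
qed

lemma cd_chain: "(c, d) \<in> chain_pairs n"
  unfolding chain_pairs_def using c d by (auto simp: pbw_le_iff_subset[OF d c] C_eq D_eq)

lemma incomparable: "pbw_incomparable n a b"
  unfolding pbw_incomparable_def using a b PQ_mem by (auto simp: pbw_le_iff_subset)

lemma same_set_column: "x \<in> pbw_columns n \<Longrightarrow> y \<in> pbw_columns n \<Longrightarrow> set x = set y \<Longrightarrow> x = y"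
  using pbw_columns_mset_inj pbw_columns_distinct set_eq_iff_mset_eq_distinct by metis

text \<open>The content leaves room for only three pairs, and an exchange relation connects them.\<close>

lemma minor_coef_support:
  "minor_coef n a b q \<noteq> 0 \<longleftrightarrow> q = (pbw_odot n a b, pbw_join n a b) \<or> q = (c, d)"
  "(c, d) \<noteq> (pbw_odot n a b, pbw_join n a b)"
proof -
  define q0 where "q0 = (pbw_odot n a b, pbw_join n a b)"
  have m0: "minor_coef n a b q0 \<noteq> 0" unfolding q0_def by (rule odot_join(1)[OF a b n])
  note f0 = minor_coef(2)[OF a b m0]
  have d_ne: "d \<noteq> pbw_join n a b" using pbw_join(2)[OF a b n] D_eq R_notin by (metis Un_iff insertI1)
  then show ne: "(c, d) \<noteq> (pbw_odot n a b, pbw_join n a b)" by simp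
  have st': "s \<noteq> t" using st by simp
  have fin: "finite (set a)" "finite (set b)" by auto
  have card: "card (set x) = length x" if "x \<in> pbw_columns n" for x using distinct_card[OF pbw_columns_distinct[OF that]] .
  \<comment> \<open>Otherwise the lengths would differ by two, whereas \<open>length_diff\<close>
    permits a difference at one position only.\<close>
  have "set b - set a \<noteq> {}"
  proof
    assume "set b - set a = {}"
    then have sub: "set b \<subseteq> set a" by auto
    have "card (set a - set b) = length a - length b" using card_Diff_subset[OF fin(2) sub] card a b by simp
    moreover have "card (set a - set b) = 2" unfolding set_diff using st by simp
    ultimately have l: "length a = length b + 2" by simp
    have "length a - 1 = t" "Suc s = t" using length_diff[of "length a - 1"] l by (auto split: if_splits)
    then show False using length_diff[of "length a"] l by (auto split: if_splits)
  qed
  then obtain j where j: "j \<in> set b - set a" by blast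
  have lens: "length (snd q) = length a" if "q \<in> {q0, (c, d)}" for q
    using that f0 length_d length_ba by (auto simp: max_def)
  have cols: "fst q \<in> pbw_columns n" "snd q \<in> pbw_columns n" "q \<in> chain_pairs n" "same_content q (a, b)" if "q \<in> {q0, (c, d)}" for q
  proof -
    have c0: "q0 \<in> chain_pairs n" "same_content q0 (a, b)" using f0 by blast+
    have "q = q0 \<or> q = (c, d)" using that by blast
    then show "q \<in> chain_pairs n" "same_content q (a, b)" using c0 cd_chain same_content_cd by blast+
    then show "fst q \<in> pbw_columns n" "snd q \<in> pbw_columns n" using chain_pairsD by blast+
  qed
  define X where "X x = set_minor (insert j (set a - {x})) * set_minor (insert x (set b - {j}))" for x
  have pm: "pair_minor q = set_minor (set (fst q)) * set_minor (set (snd q))" if "fst q \<in> pbw_columns n" "snd q \<in> pbw_columns n" for q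
    unfolding pair_minor_def using that by (simp add: set_minor_column)
  \<comment> \<open>The exchange of x for j, up to the order of the two columns, which is not known
    at this point.\<close>
  define W where "W q x \<longleftrightarrow> set (snd q) = insert j (set a - {x}) \<and> set (fst q) = insert x (set b - {j}) \<or>
      set (fst q) = insert j (set a - {x}) \<and> set (snd q) = insert x (set b - {j})" for q x
  have ex: "\<exists>x\<in>{s, t}. W q x" if q: "q \<in> {q0, (c, d)}" for q
  proof -
    have "set (snd q) = set a \<and> set (fst q) = set b \<or> set (snd q) = set b \<and> set (fst q) = set a \<or> (\<exists>x\<in>{s, t}. W q x)"
      unfolding W_def
      using two_point_split[OF fin set_diff st' j _ same_content_sets[OF cols(1,2,4)[OF q]]] card[OF a] card[OF b] length_ba
        card[OF cols(2)[OF q]] lens[OF q] by simp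
    moreover have "\<not> (set (snd q) = set a \<and> set (fst q) = set b)" "\<not> (set (snd q) = set b \<and> set (fst q) = set a)"
      using same_set_column[OF cols(2)[OF q] a] same_set_column[OF cols(1)[OF q] b] same_set_column[OF cols(2)[OF q] b] same_set_column[OF cols(1)[OF q] a]
        chain_pairsD(3)[OF cols(3)[OF q]] incomparableD(3,4)[OF incomparable] by auto
    ultimately show ?thesis by blast
  qed
  obtain x1 where x1: "x1 \<in> {s, t}" "W q0 x1" using ex by blast
  obtain x2 where x2: "x2 \<in> {s, t}" "W (c, d) x2" using ex by blast
  \<comment> \<open>The same exchange would produce the same two columns, but \<open>d\<close> lies
    strictly above the join.\<close>
  have "x1 \<noteq> x2"
  proof
    assume e: "x1 = x2"
    have "set (snd q0) = set d \<and> set (fst q0) = set c \<or> set (snd q0) = set c \<and> set (fst q0) = set d"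
      using x1(2) x2(2) unfolding W_def e fst_conv snd_conv by (elim disjE conjE) simp_all
    then have sw: "snd q0 = d \<and> fst q0 = c \<or> snd q0 = c \<and> fst q0 = d"
      using same_set_column[of "snd q0" d] same_set_column[of "fst q0" c] same_set_column[of "snd q0" c] same_set_column[of "fst q0" d]
        cols(1,2)[of q0] c d by blast
    have "snd q0 \<noteq> d" unfolding q0_def using d_ne by auto
    then have "snd q0 = c" "fst q0 = d" using sw by auto
    then have "pbw_le d c" "pbw_le c d" using chain_pairsD(3)[OF cols(3)[of q0]] chain_pairsD(3)[OF cd_chain] by auto
    then have "c = d" using pbw_le_antisym c d by blast
    then show False using \<open>snd q0 = c\<close> \<open>snd q0 \<noteq> d\<close> by simp
  qed
  then have st12: "{s, t} = {x1, x2}" using x1(1) x2(1) by auto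
  have WX: "pair_minor q = X x" if "W q x" "q \<in> {q0, (c, d)}" for q x
    using that(1) pm[OF cols(1,2)[OF that(2)]] unfolding W_def X_def by (auto simp: mult.commute)
  obtain \<epsilon> :: "nat \<Rightarrow> int" where eps: "\<And>x. \<epsilon> x \<in> {1, -1}"
    "set_minor (set a) * set_minor (set b) = (\<Sum>x\<in>set a - set b. of_int (\<epsilon> x) * X x)"
  proof -
    have le: "card (set b) \<le> card (set a)" using card[OF a] card[OF b] length_ba by simp
    show ?thesis using exchange_sets[OF fin le j] that unfolding X_def by blast
  qed
  have pab: "pair_minor (a, b) = pconst (of_int (\<epsilon> x1)) * pair_minor q0 + pconst (of_int (\<epsilon> x2)) * pair_minor (c, d)"
    using eps(2) \<open>x1 \<noteq> x2\<close> WX[OF x1(2)] WX[OF x2(2)] pm[of "(a, b)"] a b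
    unfolding set_diff st12 of_int_eq_pconst by simp
  let ?f = "\<lambda>q. if q = q0 then of_int (\<epsilon> x1) else if q = (c, d) then of_int (\<epsilon> x2) else (0 :: complex)"
  have q0cd: "q0 \<noteq> (c, d)" using ne unfolding q0_def by (rule not_sym)
  have "minor_coef n a b = ?f"
  proof (rule minor_coef(3)[OF a b])
    show "?f q = 0" if "q \<notin> chain_pairs n" for q
      using that cols(3)[of q0] cols(3)[of "(c, d)"] by (cases "q = q0"; cases "q = (c, d)") simp_all
    have "(\<Sum>q\<in>chain_pairs n. pconst (?f q) * pair_minor q) = (\<Sum>q\<in>{q0, (c, d)}. pconst (?f q) * pair_minor q)"
      by (rule sum.mono_neutral_right) (use cols(3) in \<open>auto simp: finite_chain_pairs pconst_simps\<close>)
    also have "\<dots> = pair_minor (a, b)" unfolding pab using q0cd by simp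
    finally show "pair_minor (a, b) = (\<Sum>q\<in>chain_pairs n. pconst (?f q) * pair_minor q)" ..
  qed
  moreover have "\<epsilon> x1 \<noteq> 0" "\<epsilon> x2 \<noteq> 0" using eps(1)[of x1] eps(1)[of x2] by auto
  ultimately show "minor_coef n a b q \<noteq> 0 \<longleftrightarrow> q = (pbw_odot n a b, pbw_join n a b) \<or> q = (c, d)"
    unfolding q0_def by (simp split: if_splits)
qed

end

section \<open>From ordered configurations to unordered special pairs\<close>

lemma pair_cells_commute: "pair_cells (a, b) = pair_cells (b, a)"
  unfolding pair_cells_def by (simp add: add.commute)

lemma odot_join_commute:
  assumes a: "a \<in> pbw_columns n" and b: "b \<in> pbw_columns n" and n: "2 \<le> n"
  shows "(pbw_odot n a b, pbw_join n a b) = (pbw_odot n b a, pbw_join n b a)"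
proof (rule pair_cells_inj)
  show "(pbw_odot n a b, pbw_join n a b) \<in> chain_pairs n" using minor_coef(2)[OF a b odot_join(1)[OF a b n]] by blast
  show "(pbw_odot n b a, pbw_join n b a) \<in> chain_pairs n" using minor_coef(2)[OF b a odot_join(1)[OF b a n]] by blast
  show "pair_cells (pbw_odot n a b, pbw_join n a b) = pair_cells (pbw_odot n b a, pbw_join n b a)"
    unfolding odot_join(2)[OF a b n] odot_join(2)[OF b a n] by (rule pair_cells_commute)
qed

text \<open>Everything strictly below the corner R is below P or Q, so adding R to the union yields
  an order ideal again; its column serves as \<open>d\<close>.\<close>

lemma special_diamond_intro:
  assumes n: "2 \<le> n" and a: "a \<in> pbw_columns n" and b: "b \<in> pbw_columns n" and st: "s < t"
    and AB: "col_ideal n a - col_ideal n b = {(Suc s, t)}" and BA: "col_ideal n b - col_ideal n a = {(s, Suc t)}"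
  obtains c d where "special_diamond n a b s t c d"
proof -
  let ?A = "col_ideal n a" and ?B = "col_ideal n b" and ?R = "(Suc s, Suc t)"
  have mem: "(Suc s, t) \<in> ?A" "(s, Suc t) \<in> ?B" using AB BA by auto
  have tri: "?A \<subseteq> tri n" "?B \<subseteq> tri n" using order_ideals_sub[OF col_ideal_order_ideal] by blast+
  then have bd: "1 \<le> s" "Suc t \<le> n" using mem by (auto simp: tri_iff)
  have "insert ?R (?A \<union> ?B) \<in> order_ideals n"
    unfolding order_ideals_def
  proof (intro CollectI conjI ballI impI)
    show "insert ?R (?A \<union> ?B) \<subseteq> tri n" using tri bd st by (auto simp: tri_iff)
    fix p q assume pq: "p \<in> insert ?R (?A \<union> ?B)" "q \<in> tri n" "q \<le> p"
    show "q \<in> insert ?R (?A \<union> ?B)"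
    proof (cases "p = ?R")
      case True
      then have "q = ?R \<or> q \<le> (Suc s, t) \<or> q \<le> (s, Suc t)" using pq(3) by (cases q) auto
      then show ?thesis using order_ideals_down[OF col_ideal_order_ideal mem(1) pq(2)] order_ideals_down[OF col_ideal_order_ideal mem(2) pq(2)] by auto
    next
      case False
      then show ?thesis using order_ideals_down[OF col_ideal_order_ideal _ pq(2,3)] pq(1) by auto
    qed
  qed
  then obtain d where d: "d \<in> pbw_columns n" "col_ideal n d = insert ?R (?A \<union> ?B)" using col_of_ideal n by metis
  have "special_diamond n a b s t (pbw_meet n a b) d"
    using assms d pbw_meet[OF a b n] by unfold_locales auto
  then show ?thesis by (rule that)
qed

lemma special_diamond_pair_obtain:
  assumes "special_diamond_pair n a b" "2 \<le> n"
  obtains a' b' s t c d where "{a', b'} = {a, b}" "special_diamond n a' b' s t c d"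
proof -
  obtain a' b' s t where ab: "a \<in> pbw_columns n" "b \<in> pbw_columns n" and
    st: "{a', b'} = {a, b}" "s < t" "col_ideal n a' - col_ideal n b' = {(Suc s, t)}" "col_ideal n b' - col_ideal n a' = {(s, Suc t)}"
    using assms(1) unfolding special_diamond_pair_iff[OF assms(2)] by (elim conjE exE)
  have "a' \<in> pbw_columns n" "b' \<in> pbw_columns n" using st(1) ab by auto
  then show ?thesis using special_diamond_intro[OF assms(2) _ _ st(2-4)] that st(1) by metis
qed

text \<open>The description in \<open>extra_pair\<close> is well defined because the relation has
  exactly two chain terms, one of them being the pair of the join.\<close>

lemma special_diamond_pair_extra:
  assumes sp: "special_diamond n a' b' s t c d" and ab: "{a', b'} = {a, b}"
  shows "extra_pair n a b = (c, d)" "minor_coef n a b (c, d) \<noteq> 0" "pbw_incomparable n a b"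
    "(c, d) \<noteq> (pbw_odot n a b, pbw_join n a b)"
    "minor_coef n a b q \<noteq> 0 \<longleftrightarrow> q = (pbw_odot n a b, pbw_join n a b) \<or> q = (c, d)" "special_diamond_pair n a b"
proof -
  interpret special_diamond n a' b' s t c d by (rule sp)
  have cases: "a' = a \<and> b' = b \<or> a' = b \<and> b' = a" using ab by (auto simp: doubleton_eq_iff)
  show inc: "pbw_incomparable n a b" using incomparable cases unfolding pbw_incomparable_def by auto
  have mc: "minor_coef n a' b' = minor_coef n a b" using cases minor_coef_commute by blast
  have oj: "(pbw_odot n a' b', pbw_join n a' b') = (pbw_odot n a b, pbw_join n a b)"
    using cases odot_join_commute[OF a b n] by auto
  show iff: "minor_coef n a b q \<noteq> 0 \<longleftrightarrow> q = (pbw_odot n a b, pbw_join n a b) \<or> q = (c, d)" for q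
    using minor_coef_support(1)[of q] unfolding mc oj .
  show ne: "(c, d) \<noteq> (pbw_odot n a b, pbw_join n a b)" using minor_coef_support(2) unfolding oj .
  show "minor_coef n a b (c, d) \<noteq> 0" using iff by blast
  have str: "straightening n a b q \<noteq> 0 \<longleftrightarrow> minor_coef n a b q \<noteq> 0" for q
    unfolding straightening_eq[OF inc] by simp
  show "extra_pair n a b = (c, d)"
    unfolding extra_pair_def str iff using ne by (intro the_equality) auto
  have "a \<in> pbw_columns n" "b \<in> pbw_columns n" using a b cases by auto
  then show "special_diamond_pair n a b"
    unfolding special_diamond_pair_iff[OF n]
  proof (intro conjI)
    show "\<exists>a' b' s t. {a', b'} = {a, b} \<and> s < t \<and> col_ideal n a' - col_ideal n b' = {(Suc s, t)} \<and> col_ideal n b' - col_ideal n a' = {(s, Suc t)}"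
      by (rule exI[of _ a'], rule exI[of _ b'], rule exI[of _ s], rule exI[of _ t]) (intro conjI ab st AB BA)
  qed
qed

section \<open>Reduction to diamond pairs\<close>

text \<open>The terms whose inequalities form the list in the theorem.\<close>

definition listed_term :: "nat \<Rightarrow> nat list \<Rightarrow> nat list \<Rightarrow> nat list \<times> nat list \<Rightarrow> bool"
  where "listed_term n a b q \<longleftrightarrow> diamond_pair n a b \<and> q = (pbw_odot n a b, pbw_join n a b) \<or>
    special_diamond_pair n a b \<and> q = (g1 n a b, h1 n a b)"

definition comparable :: "nat list \<Rightarrow> nat list \<Rightarrow> bool"
  where "comparable x y \<longleftrightarrow> pbw_le x y \<or> pbw_le y x"

text \<open>For q = (g, h) the comparabilities make the product of the variables of g, h and x
  standard, while incomparability of a and x supplies a second relation to start from. The condition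
  \<open>x \<noteq> b\<close> helps to keep the variable of b from dividing that product.\<close>

definition detour :: "nat \<Rightarrow> nat list \<Rightarrow> nat list \<Rightarrow> nat list \<times> nat list \<Rightarrow> nat list \<Rightarrow> bool"
  where "detour n a b q x \<longleftrightarrow> pbw_incomparable n a x \<and> x \<noteq> b \<and> comparable x (fst q) \<and> comparable x (snd q)"

text \<open>If the two elements were further apart, \<open>(s, Suc t)\<close> or
  \<open>(Suc u, v)\<close> would be an element of \<open>H\<close> outside the union lying above
  only one of them.\<close>

lemma special_configuration:
  assumes A: "A \<in> order_ideals n" and B: "B \<in> order_ideals n" and H: "H \<in> order_ideals n"
    and AB: "A - B = {(s, t)}" and BA: "B - A = {(u, v)}" and lt: "u < s" "t < v"
    and z: "z \<in> H" "z \<notin> A \<union> B" and all: "\<And>z. z \<in> H \<Longrightarrow> z \<notin> A \<union> B \<Longrightarrow> (s, t) \<le> z \<and> (u, v) \<le> z"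
  shows "s = Suc u \<and> v = Suc t"
proof -
  have mem: "(s, t) \<in> A" "(s, t) \<notin> B" "(u, v) \<in> B" "(u, v) \<notin> A" using AB BA by auto
  have tri: "(s, t) \<in> tri n" "(u, v) \<in> tri n" "z \<in> tri n" using mem z order_ideals_sub A B H by blast+
  have out: "p \<notin> A \<union> B" if "(s, t) \<le> p \<or> (u, v) \<le> p" "p \<noteq> (s, t)" "p \<noteq> (u, v)" for p
  proof
    assume "p \<in> A \<union> B"
    then have pAB: "p \<in> A" "p \<in> B" using AB BA that(2,3) by blast+
    from that(1) show False
      using order_ideals_down[OF A pAB(1) tri(2)] order_ideals_down[OF B pAB(2) tri(1)] mem by blast
  qed
  have zz: "(s, v) \<le> z" using all[OF z] lt by (cases z) auto
  have inH: "(x, y) \<in> H" if "x \<le> s" "y \<le> v" "u \<le> x" "x < y" for x y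
  proof -
    have "(x, y) \<in> tri n" using tri that lt by (auto simp: tri_iff)
    moreover have "(x, y) \<le> (s, v)" using that by simp
    ultimately show ?thesis using order_ideals_down[OF H z(1)] zz order_trans by blast
  qed
  have "(s, Suc t) \<in> H" using tri lt by (intro inH) (auto simp: tri_iff)
  moreover have "(s, Suc t) \<notin> A \<union> B" using lt by (intro out) auto
  ultimately have "(u, v) \<le> (s, Suc t)" using all by blast
  then have v: "v = Suc t" using lt by auto
  have "(Suc u, v) \<in> H" using tri lt by (intro inH) (auto simp: tri_iff)
  moreover have "(Suc u, v) \<notin> A \<union> B" using lt by (intro out) auto
  ultimately have "(s, t) \<le> (Suc u, v)" using all by blast
  then show ?thesis using v lt by auto
qed

text \<open>Enlarge the ideal of \<open>b\<close> by one element of \<open>a\<close>. The new column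
  lies between the members of \<open>q\<close>; if the ideal of \<open>a\<close> has yet another
  element outside that of \<open>b\<close>, it is incomparable to \<open>a\<close> and hence a
  detour.\<close>

lemma single_difference:
  assumes n: "2 \<le> n" and a: "a \<in> pbw_columns n" and b: "b \<in> pbw_columns n" and nle: "\<not> pbw_le a b" "\<not> pbw_le b a"
    and q: "fst q \<in> pbw_columns n" "snd q \<in> pbw_columns n" "pbw_le (fst q) b" "pbw_le a (snd q)" "pbw_le b (snd q)"
    and no: "\<And>x. \<not> detour n a b q x"
  obtains P where "col_ideal n a - col_ideal n b = {P}"
proof -
  let ?A = "col_ideal n a" and ?B = "col_ideal n b"
  have AB: "?B \<noteq> ?A \<union> ?B" using nle(1) unfolding pbw_le_iff_subset[OF b a] by auto
  obtain x where x: "x \<in> (?A \<union> ?B) - ?B" "insert x ?B \<in> order_ideals n"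
    using order_ideals_insert_minimal[OF col_ideal_order_ideal order_ideals_Un[OF col_ideal_order_ideal col_ideal_order_ideal] _ AB] by blast
  obtain b' where b': "b' \<in> pbw_columns n" "col_ideal n b' = insert x ?B" using col_of_ideal[OF x(2) n] by metis
  have "?A - ?B = {x}"
  proof (rule ccontr)
    assume "?A - ?B \<noteq> {x}"
    then obtain y where y: "y \<in> ?A" "y \<notin> ?B" "y \<noteq> x" using x(1) by blast
    have "pbw_incomparable n a b'"
      unfolding pbw_incomparable_def pbw_le_iff_subset[OF a b'(1)] pbw_le_iff_subset[OF b'(1) a] b'(2)
      using a b' y nle(2) unfolding pbw_le_iff_subset[OF a b] by auto
    moreover have "b' \<noteq> b" using b'(2) x(1) by auto
    moreover have "pbw_le (fst q) b'" using q(1,3) b' by (auto simp: pbw_le_iff_subset[OF _ q(1)] b)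
    moreover have "pbw_le b' (snd q)" using q(2,4,5) b' x(1) by (auto simp: pbw_le_iff_subset[OF q(2)] a b)
    ultimately show False using no[of b'] unfolding detour_def comparable_def by blast
  qed
  then show ?thesis by (rule that)
qed

text \<open>Enlarge the ideal of \<open>b\<close> by everything below z. If P were not below z, the
  new ideal would miss P and contain z, so its column would be incomparable to \<open>a\<close> and
  a detour.\<close>

lemma above_difference:
  assumes n: "2 \<le> n" and a: "a \<in> pbw_columns n" and b: "b \<in> pbw_columns n"
    and AB: "col_ideal n a - col_ideal n b = {P}"
    and q: "fst q \<in> pbw_columns n" "snd q \<in> pbw_columns n" "pbw_le (fst q) b" "pbw_le b (snd q)"
    and z: "z \<in> col_ideal n (snd q)" "z \<notin> col_ideal n a" "z \<notin> col_ideal n b"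
    and no: "\<And>x. \<not> detour n a b q x"
  shows "P \<le> z"
proof (rule ccontr)
  assume P: "\<not> P \<le> z"
  let ?A = "col_ideal n a" and ?B = "col_ideal n b" and ?Z = "{x \<in> tri n. x \<le> z}"
  have Z: "?Z \<in> order_ideals n" unfolding order_ideals_def by (auto intro: order_trans)
  obtain b' where b': "b' \<in> pbw_columns n" "col_ideal n b' = ?B \<union> ?Z"
    using col_of_ideal[OF order_ideals_Un[OF col_ideal_order_ideal Z] n] by metis
  have zt: "z \<in> tri n" using z(1) order_ideals_sub[OF col_ideal_order_ideal] by blast
  have PA: "P \<in> ?A" "P \<notin> ?B" using AB by auto
  have "pbw_incomparable n a b'"
    unfolding pbw_incomparable_def pbw_le_iff_subset[OF a b'(1)] pbw_le_iff_subset[OF b'(1) a] b'(2)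
    using a b'(1) PA P z(2) zt by auto
  moreover have "b' \<noteq> b" using b'(2) z(3) zt by auto
  moreover have "pbw_le (fst q) b'" using q(1,3) b' by (auto simp: pbw_le_iff_subset[OF _ q(1)] b)
  moreover have "?Z \<subseteq> col_ideal n (snd q)" using order_ideals_down[OF col_ideal_order_ideal z(1)] by blast
  then have "pbw_le b' (snd q)" using q(2,4) b' by (simp add: pbw_le_iff_subset[OF q(2)] b)
  ultimately show False using no[of b'] unfolding detour_def comparable_def by blast
qed

lemma same_content_cancel:
  assumes "x \<in> pbw_columns n" "y \<in> pbw_columns n" "same_content q (a, b)" "q = (x, a) \<and> y = b \<or> q = (x, b) \<and> y = a \<or> q = (a, x) \<and> y = b \<or> q = (b, x) \<and> y = a"
  shows "x = y"
proof (rule pbw_columns_mset_inj[OF assms(1,2)])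
  show "mset x = mset y" using assms(3,4) unfolding same_content_def by (auto simp: add.commute)
qed

text \<open>Absence of detours forces g and h to be comparable to a and b, and the content then
  forces g below and h above both. Adding single elements or principal ideals to a and b shows that
  they form a diamond, special unless h is the join.\<close>

lemma term_listed_or_detour:
  assumes n: "2 \<le> n" and t: "straight_term n a b q"
    and no: "\<And>x. \<not> detour n a b q x" "\<And>x. \<not> detour n b a q x"
  shows "listed_term n a b q"
proof -
  note tD = straight_termD[OF t] and ab = incomparableD[OF straight_termD(1)[OF t]]
  obtain g h where q: "q = (g, h)" by (cases q)
  have g: "g \<in> pbw_columns n" and h: "h \<in> pbw_columns n" and gh: "pbw_le g h" and cont: "same_content (g, h) (a, b)"
    using chain_pairsD[OF tD(2)] tD(3) unfolding q by auto
  have ne: "g \<noteq> a" "g \<noteq> b" "h \<noteq> a" "h \<noteq> b"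
  proof -
    show "g \<noteq> a" using same_content_cancel[OF h ab(2) cont] gh ab(3) by metis
    show "g \<noteq> b" using same_content_cancel[OF h ab(1) cont] gh ab(4) by metis
    show "h \<noteq> a" using same_content_cancel[OF g ab(2) cont] gh ab(4) by metis
    show "h \<noteq> b" using same_content_cancel[OF g ab(1) cont] gh ab(3) by metis
  qed
  have cmp: "comparable g h" "comparable h g" "comparable g g" "comparable h h" unfolding comparable_def using gh g h pbw_le_refl by auto
  \<comment> \<open>As g and h are comparable to each other, one of them being incomparable to a or
    b would itself be a detour.\<close>
  have comp: "pbw_le x y \<or> pbw_le y x" if xy: "x \<in> {a, b}" "y \<in> {g, h}" for x y
  proof (rule ccontr)
    assume n: "\<not> (pbw_le x y \<or> pbw_le y x)"
    then have inc: "pbw_incomparable n x y" unfolding pbw_incomparable_def using xy ab g h by auto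
    from xy(1) have "detour n a b q y \<or> detour n b a q y"
      using inc xy(2) ne cmp unfolding detour_def q by auto
    then show False using no by blast
  qed
  have cm: "mset a + mset b = mset g + mset h" using cont unfolding same_content_def by simp
  \<comment> \<open>With a and b below g they would be below h too, and equal contents would force
    all four columns to coincide.\<close>
  have not_both: "\<not> (pbw_le a y \<and> pbw_le b y)" if y: "y = g" for y
  proof
    assume le: "pbw_le a y \<and> pbw_le b y"
    then have "pbw_le a h" "pbw_le b h" using gh pbw_le_trans g h ab(1,2) unfolding y by blast+
    then show False using columns_eq_if_le_content[OF ab(1,2) g h _ _ _ _ cm] le y ab(5) by simp
  qed
  have not_both': "\<not> (pbw_le h a \<and> pbw_le h b)"
  proof
    assume le: "pbw_le h a \<and> pbw_le h b"
    then have "pbw_le g a" "pbw_le g b" using gh pbw_le_trans g h ab(1,2) by blast+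
    then show False using columns_eq_if_le_content[OF g h ab(1,2) _ _ _ _ cm[symmetric]] le ab(5) by simp
  qed
  have ga: "pbw_le g a" and gb: "pbw_le g b"
    using comp[of a g] comp[of b g] not_both[of g] ab(3,4) pbw_le_trans[OF ab(1) g ab(2)] pbw_le_trans[OF ab(2) g ab(1)] by blast+
  have ah: "pbw_le a h" and bh: "pbw_le b h"
    using comp[of a h] comp[of b h] not_both' ab(3,4) pbw_le_trans[OF ab(1) h ab(2)] pbw_le_trans[OF ab(2) h ab(1)] by blast+
  let ?A = "col_ideal n a" and ?B = "col_ideal n b" and ?H = "col_ideal n h"
  obtain P where P: "?A - ?B = {P}"
    using single_difference[of n a b q] n ab g h gb ah bh no(1) unfolding q by auto
  obtain Q where Q: "?B - ?A = {Q}"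
    using single_difference[of n b a q] n ab g h ga ah bh no(2) unfolding q by auto
  have dia: "diamond_pair n a b" unfolding diamond_pair_iff[OF n] using ab(1,2) P Q by blast
  have sub: "?A \<union> ?B \<subseteq> ?H" using ah bh unfolding pbw_le_iff_subset[OF h ab(1)] pbw_le_iff_subset[OF h ab(2)] by simp
  note j = pbw_join[OF ab(1,2) n] and oj = odot_join[OF ab(1,2) n]
  show ?thesis
  \<comment> \<open>If h is the join, the content determines g. Otherwise every further element of h
    lies above both P and Q, which is the special configuration.\<close>
  proof (cases "?H = ?A \<union> ?B")
    case True
    then have hj: "h = pbw_join n a b" using col_ideal_inj[OF h j(1)] j(2) by simp
    have m: "same_content (pbw_odot n a b, pbw_join n a b) (a, b)" "(pbw_odot n a b, pbw_join n a b) \<in> chain_pairs n"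
      using minor_coef(2)[OF ab(1,2) oj(1)] by auto
    have "mset g + mset h = mset (pbw_odot n a b) + mset h" using m(1) cont hj unfolding same_content_def by simp
    then have "mset g = mset (pbw_odot n a b)" by simp
    then have "g = pbw_odot n a b" using pbw_columns_mset_inj[OF g] chain_pairsD(1)[OF m(2)] by simp
    then show ?thesis unfolding listed_term_def q using dia hj by simp
  next
    case False
    then obtain z where z: "z \<in> ?H" "z \<notin> ?A \<union> ?B" using sub by blast
    have aP: "P \<le> z" if "z \<in> ?H" "z \<notin> ?A \<union> ?B" for z
      by (rule above_difference[OF n ab(1,2) P, of q]) (use that g h gb bh no q in auto)
    have aQ: "Q \<le> z" if "z \<in> ?H" "z \<notin> ?A \<union> ?B" for z
      by (rule above_difference[OF n ab(2,1) Q, of q]) (use that g h ga ah no q in auto)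
    have mem: "P \<in> ?A" "P \<notin> ?B" "Q \<in> ?B" "Q \<notin> ?A" using P Q by auto
    have tri: "P \<in> tri n" "Q \<in> tri n" using mem order_ideals_sub[OF col_ideal_order_ideal] by blast+
    have nPQ: "\<not> P \<le> Q" "\<not> Q \<le> P" using mem tri order_ideals_down[OF col_ideal_order_ideal] by blast+
    obtain s t u v where PQ: "P = (s, t)" "Q = (u, v)" by (cases P; cases Q)
    have "\<exists>a' b' s t. {a', b'} = {a, b} \<and> s < t \<and> col_ideal n a' - col_ideal n b' = {(Suc s, t)} \<and> col_ideal n b' - col_ideal n a' = {(s, Suc t)}"
    proof (cases "u < s")
      case True
      then have lt: "t < v" using nPQ PQ by auto
      have sp: "s = Suc u \<and> v = Suc t"
        by (rule special_configuration[OF col_ideal_order_ideal[of n a] col_ideal_order_ideal[of n b] col_ideal_order_ideal[of n h] _ _ True lt z])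
          (use P Q PQ aP aQ in auto)
      have "u < t" using sp tri unfolding PQ by (auto simp: tri_iff)
      then show ?thesis using P Q PQ sp
        by (intro exI[of _ a] exI[of _ b] exI[of _ u] exI[of _ t]) simp
    next
      case False
      then have lt: "s < u" "v < t" using nPQ PQ by auto
      have z': "z \<notin> ?B \<union> ?A" using z(2) by blast
      have sp: "u = Suc s \<and> t = Suc v"
        by (rule special_configuration[OF col_ideal_order_ideal[of n b] col_ideal_order_ideal[of n a] col_ideal_order_ideal[of n h] _ _ lt z(1) z'])
          (use P Q PQ aP aQ in auto)
      have "s < v" using sp tri unfolding PQ by (auto simp: tri_iff)
      then show ?thesis using P Q PQ sp
        by (intro exI[of _ b] exI[of _ a] exI[of _ s] exI[of _ v]) (simp add: insert_commute)
    qed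
    then have special: "special_diamond_pair n a b" unfolding special_diamond_pair_iff[OF n] using ab by simp
    obtain a' b' s t c d where sp: "{a', b'} = {a, b}" "special_diamond n a' b' s t c d"
      using special_diamond_pair_obtain[OF special n] by metis
    have "h \<noteq> pbw_join n a b" using False j(2) by auto
    moreover have "minor_coef n a b q \<noteq> 0" using t unfolding straight_term_def by simp
    ultimately have "q = (c, d)" using special_diamond_pair_extra(5)[OF sp(2,1)] unfolding q by auto
    then show ?thesis unfolding listed_term_def g1_def h1_def special_diamond_pair_extra(1)[OF sp(2,1)] using special by simp
  qed
qed

text \<open>Although expansions are chosen separately for each monomial, they respect the relations,
  because both sides are standard with the same image on minors.\<close>

lemma expansion_straighten:
  assumes n: "2 \<le> n" and inc: "pbw_incomparable n a b" and k: "supp k \<subseteq> pl_vars n"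
  shows "coef (expansion n (pair_mon (a, b) + k)) s = (\<Sum>q\<in>chain_pairs n. minor_coef n a b q * coef (expansion n (pair_mon q + k)) s)"
proof -
  note ab = incomparableD[OF inc]
  have v0: "supp (pair_mon (a, b) + k) \<subseteq> pl_vars n"
    unfolding monomial_add_supp using supp_pair_mon_vars[of "(a, b)" n] ab k by simp
  have v: "supp (pair_mon q + k) \<subseteq> pl_vars n" if "q \<in> chain_pairs n" for q
    unfolding monomial_add_supp using supp_pair_mon_vars chain_pairsD[OF that] k by simp
  define e where "e = expansion n (pair_mon (a, b) + k) - (\<Sum>q\<in>chain_pairs n. pconst (minor_coef n a b q) * expansion n (pair_mon q + k))"
  have "psubst pl_minor e = mon_eval pl_minor (pair_mon (a, b) + k)
    - (\<Sum>q\<in>chain_pairs n. pconst (minor_coef n a b q) * mon_eval pl_minor (pair_mon q + k))"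
    unfolding e_def psubst_diff psubst_sum psubst_pconst_mult expansion(1)[OF n v0]
    by (intro arg_cong2[of _ _ _ _ "(-)"] sum.cong refl) (simp add: expansion(1)[OF n v])
  also have "\<dots> = 0"
    unfolding mon_eval_add mon_eval_pair_mon mult.assoc[symmetric] sum_distrib_right[symmetric] minor_coef(1)[OF ab(1,2), symmetric] by simp
  finally have z: "psubst pl_minor e = 0" .
  have "standard n m" if m: "m \<in> supp e" for m
  proof -
    have "m \<in> supp (expansion n (pair_mon (a, b) + k)) \<union> supp (\<Sum>q\<in>chain_pairs n. pconst (minor_coef n a b q) * expansion n (pair_mon q + k))"
      using m unfolding e_def by (rule subsetD[OF keys_diff])
    then show ?thesis unfolding Un_iff
    proof
      assume "m \<in> supp (\<Sum>q\<in>chain_pairs n. pconst (minor_coef n a b q) * expansion n (pair_mon q + k))"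
      then have "m \<in> (\<Union>q\<in>chain_pairs n. supp (pconst (minor_coef n a b q) * expansion n (pair_mon q + k)))"
        using keys_sum[of "\<lambda>q. pconst (minor_coef n a b q) * expansion n (pair_mon q + k)" "chain_pairs n"] by (rule rev_subsetD)
      then obtain q where "q \<in> chain_pairs n" "m \<in> supp (pconst (minor_coef n a b q) * expansion n (pair_mon q + k))" by (rule UN_E)
      then show ?thesis using expansion(2)[OF n v] subsetD[OF supp_pconst_mult] by metis
    qed (rule expansion(2)[OF n v0])
  qed
  then have "e = 0" using z by (rule standard_independent)
  then have "coef e s = 0" by simp
  then show ?thesis unfolding e_def lookup_minus lookup_sum coef_pconst_mult by simp
qed

text \<open>Base weights rise along the path, so no single step exceeds the total rise, and each
  step falls under the hypothesis.\<close>

lemma straight_steps_small: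
  fixes w :: "nat list \<Rightarrow> real"
  assumes n: "2 \<le> n"
    and small: "\<And>a b q. straight_term n a b q \<Longrightarrow> base_weight n (fst q) + base_weight n (snd q) - base_weight n a - base_weight n b < V \<Longrightarrow>
      w a + w b < w (fst q) + w (snd q)"
    and steps: "(straight_step n)\<^sup>*\<^sup>* m m'" "col_mweight n (base_weight n) m' - col_mweight n (base_weight n) m < V"
  shows "col_mweight n w m \<le> col_mweight n w m'"
  using steps
proof (induction rule: rtranclp_induct)
  case (step m1 m2)
  let ?b = "col_mweight n (base_weight n)"
  have bm: "?b m \<le> ?b m1" by (rule straight_steps_le(1)[OF straightens_base_weight[OF n] step(1)])
  have b1: "?b m1 < ?b m2" by (rule straight_step_less[OF straightens_base_weight[OF n] step(2)])
  obtain a b q k where t: "straight_term n a b q" "m1 = pair_mon (a, b) + k" "m2 = pair_mon q + k"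
    using step(2) unfolding straight_step_def by blast
  note ab = incomparableD[OF straight_termD(1)[OF t(1)]] and q = chain_pairsD[OF straight_termD(2)[OF t(1)]]
  have cw: "col_mweight n u m1 = u a + u b + col_mweight n u k" "col_mweight n u m2 = u (fst q) + u (snd q) + col_mweight n u k" for u :: "nat list \<Rightarrow> 'r::comm_ring_1"
    unfolding t(2,3) col_mweight_add by (simp_all add: col_mweight_pair col_mweight_pair_mon ab q)
  have "w a + w b < w (fst q) + w (snd q)"
    by (rule small[OF t(1)]) (use step(4) bm cw[of "base_weight n"] in linarith)
  then have "col_mweight n w m1 < col_mweight n w m2" unfolding cw by simp
  moreover have "col_mweight n w m \<le> col_mweight n w m1" by (rule step(3)) (use step(4) b1 in linarith)
  ultimately show ?case by simp
qed simp

text \<open>A detour \<open>x\<close> makes it possible to expand \<open>X\<^sub>a X\<^sub>b X\<^sub>x\<close> in two ways, starting with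
  \<open>X\<^sub>a X\<^sub>b\<close> or with \<open>X\<^sub>a X\<^sub>x\<close>; comparing coefficients at the standard monomial \<open>X\<^sub>g X\<^sub>h X\<^sub>x\<close> writes the
  inequality of the given term as a sum of at least two others.\<close>

lemma detour_inequality:
  fixes w :: "nat list \<Rightarrow> real"
  assumes n: "2 \<le> n" and t: "straight_term n a b q" and x: "detour n a b q x"
    and small: "\<And>a' b' q'. straight_term n a' b' q' \<Longrightarrow>
      base_weight n (fst q') + base_weight n (snd q') - base_weight n a' - base_weight n b'
        < base_weight n (fst q) + base_weight n (snd q) - base_weight n a - base_weight n b \<Longrightarrow>
      w a' + w b' < w (fst q') + w (snd q')"
  shows "w a + w b < w (fst q) + w (snd q)"
proof -
  note tD = straight_termD[OF t] and ab = incomparableD[OF straight_termD(1)[OF t]] and qc = chain_pairsD[OF straight_termD(2)[OF t]]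
  have xi: "pbw_incomparable n a x" and xb: "x \<noteq> b" and cmp: "comparable x (fst q)" "comparable x (snd q)"
    using x unfolding detour_def by auto
  note ax = incomparableD[OF xi]
  let ?V = "base_weight n (fst q) + base_weight n (snd q) - base_weight n a - base_weight n b"
  let ?b = "col_mweight n (base_weight n)"
  define kx kb where "kx = monom (sort x) (Suc 0)" and "kb = monom (sort b) (Suc 0)"
  have kv: "supp kx \<subseteq> pl_vars n" "supp kb \<subseteq> pl_vars n" unfolding kx_def kb_def using sort_column_pl_vars ax ab by auto
  define M S where "M = pair_mon (a, b) + kx" and "S = pair_mon q + kx"
  have M2: "M = pair_mon (a, x) + kb" unfolding M_def kx_def kb_def pair_mon_def by (simp add: add_ac)
  have S_std: "standard n S"
    unfolding standard_def S_def monomial_add_supp supp_pair_mon kx_def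
    using qc ax(2) cmp sort_column_pl_vars pbw_le_refl unfolding comparable_def by (auto simp: var_column_sort)
  have cwM: "col_mweight n u M = u a + u b + col_mweight n u kx" "col_mweight n u S = u (fst q) + u (snd q) + col_mweight n u kx" for u :: "nat list \<Rightarrow> 'r::comm_ring_1"
    unfolding M_def S_def col_mweight_add by (simp_all add: col_mweight_pair col_mweight_pair_mon ab qc)
  have tot: "?b S - ?b M = ?V" using cwM[of "base_weight n"] by simp
  \<comment> \<open>A path with an intermediate monomial: its first step and its remainder each have
    a smaller base excess than the given term.\<close>
  have claim: "col_mweight n w M < col_mweight n w S"
    if st: "straight_step n M m" and ms: "(straight_step n)\<^sup>*\<^sup>* m S" and ne: "m \<noteq> S" for m
  proof -
    obtain a' b' q' k where t': "straight_term n a' b' q'" "M = pair_mon (a', b') + k" "m = pair_mon q' + k"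
      using st unfolding straight_step_def by blast
    note ab' = incomparableD[OF straight_termD(1)[OF t'(1)]] and q' = chain_pairsD[OF straight_termD(2)[OF t'(1)]]
    have cw: "col_mweight n u M = u a' + u b' + col_mweight n u k" "col_mweight n u m = u (fst q') + u (snd q') + col_mweight n u k" for u :: "nat list \<Rightarrow> 'r::comm_ring_1"
      unfolding t'(2,3) col_mweight_add by (simp_all add: col_mweight_pair col_mweight_pair_mon ab' q')
    have b1: "?b M < ?b m" by (rule straight_step_less[OF straightens_base_weight[OF n] st])
    have b2: "?b m < ?b S" by (rule straight_steps_le(2)[OF straightens_base_weight[OF n] ms ne])
    have "w a' + w b' < w (fst q') + w (snd q')"
      by (rule small[OF t'(1)]) (use b2 tot cw[of "base_weight n"] in linarith)
    then have "col_mweight n w M < col_mweight n w m" unfolding cw by simp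
    also have "\<dots> \<le> col_mweight n w S"
      by (rule straight_steps_small[OF n small ms]) (use b1 tot in \<open>auto\<close>)
    finally show ?thesis .
  qed
  have vq: "supp (pair_mon p + k) \<subseteq> pl_vars n" if "p \<in> chain_pairs n" "supp k \<subseteq> pl_vars n" for p k
    unfolding monomial_add_supp using supp_pair_mon_vars chain_pairsD[OF that(1)] that(2) by simp
  have step_ab: "straight_step n M (pair_mon p + kx)" if "minor_coef n a b p \<noteq> 0" for p
    unfolding straight_step_def M_def straight_term_def using that tD(1) by blast
  have step_ax: "straight_step n M (pair_mon p + kb)" if "minor_coef n a x p \<noteq> 0" for p
    unfolding straight_step_def M2 straight_term_def using that xi by blast
  have mq: "minor_coef n a b q \<noteq> 0" using t unfolding straight_term_def by simp
  \<comment> \<open>Otherwise the coefficient of \<open>S\<close> in the expansion of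
    \<open>M\<close> would be \<open>minor_coef n a b q\<close> by one computation and 0 by the
    other.\<close>
  have "(\<exists>p\<in>chain_pairs n. p \<noteq> q \<and> minor_coef n a b p * coef (expansion n (pair_mon p + kx)) S \<noteq> 0) \<or>
    (\<exists>p\<in>chain_pairs n. minor_coef n a x p * coef (expansion n (pair_mon p + kb)) S \<noteq> 0)"
  proof (rule ccontr)
    assume none: "\<not> ?thesis"
    have "coef (expansion n M) S = (\<Sum>p\<in>chain_pairs n. minor_coef n a b p * coef (expansion n (pair_mon p + kx)) S)"
      unfolding M_def by (rule expansion_straighten[OF n tD(1) kv(1)])
    also have "\<dots> = (\<Sum>p\<in>chain_pairs n. if p = q then minor_coef n a b q * coef (expansion n S) S else 0)"
      by (rule sum.cong) (use none in \<open>auto simp: S_def\<close>)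
    also have "\<dots> = minor_coef n a b q" using tD(2) finite_chain_pairs S_std by (simp add: expansion_standard)
    finally have "coef (expansion n M) S = minor_coef n a b q" .
    moreover have "coef (expansion n M) S = (\<Sum>p\<in>chain_pairs n. minor_coef n a x p * coef (expansion n (pair_mon p + kb)) S)"
      unfolding M2 by (rule expansion_straighten[OF n xi kv(2)])
    moreover have "(\<Sum>p\<in>chain_pairs n. minor_coef n a x p * coef (expansion n (pair_mon p + kb)) S) = 0"
      by (rule sum.neutral) (use none in blast)
    ultimately show False using mq by simp
  qed
  then have "col_mweight n w M < col_mweight n w S"
  proof
    assume "\<exists>p\<in>chain_pairs n. p \<noteq> q \<and> minor_coef n a b p * coef (expansion n (pair_mon p + kx)) S \<noteq> 0"
    then obtain p where p: "p \<in> chain_pairs n" "p \<noteq> q" "minor_coef n a b p \<noteq> 0" "S \<in> supp (expansion n (pair_mon p + kx))"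
      by (auto simp: in_keys_iff)
    show ?thesis
    proof (rule claim[OF step_ab[OF p(3)] expansion(3)[OF n vq[OF p(1) kv(1)] p(4)]])
      show "pair_mon p + kx \<noteq> S" unfolding S_def using pair_mon_inj[OF p(1) tD(2)] p(2) by auto
    qed
  next
    assume "\<exists>p\<in>chain_pairs n. minor_coef n a x p * coef (expansion n (pair_mon p + kb)) S \<noteq> 0"
    then obtain p where p: "p \<in> chain_pairs n" "minor_coef n a x p \<noteq> 0" "S \<in> supp (expansion n (pair_mon p + kb))"
      by (auto simp: in_keys_iff)
    show ?thesis
    proof (rule claim[OF step_ax[OF p(2)] expansion(3)[OF n vq[OF p(1) kv(2)] p(3)]])
      show "pair_mon p + kb \<noteq> S"
      proof
        assume "pair_mon p + kb = S"
        then have "sort b \<in> supp S" by (metis UnI2 insertI1 keys_single kb_def monomial_add_supp zero_neq_one One_nat_def)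
        then have "sort b \<in> {sort (fst q), sort (snd q), sort x}" unfolding S_def monomial_add_supp supp_pair_mon kx_def by auto
        \<comment> \<open>Cancelling b from the contents would identify the other member of
          \<open>q\<close> with a, making a and b comparable.\<close>
        then have "b = fst q \<or> b = snd q" using sort_column_inj ab(2) qc(1,2) ax(2) xb by blast
        then have "pbw_le b a \<or> pbw_le a b"
          using same_content_cancel[OF qc(2) ab(1) tD(3)] same_content_cancel[OF qc(1) ab(1) tD(3)] qc(3) by (metis prod.collapse)
        then show False using ab by blast
      qed
    qed
  qed
  then show ?thesis unfolding cwM by simp
qed

text \<open>Induction on the excess of the term in \<open>base_weight\<close>, a positive integer. A
  detour may arise from either of the two columns, so both orders of the pair are tried.\<close>

theorem straightens_if_listed:
  fixes w :: "nat list \<Rightarrow> real"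
  assumes n: "2 \<le> n"
    and w: "\<And>a b q. straight_term n a b q \<Longrightarrow> listed_term n a b q \<Longrightarrow> w a + w b < w (fst q) + w (snd q)"
  shows "straightens n w"
proof -
  have "w a + w b < w (fst q) + w (snd q)" if "straight_term n a b q" for a b q
    using that
  proof (induction "nat (base_weight n (fst q) + base_weight n (snd q) - base_weight n a - base_weight n b)" arbitrary: a b q rule: less_induct)
    case less
    have pos: "0 < base_weight n (fst q) + base_weight n (snd q) - base_weight n a - base_weight n b"
      using straightens_base_weight[OF n] less(2) unfolding straightens_def by (simp add: algebra_simps)
    have small: "w a' + w b' < w (fst q') + w (snd q')"
      if "straight_term n a' b' q'" "base_weight n (fst q') + base_weight n (snd q') - base_weight n a' - base_weight n b'
        < base_weight n (fst q) + base_weight n (snd q) - base_weight n a - base_weight n b" for a' b' q'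
      by (rule less(1)[OF _ that(1)]) (use that(2) pos in simp)
    have sym: "straight_term n b a q" using less(2) unfolding straight_term_def pbw_incomparable_def minor_coef_commute[of n b a] by auto
    show ?case
    proof (cases "\<exists>x. detour n a b q x")
      case True
      then obtain x where "detour n a b q x" by blast
      then show ?thesis by (rule detour_inequality[OF n less(2)]) (rule small)
    next
      case F1: False
      show ?thesis
      proof (cases "\<exists>x. detour n b a q x")
        case True
        then obtain x where "detour n b a q x" by blast
        then have "w b + w a < w (fst q) + w (snd q)"
          by (rule detour_inequality[OF n sym]) (rule small, auto)
        then show ?thesis by simp
      next
        case False
        then have "listed_term n a b q" using term_listed_or_detour[OF n less(2)] F1 by blast
        then show ?thesis by (rule w[OF less(2)])
      qed
    qed
  qed
  then show ?thesis unfolding straightens_def by blast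
qed

section \<open>Separating the inequalities\<close>

lemma finite_listed: "finite {(a, b, q). listed_term n a b q \<and> straight_term n a b q}"
proof (rule finite_subset)
  show "{(a, b, q). listed_term n a b q \<and> straight_term n a b q} \<subseteq> pbw_columns n \<times> pbw_columns n \<times> (pbw_columns n \<times> pbw_columns n)"
    using straight_termD(1,2) incomparableD(1,2) chain_pairsD by fastforce
  show "finite (pbw_columns n \<times> pbw_columns n \<times> (pbw_columns n \<times> pbw_columns n))"
    using finite_pbw_columns by blast
qed

lemma K_set_generates:
  assumes J: "J \<in> order_ideals n" and x: "x \<in> maximal_elems J"
  shows "x \<in> K_set n J"
proof -
  have "x \<in> J" using x unfolding maximal_elems_def by simp
  moreover have "x \<in> tri n" using calculation order_ideals_sub[OF J] by blast
  ultimately show ?thesis using x unfolding K_set_def V_o_def V_c_def by (cases x) (auto simp: tri_iff)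
qed

lemma K_set_sub: "K_set n J \<subseteq> J"
  unfolding K_set_def maximal_elems_def by auto

text \<open>The defining equation of \<open>pbw_odot\<close>, recovered from the equality of cells
  in \<open>odot_join\<close>.\<close>

lemma K_set_odot:
  assumes a: "a \<in> pbw_columns n" and b: "b \<in> pbw_columns n" and n: "2 \<le> n"
  shows "of_bool (x \<in> K_set n (col_ideal n a)) + of_bool (x \<in> K_set n (col_ideal n b)) =
    (of_bool (x \<in> K_set n (col_ideal n a \<union> col_ideal n b)) + of_bool (x \<in> K_set n (col_ideal n (pbw_odot n a b))) :: nat)"
proof -
  note j = pbw_join[OF a b n] and oj = odot_join[OF a b n]
  have o: "pbw_odot n a b \<in> pbw_columns n"
    using chain_pairsD(1)[of "(pbw_odot n a b, pbw_join n a b)" n] minor_coef(2)[OF a b oj(1)] by simp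
  obtain s t where x: "x = (s, t)" by (cases x)
  have co: "coef (cell_mon a) p + coef (cell_mon b) p = coef (cell_mon (pbw_odot n a b)) p + coef (cell_mon (pbw_join n a b)) p" for p
    using arg_cong[OF oj(2), of "\<lambda>m. coef m p"] unfolding pair_cells_def by (simp add: lookup_add)
  have "indicator (K_set n (col_ideal n a)) x + indicator (K_set n (col_ideal n b)) x =
    (indicator (K_set n (col_ideal n (pbw_join n a b))) x + indicator (K_set n (col_ideal n (pbw_odot n a b))) x :: nat)"
    unfolding x K_set_indicator[OF a] K_set_indicator[OF b] K_set_indicator[OF j(1)] K_set_indicator[OF o]
    using co[of "(s, t)"] by (simp add: sum.distrib[symmetric] co add.commute)
  then show ?thesis unfolding indicator_def j(2) by (simp add: of_bool_def)
qed

text \<open>A maximal element x of the ideal of \<open>a \<odot> b\<close> lies in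
  \<open>K_set\<close> of a or b. If it were in only one of the two ideals, the count would exclude
  it from \<open>K_set\<close> of the union; then it would be off the diagonal, maximal in its own
  ideal and below an element of the other, hence in both.\<close>

lemma odot_below:
  assumes a: "a \<in> pbw_columns n" and b: "b \<in> pbw_columns n" and n: "2 \<le> n"
  shows "col_ideal n (pbw_odot n a b) \<subseteq> col_ideal n a \<inter> col_ideal n b"
proof
  let ?A = "col_ideal n a" and ?B = "col_ideal n b" and ?O = "col_ideal n (pbw_odot n a b)"
  fix z assume z: "z \<in> ?O"
  obtain x where x: "x \<in> maximal_elems ?O" "z \<le> x" using maximal_above[OF col_ideal_order_ideal z] by blast
  have xK: "x \<in> K_set n ?O" by (rule K_set_generates[OF col_ideal_order_ideal x(1)])
  note K = K_set_odot[OF a b n, of x]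
  have zt: "z \<in> tri n" using z order_ideals_sub[OF col_ideal_order_ideal] by blast
  have "x \<in> ?A \<inter> ?B"
  proof (rule ccontr)
    assume nx: "x \<notin> ?A \<inter> ?B"
    have xAB: "x \<in> ?A \<union> ?B" using K xK K_set_sub[of n ?A] K_set_sub[of n ?B] by (auto split: if_splits simp: of_bool_def)
    have "x \<notin> K_set n (?A \<union> ?B)" using K xK nx K_set_sub[of n ?A] K_set_sub[of n ?B] by (auto split: if_splits simp: of_bool_def)
    then have xo: "x \<notin> V_o n" using xAB unfolding K_set_def by blast
    have xm: "x \<in> maximal_elems ?A \<or> x \<in> maximal_elems ?B" and xc: "x \<in> V_c n"
      using K xK xo unfolding K_set_def by (auto split: if_splits simp: of_bool_def)
    have "x \<notin> maximal_elems (?A \<union> ?B)" using \<open>x \<notin> K_set n (?A \<union> ?B)\<close> xc unfolding K_set_def by blast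
    then obtain y where y: "y \<in> ?A \<union> ?B" "x \<le> y" "y \<noteq> x" using xAB unfolding maximal_elems_def by blast
    have xt: "x \<in> tri n" using xAB order_ideals_sub[OF col_ideal_order_ideal] by blast
    from xm y nx show False
      using order_ideals_down[OF col_ideal_order_ideal _ xt y(2)] unfolding maximal_elems_def by blast
  qed
  then show "z \<in> ?A \<inter> ?B" using order_ideals_down[OF col_ideal_order_ideal _ zt x(2)] by blast
qed

text \<open>Such an element is counted twice on the side of a and b, but the union can account for
  one only.\<close>

lemma odot_maximal:
  assumes a: "a \<in> pbw_columns n" and b: "b \<in> pbw_columns n" and n: "2 \<le> n"
    and x: "x \<in> maximal_elems (col_ideal n a \<union> col_ideal n b)" "x \<in> col_ideal n a" "x \<in> col_ideal n b"
  shows "x \<in> col_ideal n (pbw_odot n a b)"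
proof -
  have "x \<in> maximal_elems (col_ideal n a)" "x \<in> maximal_elems (col_ideal n b)" using x unfolding maximal_elems_def by auto
  then have "x \<in> K_set n (col_ideal n a)" "x \<in> K_set n (col_ideal n b)" using K_set_generates[OF col_ideal_order_ideal] by blast+
  then have "x \<in> K_set n (col_ideal n (pbw_odot n a b))" using K_set_odot[OF a b n, of x] by (auto simp: of_bool_def split: if_splits)
  then show ?thesis using K_set_sub by blast
qed

text \<open>Above x choose a maximal element y of the intersection. As y is not in
  \<open>K_set\<close> of \<open>a \<odot> b\<close>, it is off the diagonal and maximal in neither
  ideal; but P and Q are the only elements outside the intersection that can lie above it.\<close>

lemma diamond_odot_gap:
  assumes a: "a \<in> pbw_columns n" and b: "b \<in> pbw_columns n" and n: "2 \<le> n"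
    and P: "col_ideal n a - col_ideal n b = {P}" and Q: "col_ideal n b - col_ideal n a = {Q}"
    and x: "x \<in> col_ideal n a \<inter> col_ideal n b" "x \<notin> col_ideal n (pbw_odot n a b)"
  shows "x \<le> P \<and> x \<le> Q"
proof -
  let ?A = "col_ideal n a" and ?B = "col_ideal n b" and ?O = "col_ideal n (pbw_odot n a b)"
  obtain y where y: "y \<in> maximal_elems (?A \<inter> ?B)" "x \<le> y"
    using maximal_above[OF order_ideals_Int[OF col_ideal_order_ideal col_ideal_order_ideal] x(1)] by blast
  have yC: "y \<in> ?A" "y \<in> ?B" using y(1) unfolding maximal_elems_def by auto
  have xt: "x \<in> tri n" using x(1) order_ideals_sub[OF col_ideal_order_ideal] by blast
  have yO: "y \<notin> ?O" using order_ideals_down[OF col_ideal_order_ideal _ xt y(2)] x(2) by blast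
  have yKO: "y \<notin> K_set n ?O" using yO K_set_sub by blast
  note K = K_set_odot[OF a b n, of y]
  have yo: "y \<notin> V_o n" using K yKO yC unfolding K_set_def by (auto simp: of_bool_def split: if_splits)
  have yc: "y \<in> V_c n"
    using K_set_generates[OF order_ideals_Int[OF col_ideal_order_ideal col_ideal_order_ideal] y(1)] yo unfolding K_set_def by blast
  have mK: "y \<in> K_set n J \<longleftrightarrow> y \<in> maximal_elems J" for J using yo yc unfolding K_set_def by blast
  have mU: "y \<in> maximal_elems (?A \<union> ?B) \<longleftrightarrow> y \<in> maximal_elems ?A \<and> y \<in> maximal_elems ?B"
    using yC unfolding maximal_elems_def by blast
  have nm: "y \<notin> maximal_elems ?A" "y \<notin> maximal_elems ?B"
    using K yKO unfolding mK mU by (auto simp: of_bool_def split: if_splits)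
  obtain z where z: "z \<in> ?A" "y \<le> z" "z \<noteq> y" using nm(1) yC unfolding maximal_elems_def by blast
  then have "z \<notin> ?B" using y(1) unfolding maximal_elems_def by blast
  then have "z = P" using P z(1) by blast
  then have "y \<le> P" using z(2) by simp
  obtain z' where z': "z' \<in> ?B" "y \<le> z'" "z' \<noteq> y" using nm(2) yC unfolding maximal_elems_def by blast
  then have "z' \<notin> ?A" using y(1) unfolding maximal_elems_def by blast
  then have "z' = Q" using Q z'(1) by blast
  then have "y \<le> Q" using z'(2) by simp
  then show ?thesis using \<open>y \<le> P\<close> y(2) order_trans by blast
qed

lemma difference_maximal:
  assumes "col_ideal n a - col_ideal n b = {P}"
  shows "P \<in> maximal_elems (col_ideal n a \<union> col_ideal n b)"
proof -
  have P: "P \<in> col_ideal n a" "P \<notin> col_ideal n b" "P \<in> tri n" using assms order_ideals_sub[OF col_ideal_order_ideal] by blast+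
  show ?thesis unfolding maximal_elems_def
  proof (intro CollectI conjI ballI impI)
    fix q assume q: "q \<in> col_ideal n a \<union> col_ideal n b" "P \<le> q"
    have "q \<notin> col_ideal n b" using order_ideals_down[OF col_ideal_order_ideal _ P(3) q(2)] P(2) by blast
    then show "q = P" using q assms by blast
  qed (use P in blast)
qed

context special_diamond
begin

lemma maximal_gap: "x \<in> maximal_elems D \<Longrightarrow> x \<notin> C \<Longrightarrow> x = R"
proof -
  assume x: "x \<in> maximal_elems D" "x \<notin> C"
  have "x \<in> {P, Q, R}" using x unfolding D_eq' maximal_elems_def by blast
  moreover have "P \<le> R" "Q \<le> R" "R \<in> D" unfolding D_eq' by auto
  ultimately show "x = R" using x(1) unfolding maximal_elems_def by auto
qed

lemma A_from_D: "A = D - {Q, R}" and B_from_D: "B = D - {P, R}"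
  using A_eq B_eq D_eq' notin_C by auto

end

lemma listed_term_cases:
  assumes "listed_term n a b q" "2 \<le> n"
  obtains (odot) P Q where "a \<in> pbw_columns n" "b \<in> pbw_columns n" "col_ideal n a - col_ideal n b = {P}"
      "col_ideal n b - col_ideal n a = {Q}" "q = (pbw_odot n a b, pbw_join n a b)"
  | (special) a' b' s t where "{a', b'} = {a, b}" "special_diamond n a' b' s t (fst q) (snd q)"
proof -
  consider "diamond_pair n a b" "q = (pbw_odot n a b, pbw_join n a b)" | "special_diamond_pair n a b" "q = (g1 n a b, h1 n a b)"
    using assms(1) unfolding listed_term_def by blast
  then show ?thesis
  proof cases
    case 1
    then show ?thesis using odot unfolding diamond_pair_iff[OF assms(2)] by blast
  next
    case 2
    obtain a' b' s t c d where sp: "{a', b'} = {a, b}" "special_diamond n a' b' s t c d"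
      using special_diamond_pair_obtain[OF 2(1) assms(2)] by metis
    have "fst q = c" "snd q = d" using 2(2) special_diamond_pair_extra(1)[OF sp(2,1)] unfolding g1_def h1_def by auto
    then show ?thesis using special sp by blast
  qed
qed

lemma listed_term_straight:
  assumes "listed_term n a b q" "2 \<le> n"
  shows "straight_term n a b q"
  using assms
proof (cases rule: listed_term_cases)
  case (odot P Q)
  have "pbw_incomparable n a b" unfolding pbw_incomparable_def
    using odot pbw_le_iff_subset[OF odot(2,1)] pbw_le_iff_subset[OF odot(1,2)] by blast
  then show ?thesis unfolding straight_term_def using odot_join(1)[OF odot(1,2) assms(2)] odot(5) by simp
next
  case (special a' b' s t)
  show ?thesis unfolding straight_term_def
    using special_diamond_pair_extra(2,3)[OF special(2,1)] by simp
qed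

lemma listed_term_between:
  assumes l: "listed_term n a b q" and n: "2 \<le> n"
  shows "col_ideal n (fst q) \<subseteq> col_ideal n a \<inter> col_ideal n b" "col_ideal n a \<union> col_ideal n b \<subseteq> col_ideal n (snd q)"
proof -
  have "col_ideal n (fst q) \<subseteq> col_ideal n a \<inter> col_ideal n b \<and> col_ideal n a \<union> col_ideal n b \<subseteq> col_ideal n (snd q)"
    using assms
  proof (cases rule: listed_term_cases)
    case (odot P Q)
    then show ?thesis using odot_below[OF odot(1,2) n] pbw_join(2)[OF odot(1,2) n] by simp
  next
    case (special a' b' s t)
    interpret special_diamond n a' b' s t "fst q" "snd q" by (rule special(2))
    show ?thesis using special(1) C_eq D_eq by (auto simp: doubleton_eq_iff)
  qed
  then show "col_ideal n (fst q) \<subseteq> col_ideal n a \<inter> col_ideal n b" "col_ideal n a \<union> col_ideal n b \<subseteq> col_ideal n (snd q)" by auto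
qed

text \<open>If P were the corner R of the special diamond, both its lower neighbours would be
  missing from \<open>c\<close>, hence from \<open>a \<odot> b\<close>, and so lie below Q by
  \<open>diamond_odot_gap\<close>. Then R itself would be below Q.\<close>

lemma odot_special_distinct:
  assumes a: "a \<in> pbw_columns n" and b: "b \<in> pbw_columns n" and n: "2 \<le> n"
    and P: "col_ideal n a - col_ideal n b = {P}" and Q: "col_ideal n b - col_ideal n a = {Q}"
    and sp: "special_diamond n a' b' s t c (pbw_join n a b)" and le: "col_ideal n (pbw_odot n a b) \<subseteq> col_ideal n c"
  shows "P \<noteq> (Suc s, Suc t)"
proof
  assume PR: "P = (Suc s, Suc t)"
  interpret sp: special_diamond n a' b' s t c "pbw_join n a b" by (rule sp)
  let ?A = "col_ideal n a" and ?B = "col_ideal n b" and ?D = "col_ideal n (pbw_join n a b)"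
  have D: "?D = ?A \<union> ?B" by (rule pbw_join(2)[OF a b n])
  have Qm: "Q \<in> maximal_elems ?D" using difference_maximal[OF Q] unfolding D by (simp add: Un_commute)
  have below: "x \<le> Q" if x: "x \<in> {(Suc s, t), (s, Suc t)}" for x
  proof -
    have xD: "x \<in> ?D" "x \<notin> col_ideal n c" "x \<le> P" "x \<noteq> P" "P \<in> ?D" using x sp.D_eq' sp.notin_C PR by auto
    have "x \<noteq> Q" using Qm xD unfolding maximal_elems_def by blast
    then have "x \<in> ?A \<inter> ?B" using xD P Q unfolding D by blast
    then show ?thesis using diamond_odot_gap[OF a b n P Q] le xD(2) by blast
  qed
  have "P \<le> Q" using below[of "(Suc s, t)"] below[of "(s, Suc t)"] unfolding PR by (cases Q) auto
  moreover have "P \<in> maximal_elems ?D" using difference_maximal[OF P] unfolding D by simp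
  ultimately have "P = Q" using Qm unfolding maximal_elems_def by blast
  then show False using P Q by blast
qed

text \<open>Look at the maximal elements of the common larger member outside the smaller one. For
  the term of a join they are among P and Q, for a special term only R. The elements removed in the
  second term are of this kind too, because its smaller member contains the first one.\<close>

lemma listed_term_determined:
  assumes n: "2 \<le> n" and l: "listed_term n a b q" and l': "listed_term n a' b' q'"
    and top: "snd q = snd q'" and le: "col_ideal n (fst q) \<subseteq> col_ideal n (fst q')"
  shows "{a, b} = {a', b'} \<and> q = q'"
  using l n
proof (cases rule: listed_term_cases)
  case j: (odot P Q)
  note D = pbw_join(2)[OF j(1,2) n]
  have fq: "fst q = pbw_odot n a b" "snd q = pbw_join n a b" using j(5) by auto
  \<comment> \<open>A maximal element of the join common to both ideals would persist in
    \<open>a \<odot> b\<close>.\<close>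
  have mx: "x \<in> {P, Q}" if x: "x \<in> maximal_elems (col_ideal n (pbw_join n a b))" "x \<notin> col_ideal n (pbw_odot n a b)" for x
  proof (rule ccontr)
    assume "x \<notin> {P, Q}"
    moreover have "x \<in> col_ideal n a \<union> col_ideal n b" using x(1) unfolding D maximal_elems_def by simp
    ultimately have "x \<in> col_ideal n a" "x \<in> col_ideal n b" using j(3,4) by blast+
    then show False using odot_maximal[OF j(1,2) n] x unfolding D by blast
  qed
  show ?thesis using l' n
  proof (cases rule: listed_term_cases)
    case i: (odot P' Q')
    have fq': "fst q' = pbw_odot n a' b'" "snd q' = pbw_join n a' b'" using i(5) by auto
    have D': "col_ideal n (pbw_join n a b) = col_ideal n a' \<union> col_ideal n b'"
      using top pbw_join(2)[OF i(1,2) n] fq fq' by simp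
    have "P' \<in> {P, Q}"
      by (rule mx) (use difference_maximal[OF i(3)] odot_below[OF i(1,2) n] le fq fq' i(3) in \<open>auto simp: D'\<close>)
    moreover have "Q' \<in> {P, Q}"
      by (rule mx) (use difference_maximal[OF i(4)] odot_below[OF i(1,2) n] le fq fq' i(4) in \<open>auto simp: D' Un_commute\<close>)
    moreover have "P' \<noteq> Q'" using i(3,4) by blast
    moreover have "P \<noteq> Q" using j(3,4) by blast
    moreover have "col_ideal n a = (col_ideal n (pbw_join n a b)) - {Q}" "col_ideal n b = (col_ideal n (pbw_join n a b)) - {P}"
      using D j(3,4) by blast+
    moreover have "col_ideal n a' = (col_ideal n (pbw_join n a b)) - {Q'}" "col_ideal n b' = (col_ideal n (pbw_join n a b)) - {P'}"
      using D' i(3,4) by blast+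
    ultimately have "col_ideal n a = col_ideal n a' \<and> col_ideal n b = col_ideal n b' \<or> col_ideal n a = col_ideal n b' \<and> col_ideal n b = col_ideal n a'"
      by (metis insertE singletonD)
    then have ab: "a = a' \<and> b = b' \<or> a = b' \<and> b = a'"
      using col_ideal_inj[OF j(1) i(1)] col_ideal_inj[OF j(2) i(2)] col_ideal_inj[OF j(1) i(2)] col_ideal_inj[OF j(2) i(1)] by simp
    then have "q = q'" using j(5) i(5) odot_join_commute[OF i(1,2) n] by auto
    then show ?thesis using ab by auto
  next
    case i: (special x y s t)
    interpret sp: special_diamond n x y s t "fst q'" "snd q'" by (rule i(2))
    have sp: "special_diamond n x y s t (fst q') (pbw_join n a b)" using i(2) top fq by simp
    have sp': "special_diamond n x y s t (fst q') (pbw_join n b a)" using sp odot_join_commute[OF j(1,2) n] by simp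
    have le': "col_ideal n (pbw_odot n b a) \<subseteq> col_ideal n (fst q')" using le fq odot_join_commute[OF j(1,2) n] by simp
    have "(Suc s, Suc t) \<in> {P, Q}"
      by (rule mx) (use sp.max_PQR(3) sp.notin_C(3) le top fq in auto)
    moreover have "P \<noteq> (Suc s, Suc t)"
      by (rule odot_special_distinct[OF j(1,2) n j(3,4) sp]) (use le fq in simp)
    moreover have "Q \<noteq> (Suc s, Suc t)"
      by (rule odot_special_distinct[OF j(2,1) n j(4,3) sp' le'])
    ultimately show ?thesis by blast
  qed
next
  case j: (special x y s t)
  interpret sp: special_diamond n x y s t "fst q" "snd q" by (rule j(2))
  show ?thesis using l' n
  proof (cases rule: listed_term_cases)
    case i: (odot P Q)
    have fq': "fst q' = pbw_odot n a' b'" "snd q' = pbw_join n a' b'" using i(5) by auto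
    have D: "col_ideal n (snd q) = col_ideal n a' \<union> col_ideal n b'" using pbw_join(2)[OF i(1,2) n] top fq' by simp
    have "P = (Suc s, Suc t)"
      by (rule sp.maximal_gap) (use difference_maximal[OF i(3)] odot_below[OF i(1,2) n] le fq' i(3) in \<open>auto simp: D\<close>)
    moreover have "Q = (Suc s, Suc t)"
      by (rule sp.maximal_gap) (use difference_maximal[OF i(4)] odot_below[OF i(1,2) n] le fq' i(4) in \<open>auto simp: D Un_commute\<close>)
    ultimately show ?thesis using i(3,4) by blast
  next
    case i: (special x' y' s' t')
    interpret sp': special_diamond n x' y' s' t' "fst q'" "snd q'" by (rule i(2))
    have "(Suc s', Suc t') = (Suc s, Suc t)"
      by (rule sp.maximal_gap) (use sp'.max_PQR(3) sp'.notin_C(3) le top in auto)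
    then have st: "s' = s" "t' = t" by auto
    have "col_ideal n x = col_ideal n x'" "col_ideal n y = col_ideal n y'"
      using sp.A_from_D sp'.A_from_D sp.B_from_D sp'.B_from_D unfolding top st by auto
    then have "x = x'" "y = y'" using col_ideal_inj[OF sp.a sp'.a] col_ideal_inj[OF sp.b sp'.b] by auto
    then have ab: "{a, b} = {a', b'}" using i(1) j(1) by simp
    moreover have "fst q = fst q'"
    proof -
      have "col_ideal n (fst q) = col_ideal n (fst q')" using sp.C_eq sp'.C_eq \<open>x = x'\<close> \<open>y = y'\<close> by simp
      then show ?thesis using col_ideal_inj[OF sp.c sp'.c] by simp
    qed
    ultimately show ?thesis using top by (simp add: prod_eq_iff)
  qed
qed

section \<open>Weights that repair the remaining inequalities\<close>

definition high_weight :: "nat \<Rightarrow> nat list \<Rightarrow> nat list \<Rightarrow> real"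
  where "high_weight n t x = (if col_ideal n x \<subseteq> col_ideal n t then 0 else 3 ^ card (col_ideal n x))"

definition low_weight :: "nat \<Rightarrow> nat list \<Rightarrow> nat list \<Rightarrow> real"
  where "low_weight n u x = (if col_ideal n u \<subseteq> col_ideal n x then 0 else 3 ^ (card (tri n) - card (col_ideal n x)))"

text \<open>The reason for base 3: a power exceeds the sum of two smaller ones, with 1 to spare.
  That 1 becomes the guaranteed gain in an inequality.\<close>

lemma power_three_dominates:
  assumes "i < m" "j < m"
  shows "3 ^ i + 3 ^ j + 1 \<le> (3::real) ^ m"
proof -
  obtain k where k: "m = Suc k" "i \<le> k" "j \<le> k" using assms by (cases m) auto
  have "(3::real) ^ i \<le> 3 ^ k" "(3::real) ^ j \<le> 3 ^ k" "(1::real) \<le> 3 ^ k" using k by (simp_all add: power_increasing)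
  then show ?thesis unfolding k(1) power_Suc by linarith
qed

lemma card_col_ideal_less:
  assumes "col_ideal n x \<subset> col_ideal n y"
  shows "card (col_ideal n x) < card (col_ideal n y)"
  by (rule psubset_card_mono[OF order_ideals_finite[OF col_ideal_order_ideal] assms])

lemma listed_term_strict:
  assumes l: "listed_term n a b q" and n: "2 \<le> n"
  shows "col_ideal n (fst q) \<subset> col_ideal n a" "col_ideal n (fst q) \<subset> col_ideal n b"
    "col_ideal n a \<subset> col_ideal n (snd q)" "col_ideal n b \<subset> col_ideal n (snd q)"
proof -
  note ab = incomparableD[OF straight_termD(1)[OF listed_term_straight[OF assms]]]
  have "\<not> col_ideal n a \<subseteq> col_ideal n b" "\<not> col_ideal n b \<subseteq> col_ideal n a"
    using ab(3,4) unfolding pbw_le_iff_subset[OF ab(2,1)] pbw_le_iff_subset[OF ab(1,2)] by auto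
  then show "col_ideal n (fst q) \<subset> col_ideal n a" "col_ideal n (fst q) \<subset> col_ideal n b"
    "col_ideal n a \<subset> col_ideal n (snd q)" "col_ideal n b \<subset> col_ideal n (snd q)"
    using listed_term_between[OF assms] by auto
qed

text \<open>The larger member of a term has a strictly larger ideal than a and b, so unless it is
  below t it outweighs them; if it is below t, so are a and b, and they weigh nothing.\<close>

lemma high_weight_excess:
  assumes l: "listed_term n a b q" and n: "2 \<le> n"
  shows "high_weight n t a + high_weight n t b + of_bool (\<not> col_ideal n (snd q) \<subseteq> col_ideal n t) \<le> high_weight n t (fst q) + high_weight n t (snd q)"
proof -
  note s = listed_term_strict[OF assms]
  have "3 ^ card (col_ideal n a) + 3 ^ card (col_ideal n b) + 1 \<le> (3::real) ^ card (col_ideal n (snd q))"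
    by (rule power_three_dominates[OF card_col_ideal_less[OF s(3)] card_col_ideal_less[OF s(4)]])
  moreover have "0 \<le> high_weight n t (fst q)" "high_weight n t a \<le> 3 ^ card (col_ideal n a)" "high_weight n t b \<le> 3 ^ card (col_ideal n b)"
    unfolding high_weight_def by auto
  moreover have "high_weight n t a = 0" "high_weight n t b = 0" if "col_ideal n (snd q) \<subseteq> col_ideal n t"
    using that s unfolding high_weight_def by auto
  moreover have "0 \<le> high_weight n t (snd q)" "\<not> col_ideal n (snd q) \<subseteq> col_ideal n t \<Longrightarrow> high_weight n t (snd q) = 3 ^ card (col_ideal n (snd q))"
    unfolding high_weight_def by auto
  ultimately show ?thesis by (cases "col_ideal n (snd q) \<subseteq> col_ideal n t") auto
qed

text \<open>The dual statement, with the smaller member dominating through the codimension of its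
  ideal.\<close>

lemma low_weight_excess:
  assumes l: "listed_term n a b q" and n: "2 \<le> n"
  shows "low_weight n u a + low_weight n u b + of_bool (\<not> col_ideal n u \<subseteq> col_ideal n (fst q)) \<le> low_weight n u (fst q) + low_weight n u (snd q)"
proof -
  note s = listed_term_strict[OF assms]
  let ?d = "\<lambda>x. card (tri n) - card (col_ideal n x)"
  have "3 ^ ?d a + 3 ^ ?d b + 1 \<le> (3::real) ^ ?d (fst q)"
    by (rule power_three_dominates)
      (use card_col_ideal_less[OF s(1)] card_col_ideal_less[OF s(2)] card_col_ideal_le[of n a] card_col_ideal_le[of n b] in linarith)+
  moreover have "0 \<le> low_weight n u (snd q)" "low_weight n u a \<le> 3 ^ ?d a" "low_weight n u b \<le> 3 ^ ?d b"
    unfolding low_weight_def by auto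
  moreover have "low_weight n u a = 0" "low_weight n u b = 0" if "col_ideal n u \<subseteq> col_ideal n (fst q)"
    using that s unfolding low_weight_def by auto
  moreover have "0 \<le> low_weight n u (fst q)" "\<not> col_ideal n u \<subseteq> col_ideal n (fst q) \<Longrightarrow> low_weight n u (fst q) = 3 ^ ?d (fst q)"
    unfolding low_weight_def by auto
  ultimately show ?thesis by (cases "col_ideal n u \<subseteq> col_ideal n (fst q)") auto
qed

lemma separating_weight:
  assumes n: "2 \<le> n" and l: "listed_term n a b q"
  obtains w :: "nat list \<Rightarrow> real" where "w a + w b = w (fst q) + w (snd q)"
    "\<And>a' b' q'. listed_term n a' b' q' \<Longrightarrow> ({a', b'}, q') \<noteq> ({a, b}, q) \<Longrightarrow> w a' + w b' < w (fst q') + w (snd q')"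
proof -
  define w0 where "w0 x = real_of_int (base_weight n x)" for x
  have w0: "w0 a' + w0 b' < w0 (fst q') + w0 (snd q')" if "listed_term n a' b' q'" for a' b' q'
    using straightens_base_weight[OF n] listed_term_straight[OF that n] unfolding straightens_def w0_def by fastforce
  \<comment> \<open>The slack of the chosen inequality at the base weight; lowering the coordinate
    of \<open>snd q\<close> by this amount turns it into an equality.\<close>
  define M where "M = w0 (fst q) + w0 (snd q) - w0 a - w0 b"
  have M: "0 < M" using w0[OF l] unfolding M_def by simp
  define g where "g x = high_weight n (snd q) x + low_weight n (fst q) x" for x
  define e :: "nat list \<Rightarrow> real" where "e x = of_bool (x = snd q)" for x
  \<comment> \<open>\<open>g\<close> vanishes on every listed term between \<open>fst q\<close> and
    \<open>snd q\<close>, in particular on \<open>q\<close>, so the equality is not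
    disturbed.\<close>
  define w where "w x = w0 x - M * e x + M * g x" for x
  have g: "1 \<le> g (fst q') + g (snd q') - g a' - g b'"
    if l': "listed_term n a' b' q'" and far: "\<not> (col_ideal n (snd q') \<subseteq> col_ideal n (snd q) \<and> col_ideal n (fst q) \<subseteq> col_ideal n (fst q'))" for a' b' q'
    using high_weight_excess[OF l' n, of "snd q"] low_weight_excess[OF l' n, of "fst q"] far unfolding g_def
    by (cases "col_ideal n (snd q') \<subseteq> col_ideal n (snd q)"; cases "col_ideal n (fst q) \<subseteq> col_ideal n (fst q')") simp_all
  have g0: "g (fst q') = 0" "g (snd q') = 0" "g a' = 0" "g b' = 0"
    if l': "listed_term n a' b' q'" and near: "col_ideal n (snd q') \<subseteq> col_ideal n (snd q)" "col_ideal n (fst q) \<subseteq> col_ideal n (fst q')" for a' b' q'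
    using near listed_term_strict[OF l' n] unfolding g_def high_weight_def low_weight_def by auto
  have sq: "snd q \<in> pbw_columns n" using chain_pairsD(2)[OF straight_termD(2)[OF listed_term_straight[OF l n]]] .
  have f: "w (fst q') + w (snd q') - w a' - w b' = (w0 (fst q') + w0 (snd q') - w0 a' - w0 b') - M * (e (fst q') + e (snd q') - e a' - e b') + M * (g (fst q') + g (snd q') - g a' - g b')" for a' b' q'
    unfolding w_def by (simp add: algebra_simps)
  show ?thesis
  proof (rule that[of w])
    have "e (snd q) = 1" "e (fst q) = 0" "e a = 0" "e b = 0" using listed_term_strict[OF l n] unfolding e_def by auto
    then show "w a + w b = w (fst q) + w (snd q)" using f[of q a b] g0[OF l] unfolding M_def by simp
  next
    fix a' b' q' assume l': "listed_term n a' b' q'" and ne: "({a', b'}, q') \<noteq> ({a, b}, q)"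
    note s = listed_term_strict[OF l' n]
    have "0 < w (fst q') + w (snd q') - w a' - w b'"
    proof (cases "col_ideal n (snd q') \<subseteq> col_ideal n (snd q) \<and> col_ideal n (fst q) \<subseteq> col_ideal n (fst q')")
      case True
      \<comment> \<open>By \<open>listed_term_determined\<close> no other listed term between these
        bounds has the same larger member, so the lowered coordinate does not enter it.\<close>
      have "snd q' \<noteq> snd q"
      proof
        assume "snd q' = snd q"
        then have "{a, b} = {a', b'} \<and> q = q'" using True by (intro listed_term_determined[OF n l l']) simp_all
        then show False using ne by simp
      qed
      moreover have "snd q' \<in> pbw_columns n" using chain_pairsD(2)[OF straight_termD(2)[OF listed_term_straight[OF l' n]]] .
      ultimately have "col_ideal n (snd q') \<noteq> col_ideal n (snd q)" using col_ideal_inj sq by blast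
      then have "e (snd q') = 0" "e (fst q') = 0" "e a' = 0" "e b' = 0" using True s unfolding e_def by auto
      then show ?thesis using w0[OF l'] g0[OF l'] True unfolding f by simp
    next
      case False
      \<comment> \<open>The lowering costs at most \<open>M\<close>, and outside the bounds
        \<open>g\<close> restores at least \<open>M\<close>.\<close>
      have "e (fst q') + e (snd q') - e a' - e b' \<le> 1" using s unfolding e_def by auto
      then have "M * (e (fst q') + e (snd q') - e a' - e b') \<le> M * 1" using M by (intro mult_left_mono) auto
      moreover have "M * 1 \<le> M * (g (fst q') + g (snd q') - g a' - g b')" using M g[OF l' False] by (intro mult_left_mono) auto
      ultimately show ?thesis using w0[OF l'] unfolding f by linarith
    qed
    then show "w a' + w b' < w (fst q') + w (snd q')" by simp
  qed
qed

section \<open>Facets of the cone\<close>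

text \<open>Moving from a point of the closed cone in direction \<open>w0\<close> enters the open
  cone at once.\<close>

lemma closure_open_cone:
  fixes F :: "'a::euclidean_space set"
  assumes w0: "\<And>h. h \<in> F \<Longrightarrow> 0 < inner h w0"
  shows "closure {w. \<forall>h\<in>F. 0 < inner h w} = {w. \<forall>h\<in>F. 0 \<le> inner h w}"
proof
  have "closed {w. \<forall>h\<in>F. 0 \<le> inner h w}"
    unfolding Collect_ball_eq by (intro closed_INT ballI closed_halfspace_ge)
  then show "closure {w. \<forall>h\<in>F. 0 < inner h w} \<subseteq> {w. \<forall>h\<in>F. 0 \<le> inner h w}"
    by (intro closure_minimal) (auto intro: less_imp_le)
  show "{w. \<forall>h\<in>F. 0 \<le> inner h w} \<subseteq> closure {w. \<forall>h\<in>F. 0 < inner h w}"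
  proof
    fix w assume w: "w \<in> {w. \<forall>h\<in>F. 0 \<le> inner h w}"
    have "w + inverse (real (Suc k)) *\<^sub>R w0 \<in> {w. \<forall>h\<in>F. 0 < inner h w}" for k
      using w w0 by (auto simp: inner_add_right intro!: add_nonneg_pos)
    moreover have "(\<lambda>k. w + inverse (real (Suc k)) *\<^sub>R w0) \<longlonglongrightarrow> w + 0 *\<^sub>R w0"
      by (intro tendsto_intros LIMSEQ_inverse_real_of_nat)
    ultimately show "w \<in> closure {w. \<forall>h\<in>F. 0 < inner h w}"
      unfolding closure_sequential by (intro exI[of _ "\<lambda>k. w + inverse (real (Suc k)) *\<^sub>R w0"]) simp
  qed
qed

text \<open>Near \<open>w1\<close> the hyperplane of \<open>j\<close> is contained in the closed
  cone, because the other inequalities hold strictly there; so the face has codimension one.\<close>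

lemma facet_of_cone:
  fixes F :: "'a::euclidean_space set"
  assumes fin: "finite F" and w0: "\<And>h. h \<in> F \<Longrightarrow> 0 < inner h w0"
    and j: "j \<in> F" and w1: "inner j w1 = 0" "\<And>h. h \<in> F - {j} \<Longrightarrow> 0 < inner h w1"
  shows "closure {w. \<forall>h\<in>F. 0 < inner h w} \<inter> {w. inner j w = 0} facet_of closure {w. \<forall>h\<in>F. 0 < inner h w}"
proof -
  let ?O = "{w. \<forall>h\<in>F. 0 < inner h w}" and ?S = "{w. \<forall>h\<in>F. 0 \<le> inner h w}"
  let ?H = "{w. inner j w = 0}" and ?U = "{w. \<forall>h\<in>F - {j}. 0 < inner h w}"
  have cl: "closure ?O = ?S" by (rule closure_open_cone[OF w0])
  have op: "open {w. \<forall>h\<in>G. 0 < inner h w}" if "finite G" for G :: "'a set"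
  proof -
    have "{w. \<forall>h\<in>G. 0 < inner h w} = (\<Inter>h\<in>G. {w. inner h w > 0})" by auto
    then show ?thesis using that by (auto intro!: open_INT open_halfspace_gt)
  qed
  have j0: "j \<noteq> 0" using w0[OF j] by auto
  have S: "aff_dim ?S = DIM('a)"
  proof (rule antisym[OF aff_dim_le_DIM])
    have "aff_dim ?O = DIM('a)" using op[OF fin] w0 by (intro aff_dim_open) auto
    then show "int (DIM('a)) \<le> aff_dim ?S" using aff_dim_subset[of ?O ?S] by (auto intro: less_imp_le)
  qed
  have convex: "convex ?S"
    unfolding Collect_ball_eq by (intro convex_INT ballI convex_halfspace_ge)
  have w1S: "w1 \<in> ?S \<inter> ?H"
  proof (intro IntI CollectI ballI)
    fix h assume "h \<in> F" then show "0 \<le> inner h w1" using w1 by (cases "h = j") (auto intro: less_imp_le)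
  qed (use w1 in simp)
  have H: "aff_dim ?H = int DIM('a) - 1" using aff_dim_hyperplane[OF j0, of 0] by simp
  have "aff_dim (?S \<inter> ?H) = int DIM('a) - 1"
  proof (rule antisym)
    show "aff_dim (?S \<inter> ?H) \<le> int DIM('a) - 1" unfolding H[symmetric] by (rule aff_dim_subset) simp
    have "aff_dim (?H \<inter> ?U) = aff_dim ?H"
    proof (rule aff_dim_openin)
      show "openin (top_of_set ?H) (?H \<inter> ?U)" using op[of "F - {j}"] fin by (intro openin_open_Int) simp
      show "affine ?H" by (rule affine_hyperplane)
      show "?H \<inter> ?U \<noteq> {}" using w1 by auto
    qed
    moreover have "?H \<inter> ?U \<subseteq> ?S \<inter> ?H"
    proof (intro subsetI IntI CollectI ballI)
      fix w h assume "w \<in> ?H \<inter> ?U" "h \<in> F" then show "0 \<le> inner h w" by (cases "h = j") (auto intro: less_imp_le)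
    qed auto
    then have "aff_dim (?H \<inter> ?U) \<le> aff_dim (?S \<inter> ?H)" by (rule aff_dim_subset)
    ultimately show "int DIM('a) - 1 \<le> aff_dim (?S \<inter> ?H)" using H by linarith
  qed
  moreover have "?S \<inter> ?H face_of ?S"
    by (rule face_of_Int_supporting_hyperplane_ge[OF convex]) (use j in auto)
  ultimately show ?thesis unfolding facet_of_def cl using S w1S by auto
qed

section \<open>The inequalities as inner products\<close>

definition ineq_vector :: "('m::finite \<Rightarrow> nat list) \<Rightarrow> nat list \<Rightarrow> nat list \<Rightarrow> nat list \<times> nat list \<Rightarrow> real ^ 'm"
  where "ineq_vector idx a b q = axis (inv_into UNIV idx (fst q)) 1 + axis (inv_into UNIV idx (snd q)) 1
    - axis (inv_into UNIV idx a) 1 - axis (inv_into UNIV idx b) 1"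

lemma inner_ineq_vector:
  "inner (ineq_vector idx a b q) w = coords idx w (fst q) + coords idx w (snd q) - coords idx w a - coords idx w b"
  unfolding ineq_vector_def coords_def by (simp add: inner_add_left inner_diff_left inner_axis')

lemma ineq_vector_commute: "ineq_vector idx a b q = ineq_vector idx b a q"
  unfolding ineq_vector_def by (simp add: algebra_simps)

lemma coords_realise:
  assumes "bij_betw idx UNIV (pbw_columns n)" "b \<in> pbw_columns n"
  shows "coords idx (vec_lambda (\<lambda>k. f (idx k))) b = f b"
  unfolding coords_def using bij_betw_inv_into_right[OF assms] by simp

theorem theorem8p11:
  fixes n :: nat and idx :: "'m::finite \<Rightarrow> nat list"
  assumes "2 \<le> n"
    and "bij_betw idx UNIV (pbw_columns n)"
  shows "initial_cone n idx (pl_ideal n) (monomial_ideal n) =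
      {w. (\<forall>a b. diamond_pair n a b \<longrightarrow>
             w \<in> lt_set idx a b (pbw_join n a b) (pbw_odot n a b)) \<and>
          (\<forall>a b. special_diamond_pair n a b \<longrightarrow>
             w \<in> lt_set idx a b (g1 n a b) (h1 n a b))}
    \<and> (\<forall>a b. diamond_pair n a b \<longrightarrow>
         closure (initial_cone n idx (pl_ideal n) (monomial_ideal n))
             \<inter> eq_set idx a b (pbw_join n a b) (pbw_odot n a b)
           facet_of closure (initial_cone n idx (pl_ideal n) (monomial_ideal n)))
    \<and> (\<forall>a b. special_diamond_pair n a b \<longrightarrow>
         closure (initial_cone n idx (pl_ideal n) (monomial_ideal n))
             \<inter> eq_set idx a b (g1 n a b) (h1 n a b)
           facet_of closure (initial_cone n idx (pl_ideal n) (monomial_ideal n)))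
    \<and> (\<forall>H\<in>halfspaces n idx.
         \<Inter> (halfspaces n idx - {H}) \<noteq>
           initial_cone n idx (pl_ideal n) (monomial_ideal n))"
proof -
  note n = assms(1) and idx = assms(2)
  define K where "K = initial_cone n idx (pl_ideal n) (monomial_ideal n)"
  define F where "F = (\<lambda>(a, b, q). ineq_vector idx a b q) ` {(a, b, q). listed_term n a b q \<and> straight_term n a b q}"
  have finF: "finite F" unfolding F_def by (rule finite_imageI[OF finite_listed])
  have FI: "ineq_vector idx a b q \<in> F" if "listed_term n a b q" for a b q
    unfolding F_def using that listed_term_straight[OF that n] by (intro image_eqI[of _ _ "(a, b, q)"]) auto
  have FE: "\<exists>a b q. h = ineq_vector idx a b q \<and> listed_term n a b q" if "h \<in> F" for h using that unfolding F_def by auto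
  have K1: "w \<in> K \<longleftrightarrow> straightens n (coords idx w)" for w
    unfolding K_def initial_cone_def initial_space_iff[OF n] by simp
  have KF: "K = {w. \<forall>h\<in>F. 0 < inner h w}"
  proof (intro Set.set_eqI iffI CollectI ballI)
    fix w h assume w: "w \<in> K" and "h \<in> F"
    then obtain a b q where h: "h = ineq_vector idx a b q" "listed_term n a b q" using FE by blast
    have "coords idx w a + coords idx w b < coords idx w (fst q) + coords idx w (snd q)"
      using w listed_term_straight[OF h(2) n] unfolding K1 straightens_def by blast
    then show "0 < inner h w" unfolding h inner_ineq_vector by simp
  next
    fix w assume w: "w \<in> {w. \<forall>h\<in>F. 0 < inner h w}"
    have "straightens n (coords idx w)"
    proof (rule straightens_if_listed[OF n])
      fix a b q assume "listed_term n a b q"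
      then have "0 < inner (ineq_vector idx a b q) w" using FI w by blast
      then show "coords idx w a + coords idx w b < coords idx w (fst q) + coords idx w (snd q)" unfolding inner_ineq_vector by simp
    qed
    then show "w \<in> K" unfolding K1 .
  qed
  \<comment> \<open>Both orders of the last two columns are needed: the theorem lists the join
    before the odot, \<open>listed_term\<close> after it.\<close>
  have lt: "w \<in> lt_set idx a b c d \<longleftrightarrow> 0 < inner (ineq_vector idx a b (c, d)) w"
    and lt': "w \<in> lt_set idx a b c d \<longleftrightarrow> 0 < inner (ineq_vector idx a b (d, c)) w" for w a b c d
    unfolding lt_set_def inner_ineq_vector by auto
  have eq: "eq_set idx a b c d = {w. inner (ineq_vector idx a b (c, d)) w = 0}"
    and eq': "eq_set idx a b c d = {w. inner (ineq_vector idx a b (d, c)) w = 0}" for a b c d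
    unfolding eq_set_def inner_ineq_vector by auto
  have lists: "diamond_pair n a b \<Longrightarrow> listed_term n a b (pbw_odot n a b, pbw_join n a b)"
    "special_diamond_pair n a b \<Longrightarrow> listed_term n a b (g1 n a b, h1 n a b)" for a b
    unfolding listed_term_def by auto
  have cone: "K = {w. (\<forall>a b. diamond_pair n a b \<longrightarrow> w \<in> lt_set idx a b (pbw_join n a b) (pbw_odot n a b)) \<and>
      (\<forall>a b. special_diamond_pair n a b \<longrightarrow> w \<in> lt_set idx a b (g1 n a b) (h1 n a b))}" (is "_ = ?R")
  proof
    show "K \<subseteq> ?R" unfolding KF using FI[OF lists(1)] FI[OF lists(2)] lt lt' by blast
    show "?R \<subseteq> K"
    proof
      fix w assume w: "w \<in> ?R"
      have "0 < inner h w" if h: "h \<in> F" for h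
      proof -
        obtain a b q where hq: "h = ineq_vector idx a b q" "listed_term n a b q" using FE[OF h] by blast
        show ?thesis using hq(2) w lt lt' unfolding listed_term_def hq(1) by blast
      qed
      then show "w \<in> K" unfolding KF by blast
    qed
  qed
  obtain w0 where w0: "0 < inner h w0" if "h \<in> F" for h
  proof (rule that)
    fix h assume "h \<in> F"
    then obtain a b q where h: "h = ineq_vector idx a b q" "listed_term n a b q" using FE by blast
    note t = listed_term_straight[OF h(2) n]
    note ab = incomparableD[OF straight_termD(1)[OF t]] and q = chain_pairsD[OF straight_termD(2)[OF t]]
    have "base_weight n a + base_weight n b < base_weight n (fst q) + base_weight n (snd q)"
      using straightens_base_weight[OF n] t unfolding straightens_def by blast
    then show "0 < inner h (vec_lambda (\<lambda>k. real_of_int (base_weight n (idx k))))"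
      unfolding h inner_ineq_vector
      using coords_realise[OF idx ab(1), of "\<lambda>x. real_of_int (base_weight n x)"] coords_realise[OF idx ab(2), of "\<lambda>x. real_of_int (base_weight n x)"]
        coords_realise[OF idx q(1), of "\<lambda>x. real_of_int (base_weight n x)"] coords_realise[OF idx q(2), of "\<lambda>x. real_of_int (base_weight n x)"]
      by linarith
  qed
  have expose: "\<exists>w. inner (ineq_vector idx a b q) w = 0 \<and> (\<forall>h\<in>F - {ineq_vector idx a b q}. 0 < inner h w)"
    if l: "listed_term n a b q" for a b q
  proof -
    obtain f :: "nat list \<Rightarrow> real" where f: "f a + f b = f (fst q) + f (snd q)"
      "\<And>a' b' q'. listed_term n a' b' q' \<Longrightarrow> ({a', b'}, q') \<noteq> ({a, b}, q) \<Longrightarrow> f a' + f b' < f (fst q') + f (snd q')"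
      by (rule separating_weight[OF n l]) (rule that, assumption, blast)
    let ?w = "vec_lambda (\<lambda>k. f (idx k)) :: real ^ 'm"
    have ev: "inner (ineq_vector idx a' b' q') ?w = f (fst q') + f (snd q') - f a' - f b'" if "listed_term n a' b' q'" for a' b' q'
    proof -
      note t = listed_term_straight[OF that n]
      note ab = incomparableD[OF straight_termD(1)[OF t]] and q = chain_pairsD[OF straight_termD(2)[OF t]]
      show ?thesis
        unfolding inner_ineq_vector coords_realise[OF idx ab(1)] coords_realise[OF idx ab(2)] coords_realise[OF idx q(1)] coords_realise[OF idx q(2)] ..
    qed
    have "0 < inner h ?w" if h: "h \<in> F - {ineq_vector idx a b q}" for h
    proof -
      obtain a' b' q' where hq: "h = ineq_vector idx a' b' q'" "listed_term n a' b' q'" using FE h by blast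
      \<comment> \<open>Equal unordered pairs would give equal vectors by
        \<open>ineq_vector_commute\<close>.\<close>
      have "({a', b'}, q') \<noteq> ({a, b}, q)"
        using h hq(1) ineq_vector_commute[of idx b a q] by (auto simp: doubleton_eq_iff)
      then show ?thesis unfolding hq(1) ev[OF hq(2)] using f(2)[OF hq(2)] by simp
    qed
    then show ?thesis using ev[OF l] f(1) by (intro exI[of _ ?w]) auto
  qed
  have facet: "closure K \<inter> {w. inner (ineq_vector idx a b q) w = 0} facet_of closure K" if l: "listed_term n a b q" for a b q
  proof -
    obtain w1 where w1: "inner (ineq_vector idx a b q) w1 = 0" "\<And>h. h \<in> F - {ineq_vector idx a b q} \<Longrightarrow> 0 < inner h w1"
      using expose[OF l] by blast
    show ?thesis unfolding KF by (rule facet_of_cone[OF finF w0 FI[OF l] w1])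
  qed
  have HE: "\<exists>a b q. listed_term n a b q \<and> H = {w. 0 < inner (ineq_vector idx a b q) w}" if "H \<in> halfspaces n idx" for H
  proof -
    have ltc: "lt_set idx a b c d = {w. 0 < inner (ineq_vector idx a b (c, d)) w}" "lt_set idx a b c d = {w. 0 < inner (ineq_vector idx a b (d, c)) w}" for a b c d
      using lt lt' by blast+
    from that consider a b where "diamond_pair n a b" "H = lt_set idx a b (pbw_join n a b) (pbw_odot n a b)"
      | a b where "special_diamond_pair n a b" "H = lt_set idx a b (g1 n a b) (h1 n a b)"
      unfolding halfspaces_def by blast
    then show ?thesis using lists ltc by metis
  qed
  have irredundant: "\<Inter> (halfspaces n idx - {H}) \<noteq> K" if "H \<in> halfspaces n idx" for H
  proof -
    obtain a b q where H: "listed_term n a b q" "H = {w. 0 < inner (ineq_vector idx a b q) w}" using HE \<open>H \<in> halfspaces n idx\<close> by blast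
    obtain w1 where w1: "inner (ineq_vector idx a b q) w1 = 0" "\<forall>h\<in>F - {ineq_vector idx a b q}. 0 < inner h w1"
      using expose[OF H(1)] by blast
    \<comment> \<open>The point \<open>w1\<close> turns the dropped inequality into an equality and
      satisfies all others strictly, so it separates the two sets.\<close>
    have "w1 \<notin> K" using FI[OF H(1)] w1(1) unfolding KF by force
    moreover have "w1 \<in> H'" if H': "H' \<in> halfspaces n idx - {H}" for H'
    proof -
      obtain a' b' q' where h: "listed_term n a' b' q'" "H' = {w. 0 < inner (ineq_vector idx a' b' q') w}" using HE H' by blast
      then have "ineq_vector idx a' b' q' \<in> F - {ineq_vector idx a b q}" using FI H' H(2) by auto
      then show ?thesis unfolding h(2) using w1(2) by blast
    qed
    ultimately show ?thesis by blast
  qed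
  have "closure K \<inter> eq_set idx a b (pbw_join n a b) (pbw_odot n a b) facet_of closure K" if "diamond_pair n a b" for a b
    unfolding eq' by (rule facet[OF lists(1)[OF that]])
  moreover have "closure K \<inter> eq_set idx a b (g1 n a b) (h1 n a b) facet_of closure K" if "special_diamond_pair n a b" for a b
    unfolding eq by (rule facet[OF lists(2)[OF that]])
  ultimately show ?thesis
    unfolding K_def[symmetric] using cone irredundant by blast
qed

end
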